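(* Let $\pi:X\rightarrow\mathcal{X}$ be a Deligne–Mumford analytic stack (with $X$ an analytic space and $\pi$ étale and surjective) whose diagonal morphism $\Delta:\mathcal{X}\rightarrow\mathcal{X}\times\mathcal{X}$ is closed with finite fibers. For any point $x\in\mathcal{X}$, there exists an étale morphism $$[S/G_x]\rightarrow(\mathcal{X},x)$$ where $S$ is an analytic space (with an action of $G_x$) and $G_x$ is the stabilizer of $x$.
   Context: $(Ana)$ is the category of finite-dimensional (possibly non-reduced) complex analytic spaces with the Grothendieck topology given by usual (Euclidean) open coverings. A morphism of stacks over $(Ana)$ is representable if its base change to any analytic space is an analytic space; a representable morphism has a property (étale, smooth, surjective, closed, finite fibers) if all its base changes to analytic spaces have it. A morphism of analytic spaces is smooth if it locally looks like a projection, and étale if it is a local isomorphism. An analytic stack is a stack in groupoids $\mathcal{X}$ over $(Ana)$ whose diagonal is representable and which admits a smooth surjective morphism from an analytic space; it is Deligne–Mumford if it admits an étale surjective morphism from an analytic space. $[S/G_x]$ denotes the quotient stack, i.e. the stackification of the prestack associated to the translation groupoid $G_x\times S\rightrightarrows S$. The notation $[S/G_x]\to(\mathcal{X},x)$ means a morphism of stacks to $\mathcal{X}$ sending some point of $[S/G_x]$ to $x$. *)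

theory Defs
  imports "HOL-Analysis.Analysis" "HOL-Algebra.QuotRing"
begin

section \<open>Complex analytic spaces\<close>

subsection \<open>$\mathbb C$-ringed spaces\<close>

text \<open>
  A sheaf is given by its stalks and, for every open \<open>U\<close>, the set of those functions
  assigning to each point of \<open>U\<close> a germ at that point which are sections over \<open>U\<close>; restriction
  of sections is restriction of functions.  \<open>stk X p\<close> is the stalk at \<open>p\<close> and \<open>cst X p\<close> its
  structure map from the complex numbers.  Only points of \<open>topspace (tp X)\<close> and open sets matter.
\<close>

record ('p, 'r) rspace =
  tp :: "'p topology"
  stk :: "'p \<Rightarrow> 'r ring"
  cst :: "'p \<Rightarrow> complex \<Rightarrow> 'r"
  sec :: "'p set \<Rightarrow> ('p \<Rightarrow> 'r) set"

abbreviation pts :: "('p, 'r) rspace \<Rightarrow> 'p set" where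
  "pts X \<equiv> topspace (tp X)"

definition complex_ring :: "complex ring" where
  "complex_ring = \<lparr>carrier = UNIV, mult = (*), one = 1, zero = 0, add = (+)\<rparr>"

definition c_ringed_space :: "('p, 'r) rspace \<Rightarrow> bool" where
  "c_ringed_space X \<longleftrightarrow>
    (\<forall>p\<in>pts X. cring (stk X p) \<and> cst X p \<in> ring_hom complex_ring (stk X p)) \<and>
    (\<forall>U. openin (tp X) U \<longrightarrow>
      sec X U \<subseteq> (\<Pi>\<^sub>E p\<in>U. carrier (stk X p)) \<and>
      (\<forall>c. (\<lambda>p\<in>U. cst X p c) \<in> sec X U) \<and>
      (\<forall>s\<in>sec X U. \<forall>t\<in>sec X U.
        (\<lambda>p\<in>U. s p \<oplus>\<^bsub>stk X p\<^esub> t p) \<in> sec X U \<and> (\<lambda>p\<in>U. s p \<otimes>\<^bsub>stk X p\<^esub> t p) \<in> sec X U) \<and>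
      (\<forall>s\<in>sec X U. \<forall>W. openin (tp X) W \<and> W \<subseteq> U \<longrightarrow> restrict s W \<in> sec X W) \<and>
      (\<forall>s\<in>(\<Pi>\<^sub>E p\<in>U. carrier (stk X p)).
        (\<forall>p\<in>U. \<exists>W. openin (tp X) W \<and> p \<in> W \<and> W \<subseteq> U \<and> restrict s W \<in> sec X W) \<longrightarrow> s \<in> sec X U) \<and>
      (\<forall>s\<in>sec X U. \<forall>t\<in>sec X U. \<forall>p\<in>U. s p = t p \<longrightarrow>
        (\<exists>W. openin (tp X) W \<and> p \<in> W \<and> W \<subseteq> U \<and> restrict s W = restrict t W))) \<and>
    (\<forall>p\<in>pts X. \<forall>a\<in>carrier (stk X p). \<exists>U. openin (tp X) U \<and> p \<in> U \<and> (\<exists>s\<in>sec X U. s p = a))"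

text \<open>
  A morphism is a continuous map \<open>f\<close> with \<open>\<complex>\<close>-algebra maps \<open>\<phi> p\<close> from the stalk at \<open>f p\<close> to the
  stalk at \<open>p\<close> that pull sections back to sections.  Between analytic spaces these maps are
  automatically local.
\<close>

definition rmor ::
  "('p, 'r) rspace \<Rightarrow> ('q, 's) rspace \<Rightarrow> ('p \<Rightarrow> 'q) \<Rightarrow> ('p \<Rightarrow> 's \<Rightarrow> 'r) \<Rightarrow> bool" where
  "rmor X Y f \<phi> \<longleftrightarrow>
    continuous_map (tp X) (tp Y) f \<and>
    (\<forall>p\<in>pts X. \<phi> p \<in> ring_hom (stk Y (f p)) (stk X p) \<and>
      (\<forall>c. \<phi> p (cst Y (f p) c) = cst X p c)) \<and>
    (\<forall>V. openin (tp Y) V \<longrightarrow> (\<forall>s\<in>sec Y V.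
      (\<lambda>p\<in>{p \<in> pts X. f p \<in> V}. \<phi> p (s (f p))) \<in> sec X {p \<in> pts X. f p \<in> V}))"

definition isomorphic_rspaces :: "('p, 'r) rspace \<Rightarrow> ('q, 's) rspace \<Rightarrow> bool" where
  "isomorphic_rspaces X Y \<longleftrightarrow>
    (\<exists>f \<phi> g \<gamma>. rmor X Y f \<phi> \<and> rmor Y X g \<gamma> \<and>
      (\<forall>p\<in>pts X. g (f p) = p \<and> (\<forall>a\<in>carrier (stk X p). \<phi> p (\<gamma> (f p) a) = a)) \<and>
      (\<forall>q\<in>pts Y. f (g q) = q \<and> (\<forall>b\<in>carrier (stk Y q). \<gamma> q (\<phi> (g q) b) = b)))"

definition open_sub :: "('p, 'r) rspace \<Rightarrow> 'p set \<Rightarrow> ('p, 'r) rspace" where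
  "open_sub X U = X\<lparr>tp := subtopology (tp X) U\<rparr>"

subsection \<open>Local models\<close>

text \<open>\<open>\<complex>\<^sup>n\<close> is realised inside \<^typ>\<open>nat \<Rightarrow> complex\<close> (product topology), as in
  \<^const>\<open>Euclidean_space\<close>.\<close>

definition Cn :: "nat \<Rightarrow> (nat \<Rightarrow> complex) set" where
  "Cn n = {z. \<forall>i\<ge>n. z i = 0}"

abbreviation open_Cn :: "nat \<Rightarrow> (nat \<Rightarrow> complex) set \<Rightarrow> bool" where
  "open_Cn n D \<equiv> openin (top_of_set (Cn n)) D"

text \<open>Holomorphic in several variables: locally the sum of a power series over multi-indices.\<close>

definition holo :: "nat \<Rightarrow> (nat \<Rightarrow> complex) set \<Rightarrow> ((nat \<Rightarrow> complex) \<Rightarrow> complex) \<Rightarrow> bool" where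
  "holo n D h \<longleftrightarrow>
    (\<forall>z\<in>D. \<exists>(c :: (nat \<Rightarrow> nat) \<Rightarrow> complex) N. open_Cn n N \<and> z \<in> N \<and>
      (\<forall>w\<in>N. ((\<lambda>\<alpha>. c \<alpha> * (\<Prod>i<n. (w i - z i) ^ \<alpha> i)) has_sum h w) {\<alpha>. \<forall>i\<ge>n. \<alpha> i = 0}))"

text \<open>Functions holomorphic near \<open>z\<close>.  Functions are not identified when they agree near \<open>z\<close>;
  this is done by putting the functions vanishing near \<open>z\<close> into \<open>model_ideal\<close>.\<close>

definition hol_ring :: "nat \<Rightarrow> (nat \<Rightarrow> complex) \<Rightarrow> ((nat \<Rightarrow> complex) \<Rightarrow> complex) ring" where
  "hol_ring n z =
    \<lparr>carrier = {h. \<exists>N. open_Cn n N \<and> z \<in> N \<and> holo n N h},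
     mult = (\<lambda>g h w. g w * h w), one = (\<lambda>w. 1), zero = (\<lambda>w. 0), add = (\<lambda>g h w. g w + h w)\<rparr>"

definition model_ideal ::
  "nat \<Rightarrow> ((nat \<Rightarrow> complex) \<Rightarrow> complex) set \<Rightarrow> (nat \<Rightarrow> complex) \<Rightarrow> ((nat \<Rightarrow> complex) \<Rightarrow> complex) set" where
  "model_ideal n fs z =
    Idl\<^bsub>hol_ring n z\<^esub> (fs \<union> {h. \<exists>N. open_Cn n N \<and> z \<in> N \<and> (\<forall>w\<in>N. h w = 0)})"

text \<open>The closed analytic subspace of \<open>D\<close> cut out by \<open>fs\<close>, with structure sheaf the restriction of
  \<open>\<O>\<^sub>D/(fs)\<close> to the common zero set.\<close>

definition model ::
  "nat \<Rightarrow> (nat \<Rightarrow> complex) set \<Rightarrow> ((nat \<Rightarrow> complex) \<Rightarrow> complex) set \<Rightarrow>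
    (nat \<Rightarrow> complex, ((nat \<Rightarrow> complex) \<Rightarrow> complex) set) rspace" where
  "model n D fs =
    \<lparr>tp = top_of_set {z \<in> D. \<forall>f\<in>fs. f z = 0},
     stk = (\<lambda>z. hol_ring n z Quot model_ideal n fs z),
     cst = (\<lambda>z c. model_ideal n fs z +>\<^bsub>hol_ring n z\<^esub> (\<lambda>w. c)),
     sec = (\<lambda>W. {s \<in> extensional W. \<forall>z\<in>W. \<exists>N h. open_Cn n N \<and> z \<in> N \<and> N \<subseteq> D \<and> holo n N h \<and>
       (\<forall>w\<in>N \<inter> W. s w = model_ideal n fs w +>\<^bsub>hol_ring n w\<^esub> h)})\<rparr>"

subsection \<open>Analytic spaces and their category\<close>

text \<open>\<open>dim\<^sub>p X \<le> d\<close> if \<open>p\<close> is isolated in the zero set of at most \<open>d\<close> local functions.  A germ vanishes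
  at its base point iff it is not a unit.\<close>

definition finite_dimensional :: "('p, 'r) rspace \<Rightarrow> bool" where
  "finite_dimensional X \<longleftrightarrow>
    (\<exists>d. \<forall>p\<in>pts X. \<exists>U fs. openin (tp X) U \<and> p \<in> U \<and> fs \<subseteq> sec X U \<and> finite fs \<and> card fs \<le> d \<and>
      {q \<in> U. \<forall>s\<in>fs. s q \<notin> Units (stk X q)} = {p})"

text \<open>The type \<open>'u\<close> is the universe from which both points and germs are taken; every analytic
  space of at most the cardinality of \<open>'u\<close> has an isomorphic copy on it as soon as \<open>'u\<close> has at least the
  cardinality of the continuum.\<close>

type_synonym 'u aspace = "('u, 'u) rspace"

definition analytic_space :: "'u aspace \<Rightarrow> bool" where
  "analytic_space X \<longleftrightarrow>
    c_ringed_space X \<and> Hausdorff_space (tp X) \<and> finite_dimensional X \<and>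
    (\<forall>p\<in>pts X. \<exists>U n D fs. openin (tp X) U \<and> p \<in> U \<and>
      open_Cn n D \<and> finite fs \<and> (\<forall>f\<in>fs. holo n D f) \<and>
      isomorphic_rspaces (open_sub X U) (model n D fs))"

text \<open>In all categories, \<open>Cmp C g f\<close> is ``\<open>g\<close> after \<open>f\<close>''.\<close>

record ('o, 'a) cat =
  Obj :: "'o set"
  Arr :: "'a set"
  Dom :: "'a \<Rightarrow> 'o"
  Cod :: "'a \<Rightarrow> 'o"
  Idt :: "'o \<Rightarrow> 'a"
  Cmp :: "'a \<Rightarrow> 'a \<Rightarrow> 'a"

definition hom_set :: "('o, 'a, 'm) cat_scheme \<Rightarrow> 'o \<Rightarrow> 'o \<Rightarrow> 'a set" where
  "hom_set C x y = {f \<in> Arr C. Dom C f = x \<and> Cod C f = y}"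

definition category :: "('o, 'a, 'm) cat_scheme \<Rightarrow> bool" where
  "category C \<longleftrightarrow>
    (\<forall>f\<in>Arr C. Dom C f \<in> Obj C \<and> Cod C f \<in> Obj C) \<and>
    (\<forall>x\<in>Obj C. Idt C x \<in> hom_set C x x) \<and>
    (\<forall>f\<in>Arr C. \<forall>g\<in>Arr C. Cod C f = Dom C g \<longrightarrow> Cmp C g f \<in> hom_set C (Dom C f) (Cod C g)) \<and>
    (\<forall>f\<in>Arr C. Cmp C f (Idt C (Dom C f)) = f \<and> Cmp C (Idt C (Cod C f)) f = f) \<and>
    (\<forall>f\<in>Arr C. \<forall>g\<in>Arr C. \<forall>h\<in>Arr C. Cod C f = Dom C g \<and> Cod C g = Dom C h \<longrightarrow>
      Cmp C h (Cmp C g f) = Cmp C (Cmp C h g) f)"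

definition is_isom :: "('o, 'a, 'm) cat_scheme \<Rightarrow> 'a \<Rightarrow> bool" where
  "is_isom C f \<longleftrightarrow> f \<in> Arr C \<and>
    (\<exists>g\<in>hom_set C (Cod C f) (Dom C f).
      Cmp C g f = Idt C (Dom C f) \<and> Cmp C f g = Idt C (Cod C f))"

definition is_product :: "('o, 'a, 'm) cat_scheme \<Rightarrow> 'o \<Rightarrow> 'o \<Rightarrow> 'o \<Rightarrow> 'a \<Rightarrow> 'a \<Rightarrow> bool" where
  "is_product C P A B p q \<longleftrightarrow>
    p \<in> hom_set C P A \<and> q \<in> hom_set C P B \<and>
    (\<forall>T\<in>Obj C. \<forall>a\<in>hom_set C T A. \<forall>b\<in>hom_set C T B.
      \<exists>!u. u \<in> hom_set C T P \<and> Cmp C p u = a \<and> Cmp C q u = b)"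

record 'u amor =
  mdom :: "'u aspace"
  mcod :: "'u aspace"
  mfun :: "'u \<Rightarrow> 'u"
  mgerm :: "'u \<Rightarrow> 'u \<Rightarrow> 'u"

definition ana :: "('u aspace, 'u amor) cat" where
  "ana =
    \<lparr>Obj = {X. analytic_space X},
     Arr = {m. analytic_space (mdom m) \<and> analytic_space (mcod m) \<and>
       rmor (mdom m) (mcod m) (mfun m) (mgerm m) \<and>
       mfun m \<in> extensional (pts (mdom m)) \<and> mgerm m \<in> extensional (pts (mdom m)) \<and>
       (\<forall>p\<in>pts (mdom m). mgerm m p \<in> extensional (carrier (stk (mcod m) (mfun m p))))},
     Dom = mdom,
     Cod = mcod,
     Idt = (\<lambda>X. \<lparr>mdom = X, mcod = X, mfun = (\<lambda>p\<in>pts X. p),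
       mgerm = (\<lambda>p\<in>pts X. \<lambda>a\<in>carrier (stk X p). a)\<rparr>),
     Cmp = (\<lambda>n m. \<lparr>mdom = mdom m, mcod = mcod n,
       mfun = (\<lambda>p\<in>pts (mdom m). mfun n (mfun m p)),
       mgerm = (\<lambda>p\<in>pts (mdom m). \<lambda>a\<in>carrier (stk (mcod n) (mfun n (mfun m p))).
         mgerm m p (mgerm n (mfun m p) a))\<rparr>)\<rparr>"

text \<open>The restriction \<open>W \<rightarrow> W'\<close> of \<open>m\<close> to open subspaces with \<open>m(W) \<subseteq> W'\<close>.\<close>

definition mrestr :: "'u amor \<Rightarrow> 'u set \<Rightarrow> 'u set \<Rightarrow> 'u amor" where
  "mrestr m W W' =
    \<lparr>mdom = open_sub (mdom m) W, mcod = open_sub (mcod m) W',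
     mfun = restrict (mfun m) W, mgerm = restrict (mgerm m) W\<rparr>"

definition inclusion :: "'u aspace \<Rightarrow> 'u set \<Rightarrow> 'u set \<Rightarrow> 'u amor" where
  "inclusion U W W' = mrestr (Idt ana U) W W'"

subsection \<open>Properties of morphisms of analytic spaces\<close>

definition ana_etale :: "'u amor \<Rightarrow> bool" where
  "ana_etale m \<longleftrightarrow>
    (\<forall>p\<in>pts (mdom m). \<exists>U. openin (tp (mdom m)) U \<and> p \<in> U \<and>
      openin (tp (mcod m)) (mfun m ` U) \<and> is_isom ana (mrestr m U (mfun m ` U)))"

definition ana_smooth :: "'u amor \<Rightarrow> bool" where
  "ana_smooth m \<longleftrightarrow>
    (\<forall>p\<in>pts (mdom m). \<exists>U V B n D q.
      openin (tp (mdom m)) U \<and> p \<in> U \<and> openin (tp (mcod m)) V \<and> mfun m ` U \<subseteq> V \<and>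
      B \<in> Obj ana \<and> open_Cn n D \<and> isomorphic_rspaces B (model n D {}) \<and>
      is_product ana (open_sub (mdom m) U) (open_sub (mcod m) V) B (mrestr m U V) q)"

definition ana_surjective :: "'u amor \<Rightarrow> bool" where
  "ana_surjective m \<longleftrightarrow> mfun m ` pts (mdom m) = pts (mcod m)"

definition ana_closed :: "'u amor \<Rightarrow> bool" where
  "ana_closed m \<longleftrightarrow> closed_map (tp (mdom m)) (tp (mcod m)) (mfun m)"

definition ana_finite_fibers :: "'u amor \<Rightarrow> bool" where
  "ana_finite_fibers m \<longleftrightarrow> (\<forall>q\<in>pts (mcod m). finite {p \<in> pts (mdom m). mfun m p = q})"

section \<open>Stacks over the category of analytic spaces\<close>

subsection \<open>Categories fibred in groupoids\<close>

text \<open>A category with a functor to \<^const>\<open>ana\<close>.\<close>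

record ('u, 'o, 'a) ocat = "('o, 'a) cat" +
  PO :: "'o \<Rightarrow> 'u aspace"
  PA :: "'a \<Rightarrow> 'u amor"

record ('o1, 'a1, 'o2, 'a2) fct =
  FO :: "'o1 \<Rightarrow> 'o2"
  FA :: "'a1 \<Rightarrow> 'a2"

definition is_functor ::
  "('o1, 'a1, 'm1) cat_scheme \<Rightarrow> ('o2, 'a2, 'm2) cat_scheme \<Rightarrow> ('o1, 'a1, 'o2, 'a2) fct \<Rightarrow> bool" where
  "is_functor C D F \<longleftrightarrow>
    (\<forall>x\<in>Obj C. FO F x \<in> Obj D \<and> FA F (Idt C x) = Idt D (FO F x)) \<and>
    (\<forall>f\<in>Arr C. FA F f \<in> hom_set D (FO F (Dom C f)) (FO F (Cod C f))) \<and>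
    (\<forall>f\<in>Arr C. \<forall>g\<in>Arr C. Cod C f = Dom C g \<longrightarrow> FA F (Cmp C g f) = Cmp D (FA F g) (FA F f))"

definition over_ana :: "('u, 'o, 'a) ocat \<Rightarrow> bool" where
  "over_ana X \<longleftrightarrow> category X \<and> is_functor X ana \<lparr>FO = PO X, FA = PA X\<rparr>"

definition hom_over :: "('u, 'o, 'a) ocat \<Rightarrow> 'u amor \<Rightarrow> 'o \<Rightarrow> 'o \<Rightarrow> 'a set" where
  "hom_over X f x y = {a \<in> hom_set X x y. PA X a = f}"

definition fibred_in_groupoids :: "('u, 'o, 'a) ocat \<Rightarrow> bool" where
  "fibred_in_groupoids X \<longleftrightarrow> over_ana X \<and>
    (\<forall>f\<in>Arr ana. \<forall>x\<in>Obj X. PO X x = Cod ana f \<longrightarrow> (\<exists>y\<in>Obj X. hom_over X f y x \<noteq> {})) \<and>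
    (\<forall>a\<in>Arr X. \<forall>b\<in>Arr X. \<forall>f\<in>hom_set ana (PO X (Dom X b)) (PO X (Dom X a)).
      Cod X a = Cod X b \<and> Cmp ana (PA X a) f = PA X b \<longrightarrow>
      (\<exists>!c. c \<in> hom_over X f (Dom X b) (Dom X a) \<and> Cmp X a c = b))"

text \<open>A 1-morphism over \<^const>\<open>ana\<close>.\<close>

definition morphism_over ::
  "('u, 'o1, 'a1) ocat \<Rightarrow> ('u, 'o2, 'a2) ocat \<Rightarrow> ('o1, 'a1, 'o2, 'a2) fct \<Rightarrow> bool" where
  "morphism_over X Y F \<longleftrightarrow> is_functor X Y F \<and>
    (\<forall>x\<in>Obj X. PO Y (FO F x) = PO X x) \<and> (\<forall>a\<in>Arr X. PA Y (FA F a) = PA X a)"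

definition isomorphic_over :: "('u, 'o, 'a) ocat \<Rightarrow> 'o \<Rightarrow> 'o \<Rightarrow> bool" where
  "isomorphic_over X x y \<longleftrightarrow>
    PO X x = PO X y \<and> (\<exists>a\<in>hom_over X (Idt ana (PO X x)) x y. is_isom X a)"

definition equivalence_over ::
  "('u, 'o1, 'a1) ocat \<Rightarrow> ('u, 'o2, 'a2) ocat \<Rightarrow> ('o1, 'a1, 'o2, 'a2) fct \<Rightarrow> bool" where
  "equivalence_over X Y F \<longleftrightarrow> morphism_over X Y F \<and>
    (\<forall>x\<in>Obj X. \<forall>y\<in>Obj X. bij_betw (FA F) (hom_set X x y) (hom_set Y (FO F x) (FO F y))) \<and>
    (\<forall>y\<in>Obj Y. \<exists>x\<in>Obj X. isomorphic_over Y (FO F x) y)"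

subsection \<open>Stacks\<close>

text \<open>An open covering of \<open>U\<close> is given by the set of all open subsets of its members.  A descent
  datum is then a functor over \<^const>\<open>ana\<close> on this set of opens, ordered by inclusion:
  \<open>dres d (W', W)\<close> is an arrow \<open>dobj d W' \<rightarrow> dobj d W\<close> over the inclusion \<open>W' \<subseteq> W\<close>, i.e. an
  identification of \<open>dobj d W'\<close> with the restriction of \<open>dobj d W\<close>.  Gluing isomorphisms on
  \<open>W\<^sub>1 \<inter> W\<^sub>2\<close> and their cocycle condition are obtained through the restrictions of both objects to
  \<open>W\<^sub>1 \<inter> W\<^sub>2\<close>.\<close>

definition covering_sieve :: "'u aspace \<Rightarrow> 'u set set \<Rightarrow> bool" where
  "covering_sieve U \<S> \<longleftrightarrow>
    (\<forall>W\<in>\<S>. openin (tp U) W) \<and> (\<forall>W\<in>\<S>. \<forall>W'. openin (tp U) W' \<and> W' \<subseteq> W \<longrightarrow> W' \<in> \<S>) \<and>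
    \<Union>\<S> = pts U"

record ('u, 'o, 'a) ddatum =
  dbase :: "'u aspace"
  dsieve :: "'u set set"
  dobj :: "'u set \<Rightarrow> 'o"
  dres :: "'u set \<times> 'u set \<Rightarrow> 'a"

definition descent_datum :: "('u, 'o, 'a) ocat \<Rightarrow> ('u, 'o, 'a) ddatum \<Rightarrow> bool" where
  "descent_datum X d \<longleftrightarrow>
    dbase d \<in> Obj ana \<and> covering_sieve (dbase d) (dsieve d) \<and>
    (\<forall>W\<in>dsieve d. dobj d W \<in> Obj X \<and> PO X (dobj d W) = open_sub (dbase d) W \<and>
      dres d (W, W) = Idt X (dobj d W)) \<and>
    (\<forall>W\<in>dsieve d. \<forall>W'\<in>dsieve d. W' \<subseteq> W \<longrightarrow>
      dres d (W', W) \<in> hom_over X (inclusion (dbase d) W' W) (dobj d W') (dobj d W)) \<and>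
    (\<forall>W\<in>dsieve d. \<forall>W'\<in>dsieve d. \<forall>W''\<in>dsieve d. W'' \<subseteq> W' \<and> W' \<subseteq> W \<longrightarrow>
      Cmp X (dres d (W', W)) (dres d (W'', W')) = dres d (W'', W))"

definition effective :: "('u, 'o, 'a) ocat \<Rightarrow> ('u, 'o, 'a) ddatum \<Rightarrow> bool" where
  "effective X d \<longleftrightarrow>
    (\<exists>x e. x \<in> Obj X \<and> PO X x = dbase d \<and>
      (\<forall>W\<in>dsieve d. e W \<in> hom_over X (inclusion (dbase d) W (pts (dbase d))) (dobj d W) x) \<and>
      (\<forall>W\<in>dsieve d. \<forall>W'\<in>dsieve d. W' \<subseteq> W \<longrightarrow> Cmp X (e W) (dres d (W', W)) = e W'))"

text \<open>\<open>Isom(x,y)\<close> is a sheaf: given restrictions \<open>e W\<close> of \<open>x\<close> to the members \<open>W\<close> of a covering,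
  compatible arrows from these restrictions to \<open>y\<close> glue uniquely.\<close>

definition isoms_are_sheaves :: "('u, 'o, 'a) ocat \<Rightarrow> bool" where
  "isoms_are_sheaves X \<longleftrightarrow>
    (\<forall>U\<in>Obj ana. \<forall>\<S>. covering_sieve U \<S> \<longrightarrow>
      (\<forall>x\<in>Obj X. \<forall>y\<in>Obj X. PO X x = U \<and> PO X y = U \<longrightarrow>
        (\<forall>e a.
          (\<forall>W\<in>\<S>. e W \<in> Arr X \<and> Cod X (e W) = x \<and> PA X (e W) = inclusion U W (pts U) \<and>
            a W \<in> hom_over X (inclusion U W (pts U)) (Dom X (e W)) y) \<and>
          (\<forall>W\<in>\<S>. \<forall>W'\<in>\<S>. W' \<subseteq> W \<longrightarrow> (\<forall>r\<in>hom_set X (Dom X (e W')) (Dom X (e W)).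
            Cmp X (e W) r = e W' \<longrightarrow> Cmp X (a W) r = a W')) \<longrightarrow>
          (\<exists>!b. b \<in> hom_over X (Idt ana U) x y \<and> (\<forall>W\<in>\<S>. Cmp X b (e W) = a W)))))"

definition is_stack :: "('u, 'o, 'a) ocat \<Rightarrow> bool" where
  "is_stack X \<longleftrightarrow> fibred_in_groupoids X \<and> isoms_are_sheaves X \<and>
    (\<forall>d. descent_datum X d \<longrightarrow> effective X d)"

subsection \<open>Representable morphisms\<close>

text \<open>The stack represented by \<open>T\<close>: objects over \<open>V\<close> are morphisms \<open>V \<rightarrow> T\<close>, and \<open>(m, h)\<close> is the
  arrow \<open>m \<circ> h \<rightarrow> m\<close> over \<open>h\<close>.\<close>

definition yon :: "'u aspace \<Rightarrow> ('u, 'u amor, 'u amor \<times> 'u amor) ocat" where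
  "yon T =
    \<lparr>Obj = {m \<in> Arr ana. Cod ana m = T},
     Arr = {(m, h). m \<in> Arr ana \<and> Cod ana m = T \<and> h \<in> Arr ana \<and> Cod ana h = Dom ana m},
     Dom = (\<lambda>(m, h). Cmp ana m h),
     Cod = (\<lambda>(m, h). m),
     Idt = (\<lambda>m. (m, Idt ana (Dom ana m))),
     Cmp = (\<lambda>(m, h) (m', h'). (m, Cmp ana h h')),
     PO = Dom ana,
     PA = (\<lambda>(m, h). h)\<rparr>"

text \<open>The 2-fibre product of \<open>F : A \<rightarrow> Z\<close> and \<open>G : B \<rightarrow> Z\<close>.\<close>

definition fibprod ::
  "('u, 'o1, 'a1) ocat \<Rightarrow> ('u, 'o2, 'a2) ocat \<Rightarrow> ('u, 'o3, 'a3) ocat \<Rightarrow>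
    ('o1, 'a1, 'o3, 'a3) fct \<Rightarrow> ('o2, 'a2, 'o3, 'a3) fct \<Rightarrow>
    ('u, 'o1 \<times> 'o2 \<times> 'a3, ('o1 \<times> 'o2 \<times> 'a3) \<times> ('o1 \<times> 'o2 \<times> 'a3) \<times> 'a1 \<times> 'a2) ocat" where
  "fibprod A B Z F G =
    (let Ob = {(x, y, \<alpha>). x \<in> Obj A \<and> y \<in> Obj B \<and> PO A x = PO B y \<and>
       \<alpha> \<in> hom_over Z (Idt ana (PO A x)) (FO F x) (FO G y) \<and> is_isom Z \<alpha>}
     in
    \<lparr>Obj = Ob,
     Arr = {((x, y, \<alpha>), (x', y', \<alpha>'), a, b).
       (x, y, \<alpha>) \<in> Ob \<and> (x', y', \<alpha>') \<in> Ob \<and> a \<in> hom_set A x x' \<and> b \<in> hom_set B y y' \<and>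
       PA A a = PA B b \<and> Cmp Z \<alpha>' (FA F a) = Cmp Z (FA G b) \<alpha>},
     Dom = (\<lambda>(v, v', a, b). v),
     Cod = (\<lambda>(v, v', a, b). v'),
     Idt = (\<lambda>(x, y, \<alpha>). ((x, y, \<alpha>), (x, y, \<alpha>), Idt A x, Idt B y)),
     Cmp = (\<lambda>(v', v'', a', b') (v, _, a, b). (v, v'', Cmp A a' a, Cmp B b' b)),
     PO = (\<lambda>(x, y, \<alpha>). PO A x),
     PA = (\<lambda>(v, v', a, b). PA A a)\<rparr>)"

text \<open>\<open>h : Z \<rightarrow> T\<close> is a base change of \<open>F : A \<rightarrow> B\<close> along \<open>t : T \<rightarrow> B\<close> if \<open>Z\<close> represents
  \<open>A \<times>\<^sub>B T\<close> and \<open>h\<close> corresponds to the projection \<open>A \<times>\<^sub>B T \<rightarrow> T\<close>, i.e. is its value on the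
  universal object.\<close>

definition base_change ::
  "('u, 'o1, 'a1) ocat \<Rightarrow> ('u, 'o2, 'a2) ocat \<Rightarrow> ('o1, 'a1, 'o2, 'a2) fct \<Rightarrow>
    'u aspace \<Rightarrow> ('u amor, 'u amor \<times> 'u amor, 'o2, 'a2) fct \<Rightarrow> 'u aspace \<Rightarrow> 'u amor \<Rightarrow> bool" where
  "base_change A B F T t Z h \<longleftrightarrow> Z \<in> Obj ana \<and>
    (\<exists>E. equivalence_over (yon Z) (fibprod A (yon T) B F t) E \<and>
      h = fst (snd (FO E (Idt ana Z))))"

definition representable ::
  "('u, 'o1, 'a1) ocat \<Rightarrow> ('u, 'o2, 'a2) ocat \<Rightarrow> ('o1, 'a1, 'o2, 'a2) fct \<Rightarrow> bool" where
  "representable A B F \<longleftrightarrow> morphism_over A B F \<and>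
    (\<forall>T\<in>Obj ana. \<forall>t. morphism_over (yon T) B t \<longrightarrow> (\<exists>Z h. base_change A B F T t Z h))"

definition representable_with ::
  "('u amor \<Rightarrow> bool) \<Rightarrow>
    ('u, 'o1, 'a1) ocat \<Rightarrow> ('u, 'o2, 'a2) ocat \<Rightarrow> ('o1, 'a1, 'o2, 'a2) fct \<Rightarrow> bool" where
  "representable_with R A B F \<longleftrightarrow> representable A B F \<and>
    (\<forall>T\<in>Obj ana. \<forall>t Z h. morphism_over (yon T) B t \<and> base_change A B F T t Z h \<longrightarrow> R h)"

subsection \<open>Analytic stacks\<close>

definition prod_over ::
  "('u, 'o1, 'a1) ocat \<Rightarrow> ('u, 'o2, 'a2) ocat \<Rightarrow> ('u, 'o1 \<times> 'o2, 'a1 \<times> 'a2) ocat" where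
  "prod_over A B =
    \<lparr>Obj = {(x, y). x \<in> Obj A \<and> y \<in> Obj B \<and> PO A x = PO B y},
     Arr = {(a, b). a \<in> Arr A \<and> b \<in> Arr B \<and> PA A a = PA B b},
     Dom = (\<lambda>(a, b). (Dom A a, Dom B b)),
     Cod = (\<lambda>(a, b). (Cod A a, Cod B b)),
     Idt = (\<lambda>(x, y). (Idt A x, Idt B y)),
     Cmp = (\<lambda>(a', b') (a, b). (Cmp A a' a, Cmp B b' b)),
     PO = (\<lambda>(x, y). PO A x),
     PA = (\<lambda>(a, b). PA A a)\<rparr>"

definition diagonal :: "('o, 'a, 'o \<times> 'o, 'a \<times> 'a) fct" where
  "diagonal = \<lparr>FO = (\<lambda>x. (x, x)), FA = (\<lambda>a. (a, a))\<rparr>"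

definition analytic_stack :: "('u, 'o, 'a) ocat \<Rightarrow> bool" where
  "analytic_stack \<X> \<longleftrightarrow> is_stack \<X> \<and>
    representable \<X> (prod_over \<X> \<X>) diagonal \<and>
    (\<exists>X \<pi>. X \<in> Obj ana \<and> representable_with ana_smooth (yon X) \<X> \<pi> \<and>
      representable_with ana_surjective (yon X) \<X> \<pi>)"

definition deligne_mumford ::
  "'u aspace \<Rightarrow> ('u, 'o, 'a) ocat \<Rightarrow> ('u amor, 'u amor \<times> 'u amor, 'o, 'a) fct \<Rightarrow> bool" where
  "deligne_mumford X \<X> \<pi> \<longleftrightarrow> analytic_stack \<X> \<and> X \<in> Obj ana \<and>
    representable_with ana_etale (yon X) \<X> \<pi> \<and> representable_with ana_surjective (yon X) \<X> \<pi>"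

definition one_point_space :: "'u aspace \<Rightarrow> bool" where
  "one_point_space P \<longleftrightarrow> P \<in> Obj ana \<and>
    (\<exists>p. pts P = {p} \<and> bij_betw (cst P p) UNIV (carrier (stk P p)))"

definition stack_point :: "('u, 'o, 'a) ocat \<Rightarrow> 'o \<Rightarrow> bool" where
  "stack_point X x \<longleftrightarrow> x \<in> Obj X \<and> one_point_space (PO X x)"

definition stabilizer :: "('u, 'o, 'a) ocat \<Rightarrow> 'o \<Rightarrow> 'a monoid" where
  "stabilizer X x =
    \<lparr>carrier = hom_over X (Idt ana (PO X x)) x x, mult = Cmp X, one = Idt X x\<rparr>"

section \<open>Quotient stacks by discrete groups\<close>

definition acts_on :: "('g, 'm) monoid_scheme \<Rightarrow> 'u aspace \<Rightarrow> ('g \<Rightarrow> 'u amor) \<Rightarrow> bool" where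
  "acts_on G S \<rho> \<longleftrightarrow> (\<forall>g\<in>carrier G. \<rho> g \<in> hom_set ana S S) \<and> \<rho> \<one>\<^bsub>G\<^esub> = Idt ana S \<and>
    (\<forall>g\<in>carrier G. \<forall>g'\<in>carrier G. \<rho> (g \<otimes>\<^bsub>G\<^esub> g') = Cmp ana (\<rho> g) (\<rho> g'))"

text \<open>The prestack of the translation groupoid \<open>G \<times> S \<rightrightarrows> S\<close>, \<open>(g, s) \<mapsto> s, g s\<close>, for discrete \<open>G\<close>.
  Its objects over \<open>U\<close> are morphisms \<open>U \<rightarrow> S\<close>.  Since a morphism \<open>U \<rightarrow> G \<times> S\<close> is a locally constant
  map \<open>\<gamma> : U \<rightarrow> G\<close> together with a morphism \<open>U \<rightarrow> S\<close>, an arrow from \<open>f'\<close> to \<open>f\<close> over \<open>h\<close> is given by a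
  locally constant \<open>\<gamma>\<close> with \<open>\<gamma> f' = f \<circ> h\<close>.\<close>

definition translation_prestack ::
  "('g, 'm) monoid_scheme \<Rightarrow> 'u aspace \<Rightarrow> ('g \<Rightarrow> 'u amor) \<Rightarrow>
    ('u, 'u amor, 'u amor \<times> 'u amor \<times> 'u amor \<times> ('u \<Rightarrow> 'g)) ocat" where
  "translation_prestack G S \<rho> =
    \<lparr>Obj = {f \<in> Arr ana. Cod ana f = S},
     Arr = {(f', f, h, \<gamma>).
       f' \<in> Arr ana \<and> Cod ana f' = S \<and> f \<in> Arr ana \<and> Cod ana f = S \<and>
       h \<in> hom_set ana (Dom ana f') (Dom ana f) \<and>
       \<gamma> \<in> (\<Pi>\<^sub>E p\<in>pts (Dom ana f'). carrier G) \<and>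
       (\<forall>g\<in>carrier G. let W = {p \<in> pts (Dom ana f'). \<gamma> p = g} in
         openin (tp (Dom ana f')) W \<and>
         Cmp ana (\<rho> g) (mrestr f' W (pts S)) = mrestr (Cmp ana f h) W (pts S))},
     Dom = (\<lambda>(f', f, h, \<gamma>). f'),
     Cod = (\<lambda>(f', f, h, \<gamma>). f),
     Idt = (\<lambda>f. (f, f, Idt ana (Dom ana f), \<lambda>p\<in>pts (Dom ana f). \<one>\<^bsub>G\<^esub>)),
     Cmp = (\<lambda>(_, f, k, \<delta>) (f', _, h, \<gamma>).
       (f', f, Cmp ana k h, \<lambda>p\<in>pts (Dom ana f'). \<delta> (mfun h p) \<otimes>\<^bsub>G\<^esub> \<gamma> p)),
     PO = Dom ana,
     PA = (\<lambda>(f', f, h, \<gamma>). h)\<rparr>"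

text \<open>Stackification of a prestack whose isomorphisms form sheaves (which is the case for translation
  groupoids).  Objects are descent data.  An arrow over \<open>f : U \<rightarrow> U'\<close> is a compatible family of arrows
  \<open>dobj d W \<rightarrow> dobj d' W'\<close> over the restrictions \<open>W \<rightarrow> W'\<close> of \<open>f\<close>, for all \<open>W\<close>, \<open>W'\<close> in the two coverings
  with \<open>f(W) \<subseteq> W'\<close>.  To compose families \<open>a\<close> and \<open>b\<close>, one has to glue: the composite has as component
  at \<open>(W, W'')\<close> the unique arrow whose restriction to every small enough \<open>W\<^sub>1 \<subseteq> W\<close> is the composite
  through some \<open>W'\<close>.\<close>

definition dindex ::
  "('u, 'o, 'a) ddatum \<Rightarrow> ('u, 'o, 'a) ddatum \<Rightarrow> 'u amor \<Rightarrow> ('u set \<times> 'u set) set" where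
  "dindex d d' f = {(W, W'). W \<in> dsieve d \<and> W' \<in> dsieve d' \<and> mfun f ` W \<subseteq> W'}"

definition stackification ::
  "('u, 'o, 'a) ocat \<Rightarrow>
    ('u, ('u, 'o, 'a) ddatum,
      ('u, 'o, 'a) ddatum \<times> ('u, 'o, 'a) ddatum \<times> 'u amor \<times> ('u set \<times> 'u set \<Rightarrow> 'a)) ocat" where
  "stackification P =
    \<lparr>Obj = {d. descent_datum P d},
     Arr = {(d, d', f, a).
       descent_datum P d \<and> descent_datum P d' \<and> f \<in> hom_set ana (dbase d) (dbase d') \<and>
       a \<in> extensional (dindex d d' f) \<and>
       (\<forall>(W, W')\<in>dindex d d' f. a (W, W') \<in> hom_over P (mrestr f W W') (dobj d W) (dobj d' W')) \<and>
       (\<forall>(W, W')\<in>dindex d d' f. \<forall>(V, V')\<in>dindex d d' f. V \<subseteq> W \<and> V' \<subseteq> W' \<longrightarrow>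
         Cmp P (dres d' (V', W')) (a (V, V')) = Cmp P (a (W, W')) (dres d (V, W)))},
     Dom = (\<lambda>(d, d', f, a). d),
     Cod = (\<lambda>(d, d', f, a). d'),
     Idt = (\<lambda>d. (d, d, Idt ana (dbase d), restrict (dres d) (dindex d d (Idt ana (dbase d))))),
     Cmp = (\<lambda>(d', d'', g, b) (d, _, f, a).
       (d, d'', Cmp ana g f, \<lambda>(W, W'')\<in>dindex d d'' (Cmp ana g f).
         (THE c. c \<in> hom_over P (mrestr (Cmp ana g f) W W'') (dobj d W) (dobj d'' W'') \<and>
           (\<forall>W1 W'. W1 \<subseteq> W \<and> (W1, W') \<in> dindex d d' f \<and> (W', W'') \<in> dindex d' d'' g \<longrightarrow>
             Cmp P c (dres d (W1, W)) = Cmp P (b (W', W'')) (a (W1, W')))))),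
     PO = dbase,
     PA = (\<lambda>(d, d', f, a). f)\<rparr>"

abbreviation quotient_stack where
  "quotient_stack G S \<rho> \<equiv> stackification (translation_prestack G S \<rho>)"

end

theory Submission
  imports Defs
begin

text \<open>Let \<open>p\<close> be a point of the atlas \<open>X\<close> over \<open>x\<close>, and let \<open>Z = X \<times>\<^sub>\<X> X\<close> with its two etale projections to
 \<open>X\<close>. The points of \<open>Z\<close> over \<open>(p, p)\<close> form a copy of \<open>G\<^sub>x\<close>, which is finite since the diagonal has finite
 fibres. Each of them lies on a local section of the source projection, and since the diagonal is
 closed, these finitely many sections exhaust \<open>Z\<close> near \<open>(p, p)\<close>. Composing them with the target projection
 gives maps between neighbourhoods of \<open>p\<close> which, on a small invariant neighbourhood \<open>S\<close>, form an action of
 \<open>G\<^sub>x\<close> such that \<open>Z\<close> restricts to \<open>G\<^sub>x \<times> S\<close>. So the prestack of the translation groupoid is a full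
 subcategory of \<open>\<X>\<close>; its stackification is the open substack of objects which locally admit an arrow to
 the restriction of the atlas to \<open>S\<close>, and open immersions are etale.\<close>

text \<open>Spaces may be non-reduced, so maps are not determined by points: the action is built on
  arrows into the atlas object, and identities spread from \<open>x\<close> to a neighbourhood
  because two lifts into one sheet of an etale map coincide once their images do. Fibre products are
  known only through the equivalences in \<open>base_change\<close>; Yoneda turns them once and for
  all into universal arrows, after which only composition in the stack is used. Closedness of the
  diagonal can be tested only on an analytic space with two maps to the atlas near (p, p), and this
  space must live in the type of the universe. It is cut out by the equations of a chart taken
  twice; germs are coded by Taylor coefficients, and the universe has room because the germs at the
  point underlying \<open>x\<close> are a copy of the complex numbers. Power series are inverted to
  see that evaluation is the only algebra map from a stalk to the complex numbers, so that maps from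
  a reduced point are points. The stackification is compared with the given stack through full
  faithfulness, which avoids computing its glued composites.\<close>

abbreviation ahom where "ahom \<equiv> hom_set ana"
abbreviation acmp where "acmp \<equiv> Cmp ana"
abbreviation aid where "aid \<equiv> Idt ana"
abbreviation aopen where "aopen X \<equiv> openin (tp X)"
abbreviation incl where "incl X W \<equiv> inclusion X W (pts X)"
abbreviation germs where "germs X p \<equiv> carrier (stk X p)"

section \<open>Ringed spaces and their open subspaces\<close>

lemma open_sub_sel [simp]:
 "tp (open_sub X U) = subtopology (tp X) U"
 "stk (open_sub X U) = stk X"
 "cst (open_sub X U) = cst X"
 "sec (open_sub X U) = sec X"
 by (simp_all add: open_sub_def)

lemma open_sub_pts [simp]: "open_sub X (pts X) = X"
 by (simp add: open_sub_def)

lemma open_sub_open_sub [simp]: "open_sub (open_sub X U) V = open_sub X (U \<inter> V)"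
 by (simp add: open_sub_def subtopology_subtopology)

lemma open_sub_iff:
 assumes "aopen X U"
 shows "openin (subtopology (tp X) U) W \<longleftrightarrow> aopen X W \<and> W \<subseteq> U"
 using assms openin_open_subtopology by blast

lemma pts_open_sub: "aopen X U \<Longrightarrow> pts (open_sub X U) = U"
 using openin_subset by fastforce

lemma crs_stk:
 assumes "c_ringed_space X" "p \<in> pts X"
 shows "cring (stk X p)" "cst X p \<in> ring_hom complex_ring (stk X p)"
 using assms unfolding c_ringed_space_def by auto

lemmas crs_openD =
 c_ringed_space_def[THEN iffD1, THEN conjunct2, THEN conjunct1, THEN spec, THEN mp]

lemma crs_sec:
 assumes "c_ringed_space X" "aopen X U"
 shows "sec X U \<subseteq> (\<Pi>\<^sub>E p\<in>U. germs X p)"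
  "(\<lambda>p\<in>U. cst X p c) \<in> sec X U"
  "s \<in> sec X U \<Longrightarrow> t \<in> sec X U \<Longrightarrow> (\<lambda>p\<in>U. s p \<oplus>\<^bsub>stk X p\<^esub> t p) \<in> sec X U"
  "s \<in> sec X U \<Longrightarrow> t \<in> sec X U \<Longrightarrow> (\<lambda>p\<in>U. s p \<otimes>\<^bsub>stk X p\<^esub> t p) \<in> sec X U"
  "s \<in> sec X U \<Longrightarrow> aopen X W \<Longrightarrow> W \<subseteq> U \<Longrightarrow> restrict s W \<in> sec X W"
  "s \<in> (\<Pi>\<^sub>E p\<in>U. germs X p) \<Longrightarrow>
   (\<And>p. p \<in> U \<Longrightarrow> \<exists>W. aopen X W \<and> p \<in> W \<and> W \<subseteq> U \<and> restrict s W \<in> sec X W) \<Longrightarrow>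
   s \<in> sec X U"
  "s \<in> sec X U \<Longrightarrow> t \<in> sec X U \<Longrightarrow> p \<in> U \<Longrightarrow> s p = t p \<Longrightarrow>
   \<exists>W. aopen X W \<and> p \<in> W \<and> W \<subseteq> U \<and> restrict s W = restrict t W"
proof -
 note K = crs_openD[OF assms]
 note K1 = K[THEN conjunct1]
 note K = K[THEN conjunct2] note K2 = K[THEN conjunct1, THEN spec]
 note K = K[THEN conjunct2] note K3 = K[THEN conjunct1, THEN bspec, THEN bspec]
 note K = K[THEN conjunct2] note K4 = K[THEN conjunct1, THEN bspec, THEN spec, THEN mp]
 note K = K[THEN conjunct2] note K5 = K[THEN conjunct1, THEN bspec, THEN mp]
 note K6 = K[THEN conjunct2, THEN bspec, THEN bspec, THEN bspec, THEN mp]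
 show "sec X U \<subseteq> (\<Pi>\<^sub>E p\<in>U. germs X p)" by (rule K1)
 show "(\<lambda>p\<in>U. cst X p c) \<in> sec X U" by (rule K2)
 show "s \<in> sec X U \<Longrightarrow> t \<in> sec X U \<Longrightarrow> (\<lambda>p\<in>U. s p \<oplus>\<^bsub>stk X p\<^esub> t p) \<in> sec X U"
  by (rule K3[THEN conjunct1])
 show "s \<in> sec X U \<Longrightarrow> t \<in> sec X U \<Longrightarrow> (\<lambda>p\<in>U. s p \<otimes>\<^bsub>stk X p\<^esub> t p) \<in> sec X U"
  by (rule K3[THEN conjunct2])
 show "s \<in> sec X U \<Longrightarrow> aopen X W \<Longrightarrow> W \<subseteq> U \<Longrightarrow> restrict s W \<in> sec X W"
  by (rule K4) auto
 show "s \<in> (\<Pi>\<^sub>E p\<in>U. germs X p) \<Longrightarrow>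
   (\<And>p. p \<in> U \<Longrightarrow> \<exists>W. aopen X W \<and> p \<in> W \<and> W \<subseteq> U \<and> restrict s W \<in> sec X W) \<Longrightarrow>
   s \<in> sec X U"
  by (rule K5) auto
 show "s \<in> sec X U \<Longrightarrow> t \<in> sec X U \<Longrightarrow> p \<in> U \<Longrightarrow> s p = t p \<Longrightarrow>
   \<exists>W. aopen X W \<and> p \<in> W \<and> W \<subseteq> U \<and> restrict s W = restrict t W"
  by (rule K6)
qed

lemma crs_germ:
 assumes "c_ringed_space X" "p \<in> pts X" "a \<in> germs X p"
 obtains U s where "aopen X U" "p \<in> U" "s \<in> sec X U" "s p = a"
 using assms(1)[unfolded c_ringed_space_def, THEN conjunct2, THEN conjunct2, THEN bspec,
  OF assms(2), THEN bspec, OF assms(3)] by blast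

lemma crs_sec_carrier:
 assumes "c_ringed_space X" "aopen X U" "s \<in> sec X U" "p \<in> U"
 shows "s p \<in> germs X p"
 using crs_sec(1)[OF assms(1,2)] assms(3,4) by (auto simp: PiE_iff)

text \<open>Stalks and sections are unchanged, so the work consists in cutting neighbourhoods down
  to \<open>U\<close>, notably the one carrying a section through a given germ.\<close>

lemma crs_open_sub:
 assumes X: "c_ringed_space X" and U: "aopen X U"
 shows "c_ringed_space (open_sub X U)"
proof -
 have 1: "\<exists>W'. aopen X W' \<and> W' \<subseteq> U \<and> p \<in> W' \<and> (\<exists>s\<in>sec X W'. s p = a)"
  if pa: "p \<in> pts X" "p \<in> U" "a \<in> germs X p" for p a
 proof -
  obtain W s where W: "aopen X W" "p \<in> W" "s \<in> sec X W" "s p = a"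
   using crs_germ[OF X pa(1,3)] by metis
  have "restrict s (W \<inter> U) \<in> sec X (W \<inter> U)"
   using crs_sec(5)[OF X W(1) W(3)] W U by (simp add: openin_Int)
  then have "\<exists>s'\<in>sec X (W \<inter> U). s' p = a" using W(2,4) pa(2) by (intro bexI) auto
  then show ?thesis using W U pa by (intro exI[of _ "W \<inter> U"]) (auto simp: openin_Int)
 qed
 have 3: "\<exists>W. (aopen X W \<and> W \<subseteq> U) \<and> p \<in> W \<and> W \<subseteq> V \<and> restrict s W = restrict t W"
  if V: "aopen X V" "V \<subseteq> U" and s: "s \<in> sec X V" "t \<in> sec X V" "p \<in> V" "s p = t p" for V s t p
 proof -
  have "\<exists>W. aopen X W \<and> p \<in> W \<and> W \<subseteq> V \<and> restrict s W = restrict t W"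
   by (rule crs_sec(7)[OF X V(1) s])
  then show ?thesis using V(2) by blast
 qed
 have 4: "s \<in> sec X V" if V: "aopen X V" "V \<subseteq> U" and s: "s \<in> (\<Pi>\<^sub>E p\<in>V. germs X p)"
  "\<forall>p\<in>V. \<exists>W. (aopen X W \<and> W \<subseteq> U) \<and> p \<in> W \<and> W \<subseteq> V \<and> restrict s W \<in> sec X W" for V s
  using crs_sec(6)[OF X V(1) s(1)] s(2) by blast
 show ?thesis
  unfolding c_ringed_space_def open_sub_sel open_sub_iff[OF U]
  apply (intro conjI ballI allI impI)
  subgoal by (simp add: crs_stk(1)[OF X])
  subgoal by (simp add: crs_stk(2)[OF X])
  subgoal by (simp add: crs_sec(1)[OF X])
  subgoal by (simp add: crs_sec(2)[OF X])
  subgoal by (simp add: crs_sec(3)[OF X])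
  subgoal by (simp add: crs_sec(4)[OF X])
  subgoal using crs_sec(5)[OF X] by blast
  subgoal using 4 by blast
  subgoal using 3 by blast
  subgoal using 1 by auto
  done
qed

section \<open>Morphisms of ringed spaces\<close>

lemma rmorD:
 assumes "rmor X Y f fi"
 shows "continuous_map (tp X) (tp Y) f"
  "p \<in> pts X \<Longrightarrow> fi p \<in> ring_hom (stk Y (f p)) (stk X p)"
  "p \<in> pts X \<Longrightarrow> fi p (cst Y (f p) c) = cst X p c"
  "aopen Y V \<Longrightarrow> s \<in> sec Y V \<Longrightarrow>
   (\<lambda>p\<in>{p \<in> pts X. f p \<in> V}. fi p (s (f p))) \<in> sec X {p \<in> pts X. f p \<in> V}"
  "p \<in> pts X \<Longrightarrow> f p \<in> pts Y"
 using assms unfolding rmor_def by (auto dest: continuous_map_image_subset_topspace)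

text \<open>Only values at points and on germs enter \<open>rmor\<close>. This lets raw maps be
  replaced by the extensional representatives that arrows of \<open>ana\<close> are required to
  have.\<close>

lemma rmor_cong:
 assumes Y: "c_ringed_space Y" and r: "rmor X Y f fi"
  and f: "\<And>p. p \<in> pts X \<Longrightarrow> f' p = f p"
  and fi: "\<And>p a. p \<in> pts X \<Longrightarrow> a \<in> germs Y (f p) \<Longrightarrow> fi' p a = fi p a"
 shows "rmor X Y f' fi'"
proof -
 have "continuous_map (tp X) (tp Y) f'"
  using rmorD(1)[OF r] f by (metis continuous_map_eq)
 moreover have "fi' p \<in> ring_hom (stk Y (f' p)) (stk X p)" if p: "p \<in> pts X" for p
 proof -
  interpret R: cring "stk Y (f p)" using crs_stk(1)[OF Y rmorD(5)[OF r p]] .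
  show ?thesis using rmorD(2)[OF r p] f[OF p] fi[OF p]
   unfolding ring_hom_def by auto
 qed
 moreover have "fi' p (cst Y (f' p) c) = cst X p c" if p: "p \<in> pts X" for p c
 proof -
  have "cst Y (f p) c \<in> germs Y (f p)"
   using crs_stk(2)[OF Y rmorD(5)[OF r p]] unfolding ring_hom_def complex_ring_def by auto
  then show ?thesis using rmorD(3)[OF r p] f[OF p] fi[OF p] by auto
 qed
 moreover have "(\<lambda>p\<in>{p \<in> pts X. f' p \<in> V}. fi' p (s (f' p))) \<in> sec X {p \<in> pts X. f' p \<in> V}"
  if V: "aopen Y V" and s: "s \<in> sec Y V" for V s
 proof -
  have e: "{p \<in> pts X. f' p \<in> V} = {p \<in> pts X. f p \<in> V}" using f by auto
  have "(\<lambda>p\<in>{p \<in> pts X. f p \<in> V}. fi' p (s (f' p))) = (\<lambda>p\<in>{p \<in> pts X. f p \<in> V}. fi p (s (f p)))"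
   using f fi crs_sec_carrier[OF Y V s] by (auto intro!: restrict_ext)
  then show ?thesis using rmorD(4)[OF r V s] e by simp
 qed
 ultimately show ?thesis unfolding rmor_def by blast
qed

lemma rmor_comp:
 assumes f: "rmor X Y f fi" and g: "rmor Y Z g ga"
 shows "rmor X Z (\<lambda>p. g (f p)) (\<lambda>p a. fi p (ga (f p) a))"
proof -
 have "(\<lambda>a. fi p (ga (f p) a)) \<in> ring_hom (stk Z (g (f p))) (stk X p)" if p: "p \<in> pts X" for p
  using rmorD(2)[OF f p] rmorD(2)[OF g rmorD(5)[OF f p]] ring_hom_trans
  unfolding comp_def[symmetric] by blast
 moreover have "(\<lambda>p\<in>{p \<in> pts X. g (f p) \<in> V}. fi p (ga (f p) (s (g (f p))))) \<in> sec X {p \<in> pts X. g (f p) \<in> V}"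
  if V: "aopen Z V" and s: "s \<in> sec Z V" for V s
 proof -
  let ?V = "{q \<in> pts Y. g q \<in> V}"
  have o: "aopen Y ?V" using rmorD(1)[OF g] V by (simp add: continuous_map_def)
  have e: "{p \<in> pts X. f p \<in> ?V} = {p \<in> pts X. g (f p) \<in> V}" using rmorD(5)[OF f] by auto
  have "(\<lambda>p\<in>{p \<in> pts X. g (f p) \<in> V}. fi p (ga (f p) (s (g (f p))))) =
   (\<lambda>p\<in>{p \<in> pts X. f p \<in> ?V}. fi p ((\<lambda>q\<in>?V. ga q (s (g q))) (f p)))"
   unfolding e using rmorD(5)[OF f] by (auto intro!: restrict_ext)
  then show ?thesis using rmorD(4)[OF f o rmorD(4)[OF g V s]] e by simp
 qed
 ultimately show ?thesis
  using rmorD(3)[OF f] rmorD(3)[OF g] rmorD(5)[OF f]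
   continuous_map_compose[OF rmorD(1)[OF f] rmorD(1)[OF g]]
  unfolding rmor_def comp_def by auto
qed

lemma rmor_id:
 assumes "c_ringed_space X"
 shows "rmor X X (\<lambda>p. p) (\<lambda>p a. a)"
proof -
 have "(\<lambda>p\<in>{p \<in> pts X. p \<in> V}. s p) \<in> sec X {p \<in> pts X. p \<in> V}"
  if V: "aopen X V" and s: "s \<in> sec X V" for V s
 proof -
  have e: "{p \<in> pts X. p \<in> V} = V" using openin_subset[OF V] by auto
  show ?thesis unfolding e using crs_sec(5)[OF assms V s V] by simp
 qed
 then show ?thesis unfolding rmor_def by (auto simp: ring_hom_def)
qed

lemma rmor_open_sub:
 assumes X: "c_ringed_space X" and r: "rmor X Y f fi"
  and U: "aopen X U" and V: "aopen Y V" and UV: "f ` U \<subseteq> V"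
 shows "rmor (open_sub X U) (open_sub Y V) f fi"
proof -
 have sU: "U \<subseteq> pts X" by (rule openin_subset[OF U])
 have "continuous_map (subtopology (tp X) U) (subtopology (tp Y) V) f"
  using rmorD(1)[OF r] UV by (auto simp: continuous_map_in_subtopology intro: continuous_map_from_subtopology)
 moreover have "(\<lambda>p\<in>{p \<in> U. f p \<in> W}. fi p (s (f p))) \<in> sec X {p \<in> U. f p \<in> W}"
  if W: "aopen Y W" and s: "s \<in> sec Y W" for W s
 proof -
  let ?A = "{p \<in> pts X. f p \<in> W}" let ?B = "{p \<in> U. f p \<in> W}"
  have o: "aopen X ?A" using rmorD(1)[OF r] W by (simp add: continuous_map_def)
  have e: "?B = U \<inter> ?A" using sU by auto
  have o2: "aopen X ?B" unfolding e using U o by (rule openin_Int)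
  have "restrict (\<lambda>p\<in>?A. fi p (s (f p))) ?B \<in> sec X ?B"
   using crs_sec(5)[OF X o rmorD(4)[OF r W s] o2] e by blast
  moreover have "restrict (\<lambda>p\<in>?A. fi p (s (f p))) ?B = (\<lambda>p\<in>?B. fi p (s (f p)))"
   unfolding e by (rule ext) auto
  ultimately show ?thesis by simp
 qed
 ultimately show ?thesis
  using rmorD(2,3)[OF r] sU unfolding rmor_def open_sub_sel open_sub_iff[OF U] open_sub_iff[OF V]
  by (auto simp: Int_absorb1)
qed

section \<open>Open subspaces of analytic spaces\<close>

text \<open>An open part of a zero locus is the locus of the same equations on a smaller ambient
  domain; hence open subspaces of local models are again local models.\<close>

lemma openin_model_lift:
 assumes D: "open_Cn n D" and O: "openin (top_of_set {z \<in> D. Q z}) W"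
 obtains D' where "open_Cn n D'" "D' \<subseteq> D" "{z \<in> D'. Q z} = W"
proof -
 obtain T where T: "open T" "W = {z \<in> D. Q z} \<inter> T" using O by (auto simp: openin_open)
 have "open_Cn n (D \<inter> T)" using D T(1) by (metis openin_Int_open)
 then show ?thesis using that[of "D \<inter> T"] T(2) by auto
qed

lemma holo_subset: "holo n D h \<Longrightarrow> open_Cn n D' \<Longrightarrow> D' \<subseteq> D \<Longrightarrow> holo n D' h"
 unfolding holo_def by blast

lemma model_sel [simp]:
 "tp (model n D fs) = top_of_set {z \<in> D. \<forall>f\<in>fs. f z = 0}"
 "stk (model n D fs) = (\<lambda>z. hol_ring n z Quot model_ideal n fs z)"
 "cst (model n D fs) = (\<lambda>z c. model_ideal n fs z +>\<^bsub>hol_ring n z\<^esub> (\<lambda>w. c))"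
 by (simp_all add: model_def)

text \<open>Sections are given locally by holomorphic functions on ambient neighbourhoods, and these
  can be intersected with the smaller domain.\<close>

lemma sec_model_subset:
 assumes D: "open_Cn n D" "open_Cn n D'" "D' \<subseteq> D" and W: "W \<subseteq> D'"
 shows "sec (model n D' fs) W = sec (model n D fs) W"
proof -
 have "(\<exists>N h. open_Cn n N \<and> z \<in> N \<and> N \<subseteq> D' \<and> holo n N h \<and>
    (\<forall>w\<in>N \<inter> W. s w = model_ideal n fs w +>\<^bsub>hol_ring n w\<^esub> h)) \<longleftrightarrow>
  (\<exists>N h. open_Cn n N \<and> z \<in> N \<and> N \<subseteq> D \<and> holo n N h \<and>
    (\<forall>w\<in>N \<inter> W. s w = model_ideal n fs w +>\<^bsub>hol_ring n w\<^esub> h))" (is "?L \<longleftrightarrow> ?R") if z: "z \<in> W" for z s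
 proof
  assume ?L then show ?R using D(3) by blast
 next
  assume ?R
  then obtain N h where N: "open_Cn n N" "z \<in> N" "N \<subseteq> D" "holo n N h"
    "\<forall>w\<in>N \<inter> W. s w = model_ideal n fs w +>\<^bsub>hol_ring n w\<^esub> h" by blast
  have "open_Cn n (N \<inter> D')" using N(1) D(2) by (rule openin_Int)
  then show ?L using N z W holo_subset[OF N(4)] by (intro exI[of _ "N \<inter> D'"] exI[of _ h]) auto
 qed
 then show ?thesis unfolding model_def by auto
qed

lemma isomorphic_rspaces_model_open_sub:
 assumes X: "c_ringed_space X"
  and iso: "isomorphic_rspaces X (model n D fs)" and D: "open_Cn n D" and U: "aopen X U"
 obtains D' where "open_Cn n D'" "D' \<subseteq> D" "isomorphic_rspaces (open_sub X U) (model n D' fs)"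
proof -
 let ?M = "model n D fs"
 obtain f fi g ga where fg: "rmor X ?M f fi" "rmor ?M X g ga"
  and gf: "\<And>p. p \<in> pts X \<Longrightarrow> g (f p) = p \<and> (\<forall>a\<in>germs X p. fi p (ga (f p) a) = a)"
  and fg': "\<And>q. q \<in> pts ?M \<Longrightarrow> f (g q) = q \<and> (\<forall>b\<in>germs ?M q. ga q (fi (g q) b) = b)"
  using iso unfolding isomorphic_rspaces_def by meson
 \<comment> \<open>This is the image of \<open>U\<close> under \<open>f\<close>, written as a
   preimage under the inverse so that it is visibly open.\<close>
 define W where "W = {q \<in> pts ?M. g q \<in> U}"
 have oW: "aopen ?M W" using rmorD(1)[OF fg(2)] U by (simp add: continuous_map_def W_def)
 obtain D' where D': "open_Cn n D'" "D' \<subseteq> D" "{z \<in> D'. \<forall>f\<in>fs. f z = 0} = W"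
  using openin_model_lift[OF D, of "\<lambda>z. \<forall>f\<in>fs. f z = 0" W] oW by auto
 let ?M' = "model n D' fs"
 have pts': "pts ?M' = W" using D'(3) by simp
 have tp': "tp ?M' = subtopology (tp ?M) W"
  using D'(2,3) by (auto simp: subtopology_subtopology intro!: arg_cong[where f="subtopology euclidean"])
 have sU: "U \<subseteq> pts X" using openin_subset[OF U] .
 have fU: "f ` U \<subseteq> W" using gf sU rmorD(5)[OF fg(1)] unfolding W_def by auto
 have r1: "rmor (open_sub X U) (open_sub ?M W) f fi" by (rule rmor_open_sub[OF X fg(1) U oW fU])
 have secM: "sec ?M' V = sec ?M V" if "V \<subseteq> W" for V
  using sec_model_subset[OF D D'(1,2)] that D'(3) by blast
 have r1': "rmor (open_sub X U) ?M' f fi"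
 proof -
  have "sec ?M' V = sec ?M V" if "openin (subtopology (tp ?M) W) V" for V
   using that secM open_sub_iff[OF oW] by blast
  then show ?thesis using r1 unfolding rmor_def tp' open_sub_sel by auto
 qed
 have gc: "continuous_map (tp ?M') (subtopology (tp X) U) g"
  unfolding tp' using rmorD(1)[OF fg(2)] W_def
  by (auto simp: continuous_map_in_subtopology intro: continuous_map_from_subtopology)
 have secg: "(\<lambda>p\<in>{p \<in> W. g p \<in> V}. ga p (s (g p))) \<in> sec ?M' {p \<in> W. g p \<in> V}"
  if V: "aopen X V" "V \<subseteq> U" and s: "s \<in> sec X V" for V s
 proof -
  have e: "{p \<in> W. g p \<in> V} = {p \<in> pts ?M. g p \<in> V}" using V(2) W_def by auto
  have "{p \<in> W. g p \<in> V} \<subseteq> W" by auto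
  from secM[OF this] show ?thesis using rmorD(4)[OF fg(2) V(1) s] unfolding e by simp
 qed
 have r2: "rmor ?M' (open_sub X U) g ga"
  unfolding rmor_def
  using gc secg rmorD(2,3)[OF fg(2)] W_def unfolding pts' open_sub_sel open_sub_iff[OF U] by auto
 have "isomorphic_rspaces (open_sub X U) ?M'"
  unfolding isomorphic_rspaces_def
  apply (rule exI[of _ f], rule exI[of _ fi], rule exI[of _ g], rule exI[of _ ga])
  using r1' r2 gf fg' sU W_def unfolding pts' pts_open_sub[OF U] by auto
 then show ?thesis using that D' by blast
qed

text \<open>The dimension bound survives because the isolating functions are merely restricted, and
  the local model of a neighbourhood is replaced by a model of its trace on
  \<open>U\<close>.\<close>

lemma analytic_space_open_sub:
 assumes A: "analytic_space X" and U: "aopen X U"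
 shows "analytic_space (open_sub X U)"
proof -
 have c: "c_ringed_space X" using A by (simp add: analytic_space_def)
 have sU: "U \<subseteq> pts X" using openin_subset[OF U] .
 obtain d where d: "\<And>p. p \<in> pts X \<Longrightarrow> \<exists>V fs. aopen X V \<and> p \<in> V \<and> fs \<subseteq> sec X V \<and> finite fs \<and>
   card fs \<le> d \<and> {q \<in> V. \<forall>s\<in>fs. s q \<notin> Units (stk X q)} = {p}"
  using A unfolding analytic_space_def finite_dimensional_def by meson
 have fin: "\<exists>V fs. (aopen X V \<and> V \<subseteq> U) \<and> p \<in> V \<and> fs \<subseteq> sec X V \<and> finite fs \<and>
   card fs \<le> d \<and> {q \<in> V. \<forall>s\<in>fs. s q \<notin> Units (stk X q)} = {p}" if p: "p \<in> U" for p
 proof -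
  obtain V fs where V: "aopen X V" "p \<in> V" "fs \<subseteq> sec X V" "finite fs"
   "card fs \<le> d" "{q \<in> V. \<forall>s\<in>fs. s q \<notin> Units (stk X q)} = {p}" using d[OF subsetD[OF sU p]] by (elim exE conjE)
  let ?V = "V \<inter> U" let ?fs = "(\<lambda>s. restrict s ?V) ` fs"
  have o: "aopen X ?V" using V(1) U by (rule openin_Int)
  have "?fs \<subseteq> sec X ?V" using crs_sec(5)[OF c V(1) _ o] V(3) by auto
  moreover have "card ?fs \<le> d" using card_image_le[OF V(4)] V(5) le_trans by blast
  moreover have "{q \<in> ?V. \<forall>s\<in>?fs. s q \<notin> Units (stk X q)} = {p}" using V(6) p by auto
  moreover have "finite ?fs" "p \<in> ?V" using V p by auto
  ultimately show ?thesis using o by (intro exI[of _ ?V] exI[of _ ?fs] conjI) (assumption | rule Int_lower2)+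
 qed
 have "finite_dimensional (open_sub X U)"
  unfolding finite_dimensional_def pts_open_sub[OF U] unfolding open_sub_sel open_sub_iff[OF U]
  by (rule exI[of _ d], rule ballI, rule fin)
 moreover have "\<exists>V n D fs. (aopen X V \<and> V \<subseteq> U) \<and> p \<in> V \<and>
   open_Cn n D \<and> finite fs \<and> (\<forall>f\<in>fs. holo n D f) \<and>
   isomorphic_rspaces (open_sub X (U \<inter> V)) (model n D fs)" if p: "p \<in> U" for p
 proof -
  have "p \<in> pts X" using p sU by auto
  then obtain V n D fs where V: "aopen X V" "p \<in> V" "open_Cn n D" "finite fs" "\<forall>f\<in>fs. holo n D f"
   "isomorphic_rspaces (open_sub X V) (model n D fs)"
   using A unfolding analytic_space_def by meson
  have o: "aopen (open_sub X V) (U \<inter> V)"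
   using open_sub_iff[OF V(1)] openin_Int[OF U V(1)] by auto
  obtain D' where D': "open_Cn n D'" "D' \<subseteq> D"
   "isomorphic_rspaces (open_sub (open_sub X V) (U \<inter> V)) (model n D' fs)"
   using isomorphic_rspaces_model_open_sub[OF crs_open_sub[OF c V(1)] V(6,3) o] by blast
  have e: "V \<inter> (U \<inter> V) = U \<inter> (U \<inter> V)" by auto
  show ?thesis
   apply (rule exI[of _ "U \<inter> V"], rule exI[of _ n], rule exI[of _ D'], rule exI[of _ fs])
   using D' V(2,4,5) p e openin_Int[OF U V(1)] holo_subset[OF _ D'(1,2)] by auto
 qed
 moreover have "Hausdorff_space (subtopology (tp X) U)"
  using A by (simp add: analytic_space_def Hausdorff_space_subtopology)
 ultimately show ?thesis
  using crs_open_sub[OF c U]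
  unfolding analytic_space_def pts_open_sub[OF U] unfolding open_sub_sel open_sub_iff[OF U] open_sub_open_sub
  by blast
qed

section \<open>The category of analytic spaces\<close>

lemma hom_setD:
 assumes "f \<in> hom_set C x y"
 shows "f \<in> Arr C" "Dom C f = x" "Cod C f = y"
 using assms by (simp_all add: hom_set_def)

lemma categoryD:
 assumes "category C"
 shows "f \<in> hom_set C x y \<Longrightarrow> x \<in> Obj C" "f \<in> hom_set C x y \<Longrightarrow> y \<in> Obj C"
  "x \<in> Obj C \<Longrightarrow> Idt C x \<in> hom_set C x x"
  "f \<in> hom_set C x y \<Longrightarrow> g \<in> hom_set C y z \<Longrightarrow> Cmp C g f \<in> hom_set C x z"
  "f \<in> hom_set C x y \<Longrightarrow> Cmp C f (Idt C x) = f"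
  "f \<in> hom_set C x y \<Longrightarrow> Cmp C (Idt C y) f = f"
  "f \<in> hom_set C x y \<Longrightarrow> g \<in> hom_set C y z \<Longrightarrow> h \<in> hom_set C z w \<Longrightarrow>
   Cmp C h (Cmp C g f) = Cmp C (Cmp C h g) f"
 using assms unfolding category_def hom_set_def by auto

lemma ana_sel [simp]:
 "Obj ana = {X. analytic_space X}" "Dom ana = mdom" "Cod ana = mcod"
 by (simp_all add: ana_def)

lemma crs_of_ana: "analytic_space X \<Longrightarrow> c_ringed_space X"
 by (simp add: analytic_space_def)

lemma ana_hom_iff:
 "m \<in> ahom X Y \<longleftrightarrow> mdom m = X \<and> mcod m = Y \<and> analytic_space X \<and> analytic_space Y \<and>
   rmor X Y (mfun m) (mgerm m) \<and> mfun m \<in> extensional (pts X) \<and> mgerm m \<in> extensional (pts X) \<and>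
   (\<forall>p\<in>pts X. mgerm m p \<in> extensional (germs Y (mfun m p)))"
 unfolding hom_set_def ana_def by auto

lemma ana_Arr_iff: "m \<in> Arr ana \<longleftrightarrow> m \<in> ahom (mdom m) (mcod m)"
 by (simp add: hom_set_def)

lemma ana_homD:
 assumes "m \<in> ahom X Y"
 shows "mdom m = X" "mcod m = Y" "analytic_space X" "analytic_space Y" "rmor X Y (mfun m) (mgerm m)"
  "p \<in> pts X \<Longrightarrow> mfun m p \<in> pts Y" "continuous_map (tp X) (tp Y) (mfun m)" "m \<in> Arr ana"
 using assms rmorD(1,5) unfolding ana_hom_iff ana_Arr_iff by auto

text \<open>Extensionality of the stored functions reduces equality of records to values on points
  and germs. Both kinds of values have to be compared, because spaces may be non-reduced.\<close>

lemma ana_hom_eqI: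
 assumes m: "m \<in> ahom X Y" and n: "n \<in> ahom X Y"
  and f: "\<And>p. p \<in> pts X \<Longrightarrow> mfun m p = mfun n p"
  and g: "\<And>p a. p \<in> pts X \<Longrightarrow> a \<in> germs Y (mfun m p) \<Longrightarrow> mgerm m p a = mgerm n p a"
 shows "m = n"
proof -
 have 1: "mfun m = mfun n"
  using m n f by (intro extensionalityI[of _ "pts X"]) (auto simp: ana_hom_iff)
 have "mgerm m p = mgerm n p" if p: "p \<in> pts X" for p
  using m n g[OF p] p f[OF p]
  by (intro extensionalityI[of _ "germs Y (mfun m p)"]) (auto simp: ana_hom_iff)
 moreover have "mgerm m \<in> extensional (pts X)" "mgerm n \<in> extensional (pts X)"
  using m n by (simp_all add: ana_hom_iff)
 ultimately have 2: "mgerm m = mgerm n" by (metis extensionalityI)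
 show ?thesis using 1 2 m n by (auto simp: ana_hom_iff intro: amor.equality)
qed

text \<open>Normal form of a raw morphism: cutting both components down to points and germs makes
  equality of arrows of \<open>ana\<close> mean equality of morphisms.\<close>

definition mk_amor :: "'u aspace \<Rightarrow> 'u aspace \<Rightarrow> ('u \<Rightarrow> 'u) \<Rightarrow> ('u \<Rightarrow> 'u \<Rightarrow> 'u) \<Rightarrow> 'u amor" where
 "mk_amor X Y f fi = \<lparr>mdom = X, mcod = Y, mfun = restrict f (pts X),
   mgerm = (\<lambda>p\<in>pts X. restrict (fi p) (germs Y (f p)))\<rparr>"

lemma mk_amor_hom:
 assumes X: "analytic_space X" "analytic_space Y" and r: "rmor X Y f fi"
 shows "mk_amor X Y f fi \<in> ahom X Y"
proof -
 have "rmor X Y (restrict f (pts X)) (\<lambda>p\<in>pts X. restrict (fi p) (germs Y (f p)))"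
  by (rule rmor_cong[OF crs_of_ana[OF X(2)] r]) auto
 then show ?thesis using X unfolding ana_hom_iff by (simp add: mk_amor_def)
qed

lemma mk_amor_sel:
 "p \<in> pts X \<Longrightarrow> mfun (mk_amor X Y f fi) p = f p"
 "p \<in> pts X \<Longrightarrow> a \<in> germs Y (f p) \<Longrightarrow> mgerm (mk_amor X Y f fi) p a = fi p a"
 by (simp_all add: mk_amor_def)

lemma Idt_ana: "aid X = mk_amor X X (\<lambda>p. p) (\<lambda>p a. a)"
 by (simp add: ana_def mk_amor_def)

lemma Cmp_ana: "acmp n m =
  mk_amor (mdom m) (mcod n) (\<lambda>p. mfun n (mfun m p)) (\<lambda>p a. mgerm m p (mgerm n (mfun m p) a))"
 by (simp add: ana_def mk_amor_def)

lemma aid_hom: "analytic_space X \<Longrightarrow> aid X \<in> ahom X X"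
 unfolding Idt_ana by (intro mk_amor_hom rmor_id crs_of_ana)

lemma acmp_hom:
 assumes m: "m \<in> ahom X Y" and n: "n \<in> ahom Y Z"
 shows "acmp n m \<in> ahom X Z"
 using mk_amor_hom[OF ana_homD(3)[OF m] ana_homD(4)[OF n] rmor_comp[OF ana_homD(5)[OF m] ana_homD(5)[OF n]]]
 unfolding Cmp_ana ana_homD(1)[OF m] ana_homD(2)[OF n] .

lemma mfun_Idt: "p \<in> pts X \<Longrightarrow> mfun (aid X) p = p"
 by (simp add: Idt_ana mk_amor_def)

lemma mfun_Cmp: "m \<in> ahom X Y \<Longrightarrow> p \<in> pts X \<Longrightarrow> mfun (acmp n m) p = mfun n (mfun m p)"
 by (simp add: Cmp_ana mk_amor_def ana_homD(1))

lemma mgerm_Cmp: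
 assumes "m \<in> ahom X Y" "n \<in> ahom Y Z" "p \<in> pts X" "a \<in> germs Z (mfun n (mfun m p))"
 shows "mgerm (acmp n m) p a = mgerm m p (mgerm n (mfun m p) a)"
 using assms by (simp add: Cmp_ana mk_amor_def ana_homD(1,2))

lemma mgerm_carrier:
 assumes m: "m \<in> ahom X Y" and p: "p \<in> pts X" and a: "a \<in> germs Y (mfun m p)"
 shows "mgerm m p a \<in> germs X p"
 using rmorD(2)[OF ana_homD(5)[OF m] p] a by (rule ring_hom_closed)

lemma category_ana: "category ana"
proof -
 have 1: "acmp m (aid X) = m" if m: "m \<in> ahom X Y" for m :: "'u amor" and X Y
  using ana_homD(1-4)[OF m] ana_homD(6)[OF m]
  by (intro ana_hom_eqI[OF acmp_hom[OF aid_hom m] m])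
   (auto simp: Cmp_ana Idt_ana mk_amor_sel mk_amor_def mgerm_carrier[OF m])
 have 2: "acmp (aid Y) m = m" if m: "m \<in> ahom X Y" for m :: "'u amor" and X Y
  using ana_homD(1-4)[OF m] ana_homD(6)[OF m]
  by (intro ana_hom_eqI[OF acmp_hom[OF m aid_hom] m])
   (auto simp: Cmp_ana Idt_ana mk_amor_sel mk_amor_def)
 have 3: "acmp h (acmp g f) = acmp (acmp h g) f"
  if f: "f \<in> ahom X Y" and g: "g \<in> ahom Y Z" and h: "h \<in> ahom Z W"
  for f g h :: "'u amor" and X Y Z W
 proof (rule ana_hom_eqI[OF acmp_hom[OF acmp_hom[OF f g] h] acmp_hom[OF f acmp_hom[OF g h]]])
  fix p assume p: "p \<in> pts X"
  show "mfun (acmp h (acmp g f)) p = mfun (acmp (acmp h g) f) p"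
   using p ana_homD(6)[OF f p] by (simp add: mfun_Cmp[OF acmp_hom[OF f g]] mfun_Cmp[OF f] mfun_Cmp[OF g])
  fix a assume a: "a \<in> germs W (mfun (acmp h (acmp g f)) p)"
  have a': "a \<in> germs W (mfun h (mfun g (mfun f p)))"
   using a p by (simp add: mfun_Cmp[OF acmp_hom[OF f g]] mfun_Cmp[OF f])
  have b: "mgerm h (mfun g (mfun f p)) a \<in> germs Z (mfun g (mfun f p))"
   using mgerm_carrier[OF h ana_homD(6)[OF g ana_homD(6)[OF f p]] a'] .
  show "mgerm (acmp h (acmp g f)) p a = mgerm (acmp (acmp h g) f) p a"
   using p a' b ana_homD(6)[OF f p]
   by (simp add: mgerm_Cmp[OF acmp_hom[OF f g] h] mgerm_Cmp[OF f acmp_hom[OF g h]]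
    mgerm_Cmp[OF f g] mgerm_Cmp[OF g h] mfun_Cmp[OF f] mfun_Cmp[OF g])
 qed
 show ?thesis
  unfolding category_def ana_Arr_iff ana_sel
  apply (intro conjI ballI impI)
  subgoal using ana_homD(3) by (simp add: ana_Arr_iff)
  subgoal using ana_homD(4) by (simp add: ana_Arr_iff)
  subgoal by (simp add: aid_hom)
  subgoal by (simp add: ana_Arr_iff acmp_hom)
  subgoal using 1 by (simp add: ana_Arr_iff)
  subgoal using 2 by (simp add: ana_Arr_iff)
  subgoal using 3 by (metis ana_Arr_iff)
  done
qed

lemmas anaD = categoryD[OF category_ana]

section \<open>Restriction of morphisms\<close>

lemma mrestr_hom:
 assumes m: "m \<in> ahom X Y" and W: "aopen X W" "aopen Y W'" "mfun m ` W \<subseteq> W'"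
 shows "mrestr m W W' \<in> ahom (open_sub X W) (open_sub Y W')"
proof -
 have e: "pts (open_sub X W) = W" by (rule pts_open_sub[OF W(1)])
 have s: "W \<subseteq> pts X" by (rule openin_subset[OF W(1)])
 have "rmor (open_sub X W) (open_sub Y W') (restrict (mfun m) W) (restrict (mgerm m) W)"
  using e s
  by (intro rmor_cong[OF _ rmor_open_sub[OF _ ana_homD(5)[OF m] W]])
   (auto intro!: crs_open_sub[OF crs_of_ana[OF ana_homD(3)[OF m]] W(1)]
    crs_open_sub[OF crs_of_ana[OF ana_homD(4)[OF m]] W(2)]
    crs_of_ana ana_homD(3)[OF m])
 moreover have "mgerm m p \<in> extensional (germs Y (mfun m p))" if "p \<in> W" for p
  using m that s by (auto simp: ana_hom_iff)
 moreover have "analytic_space (open_sub X W)" "analytic_space (open_sub Y W')"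
  using analytic_space_open_sub W ana_homD(3,4)[OF m] by blast+
 ultimately show ?thesis unfolding ana_hom_iff e
  by (auto simp: mrestr_def ana_homD(1,2)[OF m])
qed

lemma mfun_mrestr [simp]: "p \<in> W \<Longrightarrow> mfun (mrestr m W W') p = mfun m p"
 by (simp add: mrestr_def)

lemma mgerm_mrestr [simp]: "p \<in> W \<Longrightarrow> mgerm (mrestr m W W') p = mgerm m p"
 by (simp add: mrestr_def)

lemma mrestr_whole: "m \<in> ahom X Y \<Longrightarrow> mrestr m (pts X) (pts Y) = m"
 by (auto simp: mrestr_def ana_hom_iff extensional_restrict intro: amor.equality)

lemma mrestr_Cmp:
 assumes m: "m \<in> ahom X Y" and n: "n \<in> ahom Y Z"
  and W: "aopen X W" "aopen Y W'" "mfun m ` W \<subseteq> W'"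
  and W'': "aopen Z W''" "mfun n ` W' \<subseteq> W''"
 shows "acmp (mrestr n W' W'') (mrestr m W W') = mrestr (acmp n m) W W''"
proof -
 note mm = mrestr_hom[OF m W] and nn = mrestr_hom[OF n W(2) W'']
 have s: "W \<subseteq> pts X" by (rule openin_subset[OF W(1)])
 have e: "pts (open_sub X W) = W" by (rule pts_open_sub[OF W(1)])
 have nm: "mrestr (acmp n m) W W'' \<in> ahom (open_sub X W) (open_sub Z W'')"
  using W W'' by (intro mrestr_hom[OF acmp_hom[OF m n]]) (auto simp: mfun_Cmp[OF m subsetD[OF s]])
 show ?thesis
 proof (rule ana_hom_eqI[OF acmp_hom[OF mm nn] nm])
  fix p assume "p \<in> pts (open_sub X W)"
  then have p: "p \<in> W"  by simp
  then have q: "mfun m p \<in> W'" using W(3) by auto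
  have pX: "p \<in> pts X" using p s by auto
  show "mfun (acmp (mrestr n W' W'') (mrestr m W W')) p = mfun (mrestr (acmp n m) W W'') p"
   using p q pX by (simp add: mfun_Cmp[OF mm] mfun_Cmp[OF m])
  fix a assume a: "a \<in> germs (open_sub Z W'') (mfun (acmp (mrestr n W' W'') (mrestr m W W')) p)"
  then have "a \<in> germs Z (mfun n (mfun m p))"
   using p q e by (simp add: mfun_Cmp[OF mm])
  then show "mgerm (acmp (mrestr n W' W'') (mrestr m W W')) p a = mgerm (mrestr (acmp n m) W W'') p a"
   using p q pX by (simp add: mgerm_Cmp[OF mm nn] mgerm_Cmp[OF m n] mfun_Cmp[OF mm])
 qed
qed

lemma inclusion_hom:
 assumes "analytic_space X" "aopen X W" "aopen X W'" "W \<subseteq> W'"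
 shows "inclusion X W W' \<in> ahom (open_sub X W) (open_sub X W')"
 unfolding inclusion_def using assms
 by (intro mrestr_hom aid_hom) (auto simp: mfun_Idt[OF subsetD[OF openin_subset[OF assms(2)]]])

lemma incl_hom:
 assumes "analytic_space X" "aopen X W"
 shows "incl X W \<in> ahom (open_sub X W) X"
 using inclusion_hom[OF assms, of "pts X"] openin_subset[OF assms(2)] by simp

lemma mfun_inclusion [simp]: "W \<subseteq> pts X \<Longrightarrow> p \<in> W \<Longrightarrow> mfun (inclusion X W W') p = p"
 by (auto simp: inclusion_def mfun_Idt)

lemma mgerm_inclusion: "W \<subseteq> pts X \<Longrightarrow> p \<in> W \<Longrightarrow> a \<in> germs X p \<Longrightarrow> mgerm (inclusion X W W') p a = a"
 by (auto simp: inclusion_def Idt_ana mk_amor_def)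

lemma inclusion_refl:
 assumes "analytic_space X" "aopen X W"
 shows "inclusion X W W = aid (open_sub X W)"
 using openin_subset[OF assms(2)] pts_open_sub[OF assms(2)]
 by (intro ana_hom_eqI[OF inclusion_hom aid_hom])
  (auto simp: assms analytic_space_open_sub mfun_Idt mgerm_inclusion Idt_ana mk_amor_def)

lemma Cmp_mrestr_inclusion:
 assumes m: "m \<in> ahom X Y" and W: "aopen X W" "aopen X W'" "W \<subseteq> W'"
  and V: "aopen Y V" "mfun m ` W' \<subseteq> V"
 shows "acmp (mrestr m W' V) (inclusion X W W') = mrestr m W V"
proof -
 have "acmp (mrestr m W' V) (mrestr (aid X) W W') = mrestr (acmp m (aid X)) W V"
  using W V openin_subset[OF W(1)] ana_homD(3)[OF m]
  by (intro mrestr_Cmp[OF aid_hom m]) (auto simp: mfun_Idt[OF subsetD[OF openin_subset[OF W(1)]]])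
 then show ?thesis unfolding inclusion_def using anaD(5)[OF m] by simp
qed

lemma Cmp_inclusion_mrestr:
 assumes m: "m \<in> ahom X Y" and W: "aopen X W" "aopen Y V" "mfun m ` W \<subseteq> V"
  and V: "aopen Y V'" "V \<subseteq> V'"
 shows "acmp (inclusion Y V V') (mrestr m W V) = mrestr m W V'"
proof -
 have "acmp (mrestr (aid Y) V V') (mrestr m W V) = mrestr (acmp (aid Y) m) W V'"
  using W V openin_subset[OF W(2)] ana_homD(4)[OF m]
  by (intro mrestr_Cmp[OF m aid_hom]) (auto simp: mfun_Idt[OF subsetD[OF openin_subset[OF W(2)]]])
 then show ?thesis unfolding inclusion_def using anaD(6)[OF m] by simp
qed

lemma Cmp_inclusion:
 assumes "analytic_space X" "aopen X W" "aopen X W'" "W \<subseteq> W'" "aopen X W''" "W' \<subseteq> W''"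
 shows "acmp (inclusion X W' W'') (inclusion X W W') = inclusion X W W''"
 using assms openin_subset[OF assms(3)]
 unfolding inclusion_def[of X W' W'']
 by (subst Cmp_mrestr_inclusion[OF aid_hom])
  (auto simp: mfun_Idt[OF subsetD[OF openin_subset[OF assms(3)]]] inclusion_def)

lemma Cmp_inclusion_pts:
 assumes m: "m \<in> ahom X Y" and W: "aopen X W"
 shows "acmp m (incl X W) = mrestr m W (pts Y)"
 using Cmp_mrestr_inclusion[OF m W, of "pts X" "pts Y"] openin_subset[OF W] ana_homD(6)[OF m]
 by (auto simp: mrestr_whole[OF m])

text \<open>Open immersions are monic, since they act as the identity on points and on
  germs.\<close>

lemma inclusion_mono:
 assumes X: "analytic_space X" "aopen X W" "aopen X W'" "W \<subseteq> W'"
  and k: "k \<in> ahom Q (open_sub X W)" "k' \<in> ahom Q (open_sub X W)"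
  and eq: "acmp (inclusion X W W') k = acmp (inclusion X W W') k'"
 shows "k = k'"
proof (rule ana_hom_eqI[OF k])
 note i = inclusion_hom[OF X]
 fix p assume p: "p \<in> pts Q"
 have s: "W \<subseteq> pts X" by (rule openin_subset[OF X(2)])
 have kp: "mfun k p \<in> W" "mfun k' p \<in> W"
  using ana_homD(6)[OF k(1) p] ana_homD(6)[OF k(2) p] by auto
 show e: "mfun k p = mfun k' p"
  using mfun_Cmp[OF k(1) p, of "inclusion X W W'"] mfun_Cmp[OF k(2) p, of "inclusion X W W'"] eq kp s by simp
 fix a assume a: "a \<in> germs (open_sub X W) (mfun k p)"
 have "mgerm (acmp (inclusion X W W') k) p a = mgerm k p a"
  using a kp s by (simp add: mgerm_Cmp[OF k(1) i p] mgerm_inclusion)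
 moreover have "mgerm (acmp (inclusion X W W') k') p a = mgerm k' p a"
  using a kp s e by (simp add: mgerm_Cmp[OF k(2) i p] mgerm_inclusion)
 ultimately show "mgerm k p a = mgerm k' p a" using eq by simp
qed

text \<open>Factorization through an open subspace is decided by the underlying set alone, even for
  non-reduced spaces.\<close>

lemma factor_open:
 assumes k: "k \<in> ahom Q X" and W: "aopen X W" "mfun k ` pts Q \<subseteq> W"
 shows "mrestr k (pts Q) W \<in> ahom Q (open_sub X W)"
  "acmp (incl X W) (mrestr k (pts Q) W) = k"
proof -
 show "mrestr k (pts Q) W \<in> ahom Q (open_sub X W)"
  using mrestr_hom[OF k _ W(1), of "pts Q"] W(2) by simp
 show "acmp (incl X W) (mrestr k (pts Q) W) = k"
  using Cmp_inclusion_mrestr[OF k _ W(1,2), of "pts X"] openin_subset[OF W(1)] mrestr_whole[OF k] by simp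
qed

lemma openin_vimage:
 assumes k: "k \<in> ahom Q X" and W: "aopen X W"
 shows "aopen Q {p \<in> pts Q. mfun k p \<in> W}"
 using ana_homD(7)[OF k] W by (simp add: continuous_map_def)

section \<open>Etale morphisms\<close>

lemma is_isom_homD:
 assumes "is_isom C f"
 obtains g where "g \<in> hom_set C (Cod C f) (Dom C f)" "Cmp C g f = Idt C (Dom C f)" "Cmp C f g = Idt C (Cod C f)"
 using assms unfolding is_isom_def by blast

text \<open>Near \<open>z\<close> the map is an isomorphism onto an open set, and its inverse is the
  section \<open>s\<close>. The neighbourhood \<open>O'\<close> prescribes where the sheet
  \<open>U\<close> lies. The last clause is the rigidity of lifts into one sheet, from which all
  later local uniqueness statements come.\<close>

lemma etale_section:
 assumes m: "m \<in> ahom Z T" and et: "ana_etale m" and z: "z \<in> pts Z"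
  and O: "aopen Z O'" "z \<in> O'"
 obtains U V s where "aopen Z U" "z \<in> U" "U \<subseteq> O'" "aopen T V" "mfun m ` U = V"
  "s \<in> ahom (open_sub T V) Z" "mfun s ` V = U" "acmp m s = incl T V"
  "\<And>Q k k'. k \<in> ahom Q Z \<Longrightarrow> k' \<in> ahom Q Z \<Longrightarrow> mfun k ` pts Q \<subseteq> U \<Longrightarrow>
   mfun k' ` pts Q \<subseteq> U \<Longrightarrow> acmp m k = acmp m k' \<Longrightarrow> k = k'"
proof -
 note md = ana_homD(1,2)[OF m]
 obtain U0 where U0: "aopen Z U0" "z \<in> U0" "aopen T (mfun m ` U0)"
  "is_isom ana (mrestr m U0 (mfun m ` U0))"
  using et z unfolding ana_etale_def md by blast
 let ?V0 = "mfun m ` U0" let ?m0 = "mrestr m U0 ?V0"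
 have m0: "?m0 \<in> ahom (open_sub Z U0) (open_sub T ?V0)"
  by (rule mrestr_hom[OF m U0(1,3)]) simp
 obtain t where t: "t \<in> ahom (open_sub T ?V0) (open_sub Z U0)"
  "acmp t ?m0 = aid (open_sub Z U0)" "acmp ?m0 t = aid (open_sub T ?V0)"
  using is_isom_homD[OF U0(4)] ana_homD(1,2)[OF m0] by (metis ana_sel(2,3))
 have sU: "U0 \<subseteq> pts Z" "?V0 \<subseteq> pts T" using openin_subset U0(1,3) by blast+
 have pU: "pts (open_sub Z U0) = U0" "pts (open_sub T ?V0) = ?V0" using pts_open_sub U0(1,3) by blast+
 have tm: "mfun t (mfun m p) = p" if "p \<in> U0" for p
  using mfun_Cmp[OF m0, of p t] that mfun_Idt[of p "open_sub Z U0"] t(2) unfolding pU by simp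
 have tU: "mfun t q \<in> U0" if "q \<in> ?V0" for q using that tm by auto
 have mt: "mfun m (mfun t q) = q" if "q \<in> ?V0" for q using that tm by auto
 define U where "U = U0 \<inter> O'"
 define V where "V = mfun m ` U"
 have oU: "aopen Z U" unfolding U_def using U0(1) O(1) by (rule openin_Int)
 \<comment> \<open>Written as a preimage under the inverse \<open>t\<close>, the image of the sheet
   is open by continuity.\<close>
 have Vt: "V = {q \<in> pts (open_sub T ?V0). mfun t q \<in> U}"
  unfolding pU V_def using tm tU mt U_def by (auto intro!: image_eqI) 
 have "aopen (open_sub Z U0) U" unfolding open_sub_sel open_sub_iff[OF U0(1)] using oU U_def by auto
 then have "aopen (open_sub T ?V0) V" unfolding Vt by (rule openin_vimage[OF t(1)])
 then have oV: "aopen T V" "V \<subseteq> ?V0" unfolding open_sub_sel open_sub_iff[OF U0(3)] by auto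
 have V0: "aopen (open_sub T ?V0) V" using oV open_sub_iff[OF U0(3)] by simp
 define i where "i = incl Z U0"
 have i: "i \<in> ahom (open_sub Z U0) Z" unfolding i_def by (rule incl_hom[OF ana_homD(3)[OF m] U0(1)])
 define j where "j = inclusion T V ?V0"
 have j: "j \<in> ahom (open_sub T V) (open_sub T ?V0)" unfolding j_def
  by (rule inclusion_hom[OF ana_homD(4)[OF m] oV(1) U0(3) oV(2)])
 define s where "s = acmp i (acmp t j)"
 have s: "s \<in> ahom (open_sub T V) Z" unfolding s_def by (intro acmp_hom[OF _ i] acmp_hom[OF j t(1)])
 have sV: "V \<subseteq> pts T" using openin_subset[OF oV(1)] .
 have pV: "pts (open_sub T V) = V" using pts_open_sub[OF oV(1)] .
 have sq: "mfun s q = mfun t q" if q: "q \<in> V" for q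
 proof -
  have "mfun t q \<in> U0" using q oV(2) tU by auto
  moreover have "mfun j q = q" unfolding j_def using q sV by simp
  moreover have "mfun i (mfun t q) = mfun t q" if "mfun t q \<in> U0" unfolding i_def using that sU by simp
  ultimately show ?thesis unfolding s_def using q
   mfun_Cmp[OF acmp_hom[OF j t(1)], of q i] mfun_Cmp[OF j, of q t] unfolding pV by simp
 qed
 have im: "mfun s ` V = U"
 proof
  show "mfun s ` V \<subseteq> U" using sq tm U_def V_def by auto
  show "U \<subseteq> mfun s ` V"
  proof
   fix p assume p: "p \<in> U"
   then have "mfun s (mfun m p) = p" using sq[of "mfun m p"] tm[of p] V_def U_def by auto
   then show "p \<in> mfun s ` V" using p V_def by (metis imageI)
  qed
 qed
 have mi: "acmp m i = acmp (incl T ?V0) ?m0"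
  unfolding i_def Cmp_inclusion_pts[OF m U0(1)]
  by (rule Cmp_inclusion_mrestr[OF m U0(1,3), symmetric]) (use sU in auto)
 have jT: "incl T ?V0 \<in> ahom (open_sub T ?V0) T"
  by (rule incl_hom[OF ana_homD(4)[OF m] U0(3)])
 have ms: "acmp m s = incl T V"
 proof -
  have "acmp m s = acmp (acmp m i) (acmp t j)"
   unfolding s_def by (rule anaD(7)[OF acmp_hom[OF j t(1)] i m])
  also have "\<dots> = acmp (incl T ?V0) (acmp ?m0 (acmp t j))"
   unfolding mi by (rule anaD(7)[OF acmp_hom[OF j t(1)] m0 jT, symmetric])
  also have "acmp ?m0 (acmp t j) = j"
   using anaD(7)[OF j t(1) m0] t(3) anaD(6)[OF j] by simp
  also have "acmp (incl T ?V0) j = incl T V"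
   unfolding j_def by (rule Cmp_inclusion[OF ana_homD(4)[OF m] oV(1) U0(3) oV(2)]) (use sU in auto)
  finally show ?thesis .
 qed
 \<comment> \<open>Both maps factor through \<open>U0\<close>, where \<open>m\<close> is
   invertible.\<close>
 have mono: "k = k'" if k: "k \<in> ahom Q Z" "k' \<in> ahom Q Z" "mfun k ` pts Q \<subseteq> U"
   "mfun k' ` pts Q \<subseteq> U" "acmp m k = acmp m k'" for Q k k'
 proof -
  have kU: "mfun k ` pts Q \<subseteq> U0" "mfun k' ` pts Q \<subseteq> U0" using k U_def by auto
  define l where "l = mrestr k (pts Q) U0"
  define l' where "l' = mrestr k' (pts Q) U0"
  have l: "l \<in> ahom Q (open_sub Z U0)" "acmp i l = k"
   using factor_open[OF k(1) U0(1) kU(1)] by (auto simp: l_def i_def)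
  have l': "l' \<in> ahom Q (open_sub Z U0)" "acmp i l' = k'"
   using factor_open[OF k(2) U0(1) kU(2)] by (auto simp: l'_def i_def)
  have "acmp (incl T ?V0) (acmp ?m0 l) = acmp m k"
   using anaD(7)[OF l(1) m0 jT] anaD(7)[OF l(1) i m] mi l(2) by simp
  moreover have "acmp (incl T ?V0) (acmp ?m0 l') = acmp m k'"
   using anaD(7)[OF l'(1) m0 jT] anaD(7)[OF l'(1) i m] mi l'(2) by simp
  ultimately have "acmp ?m0 l = acmp ?m0 l'"
   using inclusion_mono[OF ana_homD(4)[OF m] U0(3) _ sU(2) acmp_hom[OF l(1) m0] acmp_hom[OF l'(1) m0]]
    k(5) by simp
  then have "acmp t (acmp ?m0 l) = acmp t (acmp ?m0 l')" by simp
  then have "l = l'"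
   unfolding anaD(7)[OF l(1) m0 t(1)] anaD(7)[OF l'(1) m0 t(1)] t(2) anaD(6)[OF l(1)] anaD(6)[OF l'(1)] .
  then show ?thesis using l l' by simp
 qed
 show ?thesis
  by (rule that[OF oU _ _ oV(1) V_def[symmetric] s im ms mono]) (use U0(2) O(2) U_def in auto)
qed

lemma ana_etale_openI:
 assumes m: "m \<in> ahom Z T" and T0: "aopen T (mfun m ` pts Z)"
  and iso: "is_isom ana (mrestr m (pts Z) (mfun m ` pts Z))"
 shows "ana_etale m"
 using assms ana_homD(1,2)[OF m] unfolding ana_etale_def by (metis openin_topspace)

section \<open>Categories fibred in groupoids\<close>

lemma hom_overI: "a \<in> hom_set C x y \<Longrightarrow> PA C a = f \<Longrightarrow> a \<in> hom_over C f x y"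
 by (simp add: hom_over_def)

lemma hom_overD: "a \<in> hom_over C f x y \<Longrightarrow> a \<in> hom_set C x y" "a \<in> hom_over C f x y \<Longrightarrow> PA C a = f"
 by (simp_all add: hom_over_def)

locale over_category =
 fixes C :: "('u, 'o, 'a) ocat"
 assumes over: "over_ana C"
begin

lemma cat: "category C" using over by (simp add: over_ana_def)

abbreviation Hom where "Hom \<equiv> hom_set C"
abbreviation Ov where "Ov \<equiv> hom_over C"
abbreviation Pts where "Pts x \<equiv> pts (PO C x)"
abbreviation Fn where "Fn a \<equiv> mfun (PA C a)"

lemmas catD = categoryD[OF cat]

lemma PA_hom: "a \<in> Hom x y \<Longrightarrow> PA C a \<in> ahom (PO C x) (PO C y)"
 using over unfolding over_ana_def is_functor_def hom_set_def by auto

lemma PO_ana: "x \<in> Obj C \<Longrightarrow> analytic_space (PO C x)"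
 using over unfolding over_ana_def is_functor_def by auto

lemma PA_Idt: "x \<in> Obj C \<Longrightarrow> PA C (Idt C x) = aid (PO C x)"
 using over unfolding over_ana_def is_functor_def by auto

lemma PA_Cmp:
 assumes "f \<in> Hom x y" "g \<in> Hom y z"
 shows "PA C (Cmp C g f) = acmp (PA C g) (PA C f)"
 using over assms unfolding over_ana_def is_functor_def hom_set_def by auto

lemma ho_comp: "a \<in> Ov f x y \<Longrightarrow> b \<in> Ov g y z \<Longrightarrow> Cmp C b a \<in> Ov (acmp g f) x z"
 unfolding hom_over_def using catD(4) PA_Cmp by auto

lemma ho_id: "x \<in> Obj C \<Longrightarrow> Idt C x \<in> Ov (aid (PO C x)) x x"
 unfolding hom_over_def using catD(3) PA_Idt by auto

lemma hoD:
 assumes "a \<in> Ov f x y"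
 shows "x \<in> Obj C" "y \<in> Obj C" "f \<in> ahom (PO C x) (PO C y)" "a \<in> Hom x y" "PA C a = f"
proof -
 note a = hom_overD[OF assms]
 show "x \<in> Obj C" "y \<in> Obj C" using catD(1,2)[OF a(1)] .
 show "f \<in> ahom (PO C x) (PO C y)" using PA_hom[OF a(1)] a(2) by simp
 show "a \<in> Hom x y" "PA C a = f" using a .
qed

lemma ho_assoc:
 "a \<in> Ov f x y \<Longrightarrow> b \<in> Ov g y z \<Longrightarrow> c \<in> Ov h z w \<Longrightarrow>
  Cmp C c (Cmp C b a) = Cmp C (Cmp C c b) a"
 using catD(7) unfolding hom_over_def by blast

lemma ho_idr: "a \<in> Ov f x y \<Longrightarrow> Cmp C a (Idt C x) = a"
 using catD(5) unfolding hom_over_def by blast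

lemma ho_idl: "a \<in> Ov f x y \<Longrightarrow> Cmp C (Idt C y) a = a"
 using catD(6) unfolding hom_over_def by blast

end

section \<open>Cartesian arrows and chosen pullbacks\<close>

locale fibred_category = over_category C for C :: "('u, 'o, 'a) ocat" +
 assumes fibred: "fibred_in_groupoids C"
begin

lemma pull_ex:
 assumes "x \<in> Obj C" "f \<in> ahom U (PO C x)"
 obtains y a where "a \<in> Ov f y x" "PO C y = U"
proof -
 have "f \<in> Arr ana" "PO C x = Cod ana f" using ana_homD(2,8)[OF assms(2)] by auto
 then obtain y where y: "y \<in> Obj C" "Ov f y x \<noteq> {}"
  using fibred assms(1) unfolding fibred_in_groupoids_def by meson
 then obtain a where a: "a \<in> Ov f y x" by blast
 show ?thesis using that[OF a] hoD(3)[OF a] ana_homD(1) assms(2) by metis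
qed

text \<open>In a category fibred in groupoids every arrow is cartesian; this restates the axiom with
  base maps recorded in \<open>hom_over\<close>.\<close>

lemma cart_ex1:
 assumes a: "a \<in> Ov g y x" and b: "b \<in> Ov h z x"
  and f: "f \<in> ahom (PO C z) (PO C y)" "acmp g f = h"
 shows "\<exists>!c. c \<in> Ov f z y \<and> Cmp C a c = b"
proof -
 have 1: "a \<in> Arr C" "b \<in> Arr C" "Dom C a = y" "Dom C b = z" "Cod C a = x" "Cod C b = x"
  using a b unfolding hom_over_def hom_set_def by auto
 have 2: "\<forall>a\<in>Arr C. \<forall>b\<in>Arr C. \<forall>f\<in>ahom (PO C (Dom C b)) (PO C (Dom C a)).
   Cod C a = Cod C b \<and> acmp (PA C a) f = PA C b \<longrightarrow>
   (\<exists>!c. c \<in> Ov f (Dom C b) (Dom C a) \<and> Cmp C a c = b)"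
  using fibred unfolding fibred_in_groupoids_def by blast
 show ?thesis
  using 2[THEN bspec, OF 1(1), THEN bspec, OF 1(2), THEN bspec, of f] f 1 hoD(5)[OF a] hoD(5)[OF b] by simp
qed

lemma cart_ex:
 assumes "a \<in> Ov g y x" "b \<in> Ov h z x"
  and "f \<in> ahom (PO C z) (PO C y)" "acmp g f = h"
 obtains c where "c \<in> Ov f z y" "Cmp C a c = b"
 using cart_ex1[OF assms] by blast

text \<open>Uniqueness of cartesian factorizations gives left cancellation among arrows over the
  same base map. Many equations are proved by composing with such an arrow.\<close>

lemma cart_eq:
 assumes a: "a \<in> Ov g y x" and c: "c \<in> Ov f z y" "c' \<in> Ov f z y"
  and e: "Cmp C a c = Cmp C a c'"
 shows "c = c'"
 using cart_ex1[OF a ho_comp[OF c(2) a] hoD(3)[OF c(1)]] c e by metis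

text \<open>The identity of \<open>x\<close> is factored through \<open>a\<close>; that the factor
  is also a left inverse follows by cancelling \<open>a\<close>.\<close>

lemma over_id_inverse:
 assumes a: "a \<in> Ov (aid U) y x"
 obtains b where "b \<in> Ov (aid U) x y" "Cmp C a b = Idt C x" "Cmp C b a = Idt C y"
proof -
 have U: "PO C y = U" "PO C x = U" using ana_homD(1,2)[OF hoD(3)[OF a]] by (simp_all add: Idt_ana mk_amor_def)
 note x = hoD(2)[OF a] and y = hoD(1)[OF a]
 have i: "aid U \<in> ahom U U" using aid_hom[OF PO_ana[OF x]] U by simp
 have ix: "Idt C x \<in> Ov (aid U) x x" using ho_id[OF x] U by simp
 have iy: "Idt C y \<in> Ov (aid U) y y" using ho_id[OF y] U by simp
 obtain b where b: "b \<in> Ov (aid U) x y" "Cmp C a b = Idt C x"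
  using cart_ex[OF a ix, of "aid U"] U i anaD(5)[OF i] by metis
 have ba: "Cmp C b a \<in> Ov (aid U) y y" using ho_comp[OF a b(1)] anaD(5)[OF i] by simp
 have "Cmp C a (Cmp C b a) = Cmp C a (Idt C y)"
  using ho_assoc[OF a b(1) a] b(2) ho_idl[OF a] ho_idr[OF a] by simp
 then have "Cmp C b a = Idt C y" by (rule cart_eq[OF a ba iy])
 then show ?thesis using that b by blast
qed

lemma over_id_is_isom:
 assumes a: "a \<in> Ov (aid U) y x"
 shows "is_isom C a"
 using over_id_inverse[OF a] hoD(4)[OF a] unfolding is_isom_def hom_over_def hom_set_def
 by (smt (verit, best) mem_Collect_eq)

text \<open>Fixes one cartesian arrow for each base map and target. No compatibility with
  composition is imposed on these choices.\<close>

definition lift :: "'u amor \<Rightarrow> 'o \<Rightarrow> 'a" where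
 "lift f x = (SOME a. \<exists>y. a \<in> Ov f y x)"

definition pull :: "'u amor \<Rightarrow> 'o \<Rightarrow> 'o" where
 "pull f x = Dom C (lift f x)"

lemma lift_ho:
 assumes "x \<in> Obj C" "f \<in> ahom U (PO C x)"
 shows "lift f x \<in> Ov f (pull f x) x"
proof -
 have "\<exists>y. lift f x \<in> Ov f y x"
  unfolding lift_def by (rule someI_ex) (use pull_ex[OF assms] in metis)
 then show ?thesis unfolding pull_def by (auto simp: hom_over_def hom_set_def)
qed

lemma PO_pull:
 assumes "x \<in> Obj C" "f \<in> ahom U (PO C x)"
 shows "PO C (pull f x) = U" "pull f x \<in> Obj C"
 using hoD(1,3)[OF lift_ho[OF assms]] assms ana_homD(1) by metis+

abbreviation lres :: "'o \<Rightarrow> 'u set \<Rightarrow> 'a" where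
 "lres x W \<equiv> lift (incl (PO C x) W) x"

abbreviation pres :: "'o \<Rightarrow> 'u set \<Rightarrow> 'o" where
 "pres x W \<equiv> pull (incl (PO C x) W) x"

lemma lres_ho:
 assumes "x \<in> Obj C" "aopen (PO C x) W"
 shows "lres x W \<in> Ov (incl (PO C x) W) (pres x W) x"
  "PO C (pres x W) = open_sub (PO C x) W" "pres x W \<in> Obj C"
 using lift_ho PO_pull incl_hom[OF PO_ana[OF assms(1)] assms(2)] assms by blast+

lemma restrict_factor:
 assumes e: "e \<in> Ov (incl U W) z x" and U: "PO C x = U"
  and W: "aopen U W" and W': "aopen U W'" "W' \<subseteq> W"
  and e': "e' \<in> Ov (incl U W') z' x"
 obtains r where "r \<in> Ov (inclusion U W' W) z' z" "Cmp C e r = e'"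
proof -
 have an: "analytic_space U" using PO_ana[OF hoD(2)[OF e]] U by simp
 have z: "PO C z = open_sub U W"
  using ana_homD(1)[OF hoD(3)[OF e]] ana_homD(1)[OF incl_hom[OF an W]] by simp
 have z': "PO C z' = open_sub U W'"
  using ana_homD(1)[OF hoD(3)[OF e']] ana_homD(1)[OF incl_hom[OF an W'(1)]] by simp
 show ?thesis
  using cart_ex[OF e e', of "inclusion U W' W"] that inclusion_hom[OF an W'(1) W W'(2)]
   Cmp_inclusion[OF an W'(1) W W'(2), of "pts U"] openin_subset[OF W] z z' by auto
qed

end

section \<open>Descent for arrows of a stack\<close>

locale ana_stack = fibred_category C for C :: "('u, 'o, 'a) ocat" +
 assumes stack: "is_stack C"
begin

lemma sheaf_over_id:
 assumes x: "x \<in> Obj C" "PO C x = U" and y: "y \<in> Obj C" "PO C y = U" and S: "covering_sieve U \<S>"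
  and e: "\<And>W. W \<in> \<S> \<Longrightarrow> e W \<in> Ov (incl U W) (z W) x"
  and a: "\<And>W. W \<in> \<S> \<Longrightarrow> a W \<in> Ov (incl U W) (z W) y"
  and c: "\<And>W W' r. W \<in> \<S> \<Longrightarrow> W' \<in> \<S> \<Longrightarrow> W' \<subseteq> W \<Longrightarrow> r \<in> Hom (z W') (z W) \<Longrightarrow>
   Cmp C (e W) r = e W' \<Longrightarrow> Cmp C (a W) r = a W'"
 shows "\<exists>!b. b \<in> Ov (aid U) x y \<and> (\<forall>W\<in>\<S>. Cmp C b (e W) = a W)"
proof -
 have U: "U \<in> Obj ana" using PO_ana[OF x(1)] x(2) by simp
 have d: "Dom C (e W) = z W" if "W \<in> \<S>" for W using e[OF that] by (auto simp: hom_over_def hom_set_def)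
 have "isoms_are_sheaves C" using stack by (simp add: is_stack_def)
 note this[unfolded isoms_are_sheaves_def, rule_format, OF U S x(1) y(1) conjI[OF x(2) y(2)], of e a]
 then show ?thesis
  using e a c by (auto simp: hom_over_def hom_set_def)
qed

text \<open>The sheaf axiom speaks only of arrows over an identity. Therefore both arrows are
  factored through the pullback \<open>y0\<close> of \<open>y\<close> along \<open>f\<close>, and
  the factors are compared.\<close>

lemma separated:
 assumes b: "b \<in> Ov f x y" "b' \<in> Ov f x y" and U: "PO C x = U"
  and loc: "\<And>v. v \<in> pts U \<Longrightarrow> \<exists>W e z. aopen U W \<and> v \<in> W \<and>
   e \<in> Ov (incl U W) z x \<and> Cmp C b e = Cmp C b' e"
 shows "b = b'"
proof -
 note x = hoD(1)[OF b(1)] and y = hoD(2)[OF b(1)]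
 note f = hoD(3)[OF b(1), unfolded U]
 have an: "analytic_space U" using PO_ana[OF x] U by simp
 define y0 where "y0 = pull f y" define l where "l = lift f y"
 have l: "l \<in> Ov f y0 y" "PO C y0 = U" "y0 \<in> Obj C"
  using lift_ho[OF y f] PO_pull[OF y f] by (auto simp: l_def y0_def)
 note iU = aid_hom[OF an]
 obtain b0 where b0: "b0 \<in> Ov (aid U) x y0" "Cmp C l b0 = b"
  using cart_ex[OF l(1) b(1), of "aid U"] iU U l(2) anaD(5)[OF f] by metis
 obtain b1 where b1: "b1 \<in> Ov (aid U) x y0" "Cmp C l b1 = b'"
  using cart_ex[OF l(1) b(2), of "aid U"] iU U l(2) anaD(5)[OF f] by metis
 let ?e = "\<lambda>W. lres x W"
 have eh: "?e W \<in> Ov (incl U W) (pres x W) x" if "aopen U W" for W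
  using lres_ho(1)[OF x] that U by simp
 have agree: "Cmp C b0 e = Cmp C b1 e \<longleftrightarrow> Cmp C b e = Cmp C b' e"
  if e: "e \<in> Ov (incl U W) z x" for e W z
 proof
  assume "Cmp C b0 e = Cmp C b1 e"
  then show "Cmp C b e = Cmp C b' e"
   using ho_assoc[OF e b0(1) l(1)] ho_assoc[OF e b1(1) l(1)] b0(2) b1(2) by simp
 next
  assume "Cmp C b e = Cmp C b' e"
  then have "Cmp C l (Cmp C b0 e) = Cmp C l (Cmp C b1 e)"
   using ho_assoc[OF e b0(1) l(1)] ho_assoc[OF e b1(1) l(1)] b0(2) b1(2) by simp
  then show "Cmp C b0 e = Cmp C b1 e"
   by (rule cart_eq[OF l(1) ho_comp[OF e b0(1)] ho_comp[OF e b1(1)]])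
 qed
 \<comment> \<open>Agreement is tested on the chosen restrictions; the fact \<open>sub\<close> below
   transfers it from an arbitrary restriction to the chosen ones on smaller opens.\<close>
 define \<S> where "\<S> = {W. aopen U W \<and> Cmp C b (?e W) = Cmp C b' (?e W)}"
 have sub: "Cmp C b (?e W') = Cmp C b' (?e W')"
  if W: "aopen U W" "aopen U W'" "W' \<subseteq> W" "e \<in> Ov (incl U W) z x"
   "Cmp C b e = Cmp C b' e" for W W' e z
 proof -
  obtain r where r: "r \<in> Ov (inclusion U W' W) (pres x W') z" "Cmp C e r = ?e W'"
   using restrict_factor[OF W(4) U W(1-3) eh[OF W(2)]] by blast
  show ?thesis using ho_assoc[OF r(1) W(4) b(1)] ho_assoc[OF r(1) W(4) b(2)] W(5) r(2) by simp
 qed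
 have S: "covering_sieve U \<S>"
  unfolding covering_sieve_def
 proof (intro conjI ballI allI impI)
  show "aopen U W" if "W \<in> \<S>" for W using that \<S>_def by auto
  show "W' \<in> \<S>" if "W \<in> \<S>" "aopen U W' \<and> W' \<subseteq> W" for W W'
   using that sub[of W W' "?e W" "pres x W"] eh \<S>_def by auto
  show "\<Union>\<S> = pts U"
  proof
   show "\<Union>\<S> \<subseteq> pts U" using \<S>_def openin_subset by blast
   show "pts U \<subseteq> \<Union>\<S>"
   proof
    fix v assume "v \<in> pts U"
    then obtain W e z where "aopen U W" "v \<in> W"
     "e \<in> Ov (incl U W) z x" "Cmp C b e = Cmp C b' e" using loc by blast
    then show "v \<in> \<Union>\<S>" using sub[of W W e z] \<S>_def by auto
   qed
  qed
 qed
 have oS: "aopen U W" if "W \<in> \<S>" for W using that \<S>_def by simp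
 have "\<exists>!b2. b2 \<in> Ov (aid U) x y0 \<and> (\<forall>W\<in>\<S>. Cmp C b2 (?e W) = Cmp C b0 (?e W))"
 proof (rule sheaf_over_id[OF x U l(3,2) S, where z="pres x"])
  show "?e W \<in> Ov (incl U W) (pres x W) x" if "W \<in> \<S>" for W using eh oS that by blast
  show "Cmp C b0 (?e W) \<in> Ov (incl U W) (pres x W) y0" if "W \<in> \<S>" for W
   using ho_comp[OF eh[OF oS[OF that]] b0(1)] anaD(6)[OF incl_hom[OF an oS[OF that]]] by simp
  show "Cmp C (Cmp C b0 (?e W)) r = Cmp C b0 (?e W')"
   if W: "W \<in> \<S>" "W' \<in> \<S>" "r \<in> Hom (pres x W') (pres x W)" "Cmp C (?e W) r = ?e W'" for W W' r
   using catD(7)[OF W(3) hoD(4)[OF eh[OF oS[OF W(1)]]] hoD(4)[OF b0(1)]] W(4) by simp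
 qed
 moreover have "\<forall>W\<in>\<S>. Cmp C b1 (?e W) = Cmp C b0 (?e W)"
  using agree[OF eh[OF oS]] \<S>_def by auto
 ultimately have "b0 = b1" using b0(1) b1(1) by metis
 then show ?thesis using b0 b1 by simp
qed

text \<open>The sheaf axiom wants data on a whole sieve, over an identity. A cover is turned into a
  sieve by choosing for each small open a member containing it, and \<open>f\<close> is removed by
  passing to the pullback \<open>y0\<close>.\<close>

lemma glue:
 assumes x: "x \<in> Obj C" "PO C x = U" and y: "y \<in> Obj C" and f: "f \<in> ahom U (PO C y)"
  and W: "\<And>i. i \<in> I \<Longrightarrow> aopen U (W i)" "pts U \<subseteq> (\<Union>i\<in>I. W i)"
  and e: "\<And>i. i \<in> I \<Longrightarrow> e i \<in> Ov (incl U (W i)) (z i) x"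
  and a: "\<And>i. i \<in> I \<Longrightarrow> a i \<in> Ov (acmp f (incl U (W i))) (z i) y"
  and c: "\<And>i j w V r s. i \<in> I \<Longrightarrow> j \<in> I \<Longrightarrow> aopen U V \<Longrightarrow> V \<subseteq> W i \<Longrightarrow> V \<subseteq> W j \<Longrightarrow> V \<noteq> {} \<Longrightarrow>
   PO C w = open_sub U V \<Longrightarrow>
   r \<in> Ov (inclusion U V (W i)) w (z i) \<Longrightarrow> s \<in> Ov (inclusion U V (W j)) w (z j) \<Longrightarrow>
   Cmp C (e i) r = Cmp C (e j) s \<Longrightarrow> Cmp C (a i) r = Cmp C (a j) s"
 obtains b where "b \<in> Ov f x y" "\<And>i. i \<in> I \<Longrightarrow> Cmp C b (e i) = a i"
proof -
 have an: "analytic_space U" using PO_ana[OF x(1)] x(2) by simp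
 define y0 where "y0 = pull f y" define l where "l = lift f y"
 have l: "l \<in> Ov f y0 y" "PO C y0 = U" "y0 \<in> Obj C"
  using lift_ho[OF y f] PO_pull[OF y f] by (auto simp: l_def y0_def)
 define \<S> where "\<S> = {V. aopen U V \<and> (\<exists>i\<in>I. V \<subseteq> W i)}"
 \<comment> \<open>Arbitrary choice of a member containing \<open>V\<close>; the compatibility
   hypothesis makes the restricted arrow \<open>a1 V\<close> independent of it.\<close>
 define ix where "ix V = (SOME i. i \<in> I \<and> V \<subseteq> W i)" for V
 have oS: "aopen U V" if "V \<in> \<S>" for V using that \<S>_def by simp
 have ix: "ix V \<in> I" "V \<subseteq> W (ix V)" if "V \<in> \<S>" for V
  using someI_ex[of "\<lambda>i. i \<in> I \<and> V \<subseteq> W i"] that \<S>_def unfolding ix_def by auto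
 have S: "covering_sieve U \<S>"
  unfolding covering_sieve_def
 proof (intro conjI ballI allI impI)
  show "aopen U V" if "V \<in> \<S>" for V using oS that by blast
  show "V' \<in> \<S>" if "V \<in> \<S>" "aopen U V' \<and> V' \<subseteq> V" for V V' using that \<S>_def by blast
  show "\<Union>\<S> = pts U"
  proof
   show "\<Union>\<S> \<subseteq> pts U" using \<S>_def openin_subset by blast
   show "pts U \<subseteq> \<Union>\<S>" using W unfolding \<S>_def by blast
  qed
 qed
 have eh: "lres x V \<in> Ov (incl U V) (pres x V) x" "PO C (pres x V) = open_sub U V"
  if "V \<in> \<S>" for V using lres_ho[OF x(1)] oS[OF that] x(2) by simp_all
 define r where "r V = (SOME r. r \<in> Ov (inclusion U V (W (ix V))) (pres x V) (z (ix V)) \<and>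
  Cmp C (e (ix V)) r = lres x V)" for V
 have r: "r V \<in> Ov (inclusion U V (W (ix V))) (pres x V) (z (ix V))"
  "Cmp C (e (ix V)) (r V) = lres x V" if V: "V \<in> \<S>" for V
 proof -
  have "\<exists>r. r \<in> Ov (inclusion U V (W (ix V))) (pres x V) (z (ix V)) \<and>
   Cmp C (e (ix V)) r = lres x V"
   using restrict_factor[OF e[OF ix(1)[OF V]] x(2) W(1)[OF ix(1)[OF V]] oS[OF V] ix(2)[OF V] eh(1)[OF V]]
   by metis
  from someI_ex[OF this] show "r V \<in> Ov (inclusion U V (W (ix V))) (pres x V) (z (ix V))"
   "Cmp C (e (ix V)) (r V) = lres x V" unfolding r_def by auto
 qed
 define a1 where "a1 V = Cmp C (a (ix V)) (r V)" for V
 have a1: "a1 V \<in> Ov (acmp f (incl U V)) (pres x V) y" if V: "V \<in> \<S>" for V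
 proof -
  let ?i = "ix V" note i = ix[OF V]
  note o1 = W(1)[OF i(1)]
  have "acmp (acmp f (incl U (W ?i))) (inclusion U V (W ?i)) =
   acmp f (incl U V)"
   using anaD(7)[OF inclusion_hom[OF an oS[OF V] o1 i(2)] incl_hom[OF an o1] f]
    Cmp_inclusion[OF an oS[OF V] o1 i(2), of "pts U"] openin_subset[OF o1] by simp
  then show ?thesis unfolding a1_def using ho_comp[OF r(1)[OF V] a[OF i(1)]] by simp
 qed
 have "\<exists>a0. a0 \<in> Ov (incl U V) (pres x V) y0 \<and> Cmp C l a0 = a1 V" if V: "V \<in> \<S>" for V
  using cart_ex[OF l(1) a1[OF V], of "incl U V"] incl_hom[OF an oS[OF V]] eh(2)[OF V] l(2)
  by metis
 then obtain a0 where a0: "\<And>V. V \<in> \<S> \<Longrightarrow> a0 V \<in> Ov (incl U V) (pres x V) y0"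
  "\<And>V. V \<in> \<S> \<Longrightarrow> Cmp C l (a0 V) = a1 V" by metis
 \<comment> \<open>Over the empty open any two arrows with the same base map agree by separatedness,
   so compatibility has to be assumed only on nonempty overlaps. With disjoint covers this leaves
   nothing to check between different members.\<close>
 have ne: "Cmp C (a i) s = Cmp C (a j) t"
  if "i \<in> I" "j \<in> I" "aopen U V" "V \<subseteq> W i" "V \<subseteq> W j" "PO C w = open_sub U V"
   "s \<in> Ov (inclusion U V (W i)) w (z i)" "t \<in> Ov (inclusion U V (W j)) w (z j)"
   "Cmp C (e i) s = Cmp C (e j) t" for i j w V s t
 proof (cases "V = {}")
  case False then show ?thesis using c that by blast
 next
  case True
  have h1: "Cmp C (a k) s \<in> Ov (acmp f (incl U V)) w y"
   if "k \<in> I" "V \<subseteq> W k" "s \<in> Ov (inclusion U V (W k)) w (z k)" for k s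
  proof -
   note o1 = W(1)[OF that(1)] note o2 = \<open>aopen U V\<close>
   have "acmp (acmp f (incl U (W k))) (inclusion U V (W k)) =
    acmp f (incl U V)"
    using anaD(7)[OF inclusion_hom[OF an o2 o1 that(2)] incl_hom[OF an o1] f]
     Cmp_inclusion[OF an o2 o1 that(2), of "pts U"] openin_subset[OF o1] by simp
   then show ?thesis using ho_comp[OF that(3) a[OF that(1)]] by simp
  qed
  show ?thesis
  proof (rule separated[OF h1[OF that(1,4,7)] h1[OF that(2,5,8)] that(6)])
  qed (use True pts_open_sub[OF that(3)] in auto)
 qed
 have "\<exists>!b0. b0 \<in> Ov (aid U) x y0 \<and> (\<forall>V\<in>\<S>. Cmp C b0 (lres x V) = a0 V)"
 proof (rule sheaf_over_id[OF x l(3,2) S, where z="pres x"])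
  show "lres x V \<in> Ov (incl U V) (pres x V) x" if "V \<in> \<S>" for V using eh that by blast
  show "a0 V \<in> Ov (incl U V) (pres x V) y0" if "V \<in> \<S>" for V using a0 that by blast
  fix V V' s assume V: "V \<in> \<S>" "V' \<in> \<S>" "V' \<subseteq> V" "s \<in> Hom (pres x V') (pres x V)"
   "Cmp C (lres x V) s = lres x V'"
  \<comment> \<open>The base map of \<open>s\<close> is forced, because open immersions are
    monic.\<close>
  have s: "s \<in> Ov (inclusion U V' V) (pres x V') (pres x V)"
  proof -
   have i: "incl U V \<in> ahom (open_sub U V) (open_sub U (pts U))"
    using incl_hom[OF an oS[OF V(1)]] by simp
   have p: "PA C s \<in> ahom (open_sub U V') (open_sub U V)"
    using PA_hom[OF V(4)] eh(2) V(1,2) by simp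
   have "acmp (incl U V) (PA C s) = incl U V'"
    using PA_Cmp[OF V(4) hoD(4)[OF eh(1)[OF V(1)]]] V(5) hoD(5)[OF eh(1)[OF V(1)]] hoD(5)[OF eh(1)[OF V(2)]] by simp
   then have "PA C s = inclusion U V' V"
    using inclusion_mono[OF an oS[OF V(1)] openin_topspace _ p inclusion_hom[OF an oS[OF V(2)] oS[OF V(1)] V(3)]]
     Cmp_inclusion[OF an oS[OF V(2)] oS[OF V(1)] V(3), of "pts U"] openin_subset[OF oS[OF V(1)]] by simp
   then show ?thesis using V(4) by (simp add: hom_over_def)
  qed
  let ?i = "ix V" let ?j = "ix V'"
  note i = ix[OF V(1)] and j = ix[OF V(2)]
  have rs: "Cmp C (r V) s \<in> Ov (inclusion U V' (W ?i)) (pres x V') (z ?i)"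
   using ho_comp[OF s r(1)[OF V(1)]]
    Cmp_inclusion[OF an oS[OF V(2)] oS[OF V(1)] V(3) W(1)[OF i(1)] i(2)] by simp
  have "Cmp C (a ?i) (Cmp C (r V) s) = Cmp C (a ?j) (r V')"
  proof (rule ne[OF i(1) j(1) oS[OF V(2)] _ j(2) eh(2)[OF V(2)] rs r(1)[OF V(2)]])
   show "V' \<subseteq> W ?i" using V(3) i(2) by blast
   show "Cmp C (e ?i) (Cmp C (r V) s) = Cmp C (e ?j) (r V')"
    using ho_assoc[OF s r(1)[OF V(1)] e[OF i(1)]] r(2)[OF V(1)] r(2)[OF V(2)] V(5) by simp
  qed
  then have "Cmp C (a1 V) s = a1 V'"
   unfolding a1_def using ho_assoc[OF s r(1)[OF V(1)] a[OF i(1)]] by simp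
  then have "Cmp C l (Cmp C (a0 V) s) = Cmp C l (a0 V')"
   using ho_assoc[OF s a0(1)[OF V(1)] l(1)] a0(2) V by simp
  moreover have "Cmp C (a0 V) s \<in> Ov (incl U V') (pres x V') y0"
   using ho_comp[OF s a0(1)[OF V(1)]]
    Cmp_inclusion[OF an oS[OF V(2)] oS[OF V(1)] V(3), of "pts U"] openin_subset[OF oS[OF V(1)]] by simp
  ultimately show "Cmp C (a0 V) s = a0 V'" using cart_eq[OF l(1) _ a0(1)[OF V(2)]] by blast
 qed
 then obtain b0 where b0: "b0 \<in> Ov (aid U) x y0" "\<And>V. V \<in> \<S> \<Longrightarrow> Cmp C b0 (lres x V) = a0 V"
  by blast
 have b: "Cmp C l b0 \<in> Ov f x y" using ho_comp[OF b0(1) l(1)] anaD(5)[OF f] by simp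
 have bV: "Cmp C (Cmp C l b0) (lres x V) = a1 V" if "V \<in> \<S>" for V
  using ho_assoc[OF eh(1)[OF that] b0(1) l(1)] b0(2)[OF that] a0(2)[OF that] by simp
 \<comment> \<open>The given \<open>e i\<close> need not be the chosen restriction to
   \<open>W i\<close>, nor need \<open>ix (W i)\<close> be \<open>i\<close>. Compatibility, applied
   with an identity on the side of \<open>i\<close>, bridges both gaps.\<close>
 have "Cmp C (Cmp C l b0) (e i) = a i" if i: "i \<in> I" for i
 proof -
  have S: "W i \<in> \<S>" using W(1)[OF i] i \<S>_def by auto
  have ii: "inclusion U (W i) (W i) = aid (open_sub U (W i))" by (rule inclusion_refl[OF an W(1)[OF i]])
  obtain t where t: "t \<in> Ov (inclusion U (W i) (W i)) (z i) (pres x (W i))" "Cmp C (lres x (W i)) t = e i"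
   using restrict_factor[OF eh(1)[OF S] x(2) W(1)[OF i] W(1)[OF i] order_refl e[OF i]] by blast
  have z: "PO C (z i) = open_sub U (W i)"
   using ana_homD(1)[OF hoD(3)[OF e[OF i]]] ana_homD(1)[OF incl_hom[OF an W(1)[OF i]]] by simp
  let ?j = "ix (W i)" note j = ix[OF S]
  have rt: "Cmp C (r (W i)) t \<in> Ov (inclusion U (W i) (W ?j)) (z i) (z ?j)"
   using ho_comp[OF t(1) r(1)[OF S]]
    Cmp_inclusion[OF an W(1)[OF i] W(1)[OF i] order_refl W(1)[OF j(1)] j(2)] by simp
  have idz: "Idt C (z i) \<in> Ov (inclusion U (W i) (W i)) (z i) (z i)"
   using ho_id[OF hoD(1)[OF e[OF i]]] ii z by simp
  have "Cmp C (a ?j) (Cmp C (r (W i)) t) = Cmp C (a i) (Idt C (z i))"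
  proof (rule ne[OF j(1) i W(1)[OF i] j(2) order_refl z rt idz])
   show "Cmp C (e ?j) (Cmp C (r (W i)) t) = Cmp C (e i) (Idt C (z i))"
    using ho_assoc[OF t(1) r(1)[OF S] e[OF j(1)]] r(2)[OF S] t(2) ho_idr[OF e[OF i]] by simp
  qed
  then have "Cmp C (a1 (W i)) t = a i"
   unfolding a1_def using ho_assoc[OF t(1) r(1)[OF S] a[OF j(1)]] ho_idr[OF a[OF i]] by simp
  then show ?thesis
   using ho_assoc[OF t(1) eh(1)[OF S] b] bV[OF S] t(2) by simp
 qed
 then show ?thesis using that b by blast
qed

end

section \<open>Extension of a fully faithful functor to the stackification\<close>

lemma inclusion_open_sub:
 assumes "aopen X W" "W' \<subseteq> W"
 shows "inclusion (open_sub X W) W' W = inclusion X W' W"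
proof -
 have s: "W \<subseteq> pts X" by (rule openin_subset[OF assms(1)])
 have "W \<inter> W' = W'" using assms(2) by auto
 moreover have "restrict (mfun (aid (open_sub X W))) W' = restrict (mfun (aid X)) W'"
  using s assms(2) by (intro restrict_ext) (auto simp: Idt_ana mk_amor_def)
 moreover have "restrict (mgerm (aid (open_sub X W))) W' = restrict (mgerm (aid X)) W'"
  using s assms(2) by (intro restrict_ext) (auto simp: Idt_ana mk_amor_def)
 ultimately show ?thesis
  unfolding inclusion_def mrestr_def by (simp add: Idt_ana mk_amor_def)
qed

lemma sieveD:
 assumes "covering_sieve U \<S>"
 shows "W \<in> \<S> \<Longrightarrow> aopen U W" "W \<in> \<S> \<Longrightarrow> aopen U W' \<Longrightarrow> W' \<subseteq> W \<Longrightarrow> W' \<in> \<S>"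
  "v \<in> pts U \<Longrightarrow> \<exists>W\<in>\<S>. v \<in> W"
 using assms unfolding covering_sieve_def by blast+

lemma datumD:
 assumes "descent_datum X d"
 shows "analytic_space (dbase d)" "covering_sieve (dbase d) (dsieve d)"
  "W \<in> dsieve d \<Longrightarrow> dobj d W \<in> Obj X" "W \<in> dsieve d \<Longrightarrow> PO X (dobj d W) = open_sub (dbase d) W"
  "W \<in> dsieve d \<Longrightarrow> dres d (W, W) = Idt X (dobj d W)"
  "W \<in> dsieve d \<Longrightarrow> W' \<in> dsieve d \<Longrightarrow> W' \<subseteq> W \<Longrightarrow>
   dres d (W', W) \<in> hom_over X (inclusion (dbase d) W' W) (dobj d W') (dobj d W)"
  "W \<in> dsieve d \<Longrightarrow> W' \<in> dsieve d \<Longrightarrow> W'' \<in> dsieve d \<Longrightarrow> W'' \<subseteq> W' \<Longrightarrow> W' \<subseteq> W \<Longrightarrow>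
   Cmp X (dres d (W', W)) (dres d (W'', W')) = dres d (W'', W)"
 using assms unfolding descent_datum_def by auto

text \<open>A fully faithful map into a stack gives a handle on the stackification: gluing takes
  place in \<open>C\<close>, and equations between compatible families are verified after mapping
  them there.\<close>

locale ff_into_stack = C: ana_stack C + P: over_category P
 for C :: "('u, 'o, 'a) ocat" and P :: "('u, 'p, 'b) ocat" +
 fixes L :: "('p, 'b, 'o, 'a) fct"
 assumes mor: "morphism_over P C L"
  and ff: "\<And>x y. x \<in> Obj P \<Longrightarrow> y \<in> Obj P \<Longrightarrow>
   bij_betw (FA L) (hom_set P x y) (hom_set C (FO L x) (FO L y))"
begin

lemma L_obj: "x \<in> Obj P \<Longrightarrow> FO L x \<in> Obj C" "x \<in> Obj P \<Longrightarrow> PO C (FO L x) = PO P x"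
 using mor unfolding morphism_over_def is_functor_def by auto

lemma L_ho: "a \<in> P.Ov f x y \<Longrightarrow> FA L a \<in> C.Ov f (FO L x) (FO L y)"
 using mor unfolding morphism_over_def is_functor_def hom_over_def hom_set_def by auto

lemma L_Idt: "x \<in> Obj P \<Longrightarrow> FA L (Idt P x) = Idt C (FO L x)"
 using mor unfolding morphism_over_def is_functor_def by auto

lemma L_Cmp: "a \<in> P.Ov f x y \<Longrightarrow> b \<in> P.Ov g y z \<Longrightarrow> FA L (Cmp P b a) = Cmp C (FA L b) (FA L a)"
 using mor unfolding morphism_over_def is_functor_def hom_over_def hom_set_def by auto

lemma L_inj: "a \<in> P.Ov f x y \<Longrightarrow> b \<in> P.Ov g x y \<Longrightarrow> FA L a = FA L b \<Longrightarrow> a = b"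
proof -
 assume a: "a \<in> P.Ov f x y" "b \<in> P.Ov g x y" "FA L a = FA L b"
 have "inj_on (FA L) (P.Hom x y)"
  using ff[OF P.hoD(1,2)[OF a(1)]] by (rule bij_betw_imp_inj_on)
 then show "a = b" using a(3) P.hoD(4)[OF a(1)] P.hoD(4)[OF a(2)] by (rule inj_onD)
qed

lemma L_surj:
 assumes "x \<in> Obj P" "y \<in> Obj P" "b \<in> C.Ov f (FO L x) (FO L y)"
 obtains a where "a \<in> P.Ov f x y" "FA L a = b"
proof -
 have "b \<in> FA L ` P.Hom x y" using ff[OF assms(1,2)] assms(3) unfolding bij_betw_def hom_over_def by blast
 then obtain a where a: "a \<in> P.Hom x y" "FA L a = b" by blast
 have "PA P a = PA C (FA L a)" using mor a(1) unfolding morphism_over_def hom_set_def by auto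
 then show ?thesis using that[of a] a assms(3) unfolding hom_over_def by auto
qed

text \<open>The object \<open>y\<close> with the arrows \<open>e\<close> solves the descent problem
  in \<open>C\<close> that is the image of \<open>d\<close> under \<open>L\<close>.\<close>

definition embeds :: "('u, 'p, 'b) ddatum \<Rightarrow> 'o \<Rightarrow> ('u set \<Rightarrow> 'a) \<Rightarrow> bool" where
 "embeds d y e \<longleftrightarrow> y \<in> Obj C \<and> PO C y = dbase d \<and>
  (\<forall>W\<in>dsieve d. e W \<in> C.Ov (incl (dbase d) W) (FO L (dobj d W)) y) \<and>
  (\<forall>W\<in>dsieve d. \<forall>W'\<in>dsieve d. W' \<subseteq> W \<longrightarrow> Cmp C (e W) (FA L (dres d (W', W))) = e W')"

lemma embeds_ex:
 assumes d: "descent_datum P d"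
 shows "\<exists>y e. embeds d y e"
proof -
 note D = datumD[OF d]
 let ?d = "\<lparr>dbase = dbase d, dsieve = dsieve d, dobj = \<lambda>W. FO L (dobj d W), dres = \<lambda>p. FA L (dres d p)\<rparr>"
 have "descent_datum C ?d"
  unfolding descent_datum_def ddatum.simps
 proof (intro conjI ballI impI)
  show "dbase d \<in> Obj ana" "covering_sieve (dbase d) (dsieve d)" using D(1,2) by simp_all
  fix W assume W: "W \<in> dsieve d"
  show "FO L (dobj d W) \<in> Obj C" "PO C (FO L (dobj d W)) = open_sub (dbase d) W"
   "FA L (dres d (W, W)) = Idt C (FO L (dobj d W))"
   using L_obj L_Idt D(3-5)[OF W] by simp_all
  fix W' assume W': "W' \<in> dsieve d"
  show "FA L (dres d (W', W)) \<in> C.Ov (inclusion (dbase d) W' W) (FO L (dobj d W')) (FO L (dobj d W))"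
   if "W' \<subseteq> W" using L_ho[OF D(6)[OF W W' that]] .
  fix W'' assume W'': "W'' \<in> dsieve d" and s: "W'' \<subseteq> W' \<and> W' \<subseteq> W"
  show "Cmp C (FA L (dres d (W', W))) (FA L (dres d (W'', W'))) = FA L (dres d (W'', W))"
   using s L_Cmp[OF D(6)[OF W' W''] D(6)[OF W W']] D(7)[OF W W' W''] by simp
 qed
 then have "effective C ?d" using C.stack unfolding is_stack_def by blast
 then show ?thesis unfolding effective_def embeds_def by simp
qed

definition Fobj :: "('u, 'p, 'b) ddatum \<Rightarrow> 'o" where
 "Fobj d = (SOME y. \<exists>e. embeds d y e)"

definition emb :: "('u, 'p, 'b) ddatum \<Rightarrow> 'u set \<Rightarrow> 'a" where
 "emb d = (SOME e. embeds d (Fobj d) e)"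

lemma embeds_emb:
 assumes "descent_datum P d"
 shows "embeds d (Fobj d) (emb d)"
proof -
 have "\<exists>e. embeds d (Fobj d) e" unfolding Fobj_def using someI_ex[OF embeds_ex[OF assms]] .
 then show ?thesis unfolding emb_def by (rule someI_ex)
qed

lemma embedsD:
 assumes "embeds d y e"
 shows "y \<in> Obj C" "PO C y = dbase d"
  "W \<in> dsieve d \<Longrightarrow> e W \<in> C.Ov (incl (dbase d) W) (FO L (dobj d W)) y"
  "W \<in> dsieve d \<Longrightarrow> W' \<in> dsieve d \<Longrightarrow> W' \<subseteq> W \<Longrightarrow> Cmp C (e W) (FA L (dres d (W', W))) = e W'"
 using assms unfolding embeds_def by auto

lemmas embD = embedsD[OF embeds_emb]

text \<open>The sieve is downward closed, so the overlap \<open>V\<close> is itself a member, and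
  restrictions from two members both pass through \<open>dobj d V\<close>.\<close>

lemma common_refinement:
 assumes d: "descent_datum P d" and E: "embeds d y e"
  and W: "W1 \<in> dsieve d" "W2 \<in> dsieve d" "aopen (dbase d) V" "V \<subseteq> W1" "V \<subseteq> W2"
  and w: "PO C w = open_sub (dbase d) V"
  and r: "r \<in> C.Ov (inclusion (dbase d) V W1) w (FO L (dobj d W1))"
  and s: "s \<in> C.Ov (inclusion (dbase d) V W2) w (FO L (dobj d W2))"
  and eq: "Cmp C (e W1) r = Cmp C (e W2) s"
 obtains t where "V \<in> dsieve d" "t \<in> C.Ov (inclusion (dbase d) V V) w (FO L (dobj d V))"
  "r = Cmp C (FA L (dres d (V, W1))) t" "s = Cmp C (FA L (dres d (V, W2))) t"
proof -
 note D = datumD[OF d] and EE = embedsD[OF E]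
 let ?U = "dbase d"
 have V: "V \<in> dsieve d" using sieveD(2)[OF D(2) W(1,3,4)] .
 have o: "aopen ?U W1" "aopen ?U W2" using sieveD(1)[OF D(2)] W by blast+
 have sub: "W1 \<subseteq> pts ?U" "W2 \<subseteq> pts ?U" using openin_subset o by blast+
 have er: "Cmp C (e W1) r \<in> C.Ov (incl ?U V) w y"
  using C.ho_comp[OF r EE(3)[OF W(1)]] Cmp_inclusion[OF D(1) W(3) o(1) W(4) openin_topspace sub(1)] by simp
 obtain t where t: "t \<in> C.Ov (inclusion ?U V V) w (FO L (dobj d V))" "Cmp C (e V) t = Cmp C (e W1) r"
  using C.restrict_factor[OF EE(3)[OF V] EE(2) W(3) W(3) order_refl er] by blast
 have main: "r' = Cmp C (FA L (dres d (V, W'))) t"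
  if W': "W' \<in> dsieve d" "V \<subseteq> W'" "r' \<in> C.Ov (inclusion ?U V W') w (FO L (dobj d W'))"
   "Cmp C (e W') r' = Cmp C (e V) t" for W' r'
 proof (rule C.cart_eq[OF EE(3)[OF W'(1)] W'(3)])
  note l = L_ho[OF D(6)[OF W'(1) V W'(2)]]
  have o': "aopen ?U W'" using sieveD(1)[OF D(2)] W' by blast
  show "Cmp C (FA L (dres d (V, W'))) t \<in> C.Ov (inclusion ?U V W') w (FO L (dobj d W'))"
   using C.ho_comp[OF t(1) l] Cmp_inclusion[OF D(1) W(3) W(3) order_refl o' W'(2)] by simp
  show "Cmp C (e W') r' = Cmp C (e W') (Cmp C (FA L (dres d (V, W'))) t)"
   using C.ho_assoc[OF t(1) l EE(3)[OF W'(1)]] EE(4)[OF W'(1) V W'(2)] W'(4) by simp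
 qed
 show ?thesis
  by (rule that[OF V t(1) main[OF W(1,4) r t(2)[symmetric]] main[OF W(2,5) s]]) (simp add: t(2) eq)
qed

abbreviation (input) QS where "QS \<equiv> stackification P"

lemma dindexD:
 assumes "descent_datum P d" "descent_datum P d'" "i \<in> dindex d d' f"
 shows "fst i \<in> dsieve d" "snd i \<in> dsieve d'" "mfun f ` fst i \<subseteq> snd i"
  "aopen (dbase d) (fst i)" "aopen (dbase d') (snd i)"
proof -
 show 1: "fst i \<in> dsieve d" "snd i \<in> dsieve d'" "mfun f ` fst i \<subseteq> snd i"
  using assms(3) by (cases i, simp add: dindex_def)+
 show "aopen (dbase d) (fst i)" "aopen (dbase d') (snd i)"
  using sieveD(1)[OF datumD(2)] assms 1 by blast+
qed

text \<open>Continuity of \<open>f\<close> and downward closure of both sieves: cut a target member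
  down to \<open>O'\<close> and take its preimage inside \<open>W\<close>.\<close>

lemma dindex_refine:
 assumes d: "descent_datum P d" "descent_datum P d'" and f: "f \<in> ahom (dbase d) (dbase d')"
  and W: "W \<in> dsieve d" "v \<in> W" and O: "aopen (dbase d') O'" "mfun f v \<in> O'"
 obtains W1 W' where "W1 \<subseteq> W" "v \<in> W1" "W' \<subseteq> O'" "(W1, W') \<in> dindex d d' f"
proof -
 note D = datumD[OF d(1)] and D' = datumD[OF d(2)]
 have oW: "aopen (dbase d) W" using sieveD(1)[OF D(2) W(1)] .
 have v: "v \<in> pts (dbase d)" using W openin_subset[OF oW] by auto
 obtain W0 where W0: "W0 \<in> dsieve d'" "mfun f v \<in> W0"
  using sieveD(3)[OF D'(2) ana_homD(6)[OF f v]] by blast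
 let ?W' = "W0 \<inter> O'"
 have o': "aopen (dbase d') ?W'" using sieveD(1)[OF D'(2) W0(1)] O(1) by (rule openin_Int)
 have W': "?W' \<in> dsieve d'" using sieveD(2)[OF D'(2) W0(1) o'] by simp
 let ?W1 = "W \<inter> {p \<in> pts (dbase d). mfun f p \<in> ?W'}"
 have "aopen (dbase d) ?W1" using oW openin_vimage[OF f o'] by (rule openin_Int)
 then have "?W1 \<in> dsieve d" using sieveD(2)[OF D(2) W(1)] by simp
 then have "(?W1, ?W') \<in> dindex d d' f" using W' unfolding dindex_def by auto
 then show ?thesis using that[of ?W1 ?W'] W v W0 O by auto
qed

section \<open>Arrows of the stackification realized in the ambient stack\<close>

lemma QS_sel [simp]:
 "Obj QS = {d. descent_datum P d}" "Dom QS (d, d', f, a) = d" "Cod QS (d, d', f, a) = d'"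
 "PO QS = dbase" "PA QS (d, d', f, a) = f"
 "Idt QS d = (d, d, aid (dbase d), restrict (dres d) (dindex d d (aid (dbase d))))"
 by (simp_all add: stackification_def)

lemma QS_Arr_iff: "(d, d', f, a) \<in> Arr QS \<longleftrightarrow>
  descent_datum P d \<and> descent_datum P d' \<and> f \<in> ahom (dbase d) (dbase d') \<and>
    a \<in> extensional (dindex d d' f) \<and>
    (\<forall>(W, W')\<in>dindex d d' f. a (W, W') \<in> P.Ov (mrestr f W W') (dobj d W) (dobj d' W')) \<and>
    (\<forall>(W, W')\<in>dindex d d' f. \<forall>(V, V')\<in>dindex d d' f. V \<subseteq> W \<and> V' \<subseteq> W' \<longrightarrow>
     Cmp P (dres d' (V', W')) (a (V, V')) = Cmp P (a (W, W')) (dres d (V, W)))"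
 by (simp add: stackification_def)

text \<open>The square expressing that \<open>b\<close> is glued from the family \<open>a\<close>:
  on a member of the first sieve it is the component of \<open>a\<close> followed by the embedding
  of a member of the second.\<close>

definition realizes where
 "realizes d d' f a b \<longleftrightarrow> b \<in> C.Ov f (Fobj d) (Fobj d') \<and>
  (\<forall>i\<in>dindex d d' f. Cmp C b (emb d (fst i)) = Cmp C (emb d' (snd i)) (FA L (a i)))"

lemma over_square:
 assumes f: "f \<in> ahom U U'" and W: "aopen U W" "aopen U' W'" "mfun f ` W \<subseteq> W'"
 shows "acmp (incl U' W') (mrestr f W W') = acmp f (incl U W)"
 using Cmp_inclusion_mrestr[OF f W openin_topspace openin_subset[OF W(2)]] Cmp_inclusion_pts[OF f W(1)] by simp

text \<open>The first components of index pairs cover the base, so separatedness applies.\<close>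

lemma realizes_unique:
 assumes d: "descent_datum P d" "descent_datum P d'" and f: "f \<in> ahom (dbase d) (dbase d')"
  and r: "realizes d d' f a b" "realizes d d' f a b'"
 shows "b = b'"
proof (rule C.separated)
 show "b \<in> C.Ov f (Fobj d) (Fobj d')" "b' \<in> C.Ov f (Fobj d) (Fobj d')"
  using r by (auto simp: realizes_def)
 show "PO C (Fobj d) = dbase d" using embD(2)[OF d(1)] .
 fix v assume v: "v \<in> pts (dbase d)"
 obtain W where W: "W \<in> dsieve d" "v \<in> W" using sieveD(3)[OF datumD(2)[OF d(1)] v] by blast
 obtain W1 W' where i: "v \<in> W1" "(W1, W') \<in> dindex d d' f"
  using dindex_refine[OF d f W openin_topspace ana_homD(6)[OF f v]] by metis
 note I = dindexD[OF d i(2)]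
 show "\<exists>W e z. aopen (dbase d) W \<and> v \<in> W \<and>
   e \<in> C.Ov (incl (dbase d) W) z (Fobj d) \<and> Cmp C b e = Cmp C b' e"
  using i I embD(3)[OF d(1), of W1] r unfolding realizes_def
  by (intro exI[of _ W1] exI[of _ "emb d W1"] exI[of _ "FO L (dobj d W1)"]) force
qed

text \<open>The pieces are indexed by pairs of opens rather than by opens of the source, because the
  components of \<open>a\<close> depend on a target member as well; \<open>glue\<close> permits
  arbitrary index sets.\<close>

lemma realizes_ex:
 assumes A: "(d, d', f, a) \<in> Arr QS"
 shows "\<exists>b. realizes d d' f a b"
proof -
 note AA = A[unfolded QS_Arr_iff]
 have d: "descent_datum P d" "descent_datum P d'" and f: "f \<in> ahom (dbase d) (dbase d')" using AA by auto
 have a: "a i \<in> P.Ov (mrestr f (fst i) (snd i)) (dobj d (fst i)) (dobj d' (snd i))"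
  if "i \<in> dindex d d' f" for i using AA that by (cases i) auto
 have ac: "Cmp P (dres d' (snd j, snd i)) (a j) = Cmp P (a i) (dres d (fst j, fst i))"
  if "i \<in> dindex d d' f" "j \<in> dindex d d' f" "fst j \<subseteq> fst i" "snd j \<subseteq> snd i" for i j
  using AA that by (cases i, cases j) auto
 note D = datumD[OF d(1)] and D' = datumD[OF d(2)]
 note E = embD[OF d(1)] and E' = embD[OF d(2)]
 let ?I = "dindex d d' f"
 have ai: "Cmp C (emb d' (snd i)) (FA L (a i)) \<in>
   C.Ov (acmp f (incl (dbase d) (fst i))) (FO L (dobj d (fst i))) (Fobj d')"
  if i: "i \<in> ?I" for i
  using C.ho_comp[OF L_ho[OF a[OF i]] E'(3)] dindexD[OF d i] over_square[OF f] by simp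
 have cov: "pts (dbase d) \<subseteq> (\<Union>i\<in>?I. fst i)"
 proof
  fix v assume v: "v \<in> pts (dbase d)"
  obtain W where W: "W \<in> dsieve d" "v \<in> W" using sieveD(3)[OF D(2) v] by blast
  obtain W1 W' where i: "v \<in> W1" "(W1, W') \<in> dindex d d' f"
   using dindex_refine[OF d f W openin_topspace ana_homD(6)[OF f v]] by metis
  then show "v \<in> (\<Union>i\<in>?I. fst i)" by force
 qed
 obtain b where b: "b \<in> C.Ov f (Fobj d) (Fobj d')"
  "\<And>i. i \<in> ?I \<Longrightarrow> Cmp C b (emb d (fst i)) = Cmp C (emb d' (snd i)) (FA L (a i))"
 proof (rule C.glue[OF E(1,2) E'(1) f[folded E'(2)], of ?I fst "\<lambda>i. emb d (fst i)" "\<lambda>i. FO L (dobj d (fst i))"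
   "\<lambda>i. Cmp C (emb d' (snd i)) (FA L (a i))"])
  show "aopen (dbase d) (fst i)" if "i \<in> ?I" for i using dindexD[OF d that] by blast
  show "pts (dbase d) \<subseteq> (\<Union>i\<in>?I. fst i)" by (rule cov)
  show "emb d (fst i) \<in> C.Ov (incl (dbase d) (fst i)) (FO L (dobj d (fst i))) (Fobj d)"
   if "i \<in> ?I" for i using dindexD[OF d that] E(3) by blast
  show "Cmp C (emb d' (snd i)) (FA L (a i)) \<in>
   C.Ov (acmp f (incl (dbase d) (fst i))) (FO L (dobj d (fst i))) (Fobj d')"
   if "i \<in> ?I" for i using ai[OF that] .
  fix i j w V r s
  assume ij: "i \<in> ?I" "j \<in> ?I" and V: "aopen (dbase d) V" "V \<subseteq> fst i" "V \<subseteq> fst j"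
   and w: "PO C w = open_sub (dbase d) V"
   and r: "r \<in> C.Ov (inclusion (dbase d) V (fst i)) w (FO L (dobj d (fst i)))"
   and s: "s \<in> C.Ov (inclusion (dbase d) V (fst j)) w (FO L (dobj d (fst j)))"
   and eq: "Cmp C (emb d (fst i)) r = Cmp C (emb d (fst j)) s"
  note I = dindexD[OF d ij(1)] and J = dindexD[OF d ij(2)]
  obtain t where t: "V \<in> dsieve d" "t \<in> C.Ov (inclusion (dbase d) V V) w (FO L (dobj d V))"
   "r = Cmp C (FA L (dres d (V, fst i))) t" "s = Cmp C (FA L (dres d (V, fst j))) t"
   using common_refinement[OF d(1) embeds_emb[OF d(1)] I(1) J(1) V w r s eq] by metis
  \<comment> \<open>Components at \<open>i\<close> and \<open>j\<close> are both compared with the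
    one at \<open>(V, ?V')\<close>, which is an index since both sieves are downward closed.\<close>
  let ?V' = "snd i \<inter> snd j"
  have V': "?V' \<in> dsieve d'"
   using sieveD(2)[OF D'(2) I(2) openin_Int[OF I(5) J(5)]] by blast
  have k: "(V, ?V') \<in> ?I" using t(1) V' V(2,3) I(3) J(3) unfolding dindex_def by blast
  note L1 = L_ho[OF a[OF k], simplified]
  have main: "Cmp C (Cmp C (emb d' (snd l)) (FA L (a l))) (Cmp C (FA L (dres d (V, fst l))) t) =
    Cmp C (emb d' ?V') (Cmp C (FA L (a (V, ?V'))) t)"
   if l: "l \<in> ?I" "V \<subseteq> fst l" "?V' \<subseteq> snd l" for l
  proof -
   note K = dindexD[OF d l(1)]
   note dr = D(6)[OF K(1) t(1) l(2)] and dr' = D'(6)[OF K(2) V' l(3)]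
   have "Cmp C (FA L (a l)) (Cmp C (FA L (dres d (V, fst l))) t) = Cmp C (FA L (Cmp P (a l) (dres d (V, fst l)))) t"
    using C.ho_assoc[OF t(2) L_ho[OF dr] L_ho[OF a[OF l(1)]]] L_Cmp[OF dr a[OF l(1)]] by simp
   also have "Cmp P (a l) (dres d (V, fst l)) = Cmp P (dres d' (?V', snd l)) (a (V, ?V'))"
    using ac[OF l(1) k] l by simp
   also have "FA L \<dots> = Cmp C (FA L (dres d' (?V', snd l))) (FA L (a (V, ?V')))"
    by (rule L_Cmp[OF a[OF k, simplified] dr'])
   finally have e: "Cmp C (FA L (a l)) (Cmp C (FA L (dres d (V, fst l))) t) =
    Cmp C (FA L (dres d' (?V', snd l))) (Cmp C (FA L (a (V, ?V'))) t)"
    using C.ho_assoc[OF t(2) L1 L_ho[OF dr']] by simp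
   have "Cmp C (Cmp C (emb d' (snd l)) (FA L (a l))) (Cmp C (FA L (dres d (V, fst l))) t) =
    Cmp C (emb d' (snd l)) (Cmp C (FA L (a l)) (Cmp C (FA L (dres d (V, fst l))) t))"
    by (rule C.ho_assoc[OF C.ho_comp[OF t(2) L_ho[OF dr]] L_ho[OF a[OF l(1)]] E'(3)[OF K(2)], symmetric])
   also have "\<dots> = Cmp C (Cmp C (emb d' (snd l)) (FA L (dres d' (?V', snd l)))) (Cmp C (FA L (a (V, ?V'))) t)"
    unfolding e by (rule C.ho_assoc[OF C.ho_comp[OF t(2) L1] L_ho[OF dr'] E'(3)[OF K(2)]])
   finally show ?thesis using E'(4)[OF K(2) V' l(3)] by simp
  qed
  show "Cmp C (Cmp C (emb d' (snd i)) (FA L (a i))) r = Cmp C (Cmp C (emb d' (snd j)) (FA L (a j))) s"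
   unfolding t(3,4) using main[OF ij(1) V(2)] main[OF ij(2) V(3)] by simp
 qed blast
 then show ?thesis unfolding realizes_def by blast
qed

text \<open>Each component is the cartesian factor of a restriction of \<open>b\<close> through the
  embedding of the target member, carried back by fullness of \<open>L\<close>. Compatibility then
  follows by cancellation and faithfulness.\<close>

lemma realizes_surj:
 assumes d: "descent_datum P d" "descent_datum P d'"
  and b: "b \<in> C.Ov f (Fobj d) (Fobj d')"
 shows "\<exists>a. (d, d', f, a) \<in> Arr QS \<and> realizes d d' f a b"
proof -
 note D = datumD[OF d(1)] and D' = datumD[OF d(2)]
 note E = embD[OF d(1)] and E' = embD[OF d(2)]
 have f: "f \<in> ahom (dbase d) (dbase d')" using C.hoD(3)[OF b] E(2) E'(2) by simp
 let ?I = "dindex d d' f"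
 have ex: "\<exists>a. a \<in> P.Ov (mrestr f (fst i) (snd i)) (dobj d (fst i)) (dobj d' (snd i)) \<and>
   Cmp C b (emb d (fst i)) = Cmp C (emb d' (snd i)) (FA L a)" if i: "i \<in> ?I" for i
 proof -
  note I = dindexD[OF d i]
  have m: "mrestr f (fst i) (snd i) \<in> ahom (PO C (FO L (dobj d (fst i)))) (PO C (FO L (dobj d' (snd i))))"
   using mrestr_hom[OF f I(4,5,3)] D(3,4)[OF I(1)] D'(3,4)[OF I(2)] L_obj by simp
  obtain c where c: "c \<in> C.Ov (mrestr f (fst i) (snd i)) (FO L (dobj d (fst i))) (FO L (dobj d' (snd i)))"
   "Cmp C (emb d' (snd i)) c = Cmp C b (emb d (fst i))"
   by (rule C.cart_ex[OF E'(3)[OF I(2)] C.ho_comp[OF E(3)[OF I(1)] b] m over_square[OF f I(4,5,3)]])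
  show ?thesis using L_surj[OF D(3)[OF I(1)] D'(3)[OF I(2)] c(1)] c(2) by metis
 qed
 then obtain a0 where a0: "\<And>i. i \<in> ?I \<Longrightarrow> a0 i \<in> P.Ov (mrestr f (fst i) (snd i)) (dobj d (fst i)) (dobj d' (snd i))"
  "\<And>i. i \<in> ?I \<Longrightarrow> Cmp C b (emb d (fst i)) = Cmp C (emb d' (snd i)) (FA L (a0 i))"
  by metis
 have ac: "Cmp P (dres d' (snd j, snd i)) (a0 j) = Cmp P (a0 i) (dres d (fst j, fst i))"
  if ij: "i \<in> ?I" "j \<in> ?I" "fst j \<subseteq> fst i" "snd j \<subseteq> snd i" for i j
 proof -
  note I = dindexD[OF d ij(1)] and J = dindexD[OF d ij(2)]
  note dr = D(6)[OF I(1) J(1) ij(3)] and dr' = D'(6)[OF I(2) J(2) ij(4)]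
  note c1 = P.ho_comp[OF a0(1)[OF ij(2)] dr'] and c2 = P.ho_comp[OF dr a0(1)[OF ij(1)]]
  have "mfun f ` fst j \<subseteq> snd i" using J(3) ij(4) by auto
  then have over: "acmp (inclusion (dbase d') (snd j) (snd i)) (mrestr f (fst j) (snd j)) =
    acmp (mrestr f (fst i) (snd i)) (inclusion (dbase d) (fst j) (fst i))"
   using Cmp_inclusion_mrestr[OF f J(4,5,3) I(5) ij(4)] Cmp_mrestr_inclusion[OF f J(4) I(4) ij(3) I(5,3)] by simp
  have "Cmp C (emb d' (snd i)) (FA L (Cmp P (dres d' (snd j, snd i)) (a0 j))) =
   Cmp C (Cmp C (emb d' (snd i)) (FA L (dres d' (snd j, snd i)))) (FA L (a0 j))"
   unfolding L_Cmp[OF a0(1)[OF ij(2)] dr'] by (rule C.ho_assoc[OF L_ho[OF a0(1)[OF ij(2)]] L_ho[OF dr'] E'(3)[OF I(2)]])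
  also have "\<dots> = Cmp C b (emb d (fst j))"
   using E'(4)[OF I(2) J(2) ij(4)] a0(2)[OF ij(2)] by simp
  also have "\<dots> = Cmp C b (Cmp C (emb d (fst i)) (FA L (dres d (fst j, fst i))))"
   using E(4)[OF I(1) J(1) ij(3)] by simp
  also have "\<dots> = Cmp C (Cmp C (emb d' (snd i)) (FA L (a0 i))) (FA L (dres d (fst j, fst i)))"
   using C.ho_assoc[OF L_ho[OF dr] E(3)[OF I(1)] b] a0(2)[OF ij(1)] by simp
  also have "\<dots> = Cmp C (emb d' (snd i)) (FA L (Cmp P (a0 i) (dres d (fst j, fst i))))"
   unfolding L_Cmp[OF dr a0(1)[OF ij(1)]]
   by (rule C.ho_assoc[OF L_ho[OF dr] L_ho[OF a0(1)[OF ij(1)]] E'(3)[OF I(2)], symmetric])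
  finally have "FA L (Cmp P (dres d' (snd j, snd i)) (a0 j)) = FA L (Cmp P (a0 i) (dres d (fst j, fst i)))"
   using C.cart_eq[OF E'(3)[OF I(2)] L_ho[OF c1] L_ho[OF c2, folded over]] by simp
  then show ?thesis using L_inj[OF c1 c2] by simp
 qed
 let ?a = "restrict a0 ?I"
 have "(d, d', f, ?a) \<in> Arr QS"
  unfolding QS_Arr_iff using d f a0(1) ac by fastforce
 moreover have "realizes d d' f ?a b" unfolding realizes_def using b a0(2) by simp
 ultimately show ?thesis by blast
qed

lemma realizes_inj:
 assumes A: "(d, d', f, a) \<in> Arr QS" "(d, d', f, a') \<in> Arr QS"
  and r: "realizes d d' f a b" "realizes d d' f a' b"
 shows "a = a'"
proof (rule extensionalityI[of _ "dindex d d' f"])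
 note AA = A[unfolded QS_Arr_iff]
 have d: "descent_datum P d" "descent_datum P d'" using AA by auto
 show "a \<in> extensional (dindex d d' f)" "a' \<in> extensional (dindex d d' f)" using AA by auto
 fix i assume i: "i \<in> dindex d d' f"
 note I = dindexD[OF d i]
 have a: "a i \<in> P.Ov (mrestr f (fst i) (snd i)) (dobj d (fst i)) (dobj d' (snd i))"
  "a' i \<in> P.Ov (mrestr f (fst i) (snd i)) (dobj d (fst i)) (dobj d' (snd i))"
  using AA i by (cases i; auto)+
 have "Cmp C (emb d' (snd i)) (FA L (a i)) = Cmp C (emb d' (snd i)) (FA L (a' i))"
  using r i unfolding realizes_def by simp
 then have "FA L (a i) = FA L (a' i)" by (rule C.cart_eq[OF embD(3)[OF d(2) I(2)] L_ho[OF a(1)] L_ho[OF a(2)]])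
 then show "a i = a' i" by (rule L_inj[OF a])
qed

definition Farr where
 "Farr t = (case t of (d, d', f, a) \<Rightarrow> THE b. realizes d d' f a b)"

lemma Farr_eqI:
 assumes "(d, d', f, a) \<in> Arr QS" "realizes d d' f a b"
 shows "Farr (d, d', f, a) = b"
proof -
 have "descent_datum P d" "descent_datum P d'" "f \<in> ahom (dbase d) (dbase d')"
  using assms(1)[unfolded QS_Arr_iff] by auto
 note u = realizes_unique[OF this _ assms(2)]
 show ?thesis
  unfolding Farr_def prod.case by (rule the_equality, rule assms(2), rule u)
qed

lemma Farr_realizes:
 assumes "(d, d', f, a) \<in> Arr QS"
 shows "realizes d d' f a (Farr (d, d', f, a))"
 using realizes_ex[OF assms] Farr_eqI[OF assms] by metis

text \<open>The composite in \<open>stackification\<close> is given by a description operator. The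
  composite formed in \<open>C\<close> is realized by some family \<open>c\<close>; its components
  satisfy the description, and separatedness in \<open>C\<close> shows that nothing else
  does.\<close>

lemma QS_Cmp:
 assumes A: "(d, d', f, a) \<in> Arr QS" and B: "(d', d'', g, b) \<in> Arr QS"
 shows "Cmp QS (d', d'', g, b) (d, d', f, a) \<in> Arr QS"
  "Farr (Cmp QS (d', d'', g, b) (d, d', f, a)) = Cmp C (Farr (d', d'', g, b)) (Farr (d, d', f, a))"
  "\<exists>c. Cmp QS (d', d'', g, b) (d, d', f, a) = (d, d'', acmp g f, c)"
proof -
 note AA = A[unfolded QS_Arr_iff] and BB = B[unfolded QS_Arr_iff]
 have d: "descent_datum P d" "descent_datum P d'" "descent_datum P d''" using AA BB by auto
 have f: "f \<in> ahom (dbase d) (dbase d')" and g: "g \<in> ahom (dbase d') (dbase d'')" using AA BB by auto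
 note gf = acmp_hom[OF f g]
 have a: "a i \<in> P.Ov (mrestr f (fst i) (snd i)) (dobj d (fst i)) (dobj d' (snd i))"
  if "i \<in> dindex d d' f" for i using AA that by (cases i) auto
 have b: "b i \<in> P.Ov (mrestr g (fst i) (snd i)) (dobj d' (fst i)) (dobj d'' (snd i))"
  if "i \<in> dindex d' d'' g" for i using BB that by (cases i) auto
 note D = datumD[OF d(1)] and D' = datumD[OF d(2)] and D'' = datumD[OF d(3)]
 note E = embD[OF d(1)] and E' = embD[OF d(2)] and E'' = embD[OF d(3)]
 define x where "x = Farr (d, d', f, a)" define y where "y = Farr (d', d'', g, b)"
 have x: "realizes d d' f a x" and y: "realizes d' d'' g b y" unfolding x_def y_def using Farr_realizes A B by blast+
 have xh: "x \<in> C.Ov f (Fobj d) (Fobj d')" and yh: "y \<in> C.Ov g (Fobj d') (Fobj d'')"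
  using x y by (auto simp: realizes_def)
 have yx: "Cmp C y x \<in> C.Ov (acmp g f) (Fobj d) (Fobj d'')" using C.ho_comp[OF xh yh] .
 obtain c where c: "(d, d'', acmp g f, c) \<in> Arr QS" "realizes d d'' (acmp g f) c (Cmp C y x)"
  using realizes_surj[OF d(1,3) yx] by blast
 note CC = c(1)[unfolded QS_Arr_iff]
 let ?I = "dindex d d'' (acmp g f)"
 let ?Q = "\<lambda>W W'' c0. c0 \<in> P.Ov (mrestr (acmp g f) W W'') (dobj d W) (dobj d'' W'') \<and>
      (\<forall>W1 W'. W1 \<subseteq> W \<and> (W1, W') \<in> dindex d d' f \<and> (W', W'') \<in> dindex d' d'' g \<longrightarrow>
       Cmp P c0 (dres d (W1, W)) = Cmp P (b (W', W'')) (a (W1, W')))"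
 have ch: "c (W, W'') \<in> P.Ov (mrestr (acmp g f) W W'') (dobj d W) (dobj d'' W'')"
  if "(W, W'') \<in> ?I" for W W'' using CC that by auto
 have Qc: "?Q W W'' (c (W, W''))" if i: "(W, W'') \<in> ?I" for W W''
 proof (intro conjI allI impI)
  show "c (W, W'') \<in> P.Ov (mrestr (acmp g f) W W'') (dobj d W) (dobj d'' W'')" using ch[OF i] .
  fix W1 W' assume *: "W1 \<subseteq> W \<and> (W1, W') \<in> dindex d d' f \<and> (W', W'') \<in> dindex d' d'' g"
  then have j: "W1 \<subseteq> W" "(W1, W') \<in> dindex d d' f" "(W', W'') \<in> dindex d' d'' g" by auto
  note I = dindexD[OF d(1,3) i, simplified] and J = dindexD[OF d(1,2) j(2), simplified]
   and K = dindexD[OF d(2,3) j(3), simplified]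
  note dr = D(6)[OF I(1) J(1) j(1)]
  note ah = a[OF j(2), simplified] and bh = b[OF j(3), simplified]
  note c1 = P.ho_comp[OF dr ch[OF i]] and c2 = P.ho_comp[OF ah bh]
  have over: "acmp (mrestr (acmp g f) W W'') (inclusion (dbase d) W1 W) = acmp (mrestr g W' W'') (mrestr f W1 W')"
   using Cmp_mrestr_inclusion[OF gf J(4) I(4) j(1) I(5,3)] mrestr_Cmp[OF f g J(4,5,3) K(5,3)] by simp
  have "Cmp C (emb d'' W'') (FA L (Cmp P (c (W, W'')) (dres d (W1, W)))) =
    Cmp C (Cmp C (emb d'' W'') (FA L (c (W, W'')))) (FA L (dres d (W1, W)))"
   unfolding L_Cmp[OF dr ch[OF i]] by (rule C.ho_assoc[OF L_ho[OF dr] L_ho[OF ch[OF i]] E''(3)[OF I(2)]])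
  also have "Cmp C (emb d'' W'') (FA L (c (W, W''))) = Cmp C (Cmp C y x) (emb d W)"
   using c(2) i unfolding realizes_def by force
  also have "Cmp C (Cmp C (Cmp C y x) (emb d W)) (FA L (dres d (W1, W))) = Cmp C (Cmp C y x) (emb d W1)"
   using C.ho_assoc[OF L_ho[OF dr] E(3)[OF I(1)] yx] E(4)[OF I(1) J(1) j(1)] by simp
  also have "\<dots> = Cmp C y (Cmp C x (emb d W1))" by (rule C.ho_assoc[OF E(3)[OF J(1)] xh yh, symmetric])
  also have "Cmp C x (emb d W1) = Cmp C (emb d' W') (FA L (a (W1, W')))"
   using x j(2) unfolding realizes_def by force
  also have "Cmp C y \<dots> = Cmp C (Cmp C y (emb d' W')) (FA L (a (W1, W')))"
   by (rule C.ho_assoc[OF L_ho[OF ah] E'(3)[OF J(2)] yh])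
  also have "Cmp C y (emb d' W') = Cmp C (emb d'' W'') (FA L (b (W', W'')))"
   using y j(3) unfolding realizes_def by force
  also have "Cmp C (Cmp C (emb d'' W'') (FA L (b (W', W'')))) (FA L (a (W1, W'))) =
   Cmp C (emb d'' W'') (FA L (Cmp P (b (W', W'')) (a (W1, W'))))"
   unfolding L_Cmp[OF ah bh] by (rule C.ho_assoc[OF L_ho[OF ah] L_ho[OF bh] E''(3)[OF I(2)], symmetric])
  finally have "FA L (Cmp P (c (W, W'')) (dres d (W1, W))) = FA L (Cmp P (b (W', W'')) (a (W1, W')))"
   using C.cart_eq[OF E''(3)[OF I(2)] L_ho[OF c1] L_ho[OF c2, folded over]] by simp
  then show "Cmp P (c (W, W'')) (dres d (W1, W)) = Cmp P (b (W', W'')) (a (W1, W'))" by (rule L_inj[OF c1 c2])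
 qed
 \<comment> \<open>Around each point of \<open>W\<close> there is a smaller member through which
   both families can be composed, so the description fixes the candidate locally.\<close>
 have uniq: "c0 = c1" if i: "(W, W'') \<in> ?I" and q: "?Q W W'' c0" "?Q W W'' c1" for W W'' c0 c1
 proof -
  note I = dindexD[OF d(1,3) i, simplified]
  have h: "c0 \<in> P.Ov (mrestr (acmp g f) W W'') (dobj d W) (dobj d'' W'')"
   "c1 \<in> P.Ov (mrestr (acmp g f) W W'') (dobj d W) (dobj d'' W'')" using q by auto
  have pW: "PO C (FO L (dobj d W)) = open_sub (dbase d) W" using L_obj D(3,4)[OF I(1)] by simp
  have "FA L c0 = FA L c1"
  proof (rule C.separated[OF L_ho[OF h(1)] L_ho[OF h(2)] pW])
   fix v assume "v \<in> pts (open_sub (dbase d) W)"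
   then have v: "v \<in> W" unfolding pts_open_sub[OF I(4)] .
   have vU: "v \<in> pts (dbase d)" using v openin_subset[OF I(4)] by auto
   let ?O = "{p \<in> pts (dbase d'). mfun g p \<in> W''}"
   have oO: "aopen (dbase d') ?O" by (rule openin_vimage[OF g I(5)])
   have fO: "mfun f v \<in> ?O" using I(3) v ana_homD(6)[OF f vU] mfun_Cmp[OF f vU, of g] by auto
   obtain W1 W' where W: "W1 \<subseteq> W" "v \<in> W1" "W' \<subseteq> ?O" "(W1, W') \<in> dindex d d' f"
    using dindex_refine[OF d(1,2) f I(1) v oO fO] by blast
   note J = dindexD[OF d(1,2) W(4), simplified]
   have k: "(W', W'') \<in> dindex d' d'' g" using J(2) I(2) W(3) unfolding dindex_def by auto
   note dr = D(6)[OF I(1) J(1) W(1)]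
   have "Cmp P c' (dres d (W1, W)) = Cmp P (b (W', W'')) (a (W1, W'))" if "?Q W W'' c'" for c'
    using that[THEN conjunct2, THEN spec, THEN spec, THEN mp, OF conjI[OF W(1) conjI[OF W(4) k]]] .
   from this[OF q(1)] this[OF q(2)]
   have "Cmp P c0 (dres d (W1, W)) = Cmp P c1 (dres d (W1, W))" by simp
   then have "Cmp C (FA L c0) (FA L (dres d (W1, W))) = Cmp C (FA L c1) (FA L (dres d (W1, W)))"
    using L_Cmp[OF dr h(1)] L_Cmp[OF dr h(2)] by simp
   moreover have "FA L (dres d (W1, W)) \<in> C.Ov (incl (open_sub (dbase d) W) W1)
     (FO L (dobj d W1)) (FO L (dobj d W))"
    unfolding pts_open_sub[OF I(4)] inclusion_open_sub[OF I(4) W(1)] by (rule L_ho[OF dr])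
   moreover have "aopen (open_sub (dbase d) W) W1"
    unfolding open_sub_sel open_sub_iff[OF I(4)] using J(4) W(1) by simp
   ultimately show "\<exists>W1 e z. aopen (open_sub (dbase d) W) W1 \<and> v \<in> W1 \<and>
    e \<in> C.Ov (incl (open_sub (dbase d) W) W1) z (FO L (dobj d W)) \<and>
    Cmp C (FA L c0) e = Cmp C (FA L c1) e" using W(2) by blast
  qed
  then show ?thesis by (rule L_inj[OF h])
 qed
 have the: "(THE c0. ?Q W W'' c0) = c (W, W'')" if i: "(W, W'') \<in> ?I" for W W''
  by (rule the_equality, rule Qc[OF i], rule uniq[OF i _ Qc[OF i]])
 have ce: "c \<in> extensional ?I" using CC by auto
 have comp: "Cmp QS (d', d'', g, b) (d, d', f, a) = (d, d'', acmp g f, c)"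
 proof -
  have "Cmp QS (d', d'', g, b) (d, d', f, a) = (d, d'', acmp g f, \<lambda>(W, W'')\<in>?I. (THE c0. ?Q W W'' c0))"
   by (simp add: stackification_def)
  also have "(\<lambda>(W, W'')\<in>?I. (THE c0. ?Q W W'' c0)) = c"
   by (rule extensionalityI[OF _ ce]) (auto simp: the)
  finally show ?thesis .
 qed
 then show "\<exists>c. Cmp QS (d', d'', g, b) (d, d', f, a) = (d, d'', acmp g f, c)" by blast
 show "Cmp QS (d', d'', g, b) (d, d', f, a) \<in> Arr QS" unfolding comp by (rule c(1))
 show "Farr (Cmp QS (d', d'', g, b) (d, d', f, a)) = Cmp C (Farr (d', d'', g, b)) (Farr (d, d', f, a))"
  unfolding comp Farr_eqI[OF c] x_def y_def by simp
qed

lemma QS_Idt: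
 assumes d: "descent_datum P d"
 shows "Idt QS d \<in> Arr QS" "Farr (Idt QS d) = Idt C (Fobj d)"
proof -
 note D = datumD[OF d] and E = embD[OF d]
 let ?i = "aid (dbase d)" let ?I = "dindex d d ?i"
 note i = aid_hom[OF D(1)]
 \<comment> \<open>An index pair for the identity map is an inclusion of members, so the restriction
   arrows of \<open>d\<close> themselves form the identity family.\<close>
 have sub: "fst j \<subseteq> snd j" "fst j \<in> dsieve d" "snd j \<in> dsieve d" if "j \<in> ?I" for j
 proof -
  note J = dindexD[OF d d that]
  show "fst j \<in> dsieve d" "snd j \<in> dsieve d" using J by auto
  show "fst j \<subseteq> snd j"
  proof
   fix v assume "v \<in> fst j"
   then show "v \<in> snd j" using J(3) mfun_Idt[of v "dbase d"] openin_subset[OF J(4)] by (metis image_subset_iff subsetD)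
  qed
 qed
 show A: "Idt QS d \<in> Arr QS"
  unfolding QS_sel QS_Arr_iff
 proof (intro conjI d i ballI)
  show "restrict (dres d) ?I \<in> extensional ?I" by simp
  fix j assume j: "j \<in> ?I"
  show "case j of (W, W') \<Rightarrow> restrict (dres d) ?I (W, W') \<in> P.Ov (mrestr ?i W W') (dobj d W) (dobj d W')"
   using D(6)[OF sub(3)[OF j] sub(2)[OF j] sub(1)[OF j]] j by (cases j) (auto simp: inclusion_def)
  show "case j of (W, W') \<Rightarrow> \<forall>(V, V')\<in>?I. V \<subseteq> W \<and> V' \<subseteq> W' \<longrightarrow>
    Cmp P (dres d (V', W')) (restrict (dres d) ?I (V, V')) = Cmp P (restrict (dres d) ?I (W, W')) (dres d (V, W))"
  proof (cases j)
   case (Pair W W')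
   have "Cmp P (dres d (V', W')) (dres d (V, V')) = Cmp P (dres d (W, W')) (dres d (V, W))"
    if k: "(V, V') \<in> ?I" "V \<subseteq> W" "V' \<subseteq> W'" for V V'
    using D(7)[of W' V' V] D(7)[of W' W V] sub[OF j] sub[OF k(1)] k Pair by simp
   then show ?thesis using Pair j by auto
  qed
 qed
 have "realizes d d ?i (restrict (dres d) ?I) (Idt C (Fobj d))"
  unfolding realizes_def
 proof (intro conjI ballI)
  show "Idt C (Fobj d) \<in> C.Ov ?i (Fobj d) (Fobj d)" using C.ho_id[OF E(1)] E(2) by simp
  fix j assume j: "j \<in> ?I"
  have "Cmp C (emb d (snd j)) (FA L (dres d (fst j, snd j))) = emb d (fst j)"
   by (rule E(4)[OF sub(3,2,1)[OF j]])
  then show "Cmp C (Idt C (Fobj d)) (emb d (fst j)) = Cmp C (emb d (snd j)) (FA L (restrict (dres d) ?I j))"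
   using C.ho_idl[OF E(3)[OF sub(2)[OF j]]] j by simp
 qed
 then show "Farr (Idt QS d) = Idt C (Fobj d)" using Farr_eqI A by simp
qed

section \<open>The fully faithful functor out of the stackification\<close>

definition FF :: "(('u, 'p, 'b) ddatum, ('u, 'p, 'b) ddatum \<times> ('u, 'p, 'b) ddatum \<times> 'u amor \<times> ('u set \<times> 'u set \<Rightarrow> 'b), 'o, 'a) fct" where
 "FF = \<lparr>FO = Fobj, FA = Farr\<rparr>"

lemma QS_homE:
 assumes "t \<in> hom_set QS d d'"
 obtains f a where "t = (d, d', f, a)" "(d, d', f, a) \<in> Arr QS"
 using assms by (cases t) (auto simp: hom_set_def)

lemma FF_ho:
 assumes "(d, d', f, a) \<in> Arr QS"
 shows "Farr (d, d', f, a) \<in> C.Ov f (Fobj d) (Fobj d')"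
 using Farr_realizes[OF assms] by (simp add: realizes_def)

lemma morphism_over_FF: "morphism_over QS C FF"
 unfolding morphism_over_def is_functor_def FF_def fct.simps
proof (intro conjI ballI impI)
 fix d assume "d \<in> Obj QS"
 then have d: "descent_datum P d" by simp
 show "Fobj d \<in> Obj C" "Farr (Idt QS d) = Idt C (Fobj d)" "PO C (Fobj d) = PO QS d"
  using embD(1,2)[OF d] QS_Idt[OF d] by simp_all
next
 fix t assume t: "t \<in> Arr QS"
 obtain d d' f a where e: "t = (d, d', f, a)" by (cases t)
 have A: "(d, d', f, a) \<in> Arr QS" using t e by simp
 show "Farr t \<in> C.Hom (Fobj (Dom QS t)) (Fobj (Cod QS t))" "PA C (Farr t) = PA QS t"
  unfolding e QS_sel using FF_ho[OF A] C.hoD by blast+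
 fix t' assume t': "t' \<in> Arr QS" "Cod QS t = Dom QS t'"
 obtain d1 d2 g b where e': "t' = (d1, d2, g, b)" by (cases t')
 have B: "(d', d2, g, b) \<in> Arr QS" using t' e e' by simp
 show "Farr (Cmp QS t' t) = Cmp C (Farr t') (Farr t)"
  using QS_Cmp(2)[OF A B] t'(2) e e' by simp
qed

lemma FF_bij:
 assumes d: "d \<in> Obj QS" "d' \<in> Obj QS"
 shows "bij_betw (FA FF) (hom_set QS d d') (C.Hom (FO FF d) (FO FF d'))"
 unfolding FF_def fct.simps bij_betw_def
proof
 show "inj_on Farr (hom_set QS d d')"
 proof (rule inj_onI)
  fix s t assume st: "s \<in> hom_set QS d d'" "t \<in> hom_set QS d d'" "Farr s = Farr t"
  obtain f a where s: "s = (d, d', f, a)" "(d, d', f, a) \<in> Arr QS" by (rule QS_homE[OF st(1)])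
  obtain g b where t: "t = (d, d', g, b)" "(d, d', g, b) \<in> Arr QS" by (rule QS_homE[OF st(2)])
  have fg: "f = g" using FF_ho[OF s(2)] FF_ho[OF t(2)] st(3) s(1) t(1) C.hoD(5) by metis
  show "s = t"
   using realizes_inj[OF s(2), of b] t s Farr_realizes[OF s(2)] Farr_realizes[OF t(2)] st(3) fg by auto
 qed
 show "Farr ` hom_set QS d d' = C.Hom (Fobj d) (Fobj d')"
 proof
  show "Farr ` hom_set QS d d' \<subseteq> C.Hom (Fobj d) (Fobj d')"
   using QS_homE FF_ho C.hoD(4) by (metis image_subsetI)
  show "C.Hom (Fobj d) (Fobj d') \<subseteq> Farr ` hom_set QS d d'"
  proof
   fix b assume "b \<in> C.Hom (Fobj d) (Fobj d')"
   then have "b \<in> C.Ov (PA C b) (Fobj d) (Fobj d')" by (simp add: hom_over_def)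
   then obtain a where a: "(d, d', PA C b, a) \<in> Arr QS" "realizes d d' (PA C b) a b"
    using realizes_surj[of d d' b] d by auto
   have "(d, d', PA C b, a) \<in> hom_set QS d d'" using a(1) by (simp add: hom_set_def)
   then show "b \<in> Farr ` hom_set QS d d'" using Farr_eqI[OF a] by (metis imageI)
  qed
 qed
qed

lemma FF_eqI: "s \<in> hom_set QS d d' \<Longrightarrow> t \<in> hom_set QS d d' \<Longrightarrow> Farr s = Farr t \<Longrightarrow> s = t"
proof -
 assume st: "s \<in> hom_set QS d d'" "t \<in> hom_set QS d d'" "Farr s = Farr t"
 obtain f a where "(d, d', f, a) \<in> Arr QS" by (rule QS_homE[OF st(1)])
 then have "d \<in> Obj QS" "d' \<in> Obj QS" unfolding QS_Arr_iff by auto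
 from bij_betw_imp_inj_on[OF FF_bij[OF this]] show "s = t" using st by (auto simp: FF_def dest: inj_onD)
qed

text \<open>The unit and associativity laws are pulled back from \<open>C\<close> along the faithful
  map \<open>Farr\<close>, so the glued composites need not be unfolded.\<close>

lemma over_ana_QS: "over_ana QS"
proof -
 have cmp: "Cmp QS t s \<in> hom_set QS d1 d3" "Farr (Cmp QS t s) = Cmp C (Farr t) (Farr s)"
  "PA QS (Cmp QS t s) = acmp (PA QS t) (PA QS s)"
  if st: "s \<in> hom_set QS d1 d2" "t \<in> hom_set QS d2 d3" for s t d1 d2 d3
 proof -
  obtain f a where s: "s = (d1, d2, f, a)" "(d1, d2, f, a) \<in> Arr QS" by (rule QS_homE[OF st(1)])
  obtain g b where t: "t = (d2, d3, g, b)" "(d2, d3, g, b) \<in> Arr QS" by (rule QS_homE[OF st(2)])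
  note c = QS_Cmp[OF s(2) t(2)]
  obtain e where e: "Cmp QS t s = (d1, d3, acmp g f, e)" using c(3) s t by auto
  show "Cmp QS t s \<in> hom_set QS d1 d3" using c(1) s t e by (simp add: hom_set_def)
  show "Farr (Cmp QS t s) = Cmp C (Farr t) (Farr s)" using c(2) s t by simp
  show "PA QS (Cmp QS t s) = acmp (PA QS t) (PA QS s)" using e s t by simp
 qed
 have idt: "Idt QS d \<in> hom_set QS d d" "Farr (Idt QS d) = Idt C (Fobj d)" if "descent_datum P d" for d
  using QS_Idt[OF that] by (simp_all add: hom_set_def)
 have dd: "descent_datum P d" "descent_datum P d'" "Farr s \<in> C.Hom (Fobj d) (Fobj d')"
  "PA QS s \<in> ahom (dbase d) (dbase d')" if sd: "s \<in> hom_set QS d d'" for s d d'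
 proof -
  obtain f a where s: "s = (d, d', f, a)" "(d, d', f, a) \<in> Arr QS" by (rule QS_homE[OF sd])
  show "descent_datum P d" "descent_datum P d'" "PA QS s \<in> ahom (dbase d) (dbase d')"
   using s(2) unfolding QS_Arr_iff s(1) by auto
  show "Farr s \<in> C.Hom (Fobj d) (Fobj d')" using C.hoD(4)[OF FF_ho[OF s(2)]] s(1) by simp
 qed
 have arr: "s \<in> hom_set QS (Dom QS s) (Cod QS s)" if "s \<in> Arr QS" for s using that by (simp add: hom_set_def)
 have "category QS"
  unfolding category_def
 proof (intro conjI ballI impI)
  fix s assume s: "s \<in> Arr QS"
  show "Dom QS s \<in> Obj QS" "Cod QS s \<in> Obj QS" using dd(1,2)[OF arr[OF s]] by simp_all
  show "Cmp QS s (Idt QS (Dom QS s)) = s"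
   using cmp(1,2)[OF idt(1) arr[OF s]] dd[OF arr[OF s]] arr[OF s] idt(2) C.catD(5)
   by (metis FF_eqI)
  show "Cmp QS (Idt QS (Cod QS s)) s = s"
   using cmp(1,2)[OF arr[OF s] idt(1)] dd[OF arr[OF s]] arr[OF s] idt(2) C.catD(6)
   by (metis FF_eqI)
  fix t assume t: "t \<in> Arr QS"
  show "Cmp QS t s \<in> hom_set QS (Dom QS s) (Cod QS t)" if "Cod QS s = Dom QS t"
   using cmp(1) arr[OF s] arr[OF t] that by simp
  fix u assume u: "u \<in> Arr QS" and ch: "Cod QS s = Dom QS t \<and> Cod QS t = Dom QS u"
  have t': "t \<in> hom_set QS (Cod QS s) (Cod QS t)" and u': "u \<in> hom_set QS (Cod QS t) (Cod QS u)"
   using arr[OF t] arr[OF u] ch by auto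
  show "Cmp QS u (Cmp QS t s) = Cmp QS (Cmp QS u t) s"
  proof (rule FF_eqI)
   show "Cmp QS u (Cmp QS t s) \<in> hom_set QS (Dom QS s) (Cod QS u)"
    by (rule cmp(1)[OF cmp(1)[OF arr[OF s] t'] u'])
   show "Cmp QS (Cmp QS u t) s \<in> hom_set QS (Dom QS s) (Cod QS u)"
    by (rule cmp(1)[OF arr[OF s] cmp(1)[OF t' u']])
   show "Farr (Cmp QS u (Cmp QS t s)) = Farr (Cmp QS (Cmp QS u t) s)"
    using cmp(2)[OF cmp(1)[OF arr[OF s] t'] u'] cmp(2)[OF arr[OF s] t'] cmp(2)[OF arr[OF s] cmp(1)[OF t' u']]
     cmp(2)[OF t' u'] C.catD(7)[OF dd(3)[OF arr[OF s]] dd(3)[OF t'] dd(3)[OF u']] by simp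
  qed
 next
  fix d assume "d \<in> Obj QS" then show "Idt QS d \<in> hom_set QS d d" using idt by simp
 qed
 moreover have "is_functor QS ana \<lparr>FO = PO QS, FA = PA QS\<rparr>"
  unfolding is_functor_def fct.simps
 proof (intro conjI ballI impI)
  fix d assume "d \<in> Obj QS"
  then have d: "descent_datum P d" by simp
  show "PO QS d \<in> Obj ana" "PA QS (Idt QS d) = aid (PO QS d)" using datumD(1)[OF d] by simp_all
 next
  fix s assume s: "s \<in> Arr QS"
  show "PA QS s \<in> ahom (PO QS (Dom QS s)) (PO QS (Cod QS s))" using dd(4)[OF arr[OF s]] by simp
  fix t assume t: "t \<in> Arr QS" "Cod QS s = Dom QS t"
  show "PA QS (Cmp QS t s) = acmp (PA QS t) (PA QS s)" using cmp(3)[OF arr[OF s]] arr[OF t(1)] t(2) by simp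
 qed
 ultimately show ?thesis by (simp add: over_ana_def)
qed

text \<open>The members of the sieve of \<open>d\<close>, with the embeddings \<open>emb d\<close>,
  supply the local preimages.\<close>

lemma FF_locally_in_image:
 assumes d: "d \<in> Obj QS" and v: "v \<in> pts (dbase d)"
 obtains W p e where "aopen (dbase d) W" "v \<in> W" "p \<in> Obj P"
  "e \<in> C.Ov (incl (dbase d) W) (FO L p) (FO FF d)"
proof -
 have d: "descent_datum P d" using d by simp
 note D = datumD[OF d] and E = embD[OF d]
 obtain W where "W \<in> dsieve d" "v \<in> W" using sieveD(3)[OF D(2) v] by blast
 then show ?thesis using that[of W "dobj d W" "emb d W"] D(3) E(3) sieveD(1)[OF D(2)] by (simp add: FF_def)
qed

text \<open>Converse to \<open>FF_locally_in_image\<close>. The objects \<open>p W\<close> may be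
  chosen independently of each other: full faithfulness of \<open>L\<close> turns the comparison
  arrows in \<open>C\<close> into restriction arrows of a descent datum.\<close>

lemma FF_essential_image:
 assumes y: "y \<in> Obj C" "PO C y = U" and S: "covering_sieve U \<S>"
  and p: "\<And>W. W \<in> \<S> \<Longrightarrow> p W \<in> Obj P"
  and e: "\<And>W. W \<in> \<S> \<Longrightarrow> e W \<in> C.Ov (incl U W) (FO L (p W)) y"
 obtains d where "d \<in> Obj QS" "dbase d = U" "isomorphic_over C (FO FF d) y"
proof -
 have an: "analytic_space U" using C.PO_ana[OF y(1)] y(2) by simp
 note So = sieveD[OF S]
 have pW: "PO P (p W) = open_sub U W" if "W \<in> \<S>" for W
  using ana_homD(1)[OF C.hoD(3)[OF e[OF that]]] ana_homD(1)[OF incl_hom[OF an So(1)[OF that]]]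
   L_obj[OF p[OF that]] by simp
 define dr where "dr = (\<lambda>(W', W). SOME r. r \<in> P.Ov (inclusion U W' W) (p W') (p W) \<and> Cmp C (e W) (FA L r) = e W')"
 have dr: "dr (W', W) \<in> P.Ov (inclusion U W' W) (p W') (p W)" "Cmp C (e W) (FA L (dr (W', W))) = e W'"
  if W: "W \<in> \<S>" "W' \<in> \<S>" "W' \<subseteq> W" for W W'
 proof -
  obtain c where c: "c \<in> C.Ov (inclusion U W' W) (FO L (p W')) (FO L (p W))" "Cmp C (e W) c = e W'"
   using C.restrict_factor[OF e[OF W(1)] y(2) So(1)[OF W(1)] So(1)[OF W(2)] W(3) e[OF W(2)]] by blast
  obtain r where "r \<in> P.Ov (inclusion U W' W) (p W') (p W)" "FA L r = c"
   using L_surj[OF p[OF W(2)] p[OF W(1)] c(1)] .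
  then have "\<exists>r. r \<in> P.Ov (inclusion U W' W) (p W') (p W) \<and> Cmp C (e W) (FA L r) = e W'" using c(2) by blast
  from someI_ex[OF this] show "dr (W', W) \<in> P.Ov (inclusion U W' W) (p W') (p W)"
   "Cmp C (e W) (FA L (dr (W', W))) = e W'" unfolding dr_def by auto
 qed
 have cancel: "r = s" if W: "W \<in> \<S>" and r: "r \<in> P.Ov g q (p W)" "s \<in> P.Ov g q (p W)"
  "Cmp C (e W) (FA L r) = Cmp C (e W) (FA L s)" for W g q r s
  using L_inj[OF r(1,2)] C.cart_eq[OF e[OF W] L_ho[OF r(1)] L_ho[OF r(2)] r(3)] by simp
 let ?d = "\<lparr>dbase = U, dsieve = \<S>, dobj = p, dres = dr\<rparr>"
 have id: "dr (W, W) = Idt P (p W)" if W: "W \<in> \<S>" for W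
 proof (rule cancel[OF W dr(1)[OF W W order_refl]])
  show "Idt P (p W) \<in> P.Ov (inclusion U W W) (p W) (p W)"
   using P.ho_id[OF p[OF W]] pW[OF W] inclusion_refl[OF an So(1)[OF W]] by simp
  show "Cmp C (e W) (FA L (dr (W, W))) = Cmp C (e W) (FA L (Idt P (p W)))"
   using dr(2)[OF W W order_refl] L_Idt[OF p[OF W]] C.ho_idr[OF e[OF W]] by simp
 qed
 have tr: "Cmp P (dr (W', W)) (dr (W'', W')) = dr (W'', W)"
  if W: "W \<in> \<S>" "W' \<in> \<S>" "W'' \<in> \<S>" "W'' \<subseteq> W'" "W' \<subseteq> W" for W W' W''
 proof (rule cancel[OF W(1)])
  note a = dr[OF W(2,3,4)] and b = dr[OF W(1,2,5)]
  show "Cmp P (dr (W', W)) (dr (W'', W')) \<in> P.Ov (inclusion U W'' W) (p W'') (p W)"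
   using P.ho_comp[OF a(1) b(1)] Cmp_inclusion[OF an So(1)[OF W(3)] So(1)[OF W(2)] W(4) So(1)[OF W(1)] W(5)] by simp
  show "dr (W'', W) \<in> P.Ov (inclusion U W'' W) (p W'') (p W)" using dr(1) W by blast
  show "Cmp C (e W) (FA L (Cmp P (dr (W', W)) (dr (W'', W')))) = Cmp C (e W) (FA L (dr (W'', W)))"
   using L_Cmp[OF a(1) b(1)] C.ho_assoc[OF L_ho[OF a(1)] L_ho[OF b(1)] e[OF W(1)]] a(2) b(2) dr(2)[of W W''] W by auto
 qed
 have d: "descent_datum P ?d"
  unfolding descent_datum_def using an S p pW id dr(1) tr by simp
 have E: "embeds ?d y e"
  unfolding embeds_def using y e dr(2) by simp
 note D = embeds_emb[OF d] and DD = embD[OF d, simplified]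
 note i = aid_hom[OF an]
 \<comment> \<open>\<open>y\<close> and the chosen object for \<open>?d\<close> solve the same
   descent problem. The arrow glued from the \<open>e W\<close> lies over an identity and is
   therefore invertible.\<close>
 obtain b where b: "b \<in> C.Ov (aid U) (Fobj ?d) y"
 proof (rule C.glue[OF DD(1,2) y(1), of "aid U" \<S> "\<lambda>W. W" "emb ?d" "\<lambda>W. FO L (p W)" e])
  show "aid U \<in> ahom U (PO C y)" using i y by simp
  show "aopen U W" if "W \<in> \<S>" for W using So(1)[OF that] .
  show "pts U \<subseteq> (\<Union>W\<in>\<S>. W)" using So(3) by auto
  show "emb ?d W \<in> C.Ov (incl U W) (FO L (p W)) (Fobj ?d)" if "W \<in> \<S>" for W
   using DD(3)[OF that] .
  show "e W \<in> C.Ov (acmp (aid U) (incl U W)) (FO L (p W)) y" if "W \<in> \<S>" for W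
   using e[OF that] anaD(6)[OF incl_hom[OF an So(1)[OF that]]] by simp
  fix W1 W2 w V r s
  assume *: "W1 \<in> \<S>" "W2 \<in> \<S>" "aopen U V" "V \<subseteq> W1" "V \<subseteq> W2" "PO C w = open_sub U V"
   "r \<in> C.Ov (inclusion U V W1) w (FO L (p W1))" "s \<in> C.Ov (inclusion U V W2) w (FO L (p W2))"
   "Cmp C (emb ?d W1) r = Cmp C (emb ?d W2) s"
  obtain t where t: "V \<in> \<S>" "t \<in> C.Ov (inclusion U V V) w (FO L (p V))"
   "r = Cmp C (FA L (dr (V, W1))) t" "s = Cmp C (FA L (dr (V, W2))) t"
   using common_refinement[OF d D, simplified, OF *(1-9)] by metis
  show "Cmp C (e W1) r = Cmp C (e W2) s"
   unfolding t(3,4) using * t(1) C.ho_assoc[OF t(2) L_ho[OF dr(1)] e] dr(2) by metis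
 qed blast
 have "isomorphic_over C (FO FF ?d) y"
  unfolding isomorphic_over_def FF_def using DD(2) y(2) b C.over_id_is_isom[OF b] by auto
 then show ?thesis using that[of ?d] d by simp
qed

end

section \<open>Base change\<close>

lemma yon_sel [simp]:
 "Dom (yon T) (m, h) = acmp m h" "Cod (yon T) (m, h) = m"
 "Idt (yon T) m = (m, aid (mdom m))" "Cmp (yon T) (m, h) (m', h') = (m, acmp h h')"
 "PO (yon T) = mdom" "PA (yon T) (m, h) = h"
 by (simp_all add: yon_def)

lemma yon_Obj: "m \<in> Obj (yon T) \<longleftrightarrow> m \<in> ahom (mdom m) T"
 by (simp add: yon_def hom_set_def)

lemma yon_ObjI: "m \<in> ahom V T \<Longrightarrow> m \<in> Obj (yon T)"
 by (simp add: yon_def hom_set_def)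

lemma yon_hom: "(n, h) \<in> hom_set (yon T) m' m \<longleftrightarrow>
 n = m \<and> m \<in> ahom (mdom m) T \<and> h \<in> ahom (mdom m') (mdom m) \<and> acmp m h = m'"
proof
 assume *: "(n, h) \<in> hom_set (yon T) m' m"
 then have m: "m \<in> ahom (mdom m) T" and h: "h \<in> ahom (mdom h) (mdom m)" and e: "n = m" "acmp m h = m'"
  by (auto simp: yon_def hom_set_def)
 have "mdom m' = mdom h" using ana_homD(1)[OF acmp_hom[OF h m]] e by simp
 then show "n = m \<and> m \<in> ahom (mdom m) T \<and> h \<in> ahom (mdom m') (mdom m) \<and> acmp m h = m'"
  using m h e by simp
qed (auto simp: yon_def hom_set_def)

lemma yon_Arr_hom: "s \<in> Arr (yon T) \<longleftrightarrow> s \<in> hom_set (yon T) (Dom (yon T) s) (Cod (yon T) s)"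
 by (simp add: hom_set_def)

lemma over_ana_yon: "over_ana (yon T)"
proof -
 have c: "category (yon T)"
  unfolding category_def
 proof (intro conjI ballI impI)
  fix s assume s: "s \<in> Arr (yon T)"
  obtain m h where e: "s = (m, h)" by (cases s)
  have m: "m \<in> ahom (mdom m) T" "h \<in> ahom (mdom (acmp m h)) (mdom m)"
   using s unfolding e yon_Arr_hom yon_sel yon_hom by auto
  show "Dom (yon T) s \<in> Obj (yon T)" "Cod (yon T) s \<in> Obj (yon T)"
   unfolding e yon_sel using yon_ObjI[OF acmp_hom[OF m(2,1)]] m(1) by (simp_all add: yon_Obj)
  show "Cmp (yon T) s (Idt (yon T) (Dom (yon T) s)) = s" "Cmp (yon T) (Idt (yon T) (Cod (yon T) s)) s = s"
   unfolding e yon_sel using anaD(5)[OF m(2)] anaD(6)[OF m(2)] by simp_all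
  fix s' assume s': "s' \<in> Arr (yon T)"
  obtain m' h' where e': "s' = (m', h')" by (cases s')
  have m': "m' \<in> ahom (mdom m') T" "h' \<in> ahom (mdom (acmp m' h')) (mdom m')"
   using s' unfolding e' yon_Arr_hom yon_sel yon_hom by auto
  show "Cmp (yon T) s' s \<in> hom_set (yon T) (Dom (yon T) s) (Cod (yon T) s')" if "Cod (yon T) s = Dom (yon T) s'"
  proof -
   have q: "m = acmp m' h'" using that e e' by simp
   show ?thesis unfolding e e' yon_sel yon_hom
    using m m' anaD(7)[of h _ _ h' _ m'] acmp_hom q by metis
  qed
  fix s'' assume s'': "s'' \<in> Arr (yon T)"
   and ch: "Cod (yon T) s = Dom (yon T) s' \<and> Cod (yon T) s' = Dom (yon T) s''"
  obtain m'' h'' where e'': "s'' = (m'', h'')" by (cases s'')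
  have m'': "h'' \<in> ahom (mdom (acmp m'' h'')) (mdom m'')"
   using s'' unfolding e'' yon_Arr_hom yon_sel yon_hom by auto
  show "Cmp (yon T) s'' (Cmp (yon T) s' s) = Cmp (yon T) (Cmp (yon T) s'' s') s"
   using ch m m' m'' anaD(7) unfolding e e' e'' yon_sel by metis
 next
  fix m assume "m \<in> Obj (yon T)"
  then have m: "m \<in> ahom (mdom m) T" by (simp add: yon_Obj)
  show "Idt (yon T) m \<in> hom_set (yon T) m m"
   unfolding yon_sel yon_hom using m anaD(5)[OF m] aid_hom[OF ana_homD(3)[OF m]] by simp
 qed
 have "is_functor (yon T) ana \<lparr>FO = PO (yon T), FA = PA (yon T)\<rparr>"
  unfolding is_functor_def fct.simps
 proof (intro conjI ballI impI)
  fix m assume "m \<in> Obj (yon T)"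
  then show "PO (yon T) m \<in> Obj ana" "PA (yon T) (Idt (yon T) m) = aid (PO (yon T) m)"
   using ana_homD(3) by (auto simp: yon_Obj)
 next
  fix s assume s: "s \<in> Arr (yon T)"
  obtain m h where e: "s = (m, h)" by (cases s)
  show "PA (yon T) s \<in> ahom (PO (yon T) (Dom (yon T) s)) (PO (yon T) (Cod (yon T) s))"
   using s unfolding e yon_Arr_hom yon_sel yon_hom by auto
  fix s' assume "s' \<in> Arr (yon T)"
  show "PA (yon T) (Cmp (yon T) s' s) = acmp (PA (yon T) s') (PA (yon T) s)"
   unfolding e by (cases s') simp
 qed
 then show ?thesis using c by (simp add: over_ana_def)
qed

lemma over_category_yon: "over_category (yon T)" by (simp add: over_category_def over_ana_yon)

lemma fibprod_sel [simp]:
 "Dom (fibprod A B Z F G) (v, v', a, b) = v" "Cod (fibprod A B Z F G) (v, v', a, b) = v'"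
 "Idt (fibprod A B Z F G) (x, y, al) = ((x, y, al), (x, y, al), Idt A x, Idt B y)"
 "Cmp (fibprod A B Z F G) (v', v'', a', b') (v, u, a, b) = (v, v'', Cmp A a' a, Cmp B b' b)"
 "PO (fibprod A B Z F G) (x, y, al) = PO A x" "PA (fibprod A B Z F G) (v, v', a, b) = PA A a"
 by (simp_all add: fibprod_def Let_def)

lemma fibprod_Obj: "(x, y, al) \<in> Obj (fibprod A B Z F G) \<longleftrightarrow> x \<in> Obj A \<and> y \<in> Obj B \<and> PO A x = PO B y \<and>
    al \<in> hom_over Z (aid (PO A x)) (FO F x) (FO G y) \<and> is_isom Z al"
 by (simp add: fibprod_def Let_def)

lemma fibprod_hom: "(v, v', a, b) \<in> hom_set (fibprod A B Z F G) (x, y, al) (x', y', al') \<longleftrightarrow>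
  v = (x, y, al) \<and> v' = (x', y', al') \<and> v \<in> Obj (fibprod A B Z F G) \<and> v' \<in> Obj (fibprod A B Z F G) \<and>
  a \<in> hom_set A x x' \<and> b \<in> hom_set B y y' \<and> PA A a = PA B b \<and> Cmp Z al' (FA F a) = Cmp Z (FA G b) al"
 by (auto simp: fibprod_def Let_def hom_set_def)

lemma morD:
 assumes "morphism_over A B F"
 shows "x \<in> Obj A \<Longrightarrow> FO F x \<in> Obj B" "x \<in> Obj A \<Longrightarrow> PO B (FO F x) = PO A x"
  "a \<in> hom_set A x y \<Longrightarrow> FA F a \<in> hom_set B (FO F x) (FO F y)"
  "a \<in> hom_over A f x y \<Longrightarrow> FA F a \<in> hom_over B f (FO F x) (FO F y)"
  "x \<in> Obj A \<Longrightarrow> FA F (Idt A x) = Idt B (FO F x)"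
  "a \<in> hom_set A x y \<Longrightarrow> b \<in> hom_set A y z \<Longrightarrow> FA F (Cmp A b a) = Cmp B (FA F b) (FA F a)"
 using assms unfolding morphism_over_def is_functor_def hom_over_def hom_set_def by auto

lemma fibprod_Cmp_hom:
 assumes A: "category A" "category B" "category Z" and F: "morphism_over A Z F" and G: "morphism_over B Z G"
  and PA: "over_ana A" "over_ana B"
  and s: "s \<in> hom_set (fibprod A B Z F G) v1 v2" and t: "t \<in> hom_set (fibprod A B Z F G) v2 v3"
 shows "Cmp (fibprod A B Z F G) t s \<in> hom_set (fibprod A B Z F G) v1 v3"
proof -
 obtain x1 y1 a1 x2 y2 a2 x3 y3 a3 where v: "v1 = (x1, y1, a1)" "v2 = (x2, y2, a2)" "v3 = (x3, y3, a3)"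
  using prod_cases3 by metis
 obtain u u' a b where s': "s = (u, u', a, b)" using prod_cases4 by blast
 obtain w w' a' b' where t': "t = (w, w', a', b')" using prod_cases4 by blast
 note S = s[unfolded v s' fibprod_hom] and T = t[unfolded v t' fibprod_hom]
 have e: "a \<in> hom_set A x1 x2" "b \<in> hom_set B y1 y2" "a' \<in> hom_set A x2 x3" "b' \<in> hom_set B y2 y3" using S T by auto
 have al: "a1 \<in> hom_set Z (FO F x1) (FO G y1)" "a2 \<in> hom_set Z (FO F x2) (FO G y2)" "a3 \<in> hom_set Z (FO F x3) (FO G y3)"
  using S T by (auto simp: fibprod_Obj hom_over_def)
 have "PA A (Cmp A a' a) = PA B (Cmp B b' b)"
  using over_category.PA_Cmp[of A a x1 x2 a' x3] over_category.PA_Cmp[of B b y1 y2 b' y3] PA S T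
  by (simp add: over_category_def)
 moreover have "Cmp Z a3 (FA F (Cmp A a' a)) = Cmp Z (FA G (Cmp B b' b)) a1"
 proof -
  note Fa = morD(3)[OF F e(1)] and Fa' = morD(3)[OF F e(3)]
   and Gb = morD(3)[OF G e(2)] and Gb' = morD(3)[OF G e(4)]
  have "Cmp Z a3 (FA F (Cmp A a' a)) = Cmp Z (Cmp Z a3 (FA F a')) (FA F a)"
   using morD(6)[OF F e(1,3)] categoryD(7)[OF A(3) Fa Fa' al(3)] by simp
  also have "\<dots> = Cmp Z (FA G b') (Cmp Z a2 (FA F a))"
   using T categoryD(7)[OF A(3) Fa al(2) Gb'] by simp
  also have "\<dots> = Cmp Z (FA G (Cmp B b' b)) a1"
   using S morD(6)[OF G e(2,4)] categoryD(7)[OF A(3) al(1) Gb Gb'] by simp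
  finally show ?thesis .
 qed
 ultimately show ?thesis
  using S T categoryD(4)[OF A(1) e(1,3)] categoryD(4)[OF A(2) e(2,4)]
  unfolding s' t' v fibprod_sel fibprod_hom by auto
qed

section \<open>Representability expressed by universal arrows\<close>

locale base_change_setting = A: over_category A + B: fibred_category B
 for A :: "('u, 'o1, 'a1) ocat" and B :: "('u, 'o2, 'a2) ocat" +
 fixes F :: "('o1, 'a1, 'o2, 'a2) fct"
 assumes F: "morphism_over A B F"
begin

text \<open>A final object among the objects of \<open>A\<close> equipped with an arrow to
  \<open>y\<close> after \<open>F\<close>. This encodes the 2-fibre product with the base of
  \<open>y\<close> without mentioning its isomorphism component.\<close>

definition universal where
 "universal w b y \<longleftrightarrow> (\<forall>w' b' h'. w' \<in> Obj A \<longrightarrow> b' \<in> B.Ov h' (FO F w') y \<longrightarrow>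
  (\<exists>!c. c \<in> A.Hom w' w \<and> Cmp B b (FA F c) = b'))"

lemma universalD:
 "universal w b y \<Longrightarrow> w' \<in> Obj A \<Longrightarrow> b' \<in> B.Ov h' (FO F w') y \<Longrightarrow>
  \<exists>!c. c \<in> A.Hom w' w \<and> Cmp B b (FA F c) = b'"
 unfolding universal_def by blast

text \<open>Yoneda: a base change \<open>h\<close> of \<open>F\<close> along \<open>t\<close> carries an object \<open>w\<close> of \<open>A\<close> and an arrow from
 \<open>F w\<close> to the object \<open>t id\<close> corresponding to \<open>t\<close>, and this pair is universal.\<close>

lemma base_change_universal:
 assumes T: "analytic_space T" and t: "morphism_over (yon T) B t" and bc: "base_change A B F T t Z h"
 obtains w b where "w \<in> Obj A" "PO A w = Z" "b \<in> B.Ov h (FO F w) (FO t (aid T))" "universal w b (FO t (aid T))"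
proof -
 let ?P = "fibprod A (yon T) B F t"
 let ?y = "FO t (aid T)"
 have Z: "analytic_space Z" using bc by (simp add: base_change_def)
 obtain E where E: "equivalence_over (yon Z) ?P E" and hE: "h = fst (snd (FO E (aid Z)))"
  using bc unfolding base_change_def by blast
 have mE: "morphism_over (yon Z) ?P E"
  and ffE: "\<And>x y. x \<in> Obj (yon Z) \<Longrightarrow> y \<in> Obj (yon Z) \<Longrightarrow>
   bij_betw (FA E) (hom_set (yon Z) x y) (hom_set ?P (FO E x) (FO E y))"
  and esE: "\<And>y. y \<in> Obj ?P \<Longrightarrow> \<exists>x\<in>Obj (yon Z). isomorphic_over ?P (FO E x) y"
  using E unfolding equivalence_over_def by blast+
 note comp = fibprod_Cmp_hom[OF A.cat over_category.cat[OF over_category_yon] B.cat F t A.over over_ana_yon]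
 note iT = aid_hom[OF T] and iZ = aid_hom[OF Z]
 have oT: "aid T \<in> Obj (yon T)" and oZ: "aid Z \<in> Obj (yon Z)" using yon_ObjI iT iZ by blast+
 have yT: "?y \<in> Obj B" "PO B ?y = T" using morD(1,2)[OF t oT] ana_homD(1)[OF iT] by auto
 \<comment> \<open>\<open>l m\<close> exhibits the value of \<open>t\<close> at \<open>m\<close> as
   the pullback of its value at the identity.\<close>
 define l where "l m = FA t (aid T, m)" for m
 have lh: "(aid T, m) \<in> hom_set (yon T) m (aid T)" if m: "m \<in> ahom V T" for m V
  unfolding yon_hom using m ana_homD(1)[OF m] ana_homD(1)[OF iT] iT anaD(6)[OF m] by simp
 have l: "l m \<in> B.Ov m (FO t m) ?y" if m: "m \<in> ahom V T" for m V
  unfolding l_def using morD(4)[OF t hom_overI[OF lh[OF m]]] by simp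
 have lt: "Cmp B (l m) (FA t s) = l m'" if s: "s \<in> hom_set (yon T) m' m" for s m m'
 proof -
  obtain n k where sn: "s = (n, k)" by (cases s)
  have S: "n = m" "m \<in> ahom (mdom m) T" "k \<in> ahom (mdom m') (mdom m)" "acmp m k = m'"
   using s[unfolded sn yon_hom] by auto
  show ?thesis unfolding l_def using morD(6)[OF t s lh[OF S(2)]] sn S by simp
 qed
 obtain w m0 al where w0: "FO E (aid Z) = (w, m0, al)" by (metis prod_cases3)
 have m0: "m0 = h" using hE w0 by simp
 have w1: "(w, h, al) \<in> Obj ?P" using morD(1)[OF mE oZ] w0 m0 by simp
 have w: "w \<in> Obj A" and hT: "h \<in> ahom (mdom h) T" and PD: "PO A w = mdom h"
  and al: "al \<in> B.Ov (aid (PO A w)) (FO F w) (FO t h)"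
  using w1[unfolded fibprod_Obj] yon_Obj by auto
 have PZ: "PO A w = Z"
  using morD(2)[OF mE oZ] w0 ana_homD(1)[OF iZ] by simp
 \<comment> \<open>The isomorphism component of the universal object is absorbed into an arrow by
   composing it with \<open>l h\<close>.\<close>
 define b where "b = Cmp B (l h) al"
 have b: "b \<in> B.Ov h (FO F w) ?y"
  unfolding b_def using B.ho_comp[OF al l[OF hT]] anaD(5)[OF hT] PD by simp
 have univ: "\<exists>!c. c \<in> A.Hom w' w \<and> Cmp B b (FA F c) = b'"
  if w': "w' \<in> Obj A" and b': "b' \<in> B.Ov h' (FO F w') ?y" for w' b' h'
 proof -
  define V where "V = PO A w'"
  have h': "h' \<in> ahom V T" using B.hoD(3)[OF b'] morD(2)[OF F w'] yT V_def by simp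
  have oh': "h' \<in> Obj (yon T)" "mdom h' = V" using yon_ObjI[OF h'] ana_homD(1)[OF h'] by auto
  have pt: "PO B (FO t h') = V" using morD(2)[OF t oh'(1)] oh'(2) by simp
  have iV: "aid V \<in> ahom V V" using aid_hom[OF ana_homD(3)[OF h']] .
  obtain al' where al': "al' \<in> B.Ov (aid V) (FO F w') (FO t h')" "Cmp B (l h') al' = b'"
   using B.cart_ex[OF l[OF h'] b', of "aid V"] pt morD(2)[OF F w'] V_def iV anaD(5)[OF h'] by metis
  \<comment> \<open>The competing arrow is repackaged as an object of the 2-fibre product; the
    equivalence hits it up to isomorphism.\<close>
  let ?om = "(w', h', al')"
  have om: "?om \<in> Obj ?P"
   unfolding fibprod_Obj using w' oh' al'(1) B.over_id_is_isom[OF al'(1)] V_def by simp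
  obtain j where j: "j \<in> Obj (yon Z)" "isomorphic_over ?P (FO E j) ?om" using esE[OF om] by blast
  obtain wj mj alj where wj: "FO E j = (wj, mj, alj)" by (metis prod_cases3)
  obtain lm where lam: "lm \<in> hom_set ?P (FO E j) ?om" "is_isom ?P lm"
   using j(2) unfolding isomorphic_over_def hom_over_def by blast
  obtain kp where kap: "kp \<in> hom_set ?P ?om (FO E j)" "Cmp ?P lm kp = Idt ?P ?om"
   using is_isom_homD[OF lam(2)] hom_setD[OF lam(1)] by metis
  obtain u u' la lb where la: "lm = (u, u', la, lb)" using prod_cases4 by blast
  obtain v v' ka kb where ka: "kp = (v, v', ka, kb)" using prod_cases4 by blast
  note LA = lam(1)[unfolded la wj fibprod_hom] and KA = kap(1)[unfolded ka wj fibprod_hom]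
  have lah: "la \<in> A.Hom wj w'" using LA by auto
  have la_ka: "Cmp A la ka = Idt A w'" using kap(2) unfolding la ka fibprod_sel by simp
  have jh: "j \<in> ahom (mdom j) Z" using j(1) by (simp add: yon_Obj)
  have jj: "(aid Z, j) \<in> hom_set (yon Z) j (aid Z)"
   unfolding yon_hom using jh ana_homD(1)[OF iZ] iZ anaD(6)[OF jh] by simp
  \<comment> \<open>The identity of \<open>Z\<close> is terminal in \<open>yon Z\<close>.\<close>
  have single: "s = (aid Z, j)" if "s \<in> hom_set (yon Z) j (aid Z)" for s
  proof -
   obtain n k where sn: "s = (n, k)" by (cases s)
   have "n = aid Z" "k \<in> ahom (mdom j) Z" "acmp (aid Z) k = j"
    using that[unfolded sn yon_hom] ana_homD(1)[OF iZ] by auto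
   then show ?thesis using anaD(6) sn by metis
  qed
  have Ejj: "FA E (aid Z, j) \<in> hom_set ?P (wj, mj, alj) (w, h, al)"
   using morD(3)[OF mE jj] w0 m0 wj by simp
  obtain x x' ea eb where ea: "FA E (aid Z, j) = (x, x', ea, eb)" using prod_cases4 by blast
  note EA = Ejj[unfolded ea fibprod_hom]
  note c = A.catD(4)[of ka w' wj ea w]
  have cc: "Cmp A ea ka \<in> A.Hom w' w" using c KA EA by simp
  have ka': "ka \<in> A.Hom w' wj" "kb \<in> hom_set (yon T) h' mj" "Cmp B alj (FA F ka) = Cmp B (FA t kb) al'"
   and ea': "ea \<in> A.Hom wj w" "eb \<in> hom_set (yon T) mj h" "Cmp B al (FA F ea) = Cmp B (FA t eb) alj"
   using KA EA by auto
  have aljh: "alj \<in> B.Hom (FO F wj) (FO t mj)" using KA by (auto simp: fibprod_Obj hom_over_def)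
  have lhh: "l h \<in> B.Hom (FO t h) ?y" using B.hoD(4)[OF l[OF hT]] .
  have mjT: "mj \<in> ahom (mdom mj) T" using KA by (auto simp: fibprod_Obj yon_Obj)
  have lmj: "l mj \<in> B.Hom (FO t mj) ?y" using B.hoD(4)[OF l[OF mjT]] .
  note Fka = morD(3)[OF F ka'(1)] and Fea = morD(3)[OF F ea'(1)]
   and tkb = morD(3)[OF t ka'(2)] and teb = morD(3)[OF t ea'(2)]
  have "Cmp B b (FA F (Cmp A ea ka)) = Cmp B (Cmp B b (FA F ea)) (FA F ka)"
   using morD(6)[OF F ka'(1) ea'(1)] B.catD(7)[OF Fka Fea B.hoD(4)[OF b]] by simp
  also have "Cmp B b (FA F ea) = Cmp B (l h) (Cmp B (FA t eb) alj)"
   unfolding b_def using B.catD(7)[OF Fea B.hoD(4)[OF al] lhh] ea'(3) by simp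
  also have "\<dots> = Cmp B (l mj) alj" using B.catD(7)[OF aljh teb lhh] lt[OF ea'(2)] by simp
  also have "Cmp B (Cmp B (l mj) alj) (FA F ka) = Cmp B (l mj) (Cmp B (FA t kb) al')"
   using B.catD(7)[OF Fka aljh lmj] ka'(3) by simp
  also have "\<dots> = b'" using B.catD(7)[OF B.hoD(4)[OF al'(1)] tkb lmj] lt[OF ka'(2)] al'(2) by simp
  finally have ex: "Cmp B b (FA F (Cmp A ea ka)) = b'" .
  \<comment> \<open>An arrow compatible with \<open>b\<close> is an arrow of the 2-fibre product,
    its second component being determined by its base map.\<close>
  have arr: "(?om, (w, h, al), c, (h, PA A c)) \<in> hom_set ?P ?om (w, h, al)"
   if c: "c \<in> A.Hom w' w" "Cmp B b (FA F c) = b'" for c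
  proof -
   have k: "PA A c \<in> ahom V Z" using A.PA_hom[OF c(1)] V_def PZ by simp
   note Fc = morD(4)[OF F hom_overI[OF c(1) refl]]
   have hk: "acmp h (PA A c) = h'"
    using B.hoD(5)[OF B.ho_comp[OF Fc b]] B.hoD(5)[OF b'] c(2) by simp
   have hd: "mdom h = Z" using PD PZ by simp
   have yk: "(h, PA A c) \<in> hom_set (yon T) h' h" unfolding yon_hom using hT k hk oh'(2) hd by simp
   note tk = morD(4)[OF t hom_overI[OF yk], of "PA A c"]
   have tk: "FA t (h, PA A c) \<in> B.Ov (PA A c) (FO t h') (FO t h)" using tk by simp
   have k1: "acmp (aid Z) (PA A c) = PA A c" "acmp (PA A c) (aid V) = PA A c"
    using anaD(5,6)[OF k] by simp_all
   have "Cmp B al (FA F c) = Cmp B (FA t (h, PA A c)) al'"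
   proof (rule B.cart_eq[OF l[OF hT]])
    show "Cmp B al (FA F c) \<in> B.Ov (PA A c) (FO F w') (FO t h)"
     using B.ho_comp[OF Fc al] k1 PZ by simp
    show "Cmp B (FA t (h, PA A c)) al' \<in> B.Ov (PA A c) (FO F w') (FO t h)"
     using B.ho_comp[OF al'(1) tk] k1 by simp
    show "Cmp B (l h) (Cmp B al (FA F c)) = Cmp B (l h) (Cmp B (FA t (h, PA A c)) al')"
     using B.ho_assoc[OF Fc al l[OF hT]] B.ho_assoc[OF al'(1) tk l[OF hT]] lt[OF yk] c(2) al'(2) b_def by simp
   qed
   then show ?thesis unfolding fibprod_hom using c(1) yk om w1 by simp
  qed
  \<comment> \<open>Precomposed with the isomorphism \<open>lm\<close>, both candidates become the
    image of the only arrow to the terminal object; the inverse of \<open>lm\<close> is then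
    cancelled.\<close>
  have uniq: "c1 = c2" if c1: "c1 \<in> A.Hom w' w" "Cmp B b (FA F c1) = b'"
   and c2: "c2 \<in> A.Hom w' w" "Cmp B b (FA F c2) = b'" for c1 c2
  proof -
   have im: "\<exists>s\<in>hom_set (yon Z) j (aid Z). FA E s = th" if "th \<in> hom_set ?P (FO E j) (w, h, al)" for th
   proof -
    have "th \<in> FA E ` hom_set (yon Z) j (aid Z)"
     using bij_betw_imp_surj_on[OF ffE[OF j(1) oZ]] that w0 m0 by simp
    then show ?thesis by blast
   qed
   have "Cmp ?P (?om, (w, h, al), c, (h, PA A c)) lm = FA E (aid Z, j)"
    if "c \<in> A.Hom w' w" "Cmp B b (FA F c) = b'" for c
    using im[OF comp[OF lam(1) arr[OF that]]] single by metis
   then have "Cmp ?P (?om, (w, h, al), c1, (h, PA A c1)) lm = Cmp ?P (?om, (w, h, al), c2, (h, PA A c2)) lm"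
    using c1 c2 by metis
   then have "Cmp A c1 la = Cmp A c2 la" unfolding la fibprod_sel by simp
   then have "Cmp A (Cmp A c1 la) ka = Cmp A (Cmp A c2 la) ka" by simp
   then show ?thesis
    using A.catD(7)[OF ka'(1) lah c1(1)] A.catD(7)[OF ka'(1) lah c2(1)] la_ka A.catD(5)[OF c1(1)] A.catD(5)[OF c2(1)]
    by simp
  qed
  show ?thesis using cc ex uniq by blast
 qed
 show ?thesis by (rule that[OF w PZ b]) (simp add: universal_def univ)
qed

text \<open>The other half of Yoneda: an object defines a 1-morphism by pullback. It is strictly
  functorial although the pullbacks are chosen freely, because arrows between them are fixed by the
  cartesian property.\<close>

definition cleave :: "'o2 \<Rightarrow> ('u amor, 'u amor \<times> 'u amor, 'o2, 'a2) fct" where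
 "cleave y = \<lparr>FO = \<lambda>m. B.pull m y,
   FA = \<lambda>(m, h). THE c. c \<in> B.Ov h (B.pull (acmp m h) y) (B.pull m y) \<and>
    Cmp B (B.lift m y) c = B.lift (acmp m h) y\<rparr>"

lemma cleave_arr:
 assumes y: "y \<in> Obj B" and m: "m \<in> ahom V (PO B y)" and h: "h \<in> ahom V' V"
 shows "FA (cleave y) (m, h) \<in> B.Ov h (B.pull (acmp m h) y) (B.pull m y)"
  "Cmp B (B.lift m y) (FA (cleave y) (m, h)) = B.lift (acmp m h) y"
proof -
 have "\<exists>!c. c \<in> B.Ov h (B.pull (acmp m h) y) (B.pull m y) \<and>
    Cmp B (B.lift m y) c = B.lift (acmp m h) y"
  using B.cart_ex1[OF B.lift_ho[OF y m] B.lift_ho[OF y acmp_hom[OF h m]]]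
   B.PO_pull[OF y m] B.PO_pull[OF y acmp_hom[OF h m]] h by simp
 from theI'[OF this] show "FA (cleave y) (m, h) \<in> B.Ov h (B.pull (acmp m h) y) (B.pull m y)"
  "Cmp B (B.lift m y) (FA (cleave y) (m, h)) = B.lift (acmp m h) y"
  by (simp_all add: cleave_def)
qed

lemma morphism_over_cleave:
 assumes y: "y \<in> Obj B"
 shows "morphism_over (yon (PO B y)) B (cleave y)"
proof -
 have FO: "FO (cleave y) m = B.pull m y" for m by (simp add: cleave_def)
 have i: "FA (cleave y) (m, aid (mdom m)) = Idt B (B.pull m y)" if m: "m \<in> ahom (mdom m) (PO B y)" for m
 proof (rule B.cart_eq[OF B.lift_ho[OF y m]])
  note iV = aid_hom[OF ana_homD(3)[OF m]]
  note c = cleave_arr[OF y m iV, unfolded anaD(5)[OF m]]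
  show "FA (cleave y) (m, aid (mdom m)) \<in> B.Ov (aid (mdom m)) (B.pull m y) (B.pull m y)" by (rule c)
  show "Idt B (B.pull m y) \<in> B.Ov (aid (mdom m)) (B.pull m y) (B.pull m y)"
   using B.ho_id B.PO_pull[OF y m] by metis
  show "Cmp B (B.lift m y) (FA (cleave y) (m, aid (mdom m))) = Cmp B (B.lift m y) (Idt B (B.pull m y))"
   using c(2) B.ho_idr[OF B.lift_ho[OF y m]] by simp
 qed
 show ?thesis
  unfolding morphism_over_def is_functor_def
 proof (intro conjI ballI impI)
  fix m assume "m \<in> Obj (yon (PO B y))"
  then have m: "m \<in> ahom (mdom m) (PO B y)" by (simp add: yon_Obj)
  show "FO (cleave y) m \<in> Obj B" "PO B (FO (cleave y) m) = PO (yon (PO B y)) m"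
   using FO B.PO_pull[OF y m] by simp_all
  show "FA (cleave y) (Idt (yon (PO B y)) m) = Idt B (FO (cleave y) m)" using i[OF m] FO by simp
 next
  fix s assume s: "s \<in> Arr (yon (PO B y))"
  obtain m h where e: "s = (m, h)" by (cases s)
  have m: "m \<in> ahom (mdom m) (PO B y)" "h \<in> ahom (mdom (acmp m h)) (mdom m)"
   using s unfolding e yon_Arr_hom yon_sel yon_hom by auto
  note c = cleave_arr[OF y m]
  show "FA (cleave y) s \<in> B.Hom (FO (cleave y) (Dom (yon (PO B y)) s)) (FO (cleave y) (Cod (yon (PO B y)) s))"
   "PA B (FA (cleave y) s) = PA (yon (PO B y)) s"
   using B.hoD(4,5)[OF c(1)] FO e by simp_all
  fix s' assume s': "s' \<in> Arr (yon (PO B y))" and st: "Cod (yon (PO B y)) s = Dom (yon (PO B y)) s'"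
  obtain m' h' where e': "s' = (m', h')" by (cases s')
  have m': "m' \<in> ahom (mdom m') (PO B y)" "h' \<in> ahom (mdom (acmp m' h')) (mdom m')"
   using s' unfolding e' yon_Arr_hom yon_sel yon_hom by auto
  have mm: "m = acmp m' h'" using st e e' by simp
  have hh: "acmp m h = acmp m' (acmp h' h)" using anaD(7)[OF m(2) _ m'(1), of h'] m'(2) mm by simp
  have h'h: "acmp h' h \<in> ahom (mdom (acmp m h)) (mdom m')" using acmp_hom[OF m(2)] m'(2) mm by simp
  note c' = cleave_arr[OF y m'] and c'' = cleave_arr[OF y m'(1) h'h]
  have "FA (cleave y) (m', acmp h' h) = Cmp B (FA (cleave y) (m', h')) (FA (cleave y) (m, h))"
  proof (rule B.cart_eq[OF B.lift_ho[OF y m'(1)] c''(1)])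
   have c0: "FA (cleave y) (m', h') \<in> B.Ov h' (B.pull m y) (B.pull m' y)" using c'(1) mm by simp
   show "Cmp B (FA (cleave y) (m', h')) (FA (cleave y) (m, h)) \<in>
    B.Ov (acmp h' h) (B.pull (acmp m' (acmp h' h)) y) (B.pull m' y)"
    using B.ho_comp[OF c(1) c0] hh by simp
   show "Cmp B (B.lift m' y) (FA (cleave y) (m', acmp h' h)) =
    Cmp B (B.lift m' y) (Cmp B (FA (cleave y) (m', h')) (FA (cleave y) (m, h)))"
    using c''(2) B.ho_assoc[OF c(1) c0 B.lift_ho[OF y m'(1)]] c'(2) c(2) mm hh by simp
  qed
  then show "FA (cleave y) (Cmp (yon (PO B y)) s' s) = Cmp B (FA (cleave y) s') (FA (cleave y) s)"
   using e e' by simp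
 qed
qed

text \<open>The value of \<open>cleave y\<close> at the identity is only isomorphic to
  \<open>y\<close>, so the universal arrow obtained from base change is corrected by the vertical
  isomorphism \<open>l\<close>.\<close>

lemma representable_universal:
 assumes rep: "representable_with R A B F" and y: "y \<in> Obj B"
 obtains w b h where "w \<in> Obj A" "b \<in> B.Ov h (FO F w) y" "R h" "universal w b y"
proof -
 let ?T = "PO B y" let ?t = "cleave y"
 have T: "analytic_space ?T" by (rule B.PO_ana[OF y])
 note t = morphism_over_cleave[OF y]
 obtain Z h where bc: "base_change A B F ?T ?t Z h"
  using rep t T unfolding representable_with_def representable_def ana_sel by blast
 have R: "R h" using rep t T bc unfolding representable_with_def ana_sel by blast
 obtain w b where w: "w \<in> Obj A" "PO A w = Z" "b \<in> B.Ov h (FO F w) (FO ?t (aid ?T))"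
  and univ: "universal w b (FO ?t (aid ?T))"
  by (rule base_change_universal[OF T t bc])
 define l where "l = B.lift (aid ?T) y"
 note iT = aid_hom[OF T]
 have l: "l \<in> B.Ov (aid ?T) (FO ?t (aid ?T)) y"
  unfolding l_def cleave_def using B.lift_ho[OF y iT] by simp
 obtain l' where l': "l' \<in> B.Ov (aid ?T) y (FO ?t (aid ?T))" "Cmp B l l' = Idt B y"
  "Cmp B l' l = Idt B (FO ?t (aid ?T))" using B.over_id_inverse[OF l] by blast
 have hT: "h \<in> ahom (PO B (FO F w)) ?T"
  using B.hoD(3)[OF w(3)] B.hoD(3)[OF l] ana_homD(1)
  by (metis ana_homD(1)[OF iT])
 have lb: "Cmp B l b \<in> B.Ov h (FO F w) y" using B.ho_comp[OF w(3) l] anaD(6)[OF hT] by simp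
 have univ': "\<exists>!c. c \<in> A.Hom w' w \<and> Cmp B (Cmp B l b) (FA F c) = b'"
  if w': "w' \<in> Obj A" and b': "b' \<in> B.Ov h' (FO F w') y" for w' b' h'
 proof -
  have "(Cmp B (Cmp B l b) (FA F c) = b') = (Cmp B b (FA F c) = Cmp B l' b')" if c: "c \<in> A.Hom w' w" for c
  proof -
   note Fc = morD(4)[OF F hom_overI[OF c refl]]
   have 1: "Cmp B (Cmp B l b) (FA F c) = Cmp B l (Cmp B b (FA F c))" using B.ho_assoc[OF Fc w(3) l] by simp
   show ?thesis
   proof
    assume "Cmp B (Cmp B l b) (FA F c) = b'"
    then have "Cmp B l' b' = Cmp B l' (Cmp B l (Cmp B b (FA F c)))" using 1 by simp
    also have "\<dots> = Cmp B b (FA F c)"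
     using B.ho_assoc[OF B.ho_comp[OF Fc w(3)] l l'(1)] l'(3) B.ho_idl[OF B.ho_comp[OF Fc w(3)]] by simp
    finally show "Cmp B b (FA F c) = Cmp B l' b'" by simp
   next
    assume "Cmp B b (FA F c) = Cmp B l' b'"
    then have "Cmp B (Cmp B l b) (FA F c) = Cmp B l (Cmp B l' b')" using 1 by simp
    also have "\<dots> = b'" using B.ho_assoc[OF b' l'(1) l] l'(2) B.ho_idl[OF b'] by simp
    finally show "Cmp B (Cmp B l b) (FA F c) = b'" .
   qed
  qed
  moreover have "\<exists>!c. c \<in> A.Hom w' w \<and> Cmp B b (FA F c) = Cmp B l' b'"
   by (rule universalD[OF univ w' B.ho_comp[OF b' l'(1)]])
  ultimately show ?thesis by metis
 qed
 show ?thesis by (rule that[OF w(1) lb R]) (simp add: universal_def univ')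
qed

end

text \<open>The condition \<open>open_image\<close> says that the locus in the base of
  \<open>y\<close> over which \<open>y\<close> lies in the essential image is open and that its
  formation commutes with pullback.\<close>

locale open_substack = A: over_category A + B: fibred_category B
 for A :: "('u, 'o1, 'a1) ocat" and B :: "('u, 'o2, 'a2) ocat" +
 fixes F :: "('o1, 'a1, 'o2, 'a2) fct"
 assumes F: "morphism_over A B F"
  and ff: "\<And>x y. x \<in> Obj A \<Longrightarrow> y \<in> Obj A \<Longrightarrow>
   bij_betw (FA F) (hom_set A x y) (hom_set B (FO F x) (FO F y))"
  and open_image: "\<And>y. y \<in> Obj B \<Longrightarrow> \<exists>T0. aopen (PO B y) T0 \<and>
   (\<forall>m z a. a \<in> hom_over B m z y \<longrightarrow>
    ((\<exists>q\<in>Obj A. isomorphic_over B (FO F q) z) \<longleftrightarrow> mfun m ` pts (PO B z) \<subseteq> T0))"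
begin

sublocale base_change_setting A B F by unfold_locales (rule F)

lemma F_inj:
 assumes "a \<in> A.Hom x y" "b \<in> A.Hom x y" "FA F a = FA F b"
 shows "a = b"
 using bij_betw_imp_inj_on[OF ff[OF A.catD(1,2)[OF assms(1)]]] assms(3,1,2) by (rule inj_onD)

lemma F_surj:
 assumes "x \<in> Obj A" "y \<in> Obj A" "b \<in> B.Ov f (FO F x) (FO F y)"
 obtains a where "a \<in> A.Ov f x y" "FA F a = b"
proof -
 have "b \<in> FA F ` A.Hom x y"
  using bij_betw_imp_surj_on[OF ff[OF assms(1,2)]] B.hoD(4)[OF assms(3)] by simp
 then obtain a where a: "a \<in> A.Hom x y" "FA F a = b" by blast
 have "PA A a = f"
  using B.hoD(5)[OF morD(4)[OF F hom_overI[OF a(1) refl]]] a(2) B.hoD(5)[OF assms(3)] by simp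
 then show ?thesis using that[of a] a by (simp add: hom_over_def)
qed

text \<open>Any base change turns out to be the inclusion of \<open>T0\<close> up to isomorphism.
  The object over \<open>T0\<close> comes from \<open>A\<close>, and universality of
  \<open>w\<close> yields the inverse \<open>k\<close>.\<close>

lemma base_change_etale:
 assumes T: "analytic_space T" and t: "morphism_over (yon T) B t" and bc: "base_change A B F T t Z h"
 shows "ana_etale h"
proof -
 let ?y = "FO t (aid T)"
 obtain w b where w: "w \<in> Obj A" "PO A w = Z" "b \<in> B.Ov h (FO F w) ?y"
  and u: "universal w b ?y"
  by (rule base_change_universal[OF T t bc])
 note univ = universalD[OF u]
 note iT = aid_hom[OF T]
 have y: "?y \<in> Obj B" "PO B ?y = T"
  using morD(1,2)[OF t yon_ObjI[OF iT]] ana_homD(1)[OF iT] by auto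
 have pw: "PO B (FO F w) = Z" "FO F w \<in> Obj B" using morD(1,2)[OF F w(1)] w(2) by auto
 have h: "h \<in> ahom Z T" using B.hoD(3)[OF w(3)] y pw by simp
 have Z: "analytic_space Z" using ana_homD(3)[OF h] .
 obtain T0 where T0: "aopen T T0"
  "\<And>m z a. a \<in> B.Ov m z ?y \<Longrightarrow>
    ((\<exists>q\<in>Obj A. isomorphic_over B (FO F q) z) \<longleftrightarrow> mfun m ` pts (PO B z) \<subseteq> T0)"
  using open_image[OF y(1)] unfolding y(2) by blast
 have "isomorphic_over B (FO F w) (FO F w)"
  unfolding isomorphic_over_def using B.ho_id[OF pw(2)] B.over_id_is_isom by blast
 then have hT0: "mfun h ` pts Z \<subseteq> T0" using T0(2)[OF w(3)] w(1) pw(1) by auto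
 define i where "i = incl T T0"
 have i: "i \<in> ahom (open_sub T T0) T" unfolding i_def by (rule incl_hom[OF T T0(1)])
 have sT0: "T0 \<subseteq> pts T" using openin_subset[OF T0(1)] .
 have pT0: "pts (open_sub T T0) = T0" by (rule pts_open_sub[OF T0(1)])
 define z0 where "z0 = B.pull i ?y" define a0 where "a0 = B.lift i ?y"
 have a0: "a0 \<in> B.Ov i z0 ?y" "PO B z0 = open_sub T T0"
  unfolding a0_def z0_def using B.lift_ho[OF y(1)] B.PO_pull[OF y(1)] i y(2) by auto
 have "mfun i ` pts (PO B z0) \<subseteq> T0" unfolding a0(2) pT0 i_def using sT0 by auto
 then obtain q where q: "q \<in> Obj A" "isomorphic_over B (FO F q) z0" using T0(2)[OF a0(1)] by blast
 obtain r where r: "r \<in> B.Ov (aid (open_sub T T0)) (FO F q) z0"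
  using q(2) a0(2) unfolding isomorphic_over_def by auto
 have b0: "Cmp B a0 r \<in> B.Ov i (FO F q) ?y" using B.ho_comp[OF r a0(1)] anaD(5)[OF i] by simp
 obtain c where c: "c \<in> A.Hom q w" "Cmp B b (FA F c) = Cmp B a0 r" using univ[OF q(1) b0] by blast
 have pq: "PO B (FO F q) = open_sub T T0" "PO A q = open_sub T T0"
  using q(2) a0(2) morD(2)[OF F q(1)] unfolding isomorphic_over_def by auto
 define k where "k = PA A c"
 have ch: "c \<in> A.Ov k q w" unfolding k_def using c(1) by (simp add: hom_over_def)
 have k: "k \<in> ahom (open_sub T T0) Z" using A.hoD(3)[OF ch] pq w(2) by simp
 note Fc = morD(4)[OF F ch]
 have hk: "acmp h k = i" using B.hoD(5)[OF B.ho_comp[OF Fc w(3)]] B.hoD(5)[OF b0] c(2) by simp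
 define h' where "h' = mrestr h (pts Z) T0"
 have h': "h' \<in> ahom Z (open_sub T T0)" "acmp i h' = h"
  unfolding h'_def i_def by (rule factor_open[OF h T0(1) hT0])+
 obtain e where e: "e \<in> B.Ov h' (FO F w) (FO F q)" "Cmp B (Cmp B a0 r) e = b"
  using B.cart_ex[OF b0 w(3), of h'] h' pw pq by metis
 obtain e' where e': "e' \<in> A.Ov h' w q" "FA F e' = e" using F_surj[OF w(1) q(1) e(1)] .
 \<comment> \<open>This endomorphism of \<open>w\<close> preserves the universal arrow and is
   therefore the identity. Together with monicity of the inclusion of \<open>T0\<close> it makes
   \<open>k\<close> a two-sided inverse of \<open>h'\<close>.\<close>
 have ce: "Cmp A c e' \<in> A.Hom w w" using A.catD(4)[OF A.hoD(4)[OF e'(1)] c(1)] .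
 have "Cmp B b (FA F (Cmp A c e')) = Cmp B (Cmp B b (FA F c)) e"
  using morD(6)[OF F A.hoD(4)[OF e'(1)] c(1)] B.ho_assoc[OF e(1) Fc w(3)] e'(2) by simp
 also have "\<dots> = b" using c(2) e(2) by simp
 finally have "Cmp B b (FA F (Cmp A c e')) = b" .
 moreover have "Cmp B b (FA F (Idt A w)) = b"
  using morD(5)[OF F w(1)] B.ho_idr[OF w(3)] by simp
 ultimately have "Cmp A c e' = Idt A w" using univ[OF w(1,3)] ce A.catD(3)[OF w(1)] by blast
 then have kh': "acmp k h' = aid Z"
  using A.hoD(5)[OF A.ho_comp[OF e'(1) ch]] A.PA_Idt[OF w(1)] w(2) by simp
 have "acmp i (acmp h' k) = acmp i (aid (open_sub T T0))"
  using anaD(7)[OF k h'(1) i] h'(2) hk anaD(5)[OF i] by simp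
 then have h'k: "acmp h' k = aid (open_sub T T0)"
  using inclusion_mono[OF T T0(1) openin_topspace sT0 acmp_hom[OF k h'(1)]
   aid_hom[OF analytic_space_open_sub[OF T T0(1)]]] unfolding i_def by blast
 have im: "mfun h ` pts Z = T0"
 proof
  show "mfun h ` pts Z \<subseteq> T0" by (rule hT0)
  show "T0 \<subseteq> mfun h ` pts Z"
  proof
   fix v assume v: "v \<in> T0"
   have "mfun h (mfun k v) = v"
    using mfun_Cmp[OF k, of v h] hk v sT0 unfolding pT0 i_def by simp
   moreover have "mfun k v \<in> pts Z" using ana_homD(6)[OF k] v unfolding pT0 by simp
   ultimately show "v \<in> mfun h ` pts Z" by (metis imageI)
  qed
 qed
 have "is_isom ana h'"
  unfolding is_isom_def using k kh' h'k ana_homD(1,2,8)[OF h'(1)] by auto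
 then show ?thesis
  using ana_etale_openI[OF h] T0(1) unfolding im h'_def by blast
qed

text \<open>The open subspace \<open>T0\<close> represents the fibre product. For every map into it
  an object of \<open>A\<close> is chosen together with an isomorphism onto the pullback; on arrows
  the functor is then forced by full faithfulness and the cartesian property.\<close>

lemma base_change_exists:
 assumes T: "analytic_space T" and t: "morphism_over (yon T) B t"
 shows "\<exists>Z h. base_change A B F T t Z h"
proof -
 let ?y = "FO t (aid T)"
 let ?P = "fibprod A (yon T) B F t"
 note iT = aid_hom[OF T]
 have oT: "aid T \<in> Obj (yon T)" by (rule yon_ObjI[OF iT])
 have y: "?y \<in> Obj B" "PO B ?y = T" using morD(1,2)[OF t oT] ana_homD(1)[OF iT] by auto
 define l where "l m = FA t (aid T, m)" for m
 have lh: "(aid T, m) \<in> hom_set (yon T) m (aid T)" if m: "m \<in> ahom V T" for m V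
  unfolding yon_hom using m ana_homD(1)[OF m] ana_homD(1)[OF iT] iT anaD(6)[OF m] by simp
 have l: "l m \<in> B.Ov m (FO t m) ?y" "PO B (FO t m) = V" if m: "m \<in> ahom V T" for m V
  unfolding l_def using morD(4)[OF t hom_overI[OF lh[OF m]]]
   morD(2)[OF t yon_ObjI[OF m]] ana_homD(1)[OF m] by simp_all
 obtain T0 where T0: "aopen T T0"
  "\<And>m z a. a \<in> B.Ov m z ?y \<Longrightarrow>
    ((\<exists>q\<in>Obj A. isomorphic_over B (FO F q) z) \<longleftrightarrow> mfun m ` pts (PO B z) \<subseteq> T0)"
  using open_image[OF y(1)] unfolding y(2) by blast
 define Z where "Z = open_sub T T0"
 have Z: "analytic_space Z" unfolding Z_def by (rule analytic_space_open_sub[OF T T0(1)])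
 have pZ: "pts Z = T0" unfolding Z_def by (rule pts_open_sub[OF T0(1)])
 have sT0: "T0 \<subseteq> pts T" using openin_subset[OF T0(1)] .
 define i where "i = incl T T0"
 have i: "i \<in> ahom Z T" unfolding i_def Z_def by (rule incl_hom[OF T T0(1)])
 have i_mono: "k = k'" if "k \<in> ahom V Z" "k' \<in> ahom V Z" "acmp i k = acmp i k'" for k k' V
  using inclusion_mono[OF T T0(1) openin_topspace sT0] that unfolding i_def Z_def by blast
 have im_i: "mfun (acmp i m) ` pts V \<subseteq> T0" if m: "m \<in> ahom V Z" for m V
 proof
  fix v assume "v \<in> mfun (acmp i m) ` pts V"
  then obtain p where p: "p \<in> pts V" "v = mfun (acmp i m) p" by blast
  have "mfun m p \<in> T0" using ana_homD(6)[OF m p(1)] pZ by simp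
  then show "v \<in> T0" using p mfun_Cmp[OF m p(1), of i] sT0 unfolding i_def by simp
 qed
 have "\<exists>q al. q \<in> Obj A \<and> al \<in> B.Ov (aid V) (FO F q) (FO t (acmp i m)) \<and> is_isom B al \<and> PO A q = V"
  if m: "m \<in> ahom V Z" for m V
 proof -
  note imT = acmp_hom[OF m i]
  obtain q where q: "q \<in> Obj A" "isomorphic_over B (FO F q) (FO t (acmp i m))"
   using T0(2)[OF l(1)[OF imT]] im_i[OF m] l(2)[OF imT] by auto
  then show ?thesis using l(2)[OF imT] morD(2)[OF F q(1)] unfolding isomorphic_over_def by metis
 qed
 then have "\<forall>m. \<exists>q al. m \<in> ahom (mdom m) Z \<longrightarrow> q \<in> Obj A \<and>
  al \<in> B.Ov (aid (mdom m)) (FO F q) (FO t (acmp i m)) \<and> is_isom B al \<and> PO A q = mdom m" by blast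
 then obtain q al where qal: "\<And>m. m \<in> ahom (mdom m) Z \<Longrightarrow> q m \<in> Obj A \<and>
  al m \<in> B.Ov (aid (mdom m)) (FO F (q m)) (FO t (acmp i m)) \<and> is_isom B (al m) \<and> PO A (q m) = mdom m"
  by metis
 have q: "q m \<in> Obj A" "PO A (q m) = V" and al: "al m \<in> B.Ov (aid V) (FO F (q m)) (FO t (acmp i m))"
  "is_isom B (al m)" if m: "m \<in> ahom V Z" for m V using qal[of m] m ana_homD(1)[OF m] by auto
 define E0 where "E0 m = (q m, acmp i m, al m)" for m
 have E0: "E0 m \<in> Obj ?P" "PO ?P (E0 m) = V" if m: "m \<in> ahom V Z" for m V
  unfolding E0_def fibprod_Obj fibprod_sel
  using q[OF m] al[OF m] yon_ObjI[OF acmp_hom[OF m i]] ana_homD(1)[OF acmp_hom[OF m i]] by auto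
 have yi: "(acmp i m, h) \<in> hom_set (yon T) (acmp i (acmp m h)) (acmp i m)"
  and ti: "FA t (acmp i m, h) \<in> B.Ov h (FO t (acmp i (acmp m h))) (FO t (acmp i m))"
  if m: "m \<in> ahom V Z" and h: "h \<in> ahom V' V" for m h V V'
 proof -
  note imT = acmp_hom[OF m i]
  show "(acmp i m, h) \<in> hom_set (yon T) (acmp i (acmp m h)) (acmp i m)"
   unfolding yon_hom using imT ana_homD(1)[OF imT] ana_homD(1)[OF acmp_hom[OF acmp_hom[OF h m] i]] h
    anaD(7)[OF h m i] by simp
  from morD(4)[OF t hom_overI[OF this]]
  show "FA t (acmp i m, h) \<in> B.Ov h (FO t (acmp i (acmp m h))) (FO t (acmp i m))" by simp
 qed
 have ex: "\<exists>!a. a \<in> A.Ov h (q (acmp m h)) (q m) \<and>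
   Cmp B (al m) (FA F a) = Cmp B (FA t (acmp i m, h)) (al (acmp m h))"
  if m: "m \<in> ahom V Z" and h: "h \<in> ahom V' V" for m h V V'
 proof -
  note mh = acmp_hom[OF h m]
  note tm = B.ho_comp[OF al(1)[OF mh] ti[OF m h], unfolded anaD(5)[OF h]]
  have p: "PO B (FO F (q (acmp m h))) = V'" "PO B (FO F (q m)) = V"
   using morD(2)[OF F q(1)] q m mh by simp_all
  obtain c where c: "c \<in> B.Ov h (FO F (q (acmp m h))) (FO F (q m))"
   "Cmp B (al m) c = Cmp B (FA t (acmp i m, h)) (al (acmp m h))"
   using B.cart_ex[OF al(1)[OF m] tm, of h] p h anaD(6)[OF h] by metis
  obtain a where a: "a \<in> A.Ov h (q (acmp m h)) (q m)" "FA F a = c"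
   using F_surj[OF q(1)[OF mh] q(1)[OF m] c(1)] .
  show ?thesis
  proof (rule ex1I[of _ a])
   show "a \<in> A.Ov h (q (acmp m h)) (q m) \<and>
    Cmp B (al m) (FA F a) = Cmp B (FA t (acmp i m, h)) (al (acmp m h))" using a c by simp
   fix a' assume a': "a' \<in> A.Ov h (q (acmp m h)) (q m) \<and>
    Cmp B (al m) (FA F a') = Cmp B (FA t (acmp i m, h)) (al (acmp m h))"
   note Fa' = morD(4)[OF F conjunct1[OF a']]
   have "FA F a' = c" by (rule B.cart_eq[OF al(1)[OF m] Fa' c(1)]) (use a' c(2) in simp)
   then show "a' = a" using F_inj[OF A.hoD(4)[OF conjunct1[OF a']] A.hoD(4)[OF a(1)]] a(2) by simp
  qed
 qed
 define E1 where "E1 m h = (THE a. a \<in> A.Ov h (q (acmp m h)) (q m) \<and>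
   Cmp B (al m) (FA F a) = Cmp B (FA t (acmp i m, h)) (al (acmp m h)))" for m h
 have E1: "E1 m h \<in> A.Ov h (q (acmp m h)) (q m)"
   "Cmp B (al m) (FA F (E1 m h)) = Cmp B (FA t (acmp i m, h)) (al (acmp m h))"
  if m: "m \<in> ahom V Z" and h: "h \<in> ahom V' V" for m h V V'
  using theI'[OF ex[OF m h]] unfolding E1_def by auto
 have E1_eq: "a = E1 m h" if m: "m \<in> ahom V Z" and h: "h \<in> ahom V' V"
  and a: "a \<in> A.Ov h (q (acmp m h)) (q m)"
   "Cmp B (al m) (FA F a) = Cmp B (FA t (acmp i m, h)) (al (acmp m h))" for m h V V' a
  using ex[OF m h] E1[OF m h] a by blast
 define E where "E = \<lparr>FO = E0, FA = \<lambda>(m, h). (E0 (acmp m h), E0 m, E1 m h, (acmp i m, h))\<rparr>"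
 have EA: "FA E (m, h) \<in> hom_set ?P (E0 (acmp m h)) (E0 m)"
  if m: "m \<in> ahom V Z" and h: "h \<in> ahom V' V" for m h V V'
 proof -
  note e = E1[OF m h]
  have "(E0 (acmp m h), E0 m, E1 m h, (acmp i m, h)) \<in> hom_set ?P (q (acmp m h), acmp i (acmp m h), al (acmp m h)) (q m, acmp i m, al m)"
   unfolding fibprod_hom using E0(1)[OF m] E0(1)[OF acmp_hom[OF h m]] A.hoD(4,5)[OF e(1)] e(2) yi[OF m h]
   by (auto simp: E0_def)
  then show ?thesis by (simp add: E_def E0_def)
 qed
 have mE: "morphism_over (yon Z) ?P E"
  unfolding morphism_over_def is_functor_def
 proof (intro conjI ballI impI)
  fix m assume "m \<in> Obj (yon Z)"
  then have m: "m \<in> ahom (mdom m) Z" by (simp add: yon_Obj)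
  show "FO E m \<in> Obj ?P" "PO ?P (FO E m) = PO (yon Z) m" using E0[OF m] by (simp_all add: E_def)
  note iV = aid_hom[OF ana_homD(3)[OF m]]
  have mi: "acmp m (aid (mdom m)) = m" by (rule anaD(5)[OF m])
  have tid: "FA t (acmp i m, aid (mdom m)) = Idt B (FO t (acmp i m))"
   using morD(5)[OF t yon_ObjI[OF acmp_hom[OF m i]]] ana_homD(1)[OF acmp_hom[OF m i]] by simp
  have "Idt A (q m) = E1 m (aid (mdom m))"
  proof (rule E1_eq[OF m iV])
   show "Idt A (q m) \<in> A.Ov (aid (mdom m)) (q (acmp m (aid (mdom m)))) (q m)"
    unfolding mi using A.ho_id[OF q(1)[OF m]] q(2)[OF m] by simp
   show "Cmp B (al m) (FA F (Idt A (q m))) =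
    Cmp B (FA t (acmp i m, aid (mdom m))) (al (acmp m (aid (mdom m))))"
    unfolding mi tid using morD(5)[OF F q(1)[OF m]] B.ho_idr[OF al(1)[OF m]] B.ho_idl[OF al(1)[OF m]] by simp
  qed
  then show "FA E (Idt (yon Z) m) = Idt ?P (FO E m)"
   using mi ana_homD(1)[OF acmp_hom[OF m i]] by (simp add: E_def E0_def)
 next
  fix s assume s: "s \<in> Arr (yon Z)"
  obtain m h where e: "s = (m, h)" by (cases s)
  have m: "m \<in> ahom (mdom m) Z" and h: "h \<in> ahom (mdom (acmp m h)) (mdom m)"
   using s unfolding e yon_Arr_hom yon_sel yon_hom by auto
  show "FA E s \<in> hom_set ?P (FO E (Dom (yon Z) s)) (FO E (Cod (yon Z) s))"
   using EA[OF m h] e by (simp add: E_def)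
  show "PA ?P (FA E s) = PA (yon Z) s" using A.hoD(5)[OF E1(1)[OF m h]] e by (simp add: E_def)
  fix s' assume s': "s' \<in> Arr (yon Z)" and st: "Cod (yon Z) s = Dom (yon Z) s'"
  obtain m' h' where e': "s' = (m', h')" by (cases s')
  have m': "m' \<in> ahom (mdom m') Z" and h': "h' \<in> ahom (mdom (acmp m' h')) (mdom m')"
   using s' unfolding e' yon_Arr_hom yon_sel yon_hom by auto
  have mm: "m = acmp m' h'" using st e e' by simp
  have hh': "h' \<in> ahom (mdom m) (mdom m')" using h' mm by simp
  note h'h = acmp_hom[OF h hh']
  have mh: "acmp m' (acmp h' h) = acmp m h" using anaD(7)[OF h hh' m'] mm by simp
  note e1 = E1[OF m h] and e2 = E1[OF m' hh']
  have tc: "FA t (acmp i m', acmp h' h) = Cmp B (FA t (acmp i m', h')) (FA t (acmp i m, h))"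
   using morD(6)[OF t yi[OF m h] yi[OF m' hh', folded mm]] by simp
  have e2': "E1 m' h' \<in> A.Ov h' (q m) (q m')" using e2(1) mm by simp
  have t2: "FA t (acmp i m', h') \<in> B.Ov h' (FO t (acmp i m)) (FO t (acmp i m'))"
   using ti[OF m' hh'] mm by simp
  note F1 = morD(4)[OF F e1(1)] and F2 = morD(4)[OF F e2']
  have "Cmp A (E1 m' h') (E1 m h) = E1 m' (acmp h' h)"
  proof (rule E1_eq[OF m' h'h])
   show "Cmp A (E1 m' h') (E1 m h) \<in> A.Ov (acmp h' h) (q (acmp m' (acmp h' h))) (q m')"
    unfolding mh using A.ho_comp[OF e1(1) e2'] .
   have "Cmp B (al m') (FA F (Cmp A (E1 m' h') (E1 m h))) = Cmp B (Cmp B (al m') (FA F (E1 m' h'))) (FA F (E1 m h))"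
    using morD(6)[OF F A.hoD(4)[OF e1(1)] A.hoD(4)[OF e2']] B.ho_assoc[OF F1 F2 al(1)[OF m']] by simp
   also have "\<dots> = Cmp B (FA t (acmp i m', h')) (Cmp B (al m) (FA F (E1 m h)))"
    unfolding e2(2) mm[symmetric] by (rule B.ho_assoc[OF F1 al(1)[OF m] t2, symmetric])
   also have "\<dots> = Cmp B (FA t (acmp i m', acmp h' h)) (al (acmp m h))"
    unfolding e1(2) tc by (rule B.ho_assoc[OF al(1)[OF acmp_hom[OF h m]] ti[OF m h] t2])
   finally show "Cmp B (al m') (FA F (Cmp A (E1 m' h') (E1 m h))) =
    Cmp B (FA t (acmp i m', acmp h' h)) (al (acmp m' (acmp h' h)))" unfolding mh .
  qed
  then show "FA E (Cmp (yon Z) s' s) = Cmp ?P (FA E s') (FA E s)"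
   using e e' mh by (simp add: E_def)
 qed
 have bij: "bij_betw (FA E) (hom_set (yon Z) m' m) (hom_set ?P (FO E m') (FO E m))"
  if o: "m' \<in> Obj (yon Z)" "m \<in> Obj (yon Z)" for m' m
 proof -
  have m: "m \<in> ahom (mdom m) Z" and m': "m' \<in> ahom (mdom m') Z" using o by (simp_all add: yon_Obj)
  have "inj_on (FA E) (hom_set (yon Z) m' m)"
   by (rule inj_onI) (auto simp: E_def yon_hom)
  moreover have "FA E ` hom_set (yon Z) m' m = hom_set ?P (FO E m') (FO E m)"
  proof
   show "FA E ` hom_set (yon Z) m' m \<subseteq> hom_set ?P (FO E m') (FO E m)"
    using EA[OF m] by (auto simp: yon_hom E_def)
   show "hom_set ?P (FO E m') (FO E m) \<subseteq> FA E ` hom_set (yon Z) m' m"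
   proof
    fix s assume s: "s \<in> hom_set ?P (FO E m') (FO E m)"
    obtain u u' a nb where e: "s = (u, u', a, nb)" using prod_cases4 by blast
    obtain n h where nb: "nb = (n, h)" by (cases nb)
    note S = s[unfolded e nb E_def fct.simps E0_def fibprod_hom yon_hom]
    have n: "n = acmp i m" and h: "h \<in> ahom (mdom m') (mdom m)" and eq: "acmp (acmp i m) h = acmp i m'"
     using S ana_homD(1)[OF acmp_hom[OF m i]] ana_homD(1)[OF acmp_hom[OF m' i]] by auto
    have mh: "acmp m h = m'"
     using i_mono[OF acmp_hom[OF h m] m'] anaD(7)[OF h m i] eq by simp
    have "a = E1 m h"
     by (rule E1_eq[OF m h]) (use S mh n in \<open>auto simp: hom_over_def\<close>)
    then have "s = FA E (m, h)" using S e nb mh by (simp add: E_def E0_def)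
    moreover have "(m, h) \<in> hom_set (yon Z) m' m" unfolding yon_hom using m h mh by simp
    ultimately show "s \<in> FA E ` hom_set (yon Z) m' m" by blast
   qed
  qed
  ultimately show ?thesis by (simp add: bij_betw_def)
 qed
 have es: "\<exists>m\<in>Obj (yon Z). isomorphic_over ?P (FO E m) v" if v: "v \<in> Obj ?P" for v
 proof -
  obtain q' n be where e: "v = (q', n, be)" by (metis prod_cases3)
  define V where "V = mdom n"
  have n: "n \<in> ahom V T" and q': "q' \<in> Obj A" "PO A q' = V"
   and be: "be \<in> B.Ov (aid V) (FO F q') (FO t n)" "is_isom B be"
   using v[unfolded e fibprod_Obj] by (auto simp: V_def yon_Obj)
  \<comment> \<open>An object of the fibre product certifies that its pullback lies in the essential
    image, so its base map lands in \<open>T0\<close> and factors through \<open>Z\<close>.\<close>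
  have iso: "isomorphic_over B (FO F q') (FO t n)"
   unfolding isomorphic_over_def using be morD(2)[OF F q'(1)] q'(2) l(2)[OF n] by auto
  then have nT0: "mfun n ` pts V \<subseteq> T0" using T0(2)[OF l(1)[OF n]] q'(1) l(2)[OF n] by auto
  define m where "m = mrestr n (pts V) T0"
  have m: "m \<in> ahom V Z" "acmp i m = n"
   unfolding m_def Z_def i_def by (rule factor_open[OF n T0(1) nT0])+
  have alm: "al m \<in> B.Ov (aid V) (FO F (q m)) (FO t n)" using al(1)[OF m(1)] m(2) by simp
  note iV = aid_hom[OF ana_homD(3)[OF n]]
  have pq: "PO B (FO F (q m)) = V" "PO B (FO F q') = V"
   using morD(2)[OF F q(1)[OF m(1)]] q(2)[OF m(1)] morD(2)[OF F q'(1)] q'(2) by simp_all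
  obtain c where c: "c \<in> B.Ov (aid V) (FO F (q m)) (FO F q')" "Cmp B be c = al m"
   using B.cart_ex[OF be(1) alm, of "aid V"] pq iV anaD(5)[OF iV] by metis
  obtain c' where c': "c' \<in> B.Ov (aid V) (FO F q') (FO F (q m))" "Cmp B c c' = Idt B (FO F q')"
   "Cmp B c' c = Idt B (FO F (q m))" using B.over_id_inverse[OF c(1)] by blast
  obtain a where a: "a \<in> A.Ov (aid V) (q m) q'" "FA F a = c" using F_surj[OF q(1)[OF m(1)] q'(1) c(1)] .
  obtain a' where a': "a' \<in> A.Ov (aid V) q' (q m)" "FA F a' = c'" using F_surj[OF q'(1) q(1)[OF m(1)] c'(1)] .
  note ah = A.hoD(4)[OF a(1)] and ah' = A.hoD(4)[OF a'(1)]
  have aa: "Cmp A a a' = Idt A q'"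
   using F_inj[OF A.catD(4)[OF ah' ah] A.catD(3)[OF q'(1)]] morD(6)[OF F ah' ah] c'(2) a(2) a'(2)
    morD(5)[OF F q'(1)] by simp
  have a'a: "Cmp A a' a = Idt A (q m)"
   using F_inj[OF A.catD(4)[OF ah ah'] A.catD(3)[OF q(1)[OF m(1)]]] morD(6)[OF F ah ah'] c'(3) a(2) a'(2)
    morD(5)[OF F q(1)[OF m(1)]] by simp
  let ?id = "Idt (yon T) n"
  note oN = yon_ObjI[OF n]
  have idh: "?id \<in> hom_set (yon T) n n" using categoryD(3)[OF over_category.cat[OF over_category_yon] oN] .
  have idid: "Cmp (yon T) ?id ?id = ?id" using categoryD(5)[OF over_category.cat[OF over_category_yon] idh] .
  have tid: "FA t ?id = Idt B (FO t n)" using morD(5)[OF t oN] .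
  have PAid: "PA (yon T) ?id = aid V" by (simp add: V_def)
  have E0m: "E0 m = (q m, n, al m)" using m(2) by (simp add: E0_def)
  let ?s = "(E0 m, v, a, ?id)" let ?s' = "(v, E0 m, a', ?id)"
  have alc': "Cmp B (al m) c' = be"
   using B.ho_assoc[OF c'(1) c(1) be(1)] c(2) c'(2) B.ho_idr[OF be(1)] by simp
  have s: "?s \<in> hom_set ?P (E0 m) v"
   unfolding E0m e fibprod_hom using E0(1)[OF m(1)] v ah A.hoD(5)[OF a(1)] idh PAid tid a(2) c(2) B.ho_idl[OF alm]
   unfolding E0m e by simp
  have s': "?s' \<in> hom_set ?P v (E0 m)"
   unfolding E0m e fibprod_hom using E0(1)[OF m(1)] v ah' A.hoD(5)[OF a'(1)] idh PAid tid a'(2) alc' B.ho_idl[OF be(1)]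
   unfolding E0m e by simp
  have "Cmp ?P ?s' ?s = Idt ?P (E0 m)" "Cmp ?P ?s ?s' = Idt ?P v"
   using idid a'a aa unfolding E0m e fibprod_sel by simp_all
  then have "is_isom ?P ?s" unfolding is_isom_def using hom_setD(1)[OF s] by (auto intro: bexI[OF _ s'])
  moreover have "?s \<in> hom_over ?P (aid (PO ?P (FO E m))) (FO E m) v"
   using s A.hoD(5)[OF a(1)] E0(2)[OF m(1)] by (simp add: hom_over_def E_def)
  moreover have "PO ?P (FO E m) = PO ?P v" using E0(2)[OF m(1)] q'(2) e by (simp add: E_def)
  ultimately have "isomorphic_over ?P (FO E m) v" unfolding isomorphic_over_def by blast
  then show ?thesis using yon_ObjI[OF m(1)] by blast
 qed
 have "equivalence_over (yon Z) ?P E" unfolding equivalence_over_def using mE bij es by blast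
 then show ?thesis unfolding base_change_def using Z by auto
qed

lemma representable_with_etale: "representable_with ana_etale A B F"
 unfolding representable_with_def representable_def
 using F base_change_exists base_change_etale by auto

end

section \<open>Holomorphic functions of several variables\<close>

no_notation Infinite_Set_Sum.abs_summable_on (infix \<open>abs'_summable'_on\<close> 50)

section \<open>Power series over multi-indices\<close>

definition midx :: "nat \<Rightarrow> (nat \<Rightarrow> nat) set" where
 "midx n = {al. \<forall>i\<ge>n. al i = 0}"

definition mpow :: "nat \<Rightarrow> (nat \<Rightarrow> 'a) \<Rightarrow> (nat \<Rightarrow> nat) \<Rightarrow> 'a::comm_semiring_1" where
 "mpow n u al = (\<Prod>i<n. u i ^ al i)"

definition pseries ::
 "nat \<Rightarrow> ((nat \<Rightarrow> nat) \<Rightarrow> complex) \<Rightarrow> (nat \<Rightarrow> complex) \<Rightarrow> (nat \<Rightarrow> complex) set \<Rightarrow> ((nat \<Rightarrow> complex) \<Rightarrow> complex) \<Rightarrow> bool" where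
 "pseries n c z N h \<longleftrightarrow>
  (\<forall>w\<in>N. ((\<lambda>al. c al * mpow n (\<lambda>i. w i - z i) al) has_sum h w) (midx n))"

lemma holo_alt: "holo n D h \<longleftrightarrow>
  (\<forall>z\<in>D. \<exists>c N. open_Cn n N \<and> z \<in> N \<and> pseries n c z N h)"
 by (simp add: holo_def pseries_def mpow_def midx_def)

lemma mpow_0 [simp]: "mpow n u (\<lambda>i. 0) = 1"
 by (simp add: mpow_def)

lemma mpow_add: "mpow n u (\<lambda>i. al i + be i) = mpow n u al * mpow n u be"
 by (simp add: mpow_def power_add prod.distrib)

lemma norm_mpow: "norm (mpow n u al) = mpow n (\<lambda>i. norm (u i :: 'a::{real_normed_field})) al"
 by (simp add: mpow_def prod_norm[symmetric] norm_power)

lemma mpow_mono: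
 assumes "\<And>i. i < n \<Longrightarrow> 0 \<le> u i" "\<And>i. i < n \<Longrightarrow> u i \<le> (v i :: real)"
 shows "mpow n u al \<le> mpow n v al"
 unfolding mpow_def using assms by (intro prod_mono) (auto intro: power_mono)

lemma mpow_nonneg: "(\<And>i. i < n \<Longrightarrow> 0 \<le> u i) \<Longrightarrow> 0 \<le> mpow n u al" for u :: "nat \<Rightarrow> real"
 unfolding mpow_def by (intro prod_nonneg) auto

lemma mpow_pos: "(\<And>i. i < n \<Longrightarrow> 0 < u i) \<Longrightarrow> 0 < mpow n u al" for u :: "nat \<Rightarrow> real"
 unfolding mpow_def by (intro prod_pos) auto

lemma mpow_zero:
 assumes "\<And>i. i < n \<Longrightarrow> u i = 0" "al \<in> midx n"
 shows "mpow n u al = (if al = (\<lambda>i. 0) then 1 else 0)"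
proof (cases "al = (\<lambda>i. 0)")
 case False
 then obtain i where i: "al i \<noteq> 0" by auto
 then have "i < n" using assms(2) by (auto simp: midx_def not_less[symmetric])
 then have "u i ^ al i = 0" using i assms(1) by (simp add: power_0_left)
 then have "mpow n u al = 0" unfolding mpow_def using \<open>i < n\<close> by (intro prod_zero) auto
 then show ?thesis using False by simp
qed simp

definition below :: "(nat \<Rightarrow> nat) \<Rightarrow> (nat \<Rightarrow> nat) set" where
 "below ga = {al. \<forall>i. al i \<le> ga i}"

lemma finite_below:
 assumes "ga \<in> midx n"
 shows "finite (below ga)"
proof (rule finite_imageD)
 have "(\<lambda>al. restrict al {..<n}) ` below ga \<subseteq> (\<Pi>\<^sub>E i\<in>{..<n}. {..ga i})"
  by (auto simp: below_def PiE_iff extensional_def split: if_splits)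
 then show "finite ((\<lambda>al. restrict al {..<n}) ` below ga)"
  by (rule finite_subset) (intro finite_PiE; simp)
 show "inj_on (\<lambda>al. restrict al {..<n}) (below ga)"
 proof (rule inj_onI, rule ext)
  fix al be i assume *: "al \<in> below ga" "be \<in> below ga" "restrict al {..<n} = restrict be {..<n}"
  show "al i = be i"
  proof (cases "i < n")
   case True then show ?thesis using fun_cong[OF *(3), of i] by simp
  next
   case False
   then have "ga i = 0" using assms by (simp add: midx_def)
   then show ?thesis using *(1,2) by (simp add: below_def) (metis le_zero_eq)
  qed
 qed
qed

definition conv :: "((nat \<Rightarrow> nat) \<Rightarrow> 'a) \<Rightarrow> ((nat \<Rightarrow> nat) \<Rightarrow> 'a) \<Rightarrow> (nat \<Rightarrow> nat) \<Rightarrow> 'a::comm_semiring_1" where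
 "conv c d ga = (\<Sum>al\<in>below ga. c al * d (\<lambda>i. ga i - al i))"

lemma below_midx: "ga \<in> midx n \<Longrightarrow> al \<in> below ga \<Longrightarrow> al \<in> midx n"
 "ga \<in> midx n \<Longrightarrow> (\<lambda>i. ga i - al i) \<in> midx n"
 by (auto simp: below_def midx_def) (metis le_zero_eq)

text \<open>Cauchy product: absolute summability over pairs of multi-indices permits regrouping by
  their sum.\<close>

lemma conv_has_sum:
 fixes c d :: "(nat \<Rightarrow> nat) \<Rightarrow> 'a::{real_normed_field,banach}"
 assumes c: "((\<lambda>al. c al * mpow n u al) has_sum s) (midx n)"
  and d: "((\<lambda>al. d al * mpow n u al) has_sum t) (midx n)"
  and ac: "(\<lambda>al. c al * mpow n u al) abs_summable_on midx n"
  and ad: "(\<lambda>al. d al * mpow n u al) abs_summable_on midx n"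
 shows "((\<lambda>ga. conv c d ga * mpow n u ga) has_sum s * t) (midx n)"
proof -
 let ?I = "midx n"
 let ?c = "\<lambda>al. c al * mpow n u al" let ?d = "\<lambda>al. d al * mpow n u al"
 let ?f = "\<lambda>(al, be). ?c al * ?d be"
 have "?f abs_summable_on Sigma ?I (\<lambda>_. ?I)"
  unfolding Infinite_Sum.abs_summable_on_Sigma_iff
 proof (intro conjI ballI)
  show "(\<lambda>be. ?f (al, be)) abs_summable_on ?I" for al
   using summable_on_cmult_right[OF ad, of "norm (?c al)"] by (simp add: norm_mult)
  have "(\<lambda>al. norm (?c al) * (\<Sum>\<^sub>\<infinity>be\<in>?I. norm (?d be))) summable_on ?I"
   using summable_on_cmult_left[OF ac] by simp
  then show "(\<lambda>al. \<Sum>\<^sub>\<infinity>be\<in>?I. norm (?f (al, be))) abs_summable_on ?I"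
   by (simp add: norm_mult infsum_cmult_right' abs_mult infsum_nonneg)
 qed
 then have sm: "?f summable_on Sigma ?I (\<lambda>_. ?I)" by (rule abs_summable_summable)
 have "(?f has_sum s * t) (Sigma ?I (\<lambda>_. ?I))"
 proof (rule has_sum_SigmaI[OF _ _ sm])
  show "((\<lambda>be. ?f (al, be)) has_sum ?c al * t) ?I" for al
   using has_sum_cmult_right[OF d, of "?c al"] by simp
  show "((\<lambda>al. ?c al * t) has_sum s * t) ?I" by (rule has_sum_cmult_left[OF c])
 qed
 \<comment> \<open>The pair \<open>(al, be)\<close> is recorded as its sum together with
   \<open>al\<close>, which ranges over the finite set below that sum.\<close>
 moreover have "(?f has_sum s * t) (Sigma ?I (\<lambda>_. ?I)) \<longleftrightarrow>
  ((\<lambda>(ga, al). c al * d (\<lambda>i. ga i - al i) * mpow n u ga) has_sum s * t) (Sigma ?I below)"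
 proof (rule has_sum_reindex_bij_witness[where j = "\<lambda>(al, be). (\<lambda>i. al i + be i, al)" and i = "\<lambda>(ga, al). (al, \<lambda>i. ga i - al i)"])
  fix p assume p: "p \<in> Sigma ?I (\<lambda>_. ?I)"
  obtain al be where e: "p = (al, be)" by (cases p)
  show "(case (case p of (al, be) \<Rightarrow> (\<lambda>i. al i + be i, al)) of (ga, al) \<Rightarrow> (al, \<lambda>i. ga i - al i)) = p"
   by (simp add: e)
  show "(case p of (al, be) \<Rightarrow> (\<lambda>i. al i + be i, al)) \<in> Sigma ?I below"
   using p by (auto simp: e midx_def below_def)
  show "(case (case p of (al, be) \<Rightarrow> (\<lambda>i. al i + be i, al)) of (ga, al) \<Rightarrow> c al * d (\<lambda>i. ga i - al i) * mpow n u ga) = ?f p"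
   by (simp add: e mpow_add)
 next
  fix p assume p: "p \<in> Sigma ?I below"
  obtain ga al where e: "p = (ga, al)" by (cases p)
  show "(case (case p of (ga, al) \<Rightarrow> (al, \<lambda>i. ga i - al i)) of (al, be) \<Rightarrow> (\<lambda>i. al i + be i, al)) = p"
   using p by (auto simp: e below_def)
  show "(case p of (ga, al) \<Rightarrow> (al, \<lambda>i. ga i - al i)) \<in> Sigma ?I (\<lambda>_. ?I)"
   using p below_midx by (auto simp: e)
 qed simp
 ultimately have "((\<lambda>(ga, al). c al * d (\<lambda>i. ga i - al i) * mpow n u ga) has_sum s * t) (Sigma ?I below)" by simp
 then show ?thesis
 proof (rule has_sum_SigmaD)
  fix ga assume "ga \<in> ?I"
  then show "((\<lambda>al. (case (ga, al) of (ga, al) \<Rightarrow> c al * d (\<lambda>i. ga i - al i) * mpow n u ga)) has_sum conv c d ga * mpow n u ga) (below ga)"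
   by (intro has_sum_finiteI finite_below) (simp_all add: conv_def sum_distrib_right)
 qed
qed

text \<open>Unordered summability of a complex family is automatically absolute; hence the
  expansions in \<open>holo\<close> may be multiplied.\<close>

lemma has_sum_complex_abs: "(f has_sum (s::complex)) A \<Longrightarrow> f abs_summable_on A"
 using summable_on_iff_abs_summable_on_complex has_sum_imp_summable by blast

lemma has_sum_single:
 assumes "\<And>al. al \<in> A \<Longrightarrow> al \<noteq> a \<Longrightarrow> f al = 0" "a \<in> A" "f a = s"
 shows "(f has_sum s) A"
proof -
 have "(f has_sum s) {a}" using assms(3) by (intro has_sum_finiteI) auto
 then show ?thesis using has_sum_cong_neutral[of "{a}" A f f s] assms by auto
qed

lemma pseries_base:
 assumes "pseries n c z N h" "z \<in> N"
 shows "c (\<lambda>i. 0) = h z"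
proof -
 have "((\<lambda>al. c al * mpow n (\<lambda>i. z i - z i) al) has_sum h z) (midx n)"
  using assms by (auto simp: pseries_def)
 moreover have "((\<lambda>al. c al * mpow n (\<lambda>i. z i - z i) al) has_sum c (\<lambda>i. 0)) (midx n)"
  by (rule has_sum_single[of _ "\<lambda>i. 0"]) (auto simp: mpow_zero, simp_all add: midx_def)
 ultimately show ?thesis using has_sum_unique by blast
qed

lemma holo_const: "open_Cn n N \<Longrightarrow> holo n N (\<lambda>w. a)"
proof -
 assume N: "open_Cn n N"
 have "pseries n (\<lambda>al. if al = (\<lambda>i. 0) then a else 0) z N (\<lambda>w. a)" for z
  unfolding pseries_def
  by (intro ballI has_sum_single[of _ "\<lambda>i. 0"]) (auto simp: midx_def)
 then show ?thesis unfolding holo_alt using N by blast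
qed

lemma holo_add:
 assumes N: "open_Cn n N" and g: "holo n N g" and h: "holo n N h"
 shows "holo n N (\<lambda>w. g w + h w)"
 unfolding holo_alt
proof
 fix z assume z: "z \<in> N"
 obtain c N1 where 1: "open_Cn n N1" "z \<in> N1" "pseries n c z N1 g" using g z unfolding holo_alt by blast
 obtain d N2 where 2: "open_Cn n N2" "z \<in> N2" "pseries n d z N2 h" using h z unfolding holo_alt by blast
 have "pseries n (\<lambda>al. c al + d al) z (N1 \<inter> N2) (\<lambda>w. g w + h w)"
  using 1(3) 2(3) has_sum_add unfolding pseries_def distrib_right by blast
 then show "\<exists>c N. open_Cn n N \<and> z \<in> N \<and> pseries n c z N (\<lambda>w. g w + h w)"
  using 1(1,2) 2(1,2) by blast
qed

lemma holo_mult: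
 assumes N: "open_Cn n N" and g: "holo n N g" and h: "holo n N h"
 shows "holo n N (\<lambda>w. g w * h w)"
 unfolding holo_alt
proof
 fix z assume z: "z \<in> N"
 obtain c N1 where 1: "open_Cn n N1" "z \<in> N1" "pseries n c z N1 g" using g z unfolding holo_alt by blast
 obtain d N2 where 2: "open_Cn n N2" "z \<in> N2" "pseries n d z N2 h" using h z unfolding holo_alt by blast
 have "pseries n (conv c d) z (N1 \<inter> N2) (\<lambda>w. g w * h w)"
  using 1(3) 2(3) conv_has_sum has_sum_complex_abs unfolding pseries_def by blast
 then show "\<exists>c N. open_Cn n N \<and> z \<in> N \<and> pseries n c z N (\<lambda>w. g w * h w)"
  using 1(1,2) 2(1,2) by blast
qed

lemma holo_cong: "holo n N h \<Longrightarrow> open_Cn n N \<Longrightarrow> (\<And>w. w \<in> N \<Longrightarrow> h w = g w) \<Longrightarrow> holo n N g"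
proof -
 assume h: "holo n N h" and N: "open_Cn n N" and e: "\<And>w. w \<in> N \<Longrightarrow> h w = g w"
 have "\<exists>c N'. open_Cn n N' \<and> z \<in> N' \<and> pseries n c z N' g" if z: "z \<in> N" for z
 proof -
  obtain c N1 where 1: "open_Cn n N1" "z \<in> N1" "pseries n c z N1 h" using h z unfolding holo_alt by blast
  have "pseries n c z (N1 \<inter> N) g" using 1(3) e unfolding pseries_def by auto
  then show ?thesis using 1(1,2) z N by blast
 qed
 then show ?thesis unfolding holo_alt by blast
qed

lemma box_open: "open_Cn n {w \<in> Cn n. \<forall>i<n. norm (w i - z i) < r}"
proof -
 have "continuous_on UNIV (\<lambda>w :: nat \<Rightarrow> complex. norm (w i - z i))" for i
  by (rule continuous_on_norm[OF continuous_on_diff[OF continuous_on_product_coordinates continuous_on_const]])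
 then have "open {w :: nat \<Rightarrow> complex. norm (w i - z i) < r}" for i
  by (rule open_Collect_less[OF _ continuous_on_const])
 then have "open (\<Inter>i\<in>{..<n}. {w :: nat \<Rightarrow> complex. norm (w i - z i) < r})" by (intro open_INT) auto
 moreover have "{w \<in> Cn n. \<forall>i<n. norm (w i - z i) < r} = Cn n \<inter> (\<Inter>i\<in>{..<n}. {w. norm (w i - z i) < r})" by auto
 ultimately show ?thesis by (simp only: openin_open_Int)
qed

lemma box_contained:
 assumes N: "open_Cn n N" "z \<in> N"
 obtains r where "r > 0" "\<And>w. w \<in> Cn n \<Longrightarrow> (\<And>i. i < n \<Longrightarrow> norm (w i - z i) \<le> r) \<Longrightarrow> w \<in> N"
proof -
 obtain T where T: "open T" "N = Cn n \<inter> T" using N(1) unfolding openin_open by blast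
 have "openin (product_topology (\<lambda>i. euclidean) UNIV) T" using T(1) by (simp add: open_fun_def)
 note K = product_topology_open_contains_basis[OF this]
 have "z \<in> T" using N T by auto
 from K[OF this] have "\<exists>X. z \<in> (\<Pi>\<^sub>E i\<in>UNIV. X i) \<and> (\<forall>i. open (X i)) \<and> finite {i. X i \<noteq> UNIV} \<and> (\<Pi>\<^sub>E i\<in>UNIV. X i) \<subseteq> T"
  by simp
 then obtain X where X: "z \<in> (\<Pi>\<^sub>E i\<in>UNIV. X i)" "\<And>i. open (X i)" "(\<Pi>\<^sub>E i\<in>UNIV. X i) \<subseteq> T" by blast
 have "\<exists>r>0. cball (z i) r \<subseteq> X i" for i using X(1,2) by (meson PiE_E UNIV_I open_contains_cball)
 then obtain r where r: "\<And>i. r i > 0" "\<And>i. cball (z i) (r i) \<subseteq> X i" by metis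
 \<comment> \<open>The inserted 1 keeps the minimum meaningful when \<open>n = 0\<close>.\<close>
 define R where "R = Min (insert 1 (r ` {..<n}))"
 have R: "R > 0" unfolding R_def using r(1) by (subst Min_gr_iff) auto
 have Rr: "R \<le> r i" if "i < n" for i unfolding R_def using that by (intro Min_le) auto
 have "w \<in> N" if w: "w \<in> Cn n" "\<And>i. i < n \<Longrightarrow> norm (w i - z i) \<le> R" for w
 proof -
  have "w i \<in> X i" for i
  proof (cases "i < n")
   case True
   then have "w i \<in> cball (z i) (r i)" using w(2)[OF True] Rr[OF True] by (simp add: dist_norm norm_minus_commute)
   then show ?thesis using r(2) by blast
  next
   case False
   then have "w i = z i" using w(1) N(2) T(2) by (auto simp: Cn_def)
   then show ?thesis using X(1) by (auto simp: PiE_iff)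
  qed
  then show ?thesis using X(3) T(2) w(1) by (auto simp: PiE_iff)
 qed
 then show ?thesis using that R by blast
qed

section \<open>Reciprocals by the geometric series\<close>

fun conv_pow :: "((nat \<Rightarrow> nat) \<Rightarrow> 'a) \<Rightarrow> nat \<Rightarrow> (nat \<Rightarrow> nat) \<Rightarrow> 'a::comm_semiring_1" where
 "conv_pow a 0 = (\<lambda>al. if al = (\<lambda>i. 0) then 1 else 0)"
| "conv_pow a (Suc j) = conv a (conv_pow a j)"

text \<open>The sum of the absolute coefficients weighted by the powers of \<open>r\<close> is a
  submultiplicative norm for \<open>conv\<close>.\<close>

lemma conv_pow_norm:
 fixes a :: "(nat \<Rightarrow> nat) \<Rightarrow> complex"
 assumes r: "r > 0" and A: "((\<lambda>al. norm (a al) * mpow n (\<lambda>i. r) al) has_sum A) (midx n)"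
 shows "\<exists>B. ((\<lambda>al. norm (conv_pow a j al) * mpow n (\<lambda>i. r) al) has_sum B) (midx n) \<and> B \<le> A ^ j"
proof (induction j)
 case 0
 have "((\<lambda>al. norm (conv_pow a 0 al) * mpow n (\<lambda>i. r) al) has_sum 1) (midx n)"
  by (rule has_sum_single[of _ "\<lambda>i. 0"]) (auto simp: midx_def)
 then show ?case by auto
next
 case (Suc j)
 then obtain B where B: "((\<lambda>al. norm (conv_pow a j al) * mpow n (\<lambda>i. r) al) has_sum B) (midx n)" "B \<le> A ^ j" by blast
 have nn: "0 \<le> mpow n (\<lambda>i. r) al" for al using r by (intro mpow_nonneg) auto
 have abs: "(\<lambda>al. norm (b al) * mpow n (\<lambda>i. r) al) abs_summable_on midx n"
  if "((\<lambda>al. norm (b al) * mpow n (\<lambda>i. r) al) has_sum S) (midx n)" for b :: "(nat \<Rightarrow> nat) \<Rightarrow> complex" and S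
  using has_sum_imp_summable[OF that] nn by (simp add: abs_mult)
 have c: "((\<lambda>ga. conv (\<lambda>al. norm (a al)) (\<lambda>al. norm (conv_pow a j al)) ga * mpow n (\<lambda>i. r) ga) has_sum A * B) (midx n)"
  by (rule conv_has_sum[OF A B(1) abs[OF A] abs[OF B(1)]])
 have le: "norm (conv_pow a (Suc j) ga) * mpow n (\<lambda>i. r) ga \<le>
   conv (\<lambda>al. norm (a al)) (\<lambda>al. norm (conv_pow a j al)) ga * mpow n (\<lambda>i. r) ga" for ga
  using nn by (intro mult_right_mono) (auto simp: conv_def norm_mult intro!: sum_norm_le)
 have "(\<lambda>ga. norm (conv_pow a (Suc j) ga) * mpow n (\<lambda>i. r) ga) summable_on midx n"
  using summable_on_comparison_test[OF has_sum_imp_summable[OF c] le] nn by simp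
 then obtain B' where B': "((\<lambda>ga. norm (conv_pow a (Suc j) ga) * mpow n (\<lambda>i. r) ga) has_sum B') (midx n)"
  by (auto simp: summable_on_def)
 have A0: "0 \<le> A" using has_sum_nonneg[OF A] nn by simp
 have "B' \<le> A * B" using has_sum_mono[OF B' c] le by blast
 also have "\<dots> \<le> A * A ^ j" using A0 B(2) by (rule mult_left_mono[rotated])
 finally show ?case using B' by auto
qed

text \<open>The powers of \<open>U\<close> have the convolution powers of \<open>a\<close> as
  coefficients. Their weighted norms are dominated by the geometric series of \<open>A\<close>, so
  the double family may be summed over the exponent first.\<close>

lemma neumann_series:
 fixes a :: "(nat \<Rightarrow> nat) \<Rightarrow> complex"
 assumes r: "r > 0" and A: "((\<lambda>al. norm (a al) * mpow n (\<lambda>i. r) al) has_sum A) (midx n)" "A < 1"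
  and u: "\<And>i. i < n \<Longrightarrow> norm (u i) \<le> r"
  and U: "((\<lambda>al. a al * mpow n u al) has_sum U) (midx n)"
 shows "norm U < 1"
  "((\<lambda>al. (\<Sum>\<^sub>\<infinity>j. conv_pow a j al) * mpow n u al) has_sum 1 / (1 - U)) (midx n)"
proof -
 let ?I = "midx n"
 have nn: "0 \<le> mpow n (\<lambda>i. r) al" for al using r by (intro mpow_nonneg) auto
 have pos: "0 < mpow n (\<lambda>i. r) al" for al using r by (intro mpow_pos) auto
 have ur: "norm (b * mpow n u al) \<le> norm b * mpow n (\<lambda>i. r) al" for b al
  unfolding norm_mult norm_mpow using u by (intro mult_left_mono mpow_mono) auto
 have A0: "0 \<le> A" using has_sum_nonneg[OF A(1)] nn by simp
 have aU: "(\<lambda>al. a al * mpow n u al) abs_summable_on ?I" by (rule has_sum_complex_abs[OF U])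
 have "norm U \<le> (\<Sum>\<^sub>\<infinity>al\<in>?I. norm (a al * mpow n u al))"
  by (rule norm_has_sum_bound[OF has_sum_infsum[OF aU] U])
 also have "\<dots> \<le> A" by (rule has_sum_mono[OF has_sum_infsum[OF aU] A(1) ur])
 finally have "norm U \<le> A" .
 then show U1: "norm U < 1" using A(2) by simp
 obtain B where B: "\<And>j. ((\<lambda>al. norm (conv_pow a j al) * mpow n (\<lambda>i. r) al) has_sum B j) ?I" "\<And>j. B j \<le> A ^ j"
  using conv_pow_norm[OF r A(1)] by metis
 have abs: "(\<lambda>al. conv_pow a j al * mpow n u al) abs_summable_on ?I" for j
  by (rule Infinite_Sum.abs_summable_on_comparison_test'[OF has_sum_imp_summable[OF B(1)] ur])
 have bnd: "(\<Sum>\<^sub>\<infinity>al\<in>?I. norm (conv_pow a j al * mpow n u al)) \<le> A ^ j" for j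
 proof -
  have "(\<Sum>\<^sub>\<infinity>al\<in>?I. norm (conv_pow a j al * mpow n u al)) \<le> B j"
   by (rule has_sum_mono[OF has_sum_infsum[OF abs] B(1) ur])
  then show ?thesis using B(2) order_trans by blast
 qed
 have pow: "((\<lambda>al. conv_pow a j al * mpow n u al) has_sum U ^ j) ?I" for j
 proof (induction j)
  case 0
  show ?case by (rule has_sum_single[of _ "\<lambda>i. 0"]) (auto simp: midx_def)
 next
  case (Suc j)
  show ?case using conv_has_sum[OF U Suc has_sum_complex_abs[OF U] abs] by simp
 qed
 let ?f = "\<lambda>(j, al). conv_pow a j al * mpow n u al"
 have geo: "(\<lambda>j. A ^ j) summable_on UNIV"
  using A0 A(2) by (subst summable_on_UNIV_nonneg_real_iff) auto
 have "?f abs_summable_on Sigma UNIV (\<lambda>_. ?I)"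
  unfolding Infinite_Sum.abs_summable_on_Sigma_iff
 proof (intro conjI ballI)
  show "(\<lambda>al. ?f (j, al)) abs_summable_on ?I" for j using abs by simp
  show "(\<lambda>j. \<Sum>\<^sub>\<infinity>al\<in>?I. norm (?f (j, al))) abs_summable_on UNIV"
   by (rule Infinite_Sum.abs_summable_on_comparison_test'[OF geo]) (use bnd in \<open>simp add: infsum_nonneg\<close>)
 qed
 then have sm: "?f summable_on UNIV \<times> ?I" by (rule abs_summable_summable)
 have "((\<lambda>j. U ^ j) has_sum 1 / (1 - U)) UNIV"
  using U1 geometric_sums[OF U1] by (intro norm_summable_imp_has_sum) (auto simp: norm_power)
 then have "(?f has_sum 1 / (1 - U)) (UNIV \<times> ?I)"
 proof (rule has_sum_SigmaI[OF _ _ sm, rotated])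
  show "((\<lambda>al. ?f (j, al)) has_sum U ^ j) ?I" for j using pow by simp
 qed
 then have sw: "((\<lambda>(al, j). conv_pow a j al * mpow n u al) has_sum 1 / (1 - U)) (?I \<times> UNIV)"
  by (subst (asm) has_sum_swap) simp
 show "((\<lambda>al. (\<Sum>\<^sub>\<infinity>j. conv_pow a j al) * mpow n u al) has_sum 1 / (1 - U)) ?I"
 proof (rule has_sum_SigmaD[OF sw])
  fix al assume al: "al \<in> ?I"
  have "norm (conv_pow a j al) \<le> A ^ j / mpow n (\<lambda>i. r) al" for j
  proof -
   have "norm (conv_pow a j al) * mpow n (\<lambda>i. r) al \<le> B j"
    using has_sum_mono_neutral[OF has_sum_finiteI[of "{al}" _ "\<lambda>al. norm (conv_pow a j al) * mpow n (\<lambda>i. r) al"] B(1)[of j]] al nn by auto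
   then show ?thesis using B(2)[of j] pos[of al] by (simp add: field_simps)
  qed
  moreover have "(\<lambda>j. A ^ j / mpow n (\<lambda>i. r) al) summable_on UNIV"
   using summable_on_cmult_left[OF geo, of "1 / mpow n (\<lambda>i. r) al"] by simp
  ultimately have "(\<lambda>j. norm (conv_pow a j al)) summable_on UNIV"
   by (intro Infinite_Sum.abs_summable_on_comparison_test')
  from has_sum_infsum[OF abs_summable_summable[OF this]]
  have "((\<lambda>j. conv_pow a j al) has_sum (\<Sum>\<^sub>\<infinity>j. conv_pow a j al)) UNIV" .
  from has_sum_cmult_left[OF this, of "mpow n u al"]
  show "((\<lambda>j. case (al, j) of (al, j) \<Rightarrow> conv_pow a j al * mpow n u al) has_sum
   (\<Sum>\<^sub>\<infinity>j. conv_pow a j al) * mpow n u al) UNIV" by simp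
 qed
qed

lemma mpow_scale: "mpow n (\<lambda>i. s * v i) al = mpow n (\<lambda>i. s) al * mpow n v al"
 by (simp add: mpow_def power_mult_distrib prod.distrib)

text \<open>A non-constant monomial contributes at least one factor \<open>s\<close>, and the
  remaining factors are at most 1.\<close>

lemma mpow_small:
 assumes s: "0 \<le> s" "s \<le> (1::real)" and al: "al \<in> midx n" "al \<noteq> (\<lambda>i. 0)"
 shows "mpow n (\<lambda>i. s) al \<le> s"
proof -
 obtain k where k: "al k \<noteq> 0" using al(2) by auto
 then have kn: "k < n" using al(1) by (auto simp: midx_def not_less[symmetric])
 have "mpow n (\<lambda>i. s) al = s ^ al k * (\<Prod>i\<in>{..<n} - {k}. s ^ al i)"
  unfolding mpow_def using kn by (subst prod.remove[of _ k]) auto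
 also have "\<dots> \<le> s ^ al k * 1"
  using s by (intro mult_left_mono prod_le_1) (auto intro: power_le_one)
 also have "\<dots> \<le> s ^ 1" using s k power_decreasing[of 1 "al k" s] by simp
 finally show ?thesis by simp
qed

text \<open>Write \<open>h = h z * (1 - U)\<close>, where \<open>U\<close> has no constant term.
  Shrinking the polyradius by \<open>s\<close> shrinks every term of \<open>U\<close> by at least
  that factor, until its norm drops below 1 and \<open>neumann_series\<close> applies.\<close>

lemma pseries_reciprocal:
 assumes N: "open_Cn n N" "z \<in> N" and h: "pseries n c z N h" and hz: "h z \<noteq> 0"
 obtains b N' where "open_Cn n N'" "z \<in> N'" "N' \<subseteq> N" "pseries n b z N' (\<lambda>w. 1 / h w)"
  "\<And>w. w \<in> N' \<Longrightarrow> h w \<noteq> 0"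
proof -
 let ?I = "midx n" let ?o = "\<lambda>i::nat. 0::nat"
 have zC: "z \<in> Cn n" using N openin_imp_subset by blast
 have c0: "c ?o = h z" by (rule pseries_base[OF h N(2)])
 obtain r where r: "r > 0" "\<And>w. w \<in> Cn n \<Longrightarrow> (\<And>i. i < n \<Longrightarrow> norm (w i - z i) \<le> r) \<Longrightarrow> w \<in> N"
  using box_contained[OF N] by metis
 \<comment> \<open>A corner of the polydisc: summability there bounds the coefficients weighted with
   the full radius \<open>r\<close>.\<close>
 define w0 where "w0 i = (if i < n then z i + of_real r else 0)" for i
 have "w0 \<in> N" using r zC by (intro r(2)) (auto simp: w0_def Cn_def)
 then have "((\<lambda>al. c al * mpow n (\<lambda>i. w0 i - z i) al) has_sum h w0) ?I" using h by (auto simp: pseries_def)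
 then have "(\<lambda>al. norm (c al * mpow n (\<lambda>i. w0 i - z i) al)) summable_on ?I" by (rule has_sum_complex_abs)
 moreover have "norm (c al * mpow n (\<lambda>i. w0 i - z i) al) = norm (c al) * mpow n (\<lambda>i. r) al" for al
  unfolding norm_mult norm_mpow using r(1) by (simp add: mpow_def w0_def)
 ultimately have sm: "(\<lambda>al. norm (c al) * mpow n (\<lambda>i. r) al) summable_on ?I" by simp
 define M where "M = (\<Sum>\<^sub>\<infinity>al\<in>?I. norm (c al) * mpow n (\<lambda>i. r) al)"
 have nn: "0 \<le> mpow n (\<lambda>i. r) al" for al using r by (intro mpow_nonneg) auto
 have M0: "0 \<le> M" unfolding M_def using nn by (intro infsum_nonneg) simp
 \<comment> \<open>Chosen so that \<open>s * M / norm (h z)\<close> becomes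
   \<open>M / (norm (h z) + 2 * M)\<close>, which is less than 1; the form also keeps
   \<open>s\<close> positive and at most 1 when \<open>M = 0\<close>.\<close>
 define s where "s = norm (h z) / (norm (h z) + 2 * M)"
 have hz': "0 < norm (h z)" using hz by simp
 have den: "0 < norm (h z) + 2 * M" using hz' M0 by (rule add_pos_nonneg[OF _ mult_nonneg_nonneg[OF zero_le_numeral]])
 have s: "0 < s" "s \<le> 1" unfolding s_def using hz' M0 den by (simp_all add: divide_le_eq)
 have sM: "s * M / norm (h z) < 1"
 proof -
  have "s * M / norm (h z) = M / (norm (h z) + 2 * M)" unfolding s_def using hz' by simp
  also have "\<dots> < 1" using den add_pos_nonneg[OF hz' M0] by (simp add: divide_less_eq)
  finally show ?thesis .
 qed
 \<comment> \<open>The coefficients of \<open>1 - h / h z\<close>; the constant term cancels because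
   \<open>c\<close> at the zero index is \<open>h z\<close>.\<close>
 define a where "a al = (if al = ?o then 0 else - c al / h z)" for al
 let ?r = "s * r"
 have rs: "0 < ?r" "?r \<le> r" using s r(1) by (auto simp: mult_le_cancel_right1)
 have le: "norm (a al) * mpow n (\<lambda>i. ?r) al \<le> s / norm (h z) * (norm (c al) * mpow n (\<lambda>i. r) al)" if "al \<in> ?I" for al
 proof (cases "al = ?o")
  case True then show ?thesis using s by (simp add: a_def)
 next
  case False
  have "norm (a al) * mpow n (\<lambda>i. ?r) al = norm (a al) * mpow n (\<lambda>i. s) al * mpow n (\<lambda>i. r) al"
   by (simp add: mpow_scale)
  also have "\<dots> \<le> norm (a al) * s * mpow n (\<lambda>i. r) al"
   using mpow_small[OF _ s(2) that False] s(1) nn by (intro mult_right_mono mult_left_mono) auto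
  finally show ?thesis using False by (simp add: a_def norm_divide mult_ac)
 qed
 have sm2: "(\<lambda>al. norm (a al) * mpow n (\<lambda>i. ?r) al) summable_on ?I"
  using rs s(1) by (intro summable_on_comparison_test[OF summable_on_cmult_right[OF sm] le] mult_nonneg_nonneg mpow_nonneg) auto
 then obtain A where A: "((\<lambda>al. norm (a al) * mpow n (\<lambda>i. ?r) al) has_sum A) ?I" by (auto simp: summable_on_def)
 have "A \<le> s / norm (h z) * M"
  by (rule has_sum_mono[OF A has_sum_cmult_right[OF has_sum_infsum[OF sm], folded M_def] le])
 then have A1: "A < 1" using sM by (simp add: mult.commute)
 define N' where "N' = N \<inter> {w \<in> Cn n. \<forall>i<n. norm (w i - z i) < ?r}"
 have N': "open_Cn n N'" "z \<in> N'" "N' \<subseteq> N"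
  unfolding N'_def using N box_open zC rs by (auto intro!: openin_Int)
 define b where "b al = 1 / h z * (\<Sum>\<^sub>\<infinity>j. conv_pow a j al)" for al
 have key: "((\<lambda>al. b al * mpow n (\<lambda>i. w i - z i) al) has_sum 1 / h w) ?I \<and> h w \<noteq> 0" if w: "w \<in> N'" for w
 proof -
  let ?u = "\<lambda>i. w i - z i"
  define U where "U = 1 - h w / h z"
  have 1: "((\<lambda>al. - (1 / h z) * (c al * mpow n ?u al)) has_sum - (1 / h z) * h w) ?I"
   using h w N'(3) by (intro has_sum_cmult_right) (auto simp: pseries_def)
  have 2: "((\<lambda>al. if al = ?o then 1 else 0) has_sum (1::complex)) ?I"
   by (rule has_sum_single[of _ ?o]) (auto simp: midx_def)
  have eU: "- (1 / h z) * h w + 1 = U" by (simp add: U_def)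
  have ca: "a al * mpow n ?u al = - (1 / h z) * (c al * mpow n ?u al) + (if al = ?o then 1 else 0)" for al
   using c0 hz by (auto simp: a_def)
  have U: "((\<lambda>al. a al * mpow n ?u al) has_sum U) ?I"
   unfolding ca by (rule has_sum_add[OF 1 2, unfolded eU])
  have "norm (?u i) \<le> ?r" if "i < n" for i using w that by (auto simp: N'_def less_imp_le)
  note ns = neumann_series[OF rs(1) A A1 this U]
  have hw: "h w = h z * (1 - U)" using hz by (simp add: U_def)
  have "U \<noteq> 1" using ns(1) by auto
  then have "h w \<noteq> 0" using hw hz by simp
  moreover have "((\<lambda>al. 1 / h z * ((\<Sum>\<^sub>\<infinity>j. conv_pow a j al) * mpow n ?u al)) has_sum 1 / h z * (1 / (1 - U))) ?I"
   by (rule has_sum_cmult_right[OF ns(2)])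
  ultimately show ?thesis unfolding b_def hw by (simp add: mult.assoc)
 qed
 show ?thesis using that[OF N', of b] key unfolding pseries_def by blast
qed

text \<open>Holomorphy asks for an expansion about each point of the neighbourhood, so the local
  statement is used again at every such point.\<close>

lemma holo_reciprocal:
 assumes N: "open_Cn n N" "z \<in> N" and h: "holo n N h" and hz: "h z \<noteq> 0"
 obtains N' where "open_Cn n N'" "z \<in> N'" "N' \<subseteq> N" "holo n N' (\<lambda>w. 1 / h w)" "\<And>w. w \<in> N' \<Longrightarrow> h w \<noteq> 0"
proof -
 have loc: "\<exists>b N'. open_Cn n N' \<and> v \<in> N' \<and> N' \<subseteq> N \<and> pseries n b v N' (\<lambda>w. 1 / h w) \<and> (\<forall>w\<in>N'. h w \<noteq> 0)"
  if v: "v \<in> N" "h v \<noteq> 0" for v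
 proof -
  obtain c N1 where 1: "open_Cn n N1" "v \<in> N1" "pseries n c v N1 h" using h v unfolding holo_alt by blast
  have "open_Cn n (N1 \<inter> N)" "v \<in> N1 \<inter> N" "pseries n c v (N1 \<inter> N) h"
   using 1 N v by (auto simp: pseries_def openin_Int)
  from pseries_reciprocal[OF this v(2)] show ?thesis by (metis Int_subset_iff)
 qed
 obtain b N' where N': "open_Cn n N'" "z \<in> N'" "N' \<subseteq> N" "\<forall>w\<in>N'. h w \<noteq> 0" using loc[OF N(2) hz] by blast
 have "holo n N' (\<lambda>w. 1 / h w)"
  unfolding holo_alt
 proof
  fix v assume "v \<in> N'"
  then have "v \<in> N" "h v \<noteq> 0" using N'(3,4) by auto
  from loc[OF this] show "\<exists>c N''. open_Cn n N'' \<and> v \<in> N'' \<and> pseries n c v N'' (\<lambda>w. 1 / h w)" by blast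
 qed
 then show ?thesis using that N' by blast
qed

text \<open>Projection onto the coordinates selected by \<open>sg\<close>. It is used with the
  identity and with the shift by \<open>n\<close>, the two projections of a product of two copies of
  n-space.\<close>

definition coord_map :: "nat \<Rightarrow> (nat \<Rightarrow> nat) \<Rightarrow> (nat \<Rightarrow> complex) \<Rightarrow> nat \<Rightarrow> complex" where
 "coord_map n sg w j = (if j < n then w (sg j) else 0)"

lemma coord_map_Cn: "coord_map n sg w \<in> Cn n"
 by (simp add: coord_map_def Cn_def)

lemma continuous_coord_map: "continuous_on S (coord_map n sg)"
proof (rule continuous_on_coordinatewise_then_product)
 fix i
 have "continuous_on S (\<lambda>w :: nat \<Rightarrow> complex. w (sg i))"
  by (rule continuous_on_subset[OF continuous_on_product_coordinates]) simp
 then show "continuous_on S (\<lambda>w. coord_map n sg w i)" by (cases "i < n") (simp_all add: coord_map_def)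
qed

lemma open_coord_map_vimage:
 assumes "open_Cn n N"
 shows "open_Cn m {w \<in> Cn m. coord_map n sg w \<in> N}"
proof -
 obtain T where T: "open T" "N = Cn n \<inter> T" using assms by (auto simp: openin_open)
 have "{w \<in> Cn m. coord_map n sg w \<in> N} = Cn m \<inter> coord_map n sg -` T" using T(2) coord_map_Cn by auto
 then show ?thesis using continuous_openin_preimage_gen[OF continuous_coord_map T(1)] by metis
qed

text \<open>The pulled-back series has the same coefficients with exponents renamed along
  \<open>sg\<close>; multi-indices involving a coordinate outside the range of \<open>sg\<close>
  receive coefficient 0.\<close>

lemma holo_coord_map:
 assumes N: "open_Cn n N" and h: "holo n N h" and inj: "inj_on sg {..<n}" and sg: "sg ` {..<n} \<subseteq> {..<m}"
 shows "holo m {w \<in> Cn m. coord_map n sg w \<in> N} (\<lambda>w. h (coord_map n sg w))"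
 unfolding holo_alt
proof
 fix z assume z: "z \<in> {w \<in> Cn m. coord_map n sg w \<in> N}"
 let ?k = "coord_map n sg"
 obtain c N1 where 1: "open_Cn n N1" "?k z \<in> N1" "pseries n c (?k z) N1 h"
  using h z unfolding holo_alt by blast
 \<comment> \<open>\<open>T\<close> collects the multi-indices supported on the selected
   coordinates; \<open>p\<close> and \<open>e\<close> below are mutually inverse between
   \<open>T\<close> and \<open>midx n\<close>.\<close>
 define T where "T = {be \<in> midx m. \<forall>k<m. k \<notin> sg ` {..<n} \<longrightarrow> be k = 0}"
 define p where "p be = (\<lambda>j. if j < n then be (sg j) else 0)" for be :: "nat \<Rightarrow> nat"
 define e where "e al = (\<lambda>k. if k \<in> sg ` {..<n} then al (the_inv_into {..<n} sg k) else 0)" for al :: "nat \<Rightarrow> nat"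
 define d where "d be = (if be \<in> T then c (p be) else 0)" for be
 have inv: "the_inv_into {..<n} sg (sg j) = j" if "j < n" for j using the_inv_into_f_f[OF inj] that by simp
 have pe: "p (e al) = al" if "al \<in> midx n" for al
  using that inv by (auto simp: p_def e_def midx_def)
 have ep: "e (p be) = be" if "be \<in> T" for be
 proof
  fix k
  show "e (p be) k = be k"
  proof (cases "k \<in> sg ` {..<n}")
   case True then show ?thesis using inv by (auto simp: e_def p_def)
  next
   case False
   then show ?thesis using that by (cases "k < m") (auto simp: e_def T_def midx_def)
  qed
 qed
 have eT: "e al \<in> T" for al using sg by (auto simp: T_def e_def midx_def)
 have pI: "p be \<in> midx n" for be by (simp add: p_def midx_def)
 have mp: "mpow m u be = mpow n (\<lambda>j. u (sg j)) (p be)" if "be \<in> T" for be and u :: "nat \<Rightarrow> complex"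
 proof -
  have "mpow m u be = (\<Prod>k\<in>sg ` {..<n}. u k ^ be k)"
   unfolding mpow_def using sg that by (intro prod.mono_neutral_right) (auto simp: T_def)
  also have "\<dots> = (\<Prod>j<n. u (sg j) ^ be (sg j))" by (subst prod.reindex[OF inj]) simp
  finally show ?thesis by (simp add: mpow_def p_def)
 qed
 let ?N = "{w \<in> Cn m. ?k w \<in> N1}"
 have "pseries m d z ?N (\<lambda>w. h (?k w))"
  unfolding pseries_def
 proof
  fix w assume w: "w \<in> ?N"
  have "((\<lambda>al. c al * mpow n (\<lambda>i. ?k w i - ?k z i) al) has_sum h (?k w)) (midx n)"
   using 1(3) w by (auto simp: pseries_def)
  moreover have "mpow n (\<lambda>i. ?k w i - ?k z i) al = mpow n (\<lambda>j. w (sg j) - z (sg j)) al" for al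
   by (simp add: mpow_def coord_map_def)
  ultimately have s: "((\<lambda>al. c al * mpow n (\<lambda>j. w (sg j) - z (sg j)) al) has_sum h (?k w)) (midx n)" by simp
  have "((\<lambda>al. c al * mpow n (\<lambda>j. w (sg j) - z (sg j)) al) has_sum h (?k w)) (midx n) \<longleftrightarrow>
   ((\<lambda>be. c (p be) * mpow n (\<lambda>j. w (sg j) - z (sg j)) (p be)) has_sum h (?k w)) T"
   by (rule has_sum_reindex_bij_witness[where i = p and j = e]) (auto simp: pe ep eT pI)
  then have "((\<lambda>be. c (p be) * mpow n (\<lambda>j. w (sg j) - z (sg j)) (p be)) has_sum h (?k w)) T" using s by simp
  then show "((\<lambda>be. d be * mpow m (\<lambda>i. w i - z i) be) has_sum h (?k w)) (midx m)"
   by (subst has_sum_cong_neutral[of T]) (auto simp: d_def mp T_def)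
 qed
 moreover have "open_Cn m ?N" by (rule open_coord_map_vimage[OF 1(1)])
 ultimately show "\<exists>c N. open_Cn m N \<and> z \<in> N \<and> pseries m c z N (\<lambda>w. h (?k w))"
  using z 1(2) by blast
qed

lemma holo_coordinate:
 assumes N: "open_Cn n N" and i: "i < n"
 shows "holo n N (\<lambda>w. w i)"
 unfolding holo_alt
proof
 fix z assume z: "z \<in> N"
 let ?o = "\<lambda>j::nat. 0::nat" let ?e = "\<lambda>j. if j = i then 1 else 0 :: nat"
 let ?c = "\<lambda>al. if al = ?o then z i else if al = ?e then 1 else 0"
 have ne: "?e \<noteq> ?o" by (metis zero_neq_one)
 have "((\<lambda>al. ?c al * mpow n (\<lambda>i. w i - z i) al) has_sum w i) (midx n)" for w
 proof -
  have "mpow n (\<lambda>i. w i - z i) ?e = (\<Prod>j<n. if j = i then w i - z i else 1)"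
   unfolding mpow_def by (intro prod.cong) auto
  then have me: "mpow n (\<lambda>i. w i - z i) ?e = w i - z i" using i by simp
  have a: "((\<lambda>al. if al = ?o then z i else 0) has_sum z i) (midx n)"
   by (rule has_sum_single[of _ ?o]) (auto simp: midx_def)
  have b: "((\<lambda>al. if al = ?e then w i - z i else 0) has_sum w i - z i) (midx n)"
   by (rule has_sum_single[of _ ?e]) (use i in \<open>auto simp: midx_def\<close>)
  have "((\<lambda>al. (if al = ?o then z i else 0) + (if al = ?e then w i - z i else 0)) has_sum w i) (midx n)"
   using has_sum_add[OF a b] by simp
  then show ?thesis
   by (rule has_sum_cong[THEN iffD1, rotated]) (use ne me in \<open>auto simp del: One_nat_def\<close>)
 qed
 then have "pseries n ?c z N (\<lambda>w. w i)" by (simp add: pseries_def)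
 then show "\<exists>c N. open_Cn n N \<and> z \<in> N \<and> pseries n c z N (\<lambda>w. w i)" using N z by blast
qed

section \<open>Germs on local models\<close>

lemma hol_ring_sel [simp]:
 "mult (hol_ring n z) = (\<lambda>g h w. g w * h w)" "one (hol_ring n z) = (\<lambda>w. 1)"
 "zero (hol_ring n z) = (\<lambda>w. 0)" "add (hol_ring n z) = (\<lambda>g h w. g w + h w)"
 by (simp_all add: hol_ring_def)

lemma hol_ring_carrier: "h \<in> carrier (hol_ring n z) \<longleftrightarrow> (\<exists>N. open_Cn n N \<and> z \<in> N \<and> holo n N h)"
 by (simp add: hol_ring_def)

lemma hol_ring_closed:
 assumes "g \<in> carrier (hol_ring n z)" "h \<in> carrier (hol_ring n z)"
 shows "(\<lambda>w. g w + h w) \<in> carrier (hol_ring n z)" "(\<lambda>w. g w * h w) \<in> carrier (hol_ring n z)"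
proof -
 obtain N1 N2 where N: "open_Cn n N1" "z \<in> N1" "holo n N1 g" "open_Cn n N2" "z \<in> N2" "holo n N2 h"
  using assms unfolding hol_ring_carrier by blast
 have o: "open_Cn n (N1 \<inter> N2)" using N by (intro openin_Int)
 have "holo n (N1 \<inter> N2) g" "holo n (N1 \<inter> N2) h"
  using holo_subset[OF N(3) o] holo_subset[OF N(6) o] by auto
 then show "(\<lambda>w. g w + h w) \<in> carrier (hol_ring n z)" "(\<lambda>w. g w * h w) \<in> carrier (hol_ring n z)"
  unfolding hol_ring_carrier using o N(2,5) holo_add[OF o] holo_mult[OF o] by blast+
qed

lemma hol_ring_const: "z \<in> Cn n \<Longrightarrow> (\<lambda>w. c) \<in> carrier (hol_ring n z)"
 unfolding hol_ring_carrier using holo_const[of n "Cn n" c] by auto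

lemma cring_hol_ring:
 assumes z: "z \<in> Cn n"
 shows "cring (hol_ring n z)"
proof (rule cringI)
 show "abelian_group (hol_ring n z)"
 proof (rule abelian_groupI)
  fix h assume h: "h \<in> carrier (hol_ring n z)"
  have "(\<lambda>w. (-1) * h w) \<in> carrier (hol_ring n z)" by (rule hol_ring_closed(2)[OF hol_ring_const[OF z] h])
  then show "\<exists>g\<in>carrier (hol_ring n z). g \<oplus>\<^bsub>hol_ring n z\<^esub> h = \<zero>\<^bsub>hol_ring n z\<^esub>"
   by (rule bexI[rotated]) auto
 qed (use hol_ring_closed hol_ring_const[OF z] in \<open>auto simp: algebra_simps\<close>)
 show "comm_monoid (hol_ring n z)"
  by (rule comm_monoidI) (use hol_ring_closed hol_ring_const[OF z] in \<open>auto simp: algebra_simps\<close>)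
qed (auto simp: algebra_simps)

lemma hol_ring_minus:
 assumes z: "z \<in> Cn n" and g: "g \<in> carrier (hol_ring n z)" and h: "h \<in> carrier (hol_ring n z)"
 shows "g \<ominus>\<^bsub>hol_ring n z\<^esub> h = (\<lambda>w. g w - h w)"
proof -
 interpret R: cring "hol_ring n z" by (rule cring_hol_ring[OF z])
 have m: "(\<lambda>w. (-1) * h w) \<in> carrier (hol_ring n z)" by (rule hol_ring_closed(2)[OF hol_ring_const[OF z] h])
 have "\<ominus>\<^bsub>hol_ring n z\<^esub> h = (\<lambda>w. (-1) * h w)"
  by (rule R.minus_equality[OF _ h m]) auto
 then show ?thesis by (simp add: a_minus_def)
qed

lemma hol_ring_nearby:
 assumes "h \<in> carrier (hol_ring n z)"
 obtains N where "open_Cn n N" "z \<in> N" "holo n N h" "\<And>w. w \<in> N \<Longrightarrow> h \<in> carrier (hol_ring n w)"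
 using assms unfolding hol_ring_carrier by blast

locale local_model =
 fixes n :: nat and D :: "(nat \<Rightarrow> complex) set" and fs :: "((nat \<Rightarrow> complex) \<Rightarrow> complex) set"
 assumes D: "open_Cn n D" and fs: "\<And>f. f \<in> fs \<Longrightarrow> holo n D f"
begin

abbreviation R where "R z \<equiv> hol_ring n z"
abbreviation I where "I z \<equiv> model_ideal n fs z"
abbreviation Q where "Q z \<equiv> R z Quot I z"
abbreviation germ where "germ z h \<equiv> I z +>\<^bsub>R z\<^esub> h"
abbreviation Zs where "Zs \<equiv> {z \<in> D. \<forall>f\<in>fs. f z = 0}"

lemma D_Cn: "z \<in> D \<Longrightarrow> z \<in> Cn n" using D openin_imp_subset by blast

lemma cringR: "z \<in> D \<Longrightarrow> cring (R z)" using cring_hol_ring D_Cn by blast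

lemma gens:
 assumes "z \<in> D"
 shows "fs \<union> {h. \<exists>N. open_Cn n N \<and> z \<in> N \<and> (\<forall>w\<in>N. h w = 0)} \<subseteq> carrier (R z)"
proof
 fix h assume "h \<in> fs \<union> {h. \<exists>N. open_Cn n N \<and> z \<in> N \<and> (\<forall>w\<in>N. h w = 0)}"
 then consider "h \<in> fs" | N where "open_Cn n N" "z \<in> N" "\<forall>w\<in>N. h w = 0" by blast
 then show "h \<in> carrier (R z)"
 proof cases
  case 1 then show ?thesis using fs D assms unfolding hol_ring_carrier by blast
 next
  case 2
  then have "holo n N h" using holo_cong[OF holo_const[of n N 0]] by auto
  then show ?thesis using 2 unfolding hol_ring_carrier by blast
 qed
qed

lemma idl: "z \<in> D \<Longrightarrow> ideal (I z) (R z)"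
 unfolding model_ideal_def using ring.genideal_ideal[OF cring.axioms(1)[OF cringR] gens] by blast

lemma cringQ: "z \<in> D \<Longrightarrow> cring (Q z)"
 using ideal.quotient_is_cring[OF idl cringR] by blast

text \<open>Serves as an induction principle: to prove a property for all members of the ideal, show
  that its instances form an ideal \<open>J\<close> containing the generators.\<close>

lemma I_minimal:
 assumes z: "z \<in> D" and J: "ideal J (R z)" and f: "fs \<subseteq> J"
  and v: "\<And>h N. open_Cn n N \<Longrightarrow> z \<in> N \<Longrightarrow> (\<And>w. w \<in> N \<Longrightarrow> h w = 0) \<Longrightarrow> h \<in> J"
 shows "I z \<subseteq> J"
 unfolding model_ideal_def
 by (rule ring.genideal_minimal[OF cring.axioms(1)[OF cringR[OF z]] J]) (use f v in blast)

lemma I_carrier: "z \<in> D \<Longrightarrow> k \<in> I z \<Longrightarrow> k \<in> carrier (R z)"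
 using ideal.Icarr[OF idl] by blast

lemma I_gens:
 assumes "z \<in> D"
 shows "f \<in> fs \<Longrightarrow> f \<in> I z" "open_Cn n N \<Longrightarrow> z \<in> N \<Longrightarrow> (\<And>w. w \<in> N \<Longrightarrow> h w = 0) \<Longrightarrow> h \<in> I z"
 using ring.genideal_self[OF cring.axioms(1)[OF cringR[OF assms]] gens[OF assms]] unfolding model_ideal_def by blast+

lemma I_closed:
 assumes z: "z \<in> D"
 shows "(\<lambda>w. 0) \<in> I z" "k \<in> I z \<Longrightarrow> l \<in> I z \<Longrightarrow> (\<lambda>w. k w + l w) \<in> I z"
  "k \<in> I z \<Longrightarrow> h \<in> carrier (R z) \<Longrightarrow> (\<lambda>w. h w * k w) \<in> I z"
proof -
 interpret i: ideal "I z" "R z" by (rule idl[OF z])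
 show "(\<lambda>w. 0) \<in> I z" using additive_subgroup.zero_closed[OF i.additive_subgroup_axioms] by simp
 show "k \<in> I z \<Longrightarrow> l \<in> I z \<Longrightarrow> (\<lambda>w. k w + l w) \<in> I z"
  using additive_subgroup.a_closed[OF i.additive_subgroup_axioms, of k l] by simp
 show "k \<in> I z \<Longrightarrow> h \<in> carrier (R z) \<Longrightarrow> (\<lambda>w. h w * k w) \<in> I z" using i.I_l_closed[of k h] by simp
qed

lemma hol_ideal:
 assumes z: "z \<in> D" and sub: "J \<subseteq> carrier (R z)" and zero: "(\<lambda>w. 0) \<in> J"
  and add: "\<And>k l. k \<in> J \<Longrightarrow> l \<in> J \<Longrightarrow> (\<lambda>w. k w + l w) \<in> J"
  and mult: "\<And>k h. k \<in> J \<Longrightarrow> h \<in> carrier (R z) \<Longrightarrow> (\<lambda>w. h w * k w) \<in> J"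
 shows "ideal J (R z)"
proof -
 interpret R: cring "R z" by (rule cringR[OF z])
 show ?thesis
 proof (rule idealI)
  show "ring (R z)" ..
  have "subgroup J (add_monoid (R z))"
  proof (rule group.subgroupI[OF R.a_group])
   show "J \<subseteq> carrier (add_monoid (R z))" using sub by simp
   show "J \<noteq> {}" using zero by auto
   show "inv\<^bsub>add_monoid (R z)\<^esub> k \<in> J" if k: "k \<in> J" for k
   proof -
    have m: "(\<lambda>w. (-1) * k w) \<in> J" using mult[OF k hol_ring_const[OF D_Cn[OF z]]] .
    have "\<ominus>\<^bsub>R z\<^esub> k = (\<lambda>w. (-1) * k w)" using R.minus_equality[of "\<lambda>w. (-1) * k w" k] sub k m by auto
    then show ?thesis using m by (simp add: a_inv_def)
   qed
   show "k \<otimes>\<^bsub>add_monoid (R z)\<^esub> l \<in> J" if "k \<in> J" "l \<in> J" for k l using add[OF that] by simp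
  qed
  then show "subgroup J (add_monoid (R z))" .
  show "h \<otimes>\<^bsub>R z\<^esub> k \<in> J" if "k \<in> J" "h \<in> carrier (R z)" for k h using mult[OF that] by simp
  show "k \<otimes>\<^bsub>R z\<^esub> h \<in> J" if "k \<in> J" "h \<in> carrier (R z)" for k h using mult[OF that] by (simp add: mult.commute)
 qed
qed

lemma germ_hom: "z \<in> D \<Longrightarrow> germ z \<in> ring_hom (R z) (Q z)"
 using ideal.rcos_ring_hom[OF idl] by blast

lemma germ_carrier: "z \<in> D \<Longrightarrow> h \<in> carrier (R z) \<Longrightarrow> germ z h \<in> carrier (Q z)"
 using ring_hom_closed[OF germ_hom] .

lemma germ_add: "z \<in> D \<Longrightarrow> g \<in> carrier (R z) \<Longrightarrow> h \<in> carrier (R z) \<Longrightarrow>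
 germ z g \<oplus>\<^bsub>Q z\<^esub> germ z h = germ z (\<lambda>w. g w + h w)"
 using ring_hom_add[OF germ_hom, of z g h] by simp

lemma germ_mult: "z \<in> D \<Longrightarrow> g \<in> carrier (R z) \<Longrightarrow> h \<in> carrier (R z) \<Longrightarrow>
 germ z g \<otimes>\<^bsub>Q z\<^esub> germ z h = germ z (\<lambda>w. g w * h w)"
 using ring_hom_mult[OF germ_hom, of z g h] by simp

lemma germ_one: "z \<in> D \<Longrightarrow> germ z (\<lambda>w. 1) = \<one>\<^bsub>Q z\<^esub>"
 using ring_hom_one[OF germ_hom, of z] by simp

lemma germ_surj:
 assumes z: "z \<in> D" and a: "a \<in> carrier (Q z)"
 obtains h where "h \<in> carrier (R z)" "a = germ z h"
 using a unfolding FactRing_def A_RCOSETS_def' by auto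

lemma germ_mem:
 assumes "z \<in> D" "h \<in> carrier (R z)"
 shows "k \<in> germ z h \<longleftrightarrow> k \<in> carrier (R z) \<and> (\<lambda>w. k w - h w) \<in> I z"
proof -
 interpret i: ideal "I z" "R z" by (rule idl[OF assms(1)])
 have "k \<in> germ z h \<Longrightarrow> k \<in> carrier (R z)"
  using i.a_r_coset_subset_G[OF i.a_subset assms(2)] by auto
 then show ?thesis
  using i.a_rcos_module_minus[OF i.ring_axioms assms(2), of k] hol_ring_minus[OF D_Cn[OF assms(1)] _ assms(2), of k] by auto
qed

lemma germ_eq_iff:
 assumes z: "z \<in> D" and g: "g \<in> carrier (R z)" and h: "h \<in> carrier (R z)"
 shows "germ z g = germ z h \<longleftrightarrow> (\<lambda>w. g w - h w) \<in> I z"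
proof -
 interpret i: ideal "I z" "R z" by (rule idl[OF z])
 show ?thesis
 proof
  assume "germ z g = germ z h"
  then have "g \<in> germ z h" using i.a_rcos_self[OF g] by simp
  then show "(\<lambda>w. g w - h w) \<in> I z" using germ_mem[OF z h] by simp
 next
  assume "(\<lambda>w. g w - h w) \<in> I z"
  then have "g \<in> germ z h" using germ_mem[OF z h] g by simp
  then show "germ z g = germ z h" using i.a_repr_independence'[OF _ h] by metis
 qed
qed

lemma germ_cong_near:
 assumes z: "z \<in> D" and g: "g \<in> carrier (R z)" and h: "h \<in> carrier (R z)"
  and N: "open_Cn n N" "z \<in> N" "\<And>w. w \<in> N \<Longrightarrow> g w = h w"
 shows "germ z g = germ z h"
 unfolding germ_eq_iff[OF z g h] by (rule I_gens(2)[OF z N(1,2)]) (simp add: N(3))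

text \<open>An expression in the generators persists on a neighbourhood, so membership in the ideal
  is an open condition. This makes sections with equal germs agree nearby.\<close>

lemma I_nearby:
 assumes z: "z \<in> D" and k: "k \<in> I z"
 obtains N where "open_Cn n N" "z \<in> N" "N \<subseteq> D" "\<And>w. w \<in> N \<Longrightarrow> k \<in> I w"
proof -
 define J where "J = {k \<in> carrier (R z). \<exists>N. open_Cn n N \<and> z \<in> N \<and> N \<subseteq> D \<and> (\<forall>w\<in>N. k \<in> I w)}"
 have "ideal J (R z)"
 proof (rule hol_ideal[OF z])
  show "J \<subseteq> carrier (R z)" by (auto simp: J_def)
  show "(\<lambda>w. 0) \<in> J" using hol_ring_const[OF D_Cn[OF z]] D z I_closed(1) by (auto simp: J_def)
  fix k assume k: "k \<in> J"
  then obtain N where N: "k \<in> carrier (R z)" "open_Cn n N" "z \<in> N" "N \<subseteq> D" "\<forall>w\<in>N. k \<in> I w" by (auto simp: J_def)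
  show "(\<lambda>w. k w + l w) \<in> J" if l: "l \<in> J" for l
  proof -
   obtain N' where N': "l \<in> carrier (R z)" "open_Cn n N'" "z \<in> N'" "N' \<subseteq> D" "\<forall>w\<in>N'. l \<in> I w" using l by (auto simp: J_def)
   have "\<forall>w\<in>N \<inter> N'. (\<lambda>w. k w + l w) \<in> I w" using N N' I_closed(2) by blast
   then show ?thesis unfolding J_def using hol_ring_closed(1)[OF N(1) N'(1)] N N' by blast
  qed
  show "(\<lambda>w. h w * k w) \<in> J" if h: "h \<in> carrier (R z)" for h
  proof -
   obtain N' where N': "open_Cn n N'" "z \<in> N'" "\<And>w. w \<in> N' \<Longrightarrow> h \<in> carrier (R w)" using hol_ring_nearby[OF h] by metis
   have "\<forall>w\<in>N \<inter> N'. (\<lambda>w. h w * k w) \<in> I w" using N N' I_closed(3) by blast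
   then show ?thesis unfolding J_def using hol_ring_closed(2)[OF h N(1)] N N' by blast
  qed
 qed
 moreover have "fs \<subseteq> J" using gens[OF z] D z I_gens(1) unfolding J_def by blast
 moreover have "h \<in> J" if "open_Cn n N" "z \<in> N" "\<And>w. w \<in> N \<Longrightarrow> h w = 0" for h N
 proof -
  have "open_Cn n (N \<inter> D)" using that(1) D by (rule openin_Int)
  moreover have "\<forall>w\<in>N \<inter> D. h \<in> I w" using I_gens(2)[OF _ that(1)] that(3) by blast
  moreover have "h \<in> carrier (R z)" using I_carrier[OF z I_gens(2)[OF z that]] .
  ultimately show ?thesis unfolding J_def using that(2) z by blast
 qed
 ultimately have "I z \<subseteq> J" by (rule I_minimal[OF z])
 then have "k \<in> J" using k by (rule subsetD)
 then obtain N where "open_Cn n N" "z \<in> N" "N \<subseteq> D" "\<forall>w\<in>N. k \<in> I w" unfolding J_def by blast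
 then show ?thesis by (intro that[of N]) auto
qed

text \<open>Evaluation at a point of the locus kills the generators, hence the ideal; so values of
  germs are well defined.\<close>

lemma I_vanish:
 assumes z: "z \<in> Zs" and k: "k \<in> I z"
 shows "k z = 0"
proof -
 have zD: "z \<in> D" using z by simp
 have "I z \<subseteq> {k \<in> carrier (R z). k z = 0}"
 proof (rule I_minimal[OF zD])
  show "ideal {k \<in> carrier (R z). k z = 0} (R z)"
   by (rule hol_ideal[OF zD]) (use hol_ring_const[OF D_Cn[OF zD]] hol_ring_closed in auto)
  show "fs \<subseteq> {k \<in> carrier (R z). k z = 0}" using z gens[OF zD] by auto
  show "h \<in> {k \<in> carrier (R z). k z = 0}" if "open_Cn n N" "z \<in> N" "\<And>w. w \<in> N \<Longrightarrow> h w = 0" for h N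
   using I_carrier[OF zD I_gens(2)[OF zD that]] that by simp
 qed
 then show ?thesis using k by auto
qed

text \<open>A non-vanishing representative is inverted by its reciprocal series; conversely, a unit
  that vanished would put a function with value -1 into an ideal of functions vanishing at
  \<open>z\<close>.\<close>

lemma germ_unit_iff:
 assumes z: "z \<in> Zs" and h: "h \<in> carrier (R z)"
 shows "germ z h \<in> Units (Q z) \<longleftrightarrow> h z \<noteq> 0"
proof
 have zD: "z \<in> D" using z by simp
 interpret Q: cring "Q z" by (rule cringQ[OF zD])
 show "germ z h \<in> Units (Q z)" if hz: "h z \<noteq> 0"
 proof -
  obtain N where N: "open_Cn n N" "z \<in> N" "holo n N h" using h unfolding hol_ring_carrier by blast
  obtain N' where N': "open_Cn n N'" "z \<in> N'" "N' \<subseteq> N" "holo n N' (\<lambda>w. 1 / h w)" "\<And>w. w \<in> N' \<Longrightarrow> h w \<noteq> 0"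
   using holo_reciprocal[OF N hz] by metis
  have i: "(\<lambda>w. 1 / h w) \<in> carrier (R z)" using N' unfolding hol_ring_carrier by blast
  have "germ z h \<otimes>\<^bsub>Q z\<^esub> germ z (\<lambda>w. 1 / h w) = germ z (\<lambda>w. 1)"
   unfolding germ_mult[OF zD h i]
   by (rule germ_cong_near[OF zD hol_ring_closed(2)[OF h i] hol_ring_const[OF D_Cn[OF zD]] N'(1,2)]) (use N'(5) in auto)
  then have "germ z h \<otimes>\<^bsub>Q z\<^esub> germ z (\<lambda>w. 1 / h w) = \<one>\<^bsub>Q z\<^esub>" using germ_one[OF zD] by simp
  moreover note Q.m_comm[OF germ_carrier[OF zD h] germ_carrier[OF zD i]]
  ultimately show ?thesis using germ_carrier[OF zD h] germ_carrier[OF zD i] unfolding Units_def by auto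
 qed
 show "h z \<noteq> 0" if hu: "germ z h \<in> Units (Q z)"
 proof
  assume h0: "h z = 0"
  obtain b where b: "b \<in> carrier (Q z)" "germ z h \<otimes>\<^bsub>Q z\<^esub> b = \<one>\<^bsub>Q z\<^esub>" using hu unfolding Units_def by auto
  obtain g where g: "g \<in> carrier (R z)" "b = germ z g" using germ_surj[OF zD b(1)] .
  have "germ z (\<lambda>w. h w * g w) = germ z (\<lambda>w. 1)" using b(2) germ_one[OF zD] germ_mult[OF zD h g(1)] g(2) by simp
  then have "(\<lambda>w. h w * g w - 1) \<in> I z"
   using germ_eq_iff[OF zD hol_ring_closed(2)[OF h g(1)] hol_ring_const[OF D_Cn[OF zD]]] by simp
  from I_vanish[OF z this] show False using h0 by simp
 qed
qed

lemma pts_model: "pts (model n D fs) = Zs" by simp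

lemma openin_Zs: "open_Cn n N \<Longrightarrow> openin (top_of_set Zs) (Zs \<inter> N)"
proof -
 assume "open_Cn n N"
 then obtain T where T: "open T" "N = Cn n \<inter> T" unfolding openin_open by blast
 have "Zs \<inter> N = Zs \<inter> T" using T(2) D_Cn by auto
 then show ?thesis using T(1) by (simp add: openin_open_Int)
qed

lemma openin_ZsD:
 assumes "openin (top_of_set Zs) U"
 obtains N where "open_Cn n N" "N \<subseteq> D" "U = Zs \<inter> N"
proof -
 obtain T where T: "open T" "U = Zs \<inter> T" using assms unfolding openin_open by blast
 have "open_Cn n (D \<inter> T)" using D T(1) by (metis openin_Int_open)
 then show ?thesis using that[of "D \<inter> T"] T(2) by auto
qed

lemma sec_model: "s \<in> sec (model n D fs) W \<longleftrightarrow> s \<in> extensional W \<and> (\<forall>z\<in>W. \<exists>N h. open_Cn n N \<and> z \<in> N \<and> N \<subseteq> D \<and> holo n N h \<and>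
    (\<forall>w\<in>N \<inter> W. s w = germ w h))"
 by (simp add: model_def)

lemma crs_model: "c_ringed_space (model n D fs)"
proof -
 let ?M = "model n D fs"
 have secE: "\<exists>N h. open_Cn n N \<and> z \<in> N \<and> N \<subseteq> D \<and> holo n N h \<and> (\<forall>w\<in>N \<inter> W. s w = germ w h)"
  if "s \<in> sec ?M W" "z \<in> W" for s W z using that by (simp add: sec_model)
 have holoR: "h \<in> carrier (R w)" if "holo n N h" "open_Cn n N" "w \<in> N" for h N w
  using that unfolding hol_ring_carrier by blast
 have sec_carrier: "sec ?M U \<subseteq> (\<Pi>\<^sub>E p\<in>U. germs ?M p)" for U
 proof
  fix s assume s: "s \<in> sec ?M U"
  have "s z \<in> carrier (Q z)" if z: "z \<in> U" for z
  proof -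
   obtain N h where N: "open_Cn n N" "z \<in> N" "N \<subseteq> D" "holo n N h" "\<forall>w\<in>N \<inter> U. s w = germ w h"
    using secE[OF s z] by blast
   then show ?thesis using germ_carrier holoR z by auto
  qed
  then show "s \<in> (\<Pi>\<^sub>E p\<in>U. germs ?M p)" using s by (auto simp: sec_model PiE_iff)
 qed
 have two: "\<exists>N h k. open_Cn n N \<and> z \<in> N \<and> N \<subseteq> D \<and> holo n N h \<and> holo n N k \<and>
   (\<forall>w\<in>N \<inter> U. s w = germ w h) \<and> (\<forall>w\<in>N \<inter> U. t w = germ w k)"
  if s: "s \<in> sec ?M U" "t \<in> sec ?M U" and z: "z \<in> U" for s t U z
 proof -
  obtain N h where N: "open_Cn n N" "z \<in> N" "N \<subseteq> D" "holo n N h" "\<forall>w\<in>N \<inter> U. s w = germ w h"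
   using secE[OF s(1) z] by blast
  obtain N' k where N': "open_Cn n N'" "z \<in> N'" "N' \<subseteq> D" "holo n N' k" "\<forall>w\<in>N' \<inter> U. t w = germ w k"
   using secE[OF s(2) z] by blast
  have o: "open_Cn n (N \<inter> N')" using N N' by (intro openin_Int)
  have "holo n (N \<inter> N') h" "holo n (N \<inter> N') k" using holo_subset[OF _ o] N N' by auto
  then show ?thesis using o N N' by (intro exI[of _ "N \<inter> N'"] exI[of _ h] exI[of _ k]) auto
 qed
 show ?thesis
  unfolding c_ringed_space_def pts_model
 proof (intro conjI ballI allI impI)
  fix p assume p: "p \<in> Zs"
  then have pD: "p \<in> D" by simp
  show "cring (stk ?M p)" using cringQ[OF pD] by simp
  show "cst ?M p \<in> ring_hom complex_ring (stk ?M p)"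
   unfolding ring_hom_def complex_ring_def using pD
   by (auto simp: germ_carrier hol_ring_const D_Cn germ_add germ_mult germ_one)
  fix a assume a: "a \<in> germs ?M p"
  obtain h where h: "h \<in> carrier (R p)" "a = germ p h" using germ_surj[OF pD] a by auto
  obtain N where N: "open_Cn n N" "p \<in> N" "holo n N h" using h(1) unfolding hol_ring_carrier by blast
  have o: "open_Cn n (N \<inter> D)" using N(1) D by (rule openin_Int)
  have "(\<lambda>w\<in>Zs \<inter> (N \<inter> D). germ w h) \<in> sec ?M (Zs \<inter> (N \<inter> D))"
   unfolding sec_model using o holo_subset[OF N(3) o] by (auto intro!: exI[of _ "N \<inter> D"] exI[of _ h])
  moreover have "aopen ?M (Zs \<inter> (N \<inter> D))" using openin_Zs[OF o] by simp
  moreover have "p \<in> Zs \<inter> (N \<inter> D)" using p N(2) by simp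
  moreover have "(\<lambda>w\<in>Zs \<inter> (N \<inter> D). germ w h) p = a" using p N(2) h(2) by simp
  ultimately show "\<exists>U. aopen ?M U \<and> p \<in> U \<and> (\<exists>s\<in>sec ?M U. s p = a)" by blast
 next
  fix U assume U0: "aopen ?M U"
  then have U: "openin (top_of_set Zs) U" by simp
  have UD: "U \<subseteq> D" "U \<subseteq> Zs" using openin_imp_subset[OF U] by auto
  show "sec ?M U \<subseteq> (\<Pi>\<^sub>E p\<in>U. germs ?M p)" by (rule sec_carrier)
  show "(\<lambda>p\<in>U. cst ?M p c) \<in> sec ?M U" for c
   unfolding sec_model using D holo_const[OF D] UD by auto
  fix s assume s: "s \<in> sec ?M U"
  show "restrict s W \<in> sec ?M W" if WU: "aopen ?M W \<and> W \<subseteq> U" for W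
   unfolding sec_model
  proof (intro conjI ballI)
   fix z assume z: "z \<in> W"
   have "z \<in> U" using z WU by blast
   from secE[OF s this]
   obtain N h where "open_Cn n N" "z \<in> N" "N \<subseteq> D" "holo n N h" "\<forall>w\<in>N \<inter> U. s w = germ w h" by blast
   then show "\<exists>N h. open_Cn n N \<and> z \<in> N \<and> N \<subseteq> D \<and> holo n N h \<and> (\<forall>w\<in>N \<inter> W. restrict s W w = germ w h)"
    using WU z by (intro exI[of _ N] exI[of _ h]) auto
  qed simp
  fix t assume t: "t \<in> sec ?M U"
  show "(\<lambda>p\<in>U. s p \<oplus>\<^bsub>stk ?M p\<^esub> t p) \<in> sec ?M U"
   unfolding sec_model
  proof (intro conjI ballI)
   fix z assume z: "z \<in> U"
   obtain N h k where N: "open_Cn n N" "z \<in> N" "N \<subseteq> D" "holo n N h" "holo n N k"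
    "\<forall>w\<in>N \<inter> U. s w = germ w h" "\<forall>w\<in>N \<inter> U. t w = germ w k" using two[OF s t z] by blast
   have "s w \<oplus>\<^bsub>stk ?M w\<^esub> t w = germ w (\<lambda>v. h v + k v)" if w: "w \<in> N \<inter> U" for w
    using N(3,6,7) w germ_add[of w h k] holoR[OF N(4,1)] holoR[OF N(5,1)] by auto
   then show "\<exists>N h. open_Cn n N \<and> z \<in> N \<and> N \<subseteq> D \<and> holo n N h \<and> (\<forall>w\<in>N \<inter> U. (\<lambda>p\<in>U. s p \<oplus>\<^bsub>stk ?M p\<^esub> t p) w = germ w h)"
    using N holo_add[OF N(1,4,5)] by (intro exI[of _ N] exI[of _ "\<lambda>v. h v + k v"]) auto
  qed simp
  show "(\<lambda>p\<in>U. s p \<otimes>\<^bsub>stk ?M p\<^esub> t p) \<in> sec ?M U"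
   unfolding sec_model
  proof (intro conjI ballI)
   fix z assume z: "z \<in> U"
   obtain N h k where N: "open_Cn n N" "z \<in> N" "N \<subseteq> D" "holo n N h" "holo n N k"
    "\<forall>w\<in>N \<inter> U. s w = germ w h" "\<forall>w\<in>N \<inter> U. t w = germ w k" using two[OF s t z] by blast
   have "s w \<otimes>\<^bsub>stk ?M w\<^esub> t w = germ w (\<lambda>v. h v * k v)" if w: "w \<in> N \<inter> U" for w
    using N(3,6,7) w germ_mult[of w h k] holoR[OF N(4,1)] holoR[OF N(5,1)] by auto
   then show "\<exists>N h. open_Cn n N \<and> z \<in> N \<and> N \<subseteq> D \<and> holo n N h \<and> (\<forall>w\<in>N \<inter> U. (\<lambda>p\<in>U. s p \<otimes>\<^bsub>stk ?M p\<^esub> t p) w = germ w h)"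
    using N holo_mult[OF N(1,4,5)] by (intro exI[of _ N] exI[of _ "\<lambda>v. h v * k v"]) auto
  qed simp
  fix p assume p: "p \<in> U" and e: "s p = t p"
  obtain N h k where N: "open_Cn n N" "p \<in> N" "N \<subseteq> D" "holo n N h" "holo n N k"
   "\<forall>w\<in>N \<inter> U. s w = germ w h" "\<forall>w\<in>N \<inter> U. t w = germ w k" using two[OF s t p] by blast
  have pD: "p \<in> D" using p UD by auto
  have "germ p h = germ p k" using N p e by auto
  then have "(\<lambda>w. h w - k w) \<in> I p" using germ_eq_iff[OF pD] holoR[OF N(4,1,2)] holoR[OF N(5,1,2)] by simp
  \<comment> \<open>Equality of the two germs at \<open>p\<close> spreads to nearby points by
    \<open>I_nearby\<close>.\<close>
  then obtain N' where N': "open_Cn n N'" "p \<in> N'" "N' \<subseteq> D" "\<And>w. w \<in> N' \<Longrightarrow> (\<lambda>w. h w - k w) \<in> I w"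
   using I_nearby[OF pD] by metis
  have o: "open_Cn n (N \<inter> N')" using N N' by (intro openin_Int)
  have "openin (top_of_set Zs) (U \<inter> (Zs \<inter> (N \<inter> N')))" using U openin_Zs[OF o] by (rule openin_Int)
  moreover have "s w = t w" if w: "w \<in> U \<inter> (Zs \<inter> (N \<inter> N'))" for w
   using w N(6,7) germ_eq_iff[of w h k] holoR[OF N(4,1)] holoR[OF N(5,1)] N'(4) by auto
  then have "restrict s (U \<inter> (Zs \<inter> (N \<inter> N'))) = restrict t (U \<inter> (Zs \<inter> (N \<inter> N')))" by (rule restrict_ext)
  ultimately show "\<exists>W. aopen ?M W \<and> p \<in> W \<and> W \<subseteq> U \<and> restrict s W = restrict t W"
   using p UD N(2) N'(2) by (intro exI[of _ "U \<inter> (Zs \<inter> (N \<inter> N'))"]) auto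
 next
  fix U s
  assume U0: "aopen ?M U" and s: "s \<in> (\<Pi>\<^sub>E p\<in>U. germs ?M p)"
   and loc: "\<forall>p\<in>U. \<exists>W. aopen ?M W \<and> p \<in> W \<and> W \<subseteq> U \<and> restrict s W \<in> sec ?M W"
  show "s \<in> sec ?M U"
   unfolding sec_model
  proof (intro conjI ballI)
   show "s \<in> extensional U" using s by (simp add: PiE_iff)
   fix z assume "z \<in> U"
   then obtain W where W: "openin (top_of_set Zs) W" "z \<in> W" "W \<subseteq> U" "restrict s W \<in> sec ?M W" using loc by auto
   obtain N h where N: "open_Cn n N" "z \<in> N" "N \<subseteq> D" "holo n N h" "\<forall>w\<in>N \<inter> W. restrict s W w = germ w h"
    using secE[OF W(4,2)] by blast
   obtain N' where N': "open_Cn n N'" "N' \<subseteq> D" "W = Zs \<inter> N'" using openin_ZsD[OF W(1)] .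
   have o: "open_Cn n (N \<inter> N')" using N N' by (intro openin_Int)
   have "U \<subseteq> Zs" using openin_subset[OF U0] by simp
   then have "s w = germ w h" if "w \<in> (N \<inter> N') \<inter> U" for w using N(5) N'(3) that by auto
   then show "\<exists>N h. open_Cn n N \<and> z \<in> N \<and> N \<subseteq> D \<and> holo n N h \<and> (\<forall>w\<in>N \<inter> U. s w = germ w h)"
    using o holo_subset[OF N(4) o] N W(2) N'(3) by (intro exI[of _ "N \<inter> N'"] exI[of _ h]) auto
  qed
 qed
qed

text \<open>The ambient coordinates, translated to vanish at \<open>p\<close>, isolate
  \<open>p\<close>; their common non-unit locus is their common zero set by
  \<open>germ_unit_iff\<close>.\<close>

lemma finite_dimensional_model: "finite_dimensional (model n D fs)"
 unfolding finite_dimensional_def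
proof (intro exI[of _ n] ballI)
 let ?M = "model n D fs"
 fix p assume "p \<in> pts ?M"
 then have p: "p \<in> Zs" by simp
 define c where "c i = (\<lambda>w\<in>Zs. germ w (\<lambda>v. v i + - p i))" for i
 have hc: "holo n D (\<lambda>v. v i + - p i)" if "i < n" for i using holo_add[OF D holo_coordinate[OF D that] holo_const[OF D]] .
 have cR: "(\<lambda>v. v i + - p i) \<in> carrier (R w)" if "i < n" "w \<in> D" for i w using hc[OF that(1)] D that(2) unfolding hol_ring_carrier by blast
 have "c i \<in> sec ?M Zs" if "i < n" for i
  unfolding sec_model c_def using D hc[OF that] by (auto intro!: exI[of _ D] exI[of _ "\<lambda>v. v i + - p i"])
 then have 1: "c ` {..<n} \<subseteq> sec ?M Zs" by auto
 have 2: "card (c ` {..<n}) \<le> n" using card_image_le[of "{..<n}" c] by simp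
 have "c i q \<notin> Units (stk ?M q) \<longleftrightarrow> q i = p i" if "i < n" "q \<in> Zs" for i q
 proof -
  have "germ q (\<lambda>v. v i + - p i) \<in> Units (Q q) \<longleftrightarrow> q i + - p i \<noteq> 0"
   by (rule germ_unit_iff[OF that(2) cR]) (use that in auto)
  then show ?thesis using that by (simp add: c_def)
 qed
 then have "{q \<in> Zs. \<forall>s\<in>c ` {..<n}. s q \<notin> Units (stk ?M q)} = {q \<in> Zs. \<forall>i<n. q i = p i}" by auto
 also have "\<dots> = {p}"
 proof -
  have "q = p" if "q \<in> Zs" "\<forall>i<n. q i = p i" for q
  proof
   fix i show "q i = p i" using that p D_Cn[of q] D_Cn[of p] by (cases "i < n") (auto simp: Cn_def)
  qed
  then show ?thesis using p by auto
 qed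
 finally have 3: "{q \<in> Zs. \<forall>s\<in>c ` {..<n}. s q \<notin> Units (stk ?M q)} = {p}" .
 have 4: "aopen ?M Zs" by simp
 show "\<exists>U fs'. aopen ?M U \<and> p \<in> U \<and> fs' \<subseteq> sec ?M U \<and> finite fs' \<and> card fs' \<le> n \<and>
   {q \<in> U. \<forall>s\<in>fs'. s q \<notin> Units (stk ?M q)} = {p}"
  by (intro exI[of _ Zs] exI[of _ "c ` {..<n}"] conjI 1 2 3 4 p finite_imageI finite_lessThan)
qed

end

section \<open>Residue fields\<close>

text \<open>Evaluation of germs: the stalk behaves as a local ring whose residue field is the
  complex numbers.\<close>

definition residue_map :: "'r ring \<Rightarrow> (complex \<Rightarrow> 'r) \<Rightarrow> ('r \<Rightarrow> complex) \<Rightarrow> bool" where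
 "residue_map A e ep \<longleftrightarrow> ep \<in> ring_hom A complex_ring \<and> (\<forall>c. ep (e c) = c) \<and>
  (\<forall>a\<in>carrier A. ep a \<noteq> 0 \<longrightarrow> a \<in> Units A)"

lemma complex_ring_sel [simp]:
 "carrier complex_ring = UNIV" "mult complex_ring = (*)" "one complex_ring = 1"
 "zero complex_ring = 0" "add complex_ring = (+)"
 by (simp_all add: complex_ring_def)

text \<open>A \<open>\<complex>\<close>-algebra map \<open>psi\<close> with \<open>psi a \<noteq> ep a\<close> would kill the unit \<open>a - psi a\<close>.\<close>

lemma residue_map_unique:
 assumes A: "cring A" and e: "e \<in> ring_hom complex_ring A" and r: "residue_map A e ep"
  and psi: "psi \<in> ring_hom A complex_ring" "\<And>c. psi (e c) = c" and a: "a \<in> carrier A"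
 shows "psi a = ep a"
proof (rule ccontr)
 assume ne: "psi a \<noteq> ep a"
 interpret A: cring A by (rule A)
 have ec: "e c \<in> carrier A" for c using ring_hom_closed[OF e] by simp
 let ?b = "a \<oplus>\<^bsub>A\<^esub> e (- psi a)"
 have b: "?b \<in> carrier A" using a ec by simp
 have ep: "ep \<in> ring_hom A complex_ring" "\<And>c. ep (e c) = c" using r by (auto simp: residue_map_def)
 have "ep ?b = ep a - psi a" using ring_hom_add[OF ep(1) a ec] ep(2) by simp
 then have "?b \<in> Units A" using r b ne by (auto simp: residue_map_def)
 then obtain c where c: "c \<in> carrier A" "?b \<otimes>\<^bsub>A\<^esub> c = \<one>\<^bsub>A\<^esub>" unfolding Units_def by auto
 have "psi ?b = 0" using ring_hom_add[OF psi(1) a ec] psi(2) by simp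
 then have "psi \<one>\<^bsub>A\<^esub> = 0" using ring_hom_mult[OF psi(1) b c(1)] c(2) by simp
 then show False using ring_hom_one[OF psi(1)] by simp
qed

lemma (in local_model) residue_map_model:
 assumes z: "z \<in> Zs"
 shows "\<exists>ep. residue_map (stk (model n D fs) z) (cst (model n D fs) z) ep"
proof -
 have zD: "z \<in> D" using z by simp
 \<comment> \<open>A class is evaluated on an arbitrary representative; by \<open>I_vanish\<close>
   the value does not depend on it.\<close>
 define ep where "ep A = (SOME h. h \<in> A) z" for A :: "((nat \<Rightarrow> complex) \<Rightarrow> complex) set"
 have ep: "ep (germ z h) = h z" if h: "h \<in> carrier (R z)" for h
 proof -
  have "h \<in> germ z h" using germ_mem[OF zD h, of h] h I_closed(1)[OF zD] by simp
  then have "(SOME h'. h' \<in> germ z h) \<in> germ z h" using someI[of "\<lambda>h'. h' \<in> germ z h" h] by simp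
  then have "(\<lambda>w. (SOME h'. h' \<in> germ z h) w - h w) \<in> I z" using germ_mem[OF zD h] by blast
  from I_vanish[OF z this] show ?thesis by (simp add: ep_def)
 qed
 have hom: "ep \<in> ring_hom (Q z) complex_ring"
 proof (rule ring_hom_memI)
  fix a assume a: "a \<in> carrier (Q z)"
  obtain g where g: "g \<in> carrier (R z)" "a = germ z g" by (rule germ_surj[OF zD a])
  show "ep a \<in> carrier complex_ring" by simp
  fix b assume b: "b \<in> carrier (Q z)"
  obtain h where h: "h \<in> carrier (R z)" "b = germ z h" by (rule germ_surj[OF zD b])
  show "ep (a \<otimes>\<^bsub>Q z\<^esub> b) = ep a \<otimes>\<^bsub>complex_ring\<^esub> ep b"
   unfolding g(2) h(2) germ_mult[OF zD g(1) h(1)] using ep g(1) h(1) hol_ring_closed(2)[OF g(1) h(1)] by simp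
  show "ep (a \<oplus>\<^bsub>Q z\<^esub> b) = ep a \<oplus>\<^bsub>complex_ring\<^esub> ep b"
   unfolding g(2) h(2) germ_add[OF zD g(1) h(1)] using ep g(1) h(1) hol_ring_closed(1)[OF g(1) h(1)] by simp
 next
  show "ep \<one>\<^bsub>Q z\<^esub> = \<one>\<^bsub>complex_ring\<^esub>"
   unfolding germ_one[OF zD, symmetric] using ep[OF hol_ring_const[OF D_Cn[OF zD]]] by simp
 qed
 have "a \<in> Units (Q z)" if a: "a \<in> carrier (Q z)" "ep a \<noteq> 0" for a
 proof -
  obtain g where g: "g \<in> carrier (R z)" "a = germ z g" by (rule germ_surj[OF zD a(1)])
  then show ?thesis using germ_unit_iff[OF z g(1)] ep[OF g(1)] a(2) by simp
 qed
 then show ?thesis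
  unfolding residue_map_def using hom ep[OF hol_ring_const[OF D_Cn[OF zD]]] by (intro exI[of _ ep]) simp
qed

lemma ring_hom_Units:
 assumes "f \<in> ring_hom A B" "a \<in> Units A"
 shows "f a \<in> Units B"
proof -
 obtain b where "b \<in> carrier A" "a \<in> carrier A" "b \<otimes>\<^bsub>A\<^esub> a = \<one>\<^bsub>A\<^esub>" "a \<otimes>\<^bsub>A\<^esub> b = \<one>\<^bsub>A\<^esub>"
  using assms(2) unfolding Units_def by auto
 then show ?thesis
  unfolding Units_def using ring_hom_closed[OF assms(1)] ring_hom_mult[OF assms(1)] ring_hom_one[OF assms(1)]
  by (metis (mono_tags, lifting) mem_Collect_eq)
qed

lemma analytic_space_residue_map:
 assumes X: "analytic_space X" and p: "p \<in> pts X"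
 shows "\<exists>ep. residue_map (stk X p) (cst X p) ep"
proof -
 obtain U n D fs where U: "aopen X U" "p \<in> U" "open_Cn n D" "\<forall>f\<in>fs. holo n D f"
  "isomorphic_rspaces (open_sub X U) (model n D fs)"
  using X p unfolding analytic_space_def by meson
 interpret local_model n D fs by unfold_locales (use U in auto)
 let ?M = "model n D fs"
 obtain f fi g ga where r: "rmor (open_sub X U) ?M f fi" "rmor ?M (open_sub X U) g ga"
  and gf: "\<And>p. p \<in> pts (open_sub X U) \<Longrightarrow> g (f p) = p \<and> (\<forall>a\<in>germs (open_sub X U) p. fi p (ga (f p) a) = a)"
  using U(5) unfolding isomorphic_rspaces_def by meson
 have pU: "p \<in> pts (open_sub X U)" unfolding pts_open_sub[OF U(1)] by (rule U(2))
 have fp: "f p \<in> pts ?M" using rmorD(5)[OF r(1) pU] .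
 then obtain ep where ep: "residue_map (stk ?M (f p)) (cst ?M (f p)) ep" using residue_map_model pts_model by blast
 have ga: "ga (f p) \<in> ring_hom (stk X p) (stk ?M (f p))" "ga (f p) (cst X p c) = cst ?M (f p) c" for c
  using rmorD(2,3)[OF r(2) fp] gf[OF pU] by simp_all
 have fi: "fi p \<in> ring_hom (stk ?M (f p)) (stk X p)" using rmorD(2)[OF r(1) pU] by simp
 have "a \<in> Units (stk X p)" if a: "a \<in> germs X p" "ep (ga (f p) a) \<noteq> 0" for a
 proof -
  have "ga (f p) a \<in> Units (stk ?M (f p))"
   using ep a ring_hom_closed[OF ga(1) a(1)] unfolding residue_map_def by blast
  from ring_hom_Units[OF fi this] show ?thesis using gf[OF pU] a(1) by simp
 qed
 moreover have "(\<lambda>a. ep (ga (f p) a)) \<in> ring_hom (stk X p) complex_ring"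
  using ring_hom_trans[OF ga(1)] ep unfolding residue_map_def comp_def by blast
 ultimately show ?thesis using ep ga(2) unfolding residue_map_def by (intro exI[of _ "\<lambda>a. ep (ga (f p) a)"]) auto
qed

section \<open>Points\<close>

lemma one_point_spaceE:
 assumes "one_point_space P"
 obtains q io where "analytic_space P" "pts P = {q}" "io \<in> ring_hom (stk P q) complex_ring"
  "\<And>c. io (cst P q c) = c" "\<And>a. a \<in> germs P q \<Longrightarrow> cst P q (io a) = a"
proof -
 obtain q where P: "analytic_space P" "pts P = {q}" "bij_betw (cst P q) UNIV (germs P q)"
  using assms unfolding one_point_space_def by auto
 have c: "cst P q \<in> ring_hom complex_ring (stk P q)"
  using crs_stk(2)[OF crs_of_ana[OF P(1)]] P(2) by simp
 define io where "io = inv_into UNIV (cst P q)"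
 have inj: "inj (cst P q)" using P(3) by (simp add: bij_betw_def)
 have 1: "io (cst P q c) = c" for c unfolding io_def using inj by (rule inv_f_f)
 have 2: "cst P q (io a) = a" if "a \<in> germs P q" for a
  unfolding io_def using that P(3) by (intro f_inv_into_f) (simp add: bij_betw_def)
 have "io \<in> ring_hom (stk P q) complex_ring"
 proof (rule ring_hom_memI)
  fix a b assume ab: "a \<in> germs P q" "b \<in> germs P q"
  have "cst P q (io a * io b) = a \<otimes>\<^bsub>stk P q\<^esub> b" using ring_hom_mult[OF c, of "io a" "io b"] 2 ab by simp
  then show "io (a \<otimes>\<^bsub>stk P q\<^esub> b) = io a \<otimes>\<^bsub>complex_ring\<^esub> io b" using 1 by (metis complex_ring_sel(2))
  have "cst P q (io a + io b) = a \<oplus>\<^bsub>stk P q\<^esub> b" using ring_hom_add[OF c, of "io a" "io b"] 2 ab by simp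
  then show "io (a \<oplus>\<^bsub>stk P q\<^esub> b) = io a \<oplus>\<^bsub>complex_ring\<^esub> io b" using 1 by (metis complex_ring_sel(5))
 next
  have "cst P q 1 = \<one>\<^bsub>stk P q\<^esub>" using ring_hom_one[OF c] by simp
  then show "io \<one>\<^bsub>stk P q\<^esub> = \<one>\<^bsub>complex_ring\<^esub>" using 1 by (metis complex_ring_sel(3))
 qed simp
 then show ?thesis using that P(1,2) 1 2 by blast
qed

text \<open>The stalk of a reduced point is the field of complex numbers, and by
  \<open>residue_map_unique\<close> the only algebra map into it is evaluation. Hence the image
  point determines the whole morphism.\<close>

lemma point_unique:
 assumes P: "one_point_space P" "pts P = {q}" and k: "k \<in> ahom P X" "k' \<in> ahom P X"
  and e: "mfun k q = mfun k' q"
 shows "k = k'"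
proof (rule ana_hom_eqI[OF k])
 obtain q' io where "pts P = {q'}" and io: "io \<in> ring_hom (stk P q') complex_ring"
  "\<And>c. io (cst P q' c) = c" "\<And>a. a \<in> germs P q' \<Longrightarrow> cst P q' (io a) = a"
  using one_point_spaceE[OF P(1)] by metis
 then have q': "q' = q" using P(2) by simp
 note io = io[unfolded q']
 have qP: "q \<in> pts P" using P(2) by simp
 let ?x = "mfun k q"
 have X: "analytic_space X" and x: "?x \<in> pts X" using ana_homD(4)[OF k(1)] ana_homD(6)[OF k(1) qP] by auto
 obtain ep where ep: "residue_map (stk X ?x) (cst X ?x) ep" using analytic_space_residue_map[OF X x] by blast
 have ev: "mgerm m q a = cst P q (ep a)" if m: "m \<in> ahom P X" "mfun m q = ?x" and a: "a \<in> germs X ?x" for m a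
 proof -
  have h: "mgerm m q \<in> ring_hom (stk X ?x) (stk P q)" "\<And>c. mgerm m q (cst X ?x c) = cst P q c"
   using rmorD(2,3)[OF ana_homD(5)[OF m(1)] qP] m(2) by simp_all
  have "(\<lambda>a. io (mgerm m q a)) \<in> ring_hom (stk X ?x) complex_ring"
   using ring_hom_trans[OF h(1) io(1)] by (simp add: comp_def)
  from residue_map_unique[OF crs_stk[OF crs_of_ana[OF X] x] ep this _ a]
  have "io (mgerm m q a) = ep a" using h(2) io(2) by simp
  then show ?thesis using io(3)[OF ring_hom_closed[OF h(1) a]] by simp
 qed
 fix p assume "p \<in> pts P"
 then have p: "p = q" using P(2) by simp
 show "mfun k p = mfun k' p" using e p by simp
 fix a assume "a \<in> germs X (mfun k p)"
 then show "mgerm k p a = mgerm k' p a" using ev[OF k(1) refl] ev[OF k(2) e[symmetric]] p by simp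
qed

text \<open>The germ map is evaluation followed by the structure map of the reduced point.\<close>

lemma point_exists:
 assumes P: "one_point_space P" "pts P = {q}" and X: "analytic_space X" and x: "x \<in> pts X"
 obtains k where "k \<in> ahom P X" "mfun k q = x"
proof -
 have aP: "analytic_space P" using P(1) by (simp add: one_point_space_def)
 have qP: "q \<in> pts P" using P(2) by simp
 obtain ep where ep: "residue_map (stk X x) (cst X x) ep" using analytic_space_residue_map[OF X x] by blast
 let ?fi = "\<lambda>p a. cst P q (ep a)"
 note cP = crs_of_ana[OF aP]
 have c: "cst P q \<in> ring_hom complex_ring (stk P q)" using crs_stk(2)[OF cP qP] .
 have "rmor P X (\<lambda>p. x) ?fi"
  unfolding rmor_def
 proof (intro conjI ballI allI impI)
  show "continuous_map (tp P) (tp X) (\<lambda>p. x)" using x by simp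
  fix p assume "p \<in> pts P"
  then have p: "p = q" using P(2) by simp
  show "?fi p \<in> ring_hom (stk X x) (stk P p)"
   using ring_hom_trans[of ep "stk X x" complex_ring "cst P q" "stk P q"] ep c p unfolding residue_map_def comp_def by simp
  show "?fi p (cst X x c) = cst P p c" for c using ep p unfolding residue_map_def by simp
 next
  fix V s assume V: "aopen X V" "s \<in> sec X V"
  define A where "A = {p \<in> pts P. x \<in> V}"
  have "A = pts P \<or> A = {}"  by (auto simp: A_def)
  then have oA: "aopen P A" by auto
  have "(\<lambda>p\<in>A. ?fi p (s x)) = (\<lambda>p\<in>A. cst P p (ep (s x)))" by (rule restrict_ext) (use P(2) A_def in auto)
  then have "(\<lambda>p\<in>A. ?fi p (s x)) \<in> sec P A" using crs_sec(2)[OF cP oA, of "ep (s x)"] by simp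
  then show "(\<lambda>p\<in>{p \<in> pts P. x \<in> V}. ?fi p (s x)) \<in> sec P {p \<in> pts P. x \<in> V}" unfolding A_def .
 qed
 then have "mk_amor P X (\<lambda>p. x) ?fi \<in> ahom P X" by (rule mk_amor_hom[OF aP X])
 then show ?thesis using that mk_amor_sel(1)[OF qP] by metis
qed

text \<open>Functions are pulled back along the projection. This descends to germs because the
  equations of the target are pulled back to equations of the source, so ideals map into
  ideals.\<close>

lemma rmor_coord_map:
 assumes M: "local_model n D fs" and M': "local_model m D' fs'"
  and inj: "inj_on sg {..<n}" "sg ` {..<n} \<subseteq> {..<m}"
  and D: "\<And>w. w \<in> D' \<Longrightarrow> coord_map n sg w \<in> D"
  and fs: "\<And>f. f \<in> fs \<Longrightarrow> (\<lambda>w. f (coord_map n sg w)) \<in> fs'"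
 shows "\<exists>fi. rmor (model m D' fs') (model n D fs) (coord_map n sg) fi"
proof -
 interpret M: local_model n D fs by (rule M)
 interpret N: local_model m D' fs' by (rule M')
 let ?k = "coord_map n sg"
 have pull: "(\<lambda>w. h (?k w)) \<in> carrier (N.R z)" if h: "h \<in> carrier (M.R (?k z))" and z: "z \<in> D'" for h z
 proof -
  obtain N where N: "open_Cn n N" "?k z \<in> N" "holo n N h" using h unfolding hol_ring_carrier by blast
  show ?thesis
   unfolding hol_ring_carrier
   using open_coord_map_vimage[OF N(1), of m sg] holo_coord_map[OF N(1,3) inj] N(2) N.D_Cn[OF z] by blast
 qed
 have pullI: "(\<lambda>w. h (?k w)) \<in> N.I z" if h: "h \<in> M.I (?k z)" and z: "z \<in> D'" for h z
 proof -
  let ?J = "{h \<in> carrier (M.R (?k z)). (\<lambda>w. h (?k w)) \<in> N.I z}"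
  note kz = D[OF z]
  have "M.I (?k z) \<subseteq> ?J"
  proof (rule M.I_minimal[OF kz])
   show "ideal ?J (M.R (?k z))"
    by (rule M.hol_ideal[OF kz])
     (use hol_ring_const[OF M.D_Cn[OF kz]] hol_ring_closed N.I_closed[OF z] pull[OF _ z] in auto)
   show "fs \<subseteq> ?J" using fs N.I_gens(1)[OF z] M.gens[OF kz] by blast
   fix h :: "(nat \<Rightarrow> complex) \<Rightarrow> complex" and N assume N: "open_Cn n N" "?k z \<in> N" "\<And>w. w \<in> N \<Longrightarrow> h w = 0"
   have "(\<lambda>w. h (?k w)) \<in> N.I z"
    by (rule N.I_gens(2)[OF z open_coord_map_vimage[OF N(1), of m sg]]) (use N N.D_Cn[OF z] in auto)
   then show "h \<in> ?J" using M.I_carrier[OF kz M.I_gens(2)[OF kz N]] by simp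
  qed
  then show ?thesis using h by blast
 qed
 \<comment> \<open>Pulls back an arbitrary representative of the class; \<open>pullI\<close> makes
   the resulting germ independent of that choice.\<close>
 define fi where "fi z A = N.germ z (\<lambda>w. (SOME h. h \<in> A) (?k w))" for z and A :: "((nat \<Rightarrow> complex) \<Rightarrow> complex) set"
 have fi: "fi z (M.germ (?k z) h) = N.germ z (\<lambda>w. h (?k w))" if h: "h \<in> carrier (M.R (?k z))" and z: "z \<in> D'" for h z
 proof -
  note kz = D[OF z]
  have "h \<in> M.germ (?k z) h" using M.germ_mem[OF kz h, of h] h M.I_closed(1)[OF kz] by simp
  then have "(SOME h'. h' \<in> M.germ (?k z) h) \<in> M.germ (?k z) h" using someI[of "\<lambda>h'. h' \<in> M.germ (?k z) h" h] by simp
  then have s: "(SOME h'. h' \<in> M.germ (?k z) h) \<in> carrier (M.R (?k z))"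
   "(\<lambda>w. (SOME h'. h' \<in> M.germ (?k z) h) w - h w) \<in> M.I (?k z)" using M.germ_mem[OF kz h] by blast+
  show ?thesis unfolding fi_def N.germ_eq_iff[OF z pull[OF s(1) z] pull[OF h z]] using pullI[OF s(2) z] .
 qed
 have kZ: "?k w \<in> M.Zs" if "w \<in> N.Zs" for w using that D fs by auto
 have "rmor (model m D' fs') (model n D fs) ?k fi"
  unfolding rmor_def N.pts_model
 proof (intro conjI ballI allI impI)
  show "continuous_map (tp (model m D' fs')) (tp (model n D fs)) ?k"
   using continuous_coord_map[of N.Zs n sg] kZ by auto
  fix z assume z: "z \<in> N.Zs"
  then have zD: "z \<in> D'" by simp
  note kz = D[OF zD]
  show "fi z \<in> ring_hom (stk (model n D fs) (?k z)) (stk (model m D' fs') z)"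
  proof (rule ring_hom_memI)
   fix a assume "a \<in> germs (model n D fs) (?k z)"
   then obtain g where g: "g \<in> carrier (M.R (?k z))" "a = M.germ (?k z) g" using M.germ_surj[OF kz] by auto
   show "fi z a \<in> germs (model m D' fs') z" unfolding g(2) fi[OF g(1) zD] using N.germ_carrier[OF zD pull[OF g(1) zD]] by simp
   fix b assume "b \<in> germs (model n D fs) (?k z)"
   then obtain h where h: "h \<in> carrier (M.R (?k z))" "b = M.germ (?k z) h" using M.germ_surj[OF kz] by auto
   show "fi z (a \<otimes>\<^bsub>stk (model n D fs) (?k z)\<^esub> b) = fi z a \<otimes>\<^bsub>stk (model m D' fs') z\<^esub> fi z b"
    unfolding g(2) h(2) model_sel M.germ_mult[OF kz g(1) h(1)] fi[OF g(1) zD] fi[OF h(1) zD]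
     fi[OF hol_ring_closed(2)[OF g(1) h(1)] zD] N.germ_mult[OF zD pull[OF g(1) zD] pull[OF h(1) zD]] ..
   show "fi z (a \<oplus>\<^bsub>stk (model n D fs) (?k z)\<^esub> b) = fi z a \<oplus>\<^bsub>stk (model m D' fs') z\<^esub> fi z b"
    unfolding g(2) h(2) model_sel M.germ_add[OF kz g(1) h(1)] fi[OF g(1) zD] fi[OF h(1) zD]
     fi[OF hol_ring_closed(1)[OF g(1) h(1)] zD] N.germ_add[OF zD pull[OF g(1) zD] pull[OF h(1) zD]] ..
  next
   show "fi z \<one>\<^bsub>stk (model n D fs) (?k z)\<^esub> = \<one>\<^bsub>stk (model m D' fs') z\<^esub>"
    unfolding model_sel M.germ_one[OF kz, symmetric] N.germ_one[OF zD, symmetric]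
     fi[OF hol_ring_const[OF M.D_Cn[OF kz]] zD] ..
  qed
  show "fi z (cst (model n D fs) (?k z) c) = cst (model m D' fs') z c" for c
   unfolding model_sel fi[OF hol_ring_const[OF M.D_Cn[OF kz]] zD] ..
 next
  fix V s assume V: "aopen (model n D fs) V" and s: "s \<in> sec (model n D fs) V"
  let ?W = "{p \<in> N.Zs. ?k p \<in> V}"
  show "(\<lambda>p\<in>?W. fi p (s (?k p))) \<in> sec (model m D' fs') ?W"
   unfolding N.sec_model
  proof (intro conjI ballI)
   fix z assume z: "z \<in> ?W"
   then obtain N h where N: "open_Cn n N" "?k z \<in> N" "N \<subseteq> D" "holo n N h" "\<forall>w\<in>N \<inter> V. s w = M.germ w h"
    using s unfolding M.sec_model by blast
   let ?N = "{w \<in> Cn m. ?k w \<in> N} \<inter> D'"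
   have o1: "open_Cn m {w \<in> Cn m. ?k w \<in> N}" by (rule open_coord_map_vimage[OF N(1)])
   have o: "open_Cn m ?N" using o1 N.D by (rule openin_Int)
   have hh: "holo m ?N (\<lambda>w. h (?k w))" by (rule holo_subset[OF holo_coord_map[OF N(1,4) inj] o]) blast
   have "(\<lambda>p\<in>?W. fi p (s (?k p))) w = N.germ w (\<lambda>v. h (?k v))" if w: "w \<in> ?N \<inter> ?W" for w
   proof -
    have "h \<in> carrier (M.R (?k w))" using N w unfolding hol_ring_carrier by blast
    then have "fi w (M.germ (?k w) h) = N.germ w (\<lambda>v. h (?k v))" using fi w by blast
    moreover have "s (?k w) = M.germ (?k w) h" using N(5) w by blast
    ultimately show ?thesis using w by simp
   qed
   moreover have "z \<in> ?N" using z N(2) N.D_Cn by auto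
   ultimately show "\<exists>N h. open_Cn m N \<and> z \<in> N \<and> N \<subseteq> D' \<and> holo m N h \<and>
     (\<forall>w\<in>N \<inter> ?W. (\<lambda>p\<in>?W. fi p (s (?k p))) w = N.germ w h)"
    using o hh by (intro exI[of _ ?N] exI[of _ "\<lambda>w. h (?k w)"] conjI ballI) auto
  qed simp
 qed
 then show ?thesis by blast
qed

section \<open>Cardinality\<close>

text \<open>A sequence of complex numbers is coded as one set of naturals: pairing separates the
  entries, even positions carry real parts and odd positions imaginary parts. Such a set is then
  coded by a real number.\<close>

lemma inj_nat_complex: "\<exists>f :: (nat \<Rightarrow> complex) \<Rightarrow> complex. inj f"
proof -
 obtain e :: "nat set \<Rightarrow> real" where e: "bij e"
  using nat_sets_eqpoll_reals unfolding eqpoll_def by blast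
 define d where "d = inv_into UNIV e"
 have d: "inj d" unfolding d_def using e by (simp add: bij_imp_bij_inv bij_is_inj)
 define S where "S z = {x. \<exists>k m. x = prod_encode (k, 2 * m) \<and> m \<in> d (Re (z k)) \<or> x = prod_encode (k, 2 * m + 1) \<and> m \<in> d (Im (z k))}"
  for z :: "nat \<Rightarrow> complex"
 have even: "prod_encode (k, 2 * m) \<in> S z \<longleftrightarrow> m \<in> d (Re (z k))" and odd: "prod_encode (k, 2 * m + 1) \<in> S z \<longleftrightarrow> m \<in> d (Im (z k))" for k m z
  unfolding S_def by (auto; presburger)+
 have "inj S"
 proof (rule injI, rule ext)
  fix y z :: "nat \<Rightarrow> complex" and k assume S: "S y = S z"
  have "d (Re (y k)) = d (Re (z k))" using even[of k _ y] even[of k _ z] S by auto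
  moreover have "d (Im (y k)) = d (Im (z k))" using odd[of k _ y] odd[of k _ z] S by auto
  ultimately show "y k = z k" using d by (simp add: complex_eq_iff inj_eq)
 qed
 moreover have "inj (\<lambda>A. complex_of_real (e A))" using e by (auto simp: inj_def bij_def)
 ultimately have "inj (\<lambda>z. complex_of_real (e (S z)))" by (auto simp: inj_def)
 then show ?thesis by blast
qed

lemma countable_multi_idx: "countable (midx n)"
proof (rule countable_image_inj_on)
 have "(\<lambda>al. map al [0..<n]) ` midx n \<subseteq> UNIV" by simp
 then show "countable ((\<lambda>al. map al [0..<n]) ` midx n)" by (rule countable_subset) simp
 show "inj_on (\<lambda>al. map al [0..<n]) (midx n)"
 proof (rule inj_onI, rule ext)
  fix al be i assume *: "al \<in> midx n" "be \<in> midx n" "map al [0..<n] = map be [0..<n]"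
  then show "al i = be i" by (cases "i < n") (auto simp: midx_def map_eq_conv)
 qed
qed

text \<open>A germ has a representative given near \<open>z\<close> by a power series, hence is
  determined by countably many coefficients. The coefficients come from a chosen representative; for
  injectivity this suffices.\<close>

lemma (in local_model) germs_embed:
 assumes z: "z \<in> D"
 shows "\<exists>f :: ((nat \<Rightarrow> complex) \<Rightarrow> complex) set \<Rightarrow> complex. inj_on f (carrier (Q z))"
proof -
 have "\<exists>h c N. a = germ z h \<and> h \<in> carrier (R z) \<and> open_Cn n N \<and> z \<in> N \<and> pseries n c z N h" if a: "a \<in> carrier (Q z)" for a
 proof -
  obtain h where h: "h \<in> carrier (R z)" "a = germ z h" by (rule germ_surj[OF z a])
  obtain N where N: "open_Cn n N" "z \<in> N" "holo n N h" using h(1) unfolding hol_ring_carrier by blast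
  then show ?thesis using h unfolding holo_alt by blast
 qed
 then obtain h c N where hcN: "\<And>a. a \<in> carrier (Q z) \<Longrightarrow> a = germ z (h a) \<and> h a \<in> carrier (R z) \<and>
  open_Cn n (N a) \<and> z \<in> N a \<and> pseries n (c a) z (N a) (h a)" by metis
 obtain f :: "(nat \<Rightarrow> complex) \<Rightarrow> complex" where f: "inj f" using inj_nat_complex by blast
 define g where "g a = f (\<lambda>k. c a (from_nat_into (midx n) k))" for a
 have "inj_on g (carrier (Q z))"
 proof (rule inj_onI)
  fix a b assume ab: "a \<in> carrier (Q z)" "b \<in> carrier (Q z)" "g a = g b"
  note A = hcN[OF ab(1)] and B = hcN[OF ab(2)]
  have "(\<lambda>k. c a (from_nat_into (midx n) k)) = (\<lambda>k. c b (from_nat_into (midx n) k))"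
   using ab(3) f unfolding g_def by (simp add: inj_eq)
  then have c: "c a al = c b al" if "al \<in> midx n" for al
   using from_nat_into_to_nat_on[OF countable_multi_idx that] by metis
  have "h a w = h b w" if w: "w \<in> N a \<inter> N b" for w
  proof -
   have "((\<lambda>al. c a al * mpow n (\<lambda>i. w i - z i) al) has_sum h a w) (midx n)"
    "((\<lambda>al. c b al * mpow n (\<lambda>i. w i - z i) al) has_sum h b w) (midx n)"
    using A B w unfolding pseries_def by auto
   moreover have "((\<lambda>al. c a al * mpow n (\<lambda>i. w i - z i) al) has_sum h a w) (midx n) \<longleftrightarrow>
    ((\<lambda>al. c b al * mpow n (\<lambda>i. w i - z i) al) has_sum h a w) (midx n)"
    by (rule has_sum_cong) (simp add: c)
   ultimately show ?thesis using has_sum_unique by blast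
  qed
  moreover have "open_Cn n (N a \<inter> N b)" "z \<in> N a \<inter> N b" using A B by (auto intro: openin_Int)
  ultimately have "germ z (h a) = germ z (h b)" using germ_cong_near[OF z] A B by blast
  then show "a = b" using A B by metis
 qed
 then show ?thesis by blast
qed

section \<open>Transport of structure\<close>

text \<open>Structure is carried along one injection of points and a separate injection of germs at
  each point; the images for different points may overlap.\<close>

locale transport =
 fixes M :: "('p, 'r) rspace" and i :: "'p \<Rightarrow> 'u" and J :: "'p \<Rightarrow> 'r \<Rightarrow> 'u"
 assumes M: "c_ringed_space M" and i: "inj_on i (pts M)"
  and J: "\<And>p. p \<in> pts M \<Longrightarrow> inj_on (J p) (germs M p)"
begin

definition ri where "ri = inv_into (pts M) i"
definition K where "K p = inv_into (germs M p) (J p)"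

definition cp :: "'u aspace" where
 "cp = \<lparr>tp = pullback_topology (i ` pts M) ri (tp M),
   stk = (\<lambda>q. \<lparr>carrier = J (ri q) ` germs M (ri q),
    mult = (\<lambda>a b. J (ri q) (K (ri q) a \<otimes>\<^bsub>stk M (ri q)\<^esub> K (ri q) b)),
    one = J (ri q) \<one>\<^bsub>stk M (ri q)\<^esub>, zero = J (ri q) \<zero>\<^bsub>stk M (ri q)\<^esub>,
    add = (\<lambda>a b. J (ri q) (K (ri q) a \<oplus>\<^bsub>stk M (ri q)\<^esub> K (ri q) b))\<rparr>),
   cst = (\<lambda>q c. J (ri q) (cst M (ri q) c)),
   sec = (\<lambda>V. {s \<in> (\<Pi>\<^sub>E q\<in>V. J (ri q) ` germs M (ri q)).
    (\<lambda>p\<in>{p \<in> pts M. i p \<in> V}. K p (s (i p))) \<in> sec M {p \<in> pts M. i p \<in> V}})\<rparr>"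

lemma ri: "p \<in> pts M \<Longrightarrow> ri (i p) = p"
 unfolding ri_def using i by (rule inv_into_f_f)

lemma KJ: "p \<in> pts M \<Longrightarrow> a \<in> germs M p \<Longrightarrow> K p (J p a) = a"
 unfolding K_def using J by (simp add: inv_into_f_f)

lemma pts_cp: "pts cp = i ` pts M"
 using ri by (auto simp: cp_def topspace_pullback_topology)

lemma openin_cp: "aopen cp V \<longleftrightarrow> V \<subseteq> i ` pts M \<and> aopen M {p \<in> pts M. i p \<in> V}"
proof
 assume "aopen cp V"
 then obtain U where U: "aopen M U" "V = ri -` U \<inter> i ` pts M"
  by (auto simp: cp_def openin_pullback_topology)
 have "i p \<in> V \<longleftrightarrow> p \<in> U" if "p \<in> pts M" for p using U(2) ri[OF that] that by simp
 then have "{p \<in> pts M. i p \<in> V} = U" using openin_subset[OF U(1)] by auto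
 then show "V \<subseteq> i ` pts M \<and> aopen M {p \<in> pts M. i p \<in> V}" using U by auto
next
 assume V: "V \<subseteq> i ` pts M \<and> aopen M {p \<in> pts M. i p \<in> V}"
 moreover have "V = ri -` {p \<in> pts M. i p \<in> V} \<inter> i ` pts M" using V ri by auto
 ultimately show "aopen cp V" by (auto simp: cp_def openin_pullback_topology)
qed

lemma stk_cp:
 assumes p: "p \<in> pts M"
 shows "cring (stk cp (i p))" "J p \<in> ring_hom (stk M p) (stk cp (i p))" "K p \<in> ring_hom (stk cp (i p)) (stk M p)"
  "germs cp (i p) = J p ` germs M p" "cst cp (i p) c = J p (cst M p c)"
proof -
 interpret R: cring "stk M p" using crs_stk(1)[OF M p] .
 let ?S = "stk cp (i p)"
 show car: "carrier ?S = J p ` germs M p" and cs: "cst cp (i p) c = J p (cst M p c)" using ri[OF p] by (simp_all add: cp_def)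
 have ops: "mult ?S = (\<lambda>a b. J p (K p a \<otimes>\<^bsub>stk M p\<^esub> K p b))" "add ?S = (\<lambda>a b. J p (K p a \<oplus>\<^bsub>stk M p\<^esub> K p b))"
  "one ?S = J p \<one>\<^bsub>stk M p\<^esub>" "zero ?S = J p \<zero>\<^bsub>stk M p\<^esub>" using ri[OF p] by (simp_all add: cp_def)
 show hom: "J p \<in> ring_hom (stk M p) ?S"
  by (rule ring_hom_memI) (auto simp: car ops KJ[OF p])
 show "K p \<in> ring_hom ?S (stk M p)"
  by (rule ring_hom_memI) (auto simp: car ops KJ[OF p])
 have "J p \<in> ring_iso (stk M p) ?S"
  using hom J[OF p] by (simp add: ring_iso_def bij_betw_def car)
 from R.ring_iso_imp_img_cring[OF this] show "cring ?S"
  by (simp add: ops[symmetric])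
qed

lemma sec_cp: "s \<in> sec cp V \<longleftrightarrow> s \<in> (\<Pi>\<^sub>E q\<in>V. J (ri q) ` germs M (ri q)) \<and>
    (\<lambda>p\<in>{p \<in> pts M. i p \<in> V}. K p (s (i p))) \<in> sec M {p \<in> pts M. i p \<in> V}"
 by (simp add: cp_def)

lemma sec_cp_carrier:
 assumes "s \<in> sec cp V" "p \<in> pts M" "i p \<in> V"
 obtains a where "a \<in> germs M p" "s (i p) = J p a" "K p (s (i p)) = a"
 using assms KJ ri by (force simp: sec_cp PiE_iff)

text \<open>Each axiom is checked on the section of \<open>M\<close> sending \<open>p\<close> to
  \<open>K p (s (i p))\<close>, where it becomes the corresponding axiom of
  \<open>M\<close>.\<close>

lemma crs_cp: "c_ringed_space cp"
proof -
 let ?pre = "\<lambda>V. {p \<in> pts M. i p \<in> V}"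
 have sub: "?pre W \<subseteq> ?pre V" if "W \<subseteq> V" for V W using that by auto
 have img: "aopen cp (i ` W)" "?pre (i ` W) = W" if W: "aopen M W" for W
 proof -
  have s: "W \<subseteq> pts M" by (rule openin_subset[OF W])
  show "?pre (i ` W) = W" using s inj_on_image_mem_iff[OF i _ s] by auto
  then show "aopen cp (i ` W)" unfolding openin_cp using W by auto
 qed
 show ?thesis
  unfolding c_ringed_space_def pts_cp
 proof (intro conjI ballI allI impI)
  fix q assume "q \<in> i ` pts M"
  then obtain p where p: "p \<in> pts M" "q = i p" by blast
  note S = stk_cp[OF p(1)] and R = crs_stk[OF M p(1)]
  show "cring (stk cp q)" using S(1) p(2) by simp
  have "(\<lambda>c. J p (cst M p c)) \<in> ring_hom complex_ring (stk cp (i p))"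
   using ring_hom_trans[OF R(2) S(2)] by (simp add: comp_def)
  moreover have "cst cp (i p) = (\<lambda>c. J p (cst M p c))" using S(5) by auto
  ultimately show "cst cp q \<in> ring_hom complex_ring (stk cp q)" using p(2) by simp
  fix a assume "a \<in> germs cp q"
  then obtain b where b: "b \<in> germs M p" "a = J p b" using S(4) p(2) by auto
  obtain U s where U: "aopen M U" "p \<in> U" "s \<in> sec M U" "s p = b" using crs_germ[OF M p(1) b(1)] .
  let ?s = "\<lambda>q\<in>i ` U. J (ri q) (s (ri q))"
  have sU: "U \<subseteq> pts M" using openin_subset[OF U(1)] .
  have car: "s v \<in> germs M v" if "v \<in> U" for v by (rule crs_sec_carrier[OF M U(1,3) that])
  have "(\<lambda>v\<in>U. K v (?s (i v))) = restrict s U"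
   using sU ri KJ car by (intro restrict_ext) (auto simp: subset_iff)
  then have "(\<lambda>v\<in>?pre (i ` U). K v (?s (i v))) \<in> sec M (?pre (i ` U))"
   unfolding img(2)[OF U(1)] using crs_sec(5)[OF M U(1,3,1) order_refl] by simp
  moreover have "?s \<in> (\<Pi>\<^sub>E q\<in>i ` U. J (ri q) ` germs M (ri q))" using car ri sU by (auto simp: subset_iff)
  ultimately have "?s \<in> sec cp (i ` U)" unfolding sec_cp by blast
  moreover have "?s q = a" using p(2) U(2,4) ri[OF p(1)] b(2) by simp
  ultimately show "\<exists>U. aopen cp U \<and> q \<in> U \<and> (\<exists>s\<in>sec cp U. s q = a)"
   using img(1)[OF U(1)] p(2) U(2) by (intro exI[of _ "i ` U"]) blast
 next
  fix V assume V: "aopen cp V"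
  then have V': "V \<subseteq> i ` pts M" "aopen M (?pre V)" unfolding openin_cp by auto
  have carE: "\<exists>p\<in>pts M. q = i p" if "q \<in> V" for q using V' that by auto
  have car: "J (ri q) ` germs M (ri q) = germs cp q" for q by (simp add: cp_def)
  show "sec cp V \<subseteq> (\<Pi>\<^sub>E p\<in>V. germs cp p)"
   by (auto simp: sec_cp car)
  show "(\<lambda>p\<in>V. cst cp p c) \<in> sec cp V" for c
  proof -
   have cM: "cst M p c \<in> germs M p" if "p \<in> pts M" for p
    using ring_hom_closed[OF crs_stk(2)[OF M that]] by simp
   have "(\<lambda>p\<in>?pre V. K p ((\<lambda>p\<in>V. cst cp p c) (i p))) = (\<lambda>p\<in>?pre V. cst M p c)"
    by (rule restrict_ext) (auto simp: stk_cp(5) KJ cM)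
   then have "(\<lambda>p\<in>?pre V. K p ((\<lambda>p\<in>V. cst cp p c) (i p))) \<in> sec M (?pre V)"
    using crs_sec(2)[OF M V'(2)] by simp
   moreover have "cst cp q c \<in> germs cp q" if "q \<in> V" for q
    using carE[OF that] cM by (auto simp: stk_cp(4,5))
   ultimately show ?thesis unfolding sec_cp car by simp
  qed
  fix s assume s: "s \<in> sec cp V"
  note s' = conjunct2[OF s[unfolded sec_cp]]
  show "restrict s W \<in> sec cp W" if W: "aopen cp W \<and> W \<subseteq> V" for W
  proof -
   have "aopen M (?pre W)" using W unfolding openin_cp by blast
   from crs_sec(5)[OF M V'(2) s' this sub]
   have "restrict (\<lambda>p\<in>?pre V. K p (s (i p))) (?pre W) \<in> sec M (?pre W)" using W by blast
   moreover have "restrict (\<lambda>p\<in>?pre V. K p (s (i p))) (?pre W) = (\<lambda>p\<in>?pre W. K p (restrict s W (i p)))"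
    using W by (intro ext) auto
   ultimately show ?thesis using s W unfolding sec_cp by (auto simp: PiE_iff)
  qed
  fix t assume t: "t \<in> sec cp V"
  note t' = conjunct2[OF t[unfolded sec_cp]]
  show "(\<lambda>p\<in>V. s p \<oplus>\<^bsub>stk cp p\<^esub> t p) \<in> sec cp V"
  proof -
   have e: "s (i p) \<in> germs cp (i p) \<and> t (i p) \<in> germs cp (i p)" if "p \<in> pts M" "i p \<in> V" for p
    using s t that by (auto simp: sec_cp car PiE_iff)
   have "(\<lambda>p\<in>?pre V. K p ((\<lambda>p\<in>V. s p \<oplus>\<^bsub>stk cp p\<^esub> t p) (i p))) =
    (\<lambda>p\<in>?pre V. (\<lambda>p\<in>?pre V. K p (s (i p))) p \<oplus>\<^bsub>stk M p\<^esub> (\<lambda>p\<in>?pre V. K p (t (i p))) p)"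
    using e ring_hom_add[OF stk_cp(3)] by (intro restrict_ext) simp
   moreover have "s q \<oplus>\<^bsub>stk cp q\<^esub> t q \<in> germs cp q" if q: "q \<in> V" for q
   proof -
    obtain p where p: "p \<in> pts M" "q = i p" using carE[OF q] by blast
    interpret cring "stk cp (i p)" by (rule stk_cp(1)[OF p(1)])
    show ?thesis using e[OF p(1)] q p(2) by simp
   qed
   ultimately show ?thesis unfolding sec_cp car using crs_sec(3)[OF M V'(2) s' t'] by simp
  qed
  show "(\<lambda>p\<in>V. s p \<otimes>\<^bsub>stk cp p\<^esub> t p) \<in> sec cp V"
  proof -
   have e: "s (i p) \<in> germs cp (i p) \<and> t (i p) \<in> germs cp (i p)" if "p \<in> pts M" "i p \<in> V" for p
    using s t that by (auto simp: sec_cp car PiE_iff)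
   have "(\<lambda>p\<in>?pre V. K p ((\<lambda>p\<in>V. s p \<otimes>\<^bsub>stk cp p\<^esub> t p) (i p))) =
    (\<lambda>p\<in>?pre V. (\<lambda>p\<in>?pre V. K p (s (i p))) p \<otimes>\<^bsub>stk M p\<^esub> (\<lambda>p\<in>?pre V. K p (t (i p))) p)"
    using e ring_hom_mult[OF stk_cp(3)] by (intro restrict_ext) simp
   moreover have "s q \<otimes>\<^bsub>stk cp q\<^esub> t q \<in> germs cp q" if q: "q \<in> V" for q
   proof -
    obtain p where p: "p \<in> pts M" "q = i p" using carE[OF q] by blast
    interpret cring "stk cp (i p)" by (rule stk_cp(1)[OF p(1)])
    show ?thesis using e[OF p(1)] q p(2) by simp
   qed
   ultimately show ?thesis unfolding sec_cp car using crs_sec(4)[OF M V'(2) s' t'] by simp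
  qed
  fix q assume q: "q \<in> V" and eq: "s q = t q"
  obtain p where p: "p \<in> pts M" "q = i p" using carE[OF q] by blast
  have pV: "p \<in> ?pre V" using p q by simp
  obtain W where W: "aopen M W" "p \<in> W" "W \<subseteq> ?pre V"
   "restrict (\<lambda>p\<in>?pre V. K p (s (i p))) W = restrict (\<lambda>p\<in>?pre V. K p (t (i p))) W"
   using crs_sec(7)[OF M V'(2) s' t' pV] eq p pV by auto
  have "s (i v) = t (i v)" if v: "v \<in> W" for v
  proof -
   have vV: "v \<in> pts M" "i v \<in> V" using v W(3) by auto
   obtain a where a: "s (i v) = J v a" "K v (s (i v)) = a" using sec_cp_carrier[OF s vV] by metis
   obtain b where b: "t (i v) = J v b" "K v (t (i v)) = b" using sec_cp_carrier[OF t vV] by metis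
   have "K v (s (i v)) = K v (t (i v))" using fun_cong[OF W(4), of v] v vV by simp
   then show ?thesis using a b by simp
  qed
  then have "restrict s (i ` W) = restrict t (i ` W)" by (intro restrict_ext) auto
  then show "\<exists>W. aopen cp W \<and> q \<in> W \<and> W \<subseteq> V \<and> restrict s W = restrict t W"
   using img(1)[OF W(1)] W(2,3) p(2) by (intro exI[of _ "i ` W"]) auto
 next
  fix V s assume V: "aopen cp V" and s: "s \<in> (\<Pi>\<^sub>E p\<in>V. germs cp p)"
   and loc: "\<forall>p\<in>V. \<exists>W. aopen cp W \<and> p \<in> W \<and> W \<subseteq> V \<and> restrict s W \<in> sec cp W"
  have V': "V \<subseteq> i ` pts M" "aopen M (?pre V)" using V unfolding openin_cp by auto
  have car: "J (ri q) ` germs M (ri q) = germs cp q" for q by (simp add: cp_def)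
  have "(\<lambda>p\<in>?pre V. K p (s (i p))) \<in> sec M (?pre V)"
  proof (rule crs_sec(6)[OF M V'(2)])
   show "(\<lambda>p\<in>?pre V. K p (s (i p))) \<in> (\<Pi>\<^sub>E p\<in>?pre V. germs M p)"
    using s ring_hom_closed[OF stk_cp(3)] by (auto simp: PiE_iff)
   fix p assume p: "p \<in> ?pre V"
   then obtain W where W: "aopen cp W" "i p \<in> W" "W \<subseteq> V" "restrict s W \<in> sec cp W" using loc by auto
   have "aopen M (?pre W)" using W(1) unfolding openin_cp by blast
   moreover have "restrict (\<lambda>p\<in>?pre V. K p (s (i p))) (?pre W) = (\<lambda>p\<in>?pre W. K p (restrict s W (i p)))"
    using W(3) by (intro ext) auto
   ultimately show "\<exists>W. aopen M W \<and> p \<in> W \<and> W \<subseteq> ?pre V \<and> restrict (\<lambda>p\<in>?pre V. K p (s (i p))) W \<in> sec M W"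
    using W p sub[OF W(3)] conjunct2[OF W(4)[unfolded sec_cp]] by (intro exI[of _ "?pre W"]) auto
  qed
  then show "s \<in> sec cp V" using s unfolding sec_cp car by blast
 qed
qed

lemma rmor_to_cp: "rmor M cp i K"
 unfolding rmor_def
proof (intro conjI ballI allI impI)
 show "continuous_map (tp M) (tp cp) i"
  unfolding continuous_map_def pts_cp openin_cp by auto
 fix p assume p: "p \<in> pts M"
 show "K p \<in> ring_hom (stk cp (i p)) (stk M p)" by (rule stk_cp(3)[OF p])
 show "K p (cst cp (i p) c) = cst M p c" for c
  using KJ[OF p] ring_hom_closed[OF crs_stk(2)[OF M p]] stk_cp(5)[OF p] by simp
qed (simp add: sec_cp)

lemma rmor_from_cp: "rmor cp M ri (\<lambda>q. J (ri q))"
 unfolding rmor_def pts_cp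
proof (intro conjI ballI allI impI)
 have pre: "{p \<in> pts M. i p \<in> {q \<in> i ` pts M. ri q \<in> U}} = U" if U: "aopen M U" for U
 proof -
  have "i p \<in> {q \<in> i ` pts M. ri q \<in> U} \<longleftrightarrow> p \<in> U" if "p \<in> pts M" for p using ri[OF that] that by simp
  then show ?thesis using openin_subset[OF U] by auto
 qed
 show "continuous_map (tp cp) (tp M) ri"
  unfolding continuous_map_def pts_cp openin_cp using pre by auto
 fix q assume "q \<in> i ` pts M"
 then obtain p where p: "p \<in> pts M" "q = i p" by blast
 show "J (ri q) \<in> ring_hom (stk M (ri q)) (stk cp q)" using stk_cp(2)[OF p(1)] ri[OF p(1)] p(2) by simp
 show "J (ri q) (cst M (ri q) c) = cst cp q c" for c by (simp add: cp_def)
next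
 fix U s assume U: "aopen M U" and s: "s \<in> sec M U"
 let ?V = "{q \<in> i ` pts M. ri q \<in> U}"
 have "i p \<in> ?V \<longleftrightarrow> p \<in> U" if "p \<in> pts M" for p using ri[OF that] that by simp
 then have pre: "{p \<in> pts M. i p \<in> ?V} = U" using openin_subset[OF U] by auto
 have car: "s v \<in> germs M v" if "v \<in> U" for v by (rule crs_sec_carrier[OF M U s that])
 have "(\<lambda>p\<in>U. K p ((\<lambda>q\<in>?V. J (ri q) (s (ri q))) (i p))) = restrict s U"
  using openin_subset[OF U] ri KJ car by (intro restrict_ext) (auto simp: subset_iff)
 then have "(\<lambda>p\<in>{p \<in> pts M. i p \<in> ?V}. K p ((\<lambda>q\<in>?V. J (ri q) (s (ri q))) (i p))) \<in> sec M {p \<in> pts M. i p \<in> ?V}"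
  unfolding pre using crs_sec(5)[OF M U s U order_refl] by simp
 then show "(\<lambda>q\<in>?V. J (ri q) (s (ri q))) \<in> sec cp ?V"
  unfolding sec_cp using car by auto
qed

lemma isomorphic_cp: "isomorphic_rspaces cp M"
 unfolding isomorphic_rspaces_def
 apply (rule exI[of _ ri], rule exI[of _ "\<lambda>q. J (ri q)"], rule exI[of _ i], rule exI[of _ K])
 using rmor_to_cp rmor_from_cp ri KJ stk_cp(4) unfolding pts_cp by auto

end

text \<open>Units correspond under the isomorphisms of stalks, so the pulled-back functions isolate
  the corresponding point and the same bound \<open>d\<close> works.\<close>

lemma finite_dimensional_isomorphic:
 assumes cX: "c_ringed_space X" and iso: "isomorphic_rspaces Y X" and fd: "finite_dimensional X"
 shows "finite_dimensional Y"
proof -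
 obtain f fi g ga where r: "rmor Y X f fi" "rmor X Y g ga"
  and gf: "\<And>p. p \<in> pts Y \<Longrightarrow> g (f p) = p \<and> (\<forall>a\<in>germs Y p. fi p (ga (f p) a) = a)"
  and fg: "\<And>q. q \<in> pts X \<Longrightarrow> f (g q) = q \<and> (\<forall>b\<in>germs X q. ga q (fi (g q) b) = b)"
  using iso unfolding isomorphic_rspaces_def by meson
 obtain d where d: "\<And>p. p \<in> pts X \<Longrightarrow> \<exists>V fs. aopen X V \<and> p \<in> V \<and> fs \<subseteq> sec X V \<and> finite fs \<and>
   card fs \<le> d \<and> {q \<in> V. \<forall>s\<in>fs. s q \<notin> Units (stk X q)} = {p}"
  using fd unfolding finite_dimensional_def by meson
 have unit: "fi p b \<in> Units (stk Y p) \<longleftrightarrow> b \<in> Units (stk X (f p))" if p: "p \<in> pts Y" and b: "b \<in> germs X (f p)" for p b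
 proof
  have fp: "f p \<in> pts X" by (rule rmorD(5)[OF r(1) p])
  show "b \<in> Units (stk X (f p)) \<Longrightarrow> fi p b \<in> Units (stk Y p)" by (rule ring_hom_Units[OF rmorD(2)[OF r(1) p]])
  have "ga (f p) \<in> ring_hom (stk Y p) (stk X (f p))" using rmorD(2)[OF r(2) fp] gf[OF p] by simp
  moreover have "ga (f p) (fi p b) = b" using fg[OF fp] gf[OF p] b by simp
  ultimately show "fi p b \<in> Units (stk Y p) \<Longrightarrow> b \<in> Units (stk X (f p))" using ring_hom_Units by metis
 qed
 have "\<exists>V fs. aopen Y V \<and> p \<in> V \<and> fs \<subseteq> sec Y V \<and> finite fs \<and> card fs \<le> d \<and>
   {q \<in> V. \<forall>s\<in>fs. s q \<notin> Units (stk Y q)} = {p}" if p: "p \<in> pts Y" for p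
 proof -
  have fp: "f p \<in> pts X" by (rule rmorD(5)[OF r(1) p])
  obtain V fs where V: "aopen X V" "f p \<in> V" "fs \<subseteq> sec X V" "finite fs" "card fs \<le> d"
   "{q \<in> V. \<forall>s\<in>fs. s q \<notin> Units (stk X q)} = {f p}" using d[OF fp] by (elim exE conjE)
  let ?V = "{p \<in> pts Y. f p \<in> V}"
  define h where "h s = (\<lambda>p\<in>?V. fi p (s (f p)))" for s
  have 1: "aopen Y ?V" using rmorD(1)[OF r(1)] V(1) by (simp add: continuous_map_def)
  have 2: "h ` fs \<subseteq> sec Y ?V" using rmorD(4)[OF r(1) V(1)] V(3) unfolding h_def by blast
  have 3: "card (h ` fs) \<le> d" using card_image_le[OF V(4)] V(5) le_trans by blast
  have "(\<forall>s\<in>h ` fs. s q \<notin> Units (stk Y q)) \<longleftrightarrow> f q = f p" if q: "q \<in> ?V" for q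
  proof -
   have "h s q \<in> Units (stk Y q) \<longleftrightarrow> s (f q) \<in> Units (stk X (f q))" if s: "s \<in> fs" for s
   proof -
    have Xc: "s (f q) \<in> germs X (f q)" using crs_sec_carrier[OF cX V(1)] V(3) s q by blast
    show ?thesis using unit[OF _ Xc] q by (simp add: h_def)
   qed
   then show ?thesis using V(6) q by auto
  qed
  then have 4: "{q \<in> ?V. \<forall>s\<in>h ` fs. s q \<notin> Units (stk Y q)} = {p}"
   using gf p V(2) by (auto; metis)
  show ?thesis by (intro exI[of _ ?V] exI[of _ "h ` fs"] conjI 1 2 3 4 finite_imageI V(4)) (use p V(2) in simp)
 qed
 then show ?thesis unfolding finite_dimensional_def by blast
qed

lemma isomorphic_rspaces_homeomorphic:
 assumes "isomorphic_rspaces Y X"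
 shows "tp Y homeomorphic_space tp X"
proof -
 obtain f fi g ga where r: "rmor Y X f fi" "rmor X Y g ga"
  and "\<And>p. p \<in> pts Y \<Longrightarrow> g (f p) = p" "\<And>q. q \<in> pts X \<Longrightarrow> f (g q) = q"
  using assms unfolding isomorphic_rspaces_def by meson
 then show ?thesis
  unfolding homeomorphic_space_def homeomorphic_maps_def using rmorD(1)[OF r(1)] rmorD(1)[OF r(2)] by blast
qed

text \<open>Points and germs of a model are coded by complex numbers through
  \<open>inj_nat_complex\<close> and \<open>germs_embed\<close>; the injection \<open>j\<close> then
  makes room for them in the universe.\<close>

lemma (in local_model) analytic_space_copy:
 fixes j :: "complex \<Rightarrow> 'u"
 assumes j: "inj j" and fin: "finite fs"
 obtains T :: "'u aspace" and f fi where "analytic_space T" "rmor T (model n D fs) f fi"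
  "homeomorphic_map (tp T) (tp (model n D fs)) f"
proof -
 let ?M = "model n D fs"
 obtain e :: "(nat \<Rightarrow> complex) \<Rightarrow> complex" where e: "inj e" using inj_nat_complex by blast
 define g where "g z = (SOME g :: ((nat \<Rightarrow> complex) \<Rightarrow> complex) set \<Rightarrow> complex. inj_on g (carrier (Q z)))" for z
 have g: "inj_on (g z) (carrier (Q z))" if "z \<in> D" for z
  unfolding g_def using germs_embed[OF that] by (rule someI_ex)
 interpret tr: transport ?M "\<lambda>z. j (e z)" "\<lambda>z a. j (g z a)"
 proof
  show "c_ringed_space ?M" by (rule crs_model)
  show "inj_on (\<lambda>z. j (e z)) (pts ?M)"
   using inj_on_subset[OF inj_compose[OF j e]] by (simp add: comp_def)
  show "inj_on (\<lambda>a. j (g z a)) (germs ?M z)" if "z \<in> pts ?M" for z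
   using comp_inj_on[OF g[of z] inj_on_subset[OF j]] that by (simp add: comp_def)
 qed
 let ?T = "tr.cp"
 have "Hausdorff_space (tp ?T)"
  using homeomorphic_Hausdorff_space[OF isomorphic_rspaces_homeomorphic[OF tr.isomorphic_cp]]
  by (simp add: Hausdorff_space_subtopology)
 moreover have "\<exists>U n D fs. aopen ?T U \<and> p \<in> U \<and> open_Cn n D \<and> finite fs \<and> (\<forall>f\<in>fs. holo n D f) \<and>
   isomorphic_rspaces (open_sub ?T U) (model n D fs)" if p: "p \<in> pts ?T" for p
  using p D fin fs tr.isomorphic_cp
  by (intro exI[of _ "pts ?T"] exI[of _ n] exI[of _ D] exI[of _ fs]) auto
 ultimately have an: "analytic_space ?T"
  unfolding analytic_space_def
  using tr.crs_cp finite_dimensional_isomorphic[OF crs_model tr.isomorphic_cp finite_dimensional_model]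
  by blast
 have "homeomorphic_maps (tp ?T) (tp ?M) tr.ri (\<lambda>z. j (e z))"
  unfolding homeomorphic_maps_def
  using rmorD(1)[OF tr.rmor_from_cp] rmorD(1)[OF tr.rmor_to_cp] tr.ri unfolding tr.pts_cp by auto
 then have "homeomorphic_map (tp ?T) (tp ?M) tr.ri" using homeomorphic_map_maps by blast
 then show ?thesis using that[OF an tr.rmor_from_cp] by blast
qed

section \<open>A space with the topology of a product\<close>

text \<open>The space \<open>T\<close> is the product of two charts, but only its topology and the two projections are
 needed, not its universal property.\<close>

lemma local_product:
 fixes X :: "'u aspace"
 assumes X: "analytic_space X" and p: "p \<in> pts X" and P: "one_point_space (P :: 'u aspace)"
 obtains T :: "'u aspace" and a1 a2 t0 U where
  "a1 \<in> ahom T X" "a2 \<in> ahom T X" "t0 \<in> pts T" "mfun a1 t0 = p" "mfun a2 t0 = p"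
  "aopen X U" "p \<in> U"
  "\<And>u v. u \<in> U \<Longrightarrow> v \<in> U \<Longrightarrow> \<exists>t\<in>pts T. mfun a1 t = u \<and> mfun a2 t = v"
  "\<And>W. aopen T W \<Longrightarrow> t0 \<in> W \<Longrightarrow>
   \<exists>V. aopen X V \<and> p \<in> V \<and> V \<subseteq> U \<and> (\<forall>t\<in>pts T. mfun a1 t \<in> V \<and> mfun a2 t \<in> V \<longrightarrow> t \<in> W)"
proof -
 obtain q where q: "pts P = {q}" "bij_betw (cst P q) UNIV (germs P q)"
  using P unfolding one_point_space_def by blast
 \<comment> \<open>Here the universe is seen to contain the complex numbers: they are the germs at
   the one-point space.\<close>
 have j: "inj (cst P q)" using q(2) by (simp add: bij_betw_def)
 obtain U n D fs where U: "aopen X U" "p \<in> U" and D: "open_Cn n D" "finite fs" "\<forall>f\<in>fs. holo n D f"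
  and iso: "isomorphic_rspaces (open_sub X U) (model n D fs)"
  using X p unfolding analytic_space_def by meson
 interpret M: local_model n D fs by unfold_locales (use D in auto)
 let ?M = "model n D fs"
 obtain f fi g ga where r: "rmor (open_sub X U) ?M f fi" "rmor ?M (open_sub X U) g ga"
  and gf: "\<And>p. p \<in> U \<Longrightarrow> g (f p) = p" and fg: "\<And>q. q \<in> M.Zs \<Longrightarrow> f (g q) = q"
  using iso unfolding isomorphic_rspaces_def pts_open_sub[OF U(1)] M.pts_model by meson
 let ?m = "n + n"
 \<comment> \<open>\<open>k1\<close> and \<open>k2\<close> read off the first and the last
   \<open>n\<close> coordinates; imposing the equations of the chart on both gives the product of
   the chart with itself.\<close>
 define k1 where "k1 = coord_map n (\<lambda>j. j)"
 define k2 where "k2 = coord_map n (\<lambda>j. j + n)"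
 define D' where "D' = {w \<in> Cn ?m. k1 w \<in> D} \<inter> {w \<in> Cn ?m. k2 w \<in> D}"
 define fs' where "fs' = (\<lambda>f w. f (k1 w)) ` fs \<union> (\<lambda>f w. f (k2 w)) ` fs"
 have inj: "inj_on (\<lambda>j. j) {..<n}" "(\<lambda>j. j) ` {..<n} \<subseteq> {..<?m}" "inj_on (\<lambda>j. j + n) {..<n}" "(\<lambda>j. j + n) ` {..<n} \<subseteq> {..<?m}"
  by auto
 have o: "open_Cn ?m {w \<in> Cn ?m. k1 w \<in> D}" "open_Cn ?m {w \<in> Cn ?m. k2 w \<in> D}"
  unfolding k1_def k2_def by (rule open_coord_map_vimage[OF D(1)])+
 have D': "open_Cn ?m D'" unfolding D'_def using o by (rule openin_Int)
 have fs': "holo ?m D' h" if h: "h \<in> fs'" for h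
 proof -
  obtain f where f: "f \<in> fs" "h = (\<lambda>w. f (k1 w)) \<or> h = (\<lambda>w. f (k2 w))" using h unfolding fs'_def by blast
  have hf: "holo n D f" using D(3) f(1) by blast
  have "holo ?m {w \<in> Cn ?m. k1 w \<in> D} (\<lambda>w. f (k1 w))" "holo ?m {w \<in> Cn ?m. k2 w \<in> D} (\<lambda>w. f (k2 w))"
   unfolding k1_def k2_def by (rule holo_coord_map[OF D(1) hf inj(1,2)], rule holo_coord_map[OF D(1) hf inj(3,4)])
  then have "holo ?m D' (\<lambda>w. f (k1 w))" "holo ?m D' (\<lambda>w. f (k2 w))"
   using holo_subset[OF _ D'] unfolding D'_def by auto
  then show ?thesis using f(2) by auto
 qed
 interpret N: local_model ?m D' fs' by unfold_locales (use D' fs' in auto)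
 let ?N = "model ?m D' fs'"
 obtain fi1 where k1: "rmor ?N ?M k1 fi1"
  using rmor_coord_map[OF M.local_model_axioms N.local_model_axioms inj(1,2)] unfolding k1_def[symmetric] D'_def fs'_def by blast
 obtain fi2 where k2: "rmor ?N ?M k2 fi2"
  using rmor_coord_map[OF M.local_model_axioms N.local_model_axioms inj(3,4)] unfolding k2_def[symmetric] D'_def fs'_def by blast
 have "finite fs'" unfolding fs'_def using D(2) by simp
 then obtain T :: "'u aspace" and c cg where T: "analytic_space T" and c: "rmor T ?N c cg" "homeomorphic_map (tp T) (tp ?N) c"
  by (rule N.analytic_space_copy[OF j])
 have incl: "incl X U \<in> ahom (open_sub X U) X" by (rule incl_hom[OF X U(1)])
 have sU: "U \<subseteq> pts X" by (rule openin_subset[OF U(1)])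
 have XU: "analytic_space (open_sub X U)" by (rule analytic_space_open_sub[OF X U(1)])
 have "\<exists>a\<in>ahom T X. \<forall>t\<in>pts T. mfun a t = g (k (c t))" if k: "rmor ?N ?M k psi" for k psi
 proof -
  note R = rmor_comp[OF rmor_comp[OF c(1) k] r(2)]
  let ?a = "mk_amor T (open_sub X U) (\<lambda>t. g (k (c t))) (\<lambda>p a. cg p (psi (c p) (ga (k (c p)) a)))"
  have a: "?a \<in> ahom T (open_sub X U)" by (rule mk_amor_hom[OF T XU R])
  have "mfun (acmp (incl X U) ?a) t = g (k (c t))" if t: "t \<in> pts T" for t
  proof -
   have "g (k (c t)) \<in> U" using rmorD(5)[OF R t] unfolding pts_open_sub[OF U(1)] .
   then show ?thesis using mfun_Cmp[OF a t] mk_amor_sel(1)[OF t] sU by simp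
  qed
  then show ?thesis using acmp_hom[OF a incl] by blast
 qed
 from this[OF k1] this[OF k2] obtain a1 a2 where a: "a1 \<in> ahom T X" "a2 \<in> ahom T X"
  "\<And>t. t \<in> pts T \<Longrightarrow> mfun a1 t = g (k1 (c t))" "\<And>t. t \<in> pts T \<Longrightarrow> mfun a2 t = g (k2 (c t))" by blast
 \<comment> \<open>On points, the inverse of taking both projections; it shows that all pairs of
   points of the chart are hit.\<close>
 define pair where "pair x y j = (if j < n then x j else if j < n + n then y (j - n) else 0 :: complex)" for x y and j :: nat
 have k1p: "k1 (pair x y) = x" if "x \<in> Cn n" for x y using that by (auto simp: k1_def coord_map_def pair_def Cn_def)
 have k2p: "k2 (pair x y) = y" if "y \<in> Cn n" for x y using that by (auto simp: k2_def coord_map_def pair_def Cn_def)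
 have pC: "pair x y \<in> Cn ?m" for x y by (simp add: pair_def Cn_def)
 have fU: "f u \<in> M.Zs" "f u \<in> Cn n" if "u \<in> U" for u
 proof -
  have "u \<in> pts (open_sub X U)" unfolding pts_open_sub[OF U(1)] by (rule that)
  then show "f u \<in> M.Zs" using rmorD(5)[OF r(1)] unfolding M.pts_model by blast
  then show "f u \<in> Cn n" using M.D_Cn by blast
 qed
 have pair_Zs: "pair x y \<in> N.Zs" if "x \<in> M.Zs" "y \<in> M.Zs" for x y
  using that k1p[of x y] k2p[of y x] M.D_Cn pC unfolding D'_def fs'_def by auto
 have csurj: "\<exists>t\<in>pts T. c t = w" if "w \<in> N.Zs" for w
 proof -
  have "w \<in> c ` pts T" using homeomorphic_imp_surjective_map[OF c(2)] that unfolding N.pts_model by simp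
  then show ?thesis by blast
 qed
 have hit: "\<exists>t\<in>pts T. mfun a1 t = u \<and> mfun a2 t = v" if uv: "u \<in> U" "v \<in> U" for u v
 proof -
  obtain t where t: "t \<in> pts T" "c t = pair (f u) (f v)"
   using csurj[OF pair_Zs[OF fU(1)[OF uv(1)] fU(1)[OF uv(2)]]] by blast
  then show ?thesis using a(3,4)[OF t(1)] k1p[OF fU(2)] k2p[OF fU(2)] gf uv by auto
 qed
 obtain t0 where t0: "t0 \<in> pts T" "c t0 = pair (f p) (f p)"
  using csurj[OF pair_Zs[OF fU(1)[OF U(2)] fU(1)[OF U(2)]]] by blast
 have at0: "mfun a1 t0 = p" "mfun a2 t0 = p" using a(3,4)[OF t0(1)] t0(2) k1p[OF fU(2)] k2p[OF fU(2)] gf U(2) by auto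
 have nbhd: "\<exists>V. aopen X V \<and> p \<in> V \<and> V \<subseteq> U \<and> (\<forall>t\<in>pts T. mfun a1 t \<in> V \<and> mfun a2 t \<in> V \<longrightarrow> t \<in> W)"
  if W: "aopen T W" "t0 \<in> W" for W
 proof -
  have sW: "W \<subseteq> pts T" by (rule openin_subset[OF W(1)])
  have "aopen ?N (c ` W)" using homeomorphic_imp_open_map[OF c(2)] W(1) unfolding open_map_def by blast
  then have "openin (top_of_set N.Zs) (c ` W)" by simp
  then obtain B where B: "open_Cn ?m B" "c ` W = N.Zs \<inter> B" by (rule N.openin_ZsD)
  have pB: "pair (f p) (f p) \<in> B" using imageI[OF W(2), of c] unfolding t0(2) B(2) by blast
  obtain \<rho> where \<rho>: "\<rho> > 0" "\<And>w. w \<in> Cn ?m \<Longrightarrow> (\<And>i. i < ?m \<Longrightarrow> norm (w i - pair (f p) (f p) i) \<le> \<rho>) \<Longrightarrow> w \<in> B"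
  proof (rule box_contained[OF B(1) pB])
   fix r :: real
   assume r: "0 < r" "\<And>w. w \<in> Cn ?m \<Longrightarrow> (\<And>i. i < ?m \<Longrightarrow> norm (w i - pair (f p) (f p) i) \<le> r) \<Longrightarrow> w \<in> B"
   show thesis by (rule that[OF r(1)]) (blast intro: r(2))
  qed
  \<comment> \<open>A polydisc of equal radii about \<open>pair (f p) (f p)\<close> is the product
    of two copies of this one, so a single open set \<open>V\<close> serves both factors.\<close>
  define E where "E = {x \<in> Cn n. \<forall>i<n. norm (x i - f p i) < \<rho>}"
  define V where "V = {u \<in> U. f u \<in> M.Zs \<inter> E}"
  have "openin (top_of_set M.Zs) (M.Zs \<inter> E)" unfolding E_def by (rule M.openin_Zs[OF box_open])
  then have "aopen (open_sub X U) {u \<in> pts (open_sub X U). f u \<in> M.Zs \<inter> E}"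
   using openin_continuous_map_preimage[OF rmorD(1)[OF r(1)], of "M.Zs \<inter> E"] unfolding model_sel by blast
  moreover have "{u \<in> pts (open_sub X U). f u \<in> M.Zs \<inter> E} = V" unfolding pts_open_sub[OF U(1)] V_def by blast
  ultimately have oV: "aopen X V" using open_sub_iff[OF U(1)] by simp
  have pV: "p \<in> V" unfolding V_def E_def using U(2) fU[OF U(2)] \<rho>(1) by simp
  have "t \<in> W" if t: "t \<in> pts T" "mfun a1 t \<in> V" "mfun a2 t \<in> V" for t
  proof -
   have cN: "c t \<in> N.Zs" using rmorD(5)[OF c(1) t(1)] unfolding N.pts_model .
   then have kk: "k1 (c t) \<in> M.Zs" "k2 (c t) \<in> M.Zs"
    using rmorD(5)[OF k1] rmorD(5)[OF k2] unfolding N.pts_model M.pts_model by blast+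
   have "f (g (k1 (c t))) \<in> E" "f (g (k2 (c t))) \<in> E" using t(2,3) a(3,4)[OF t(1)] unfolding V_def by auto
   then have E: "k1 (c t) \<in> E" "k2 (c t) \<in> E" using fg kk by auto
   have "c t \<in> B"
   proof (rule \<rho>(2))
    show "c t \<in> Cn ?m" using cN N.D_Cn by blast
    fix i assume i: "i < ?m"
    show "norm (c t i - pair (f p) (f p) i) \<le> \<rho>"
    proof (cases "i < n")
     case True
     then show ?thesis using E(1) unfolding E_def k1_def coord_map_def pair_def by (auto intro: less_imp_le)
    next
     case False
     then have lt: "i - n < n" using i by arith
     then have "norm (k2 (c t) (i - n) - f p (i - n)) < \<rho>" using E(2) unfolding E_def by blast
     then show ?thesis using False i lt unfolding k2_def coord_map_def pair_def by simp
    qed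
   qed
   then have "c t \<in> c ` W" using B(2) cN by blast
   moreover have "inj_on c (pts T)" by (rule homeomorphic_imp_injective_map[OF c(2)])
   ultimately show "t \<in> W" using t(1) sW by (auto dest: inj_onD)
  qed
  then show ?thesis using oV pV unfolding V_def by blast
 qed
 show ?thesis by (rule that[OF a(1,2) t0(1) at0 U hit nbhd])
qed

section \<open>The diagonal\<close>

lemma prod_over_sel [simp]:
 "Dom (prod_over A B) (a, b) = (Dom A a, Dom B b)" "Cod (prod_over A B) (a, b) = (Cod A a, Cod B b)"
 "Idt (prod_over A B) (x, y) = (Idt A x, Idt B y)" "Cmp (prod_over A B) (a', b') (a, b) = (Cmp A a' a, Cmp B b' b)"
 "PO (prod_over A B) (x, y) = PO A x" "PA (prod_over A B) (a, b) = PA A a"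
 by (simp_all add: prod_over_def)

lemma prod_over_Obj: "(x, y) \<in> Obj (prod_over A B) \<longleftrightarrow> x \<in> Obj A \<and> y \<in> Obj B \<and> PO A x = PO B y"
 by (simp add: prod_over_def)

lemma prod_over_hom: "(a, b) \<in> hom_set (prod_over A B) (x, y) (x', y') \<longleftrightarrow>
 a \<in> hom_set A x x' \<and> b \<in> hom_set B y y' \<and> PA A a = PA B b"
 by (auto simp: prod_over_def hom_set_def)

lemma prod_over_ho: "(a, b) \<in> hom_over (prod_over A B) f (x, y) (x', y') \<longleftrightarrow>
 a \<in> hom_over A f x x' \<and> b \<in> hom_over B f y y'"
 by (auto simp: hom_over_def prod_over_hom)

text \<open>Required in order to apply the universal-arrow form of base change to the diagonal,
  whose target is this product.\<close>

lemma fibred_category_prod_over: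
 assumes A: "fibred_category A" and B: "fibred_category B"
 shows "fibred_category (prod_over A B)"
proof -
 interpret A: fibred_category A by (rule A)
 interpret B: fibred_category B by (rule B)
 let ?P = "prod_over A B"
 have arr: "s \<in> hom_set ?P (Dom ?P s) (Cod ?P s)" if "s \<in> Arr ?P" for s using that by (simp add: hom_set_def)
 have PO: "PO A (Dom A a) = PO B (Dom B b) \<and> PO A (Cod A a) = PO B (Cod B b)"
  if "a \<in> hom_set A x x'" "b \<in> hom_set B y y'" "PA A a = PA B b" for a b x x' y y'
  using A.PA_hom[OF that(1)] B.PA_hom[OF that(2)] that hom_setD by metis
 have cat: "category ?P"
  unfolding category_def
 proof (intro conjI ballI impI)
  fix s assume s: "s \<in> Arr ?P"
  obtain a b where e: "s = (a, b)" by (cases s)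
  have ab: "a \<in> hom_set A (Dom A a) (Cod A a)" "b \<in> hom_set B (Dom B b) (Cod B b)" "PA A a = PA B b"
   using arr[OF s] unfolding e prod_over_sel prod_over_hom by auto
  show "Dom ?P s \<in> Obj ?P" "Cod ?P s \<in> Obj ?P"
   unfolding e prod_over_sel prod_over_Obj
   using A.catD(1,2)[OF ab(1)] B.catD(1,2)[OF ab(2)] PO[OF ab] by auto
  show "Cmp ?P s (Idt ?P (Dom ?P s)) = s" "Cmp ?P (Idt ?P (Cod ?P s)) s = s"
   unfolding e using A.catD(5,6)[OF ab(1)] B.catD(5,6)[OF ab(2)] by simp_all
  fix s' assume s': "s' \<in> Arr ?P"
  obtain a' b' where e': "s' = (a', b')" by (cases s')
  have ab': "a' \<in> hom_set A (Dom A a') (Cod A a')" "b' \<in> hom_set B (Dom B b') (Cod B b')" "PA A a' = PA B b'"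
   using arr[OF s'] unfolding e' prod_over_sel prod_over_hom by auto
  show "Cmp ?P s' s \<in> hom_set ?P (Dom ?P s) (Cod ?P s')" if "Cod ?P s = Dom ?P s'"
  proof -
   have a'': "a' \<in> hom_set A (Cod A a) (Cod A a')" "b' \<in> hom_set B (Cod B b) (Cod B b')"
    using ab' that unfolding e e' by simp_all
   show ?thesis unfolding e e' prod_over_sel prod_over_hom
    using A.catD(4)[OF ab(1) a''(1)] B.catD(4)[OF ab(2) a''(2)] A.PA_Cmp[OF ab(1) a''(1)] B.PA_Cmp[OF ab(2) a''(2)]
     ab(3) ab'(3) by simp
  qed
  fix s'' assume s'': "s'' \<in> Arr ?P" and ch: "Cod ?P s = Dom ?P s' \<and> Cod ?P s' = Dom ?P s''"
  obtain a'' b'' where e'': "s'' = (a'', b'')" by (cases s'')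
  have ab'': "a'' \<in> hom_set A (Dom A a'') (Cod A a'')" "b'' \<in> hom_set B (Dom B b'') (Cod B b'')"
   using arr[OF s''] unfolding e'' prod_over_sel prod_over_hom by auto
  show "Cmp ?P s'' (Cmp ?P s' s) = Cmp ?P (Cmp ?P s'' s') s"
   using A.catD(7)[OF ab(1), of a' _ a''] B.catD(7)[OF ab(2), of b' _ b''] ab' ab'' ch unfolding e e' e'' by simp
 next
  fix v assume v: "v \<in> Obj ?P"
  obtain x y where e: "v = (x, y)" by (cases v)
  have xy: "x \<in> Obj A" "y \<in> Obj B" "PO A x = PO B y" using v[unfolded e prod_over_Obj] by auto
  show "Idt ?P v \<in> hom_set ?P v v" unfolding e prod_over_sel prod_over_hom
   using A.catD(3)[OF xy(1)] B.catD(3)[OF xy(2)] A.PA_Idt[OF xy(1)] B.PA_Idt[OF xy(2)] xy(3) by simp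
 qed
 have "is_functor ?P ana \<lparr>FO = PO ?P, FA = PA ?P\<rparr>"
  unfolding is_functor_def fct.simps
 proof (intro conjI ballI impI)
  fix v assume v: "v \<in> Obj ?P"
  obtain x y where e: "v = (x, y)" by (cases v)
  have "x \<in> Obj A" using v[unfolded e prod_over_Obj] by auto
  then show "PO ?P v \<in> Obj ana" "PA ?P (Idt ?P v) = aid (PO ?P v)"
   using e A.PO_ana A.PA_Idt by simp_all
 next
  fix s assume s: "s \<in> Arr ?P"
  obtain a b where e: "s = (a, b)" by (cases s)
  have a: "a \<in> hom_set A (Dom A a) (Cod A a)"
   using arr[OF s] unfolding e prod_over_sel prod_over_hom by auto
  show "PA ?P s \<in> ahom (PO ?P (Dom ?P s)) (PO ?P (Cod ?P s))" using A.PA_hom[OF a] e by simp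
  fix s' assume s': "s' \<in> Arr ?P" and ch: "Cod ?P s = Dom ?P s'"
  obtain a' b' where e': "s' = (a', b')" by (cases s')
  have a': "a' \<in> hom_set A (Cod A a) (Cod A a')"
   using arr[OF s'] ch unfolding e e' prod_over_sel prod_over_hom by auto
  show "PA ?P (Cmp ?P s' s) = acmp (PA ?P s') (PA ?P s)" using A.PA_Cmp[OF a a'] e e' by simp
 qed
 then have over: "over_ana ?P" using cat by (simp add: over_ana_def)
 have lift: "\<exists>w\<in>Obj ?P. hom_over ?P f w v \<noteq> {}" if f: "f \<in> Arr ana" and v: "v \<in> Obj ?P" "PO ?P v = Cod ana f" for f v
 proof -
  obtain x y where e: "v = (x, y)" by (cases v)
  have xy: "x \<in> Obj A" "y \<in> Obj B" "PO A x = PO B y" using v(1)[unfolded e prod_over_Obj] by auto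
  have f': "f \<in> ahom (mdom f) (PO A x)" using f v(2) e by (simp add: hom_set_def)
  have "(A.lift f x, B.lift f y) \<in> hom_over ?P f (A.pull f x, B.pull f y) (x, y)"
   unfolding prod_over_ho using A.lift_ho[OF xy(1) f'] B.lift_ho[OF xy(2)] f' xy(3) by simp
  moreover have "(A.pull f x, B.pull f y) \<in> Obj ?P"
   unfolding prod_over_Obj using A.PO_pull[OF xy(1) f'] B.PO_pull[OF xy(2)] f' xy(3) by simp
  ultimately show ?thesis unfolding e by blast
 qed
 have cart: "\<exists>!c. c \<in> hom_over ?P f (Dom ?P t) (Dom ?P s) \<and> Cmp ?P s c = t"
  if s: "s \<in> Arr ?P" and t: "t \<in> Arr ?P" and f: "f \<in> ahom (PO ?P (Dom ?P t)) (PO ?P (Dom ?P s))"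
   and e: "Cod ?P s = Cod ?P t \<and> acmp (PA ?P s) f = PA ?P t" for s t f
 proof -
  obtain a b where s': "s = (a, b)" by (cases s)
  obtain a' b' where t': "t = (a', b')" by (cases t)
  have ab: "a \<in> hom_set A (Dom A a) (Cod A a)" "b \<in> hom_set B (Dom B b) (Cod B b)" "PA A a = PA B b"
   using arr[OF s] unfolding s' prod_over_sel prod_over_hom by auto
  have ab': "a' \<in> hom_set A (Dom A a') (Cod A a)" "b' \<in> hom_set B (Dom B b') (Cod B b)" "PA A a' = PA B b'"
   using arr[OF t] e unfolding s' t' prod_over_sel prod_over_hom by auto
  have fB: "f \<in> ahom (PO B (Dom B b')) (PO B (Dom B b))"
   using f PO[OF ab] PO[OF ab'(1,2,3)] unfolding s' t' by simp
  obtain c where c: "c \<in> hom_over A f (Dom A a') (Dom A a)" "Cmp A a c = a'"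
   using A.cart_ex[OF hom_overI[OF ab(1) refl] hom_overI[OF ab'(1) refl], of f] f e unfolding s' t' by auto
  obtain d where d: "d \<in> hom_over B f (Dom B b') (Dom B b)" "Cmp B b d = b'"
   using B.cart_ex[OF hom_overI[OF ab(2) refl] hom_overI[OF ab'(2) refl] fB] e ab(3) ab'(3) unfolding s' t' by auto
  show ?thesis
  proof (rule ex1I[of _ "(c, d)"])
   show "(c, d) \<in> hom_over ?P f (Dom ?P t) (Dom ?P s) \<and> Cmp ?P s (c, d) = t"
    unfolding s' t' prod_over_sel prod_over_ho using c d by simp
   fix u assume u: "u \<in> hom_over ?P f (Dom ?P t) (Dom ?P s) \<and> Cmp ?P s u = t"
   obtain c' d' where u': "u = (c', d')" by (cases u)
   have "c' \<in> hom_over A f (Dom A a') (Dom A a)" "d' \<in> hom_over B f (Dom B b') (Dom B b)" "Cmp A a c' = a'" "Cmp B b d' = b'"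
    using u unfolding u' s' t' prod_over_sel prod_over_ho by auto
   then show "u = (c, d)" unfolding u'
    using A.cart_eq[OF hom_overI[OF ab(1) refl] _ c(1)] B.cart_eq[OF hom_overI[OF ab(2) refl] _ d(1)] c(2) d(2) by simp
  qed
 qed
 have "fibred_in_groupoids ?P" unfolding fibred_in_groupoids_def using over lift cart by blast
 then show ?thesis using over by (simp add: fibred_category_def over_category_def fibred_category_axioms_def)
qed

lemma morphism_over_diagonal: "over_category A \<Longrightarrow> morphism_over A (prod_over A A) diagonal"
 unfolding morphism_over_def is_functor_def diagonal_def prod_over_def hom_set_def by auto

section \<open>Spaces of isomorphisms and fibre products with the atlas\<close>

context fibred_category
begin

text \<open>An arrow from a diagonal object is a pair of arrows over one base map. So the universal
  object represents the isomorphisms between the pullbacks of \<open>y1\<close> and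
  \<open>y2\<close>, and \<open>h\<close> is the structure map of that space.\<close>

lemma diagonal_universal:
 assumes rep: "representable_with R C (prod_over C C) diagonal"
  and y: "y1 \<in> Obj C" "y2 \<in> Obj C" "PO C y1 = PO C y2"
 obtains w b1 b2 h where "b1 \<in> Ov h w y1" "b2 \<in> Ov h w y2" "R h"
  "\<And>w' b1' b2' h'. b1' \<in> Ov h' w' y1 \<Longrightarrow> b2' \<in> Ov h' w' y2 \<Longrightarrow>
   \<exists>!c. c \<in> Hom w' w \<and> Cmp C b1 c = b1' \<and> Cmp C b2 c = b2'"
proof -
 have fc: "fibred_category C" ..
 interpret bcs: base_change_setting C "prod_over C C" diagonal
 proof (rule base_change_setting.intro)
  show oc: "over_category C" ..
  show "fibred_category (prod_over C C)" by (rule fibred_category_prod_over[OF fc fc])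
  show "base_change_setting_axioms C (prod_over C C) diagonal"
   by (rule base_change_setting_axioms.intro) (rule morphism_over_diagonal[OF oc])
 qed
 have yy: "(y1, y2) \<in> Obj (prod_over C C)" using y by (simp add: prod_over_Obj)
 show ?thesis
 proof (rule bcs.representable_universal[OF rep yy])
  fix w b h
  assume b: "b \<in> hom_over (prod_over C C) h (FO diagonal w) (y1, y2)" "R h" and u: "bcs.universal w b (y1, y2)"
  obtain b1 b2 where e: "b = (b1, b2)" by (cases b)
  have b': "b1 \<in> Ov h w y1" "b2 \<in> Ov h w y2"
   using b(1) unfolding e by (simp_all add: diagonal_def prod_over_ho)
  show ?thesis
  proof (rule that[OF b' b(2)])
   fix w' b1' b2' h' assume *: "b1' \<in> Ov h' w' y1" "b2' \<in> Ov h' w' y2"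
   have "(b1', b2') \<in> hom_over (prod_over C C) h' (FO diagonal w') (y1, y2)"
    using * by (simp add: diagonal_def prod_over_ho)
   from bcs.universalD[OF u hoD(1)[OF *(1)] this]
   show "\<exists>!c. c \<in> Hom w' w \<and> Cmp C b1 c = b1' \<and> Cmp C b2 c = b2'"
    by (simp add: e diagonal_def)
  qed
 qed
qed

text \<open>Yoneda turns objects of \<open>yon X\<close> into arrows to the atlas object, so the
  fibre product of the atlas with the base of \<open>y\<close> becomes a universal pair of arrows.
  Competitors range over all objects of the stack, including those outside the image of
  \<open>\<pi>\<close>.\<close>

lemma atlas_universal:
 assumes X: "analytic_space X" and rep: "representable_with R (yon X) C \<pi>" and y: "y \<in> Obj C"
 obtains w a b where "a \<in> Hom w (FO \<pi> (aid X))" "b \<in> Hom w y" "R (PA C b)"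
  "\<And>w' a' b'. a' \<in> Hom w' (FO \<pi> (aid X)) \<Longrightarrow> b' \<in> Hom w' y \<Longrightarrow>
   \<exists>!c. c \<in> Hom w' w \<and> Cmp C a c = a' \<and> Cmp C b c = b'"
proof -
 have m\<pi>: "morphism_over (yon X) C \<pi>" using rep by (simp add: representable_with_def representable_def)
 interpret bcs: base_change_setting "yon X" C \<pi>
  by (rule base_change_setting.intro[OF over_category_yon fibred_category_axioms base_change_setting_axioms.intro[OF m\<pi>]])
 let ?xi = "FO \<pi> (aid X)"
 note iX = aid_hom[OF X]
 have xi: "?xi \<in> Obj C" "PO C ?xi = X" using morD(1,2)[OF m\<pi> yon_ObjI[OF iX]] ana_homD(1)[OF iX] by auto
 define l where "l f = FA \<pi> (aid X, f)" for f
 have lh: "(aid X, f) \<in> hom_set (yon X) f (aid X)" if f: "f \<in> ahom V X" for f V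
  unfolding yon_hom using f ana_homD(1)[OF f] ana_homD(1)[OF iX] iX anaD(6)[OF f] by simp
 have l: "l f \<in> Ov f (FO \<pi> f) ?xi" "PO C (FO \<pi> f) = V" if f: "f \<in> ahom V X" for f V
  unfolding l_def using morD(4)[OF m\<pi> hom_overI[OF lh[OF f]]]
   morD(2)[OF m\<pi> yon_ObjI[OF f]] ana_homD(1)[OF f] by simp_all
 obtain f b h where f0: "f \<in> Obj (yon X)" and b: "b \<in> Ov h (FO \<pi> f) y" and R: "R h"
  and univ: "bcs.universal f b y"
  by (rule bcs.representable_universal[OF rep y])
 have f: "f \<in> ahom (mdom f) X" using f0 by (simp add: yon_Obj)
 have R': "R (PA C b)" using R hoD(5)[OF b] by simp
 have univ': "\<exists>!c. c \<in> Hom w' (FO \<pi> f) \<and> Cmp C (l f) c = a' \<and> Cmp C b c = b'"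
  if a': "a' \<in> Hom w' ?xi" and b': "b' \<in> Hom w' y" for w' a' b'
 proof -
  define f' where "f' = PA C a'" define V where "V = PO C w'"
  have f': "f' \<in> ahom V X" using PA_hom[OF a'] xi(2) by (simp add: f'_def V_def)
  have iV: "aid V \<in> ahom V V" using aid_hom[OF ana_homD(3)[OF f']] .
  \<comment> \<open>An object with an arrow to the atlas object is isomorphic to one in the image of
    \<open>\<pi>\<close>; universality is applied there and transported back along
    \<open>th\<close>.\<close>
  obtain th where th: "th \<in> Ov (aid V) w' (FO \<pi> f')" "Cmp C (l f') th = a'"
   using cart_ex[OF l(1)[OF f'] hom_overI[OF a' f'_def[symmetric]], of "aid V"] l(2)[OF f'] iV anaD(5)[OF f'] V_def by metis
  obtain th' where th': "th' \<in> Ov (aid V) (FO \<pi> f') w'" "Cmp C th th' = Idt C (FO \<pi> f')" "Cmp C th' th = Idt C w'"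
   using over_id_inverse[OF th(1)] by blast
  note b'h = hom_overI[OF b' refl]
  have b'': "Cmp C b' th' \<in> Ov (acmp (PA C b') (aid V)) (FO \<pi> f') y" by (rule ho_comp[OF th'(1) b'h])
  obtain s where s: "s \<in> hom_set (yon X) f' f" "Cmp C b (FA \<pi> s) = Cmp C b' th'"
   and su: "\<And>s'. s' \<in> hom_set (yon X) f' f \<Longrightarrow> Cmp C b (FA \<pi> s') = Cmp C b' th' \<Longrightarrow> s' = s"
   using bcs.universalD[OF univ yon_ObjI[OF f'] b''] by blast
  have lt: "Cmp C (l f) (FA \<pi> s') = l f'" if s': "s' \<in> hom_set (yon X) f' f" for s'
  proof -
   obtain n k where sn: "s' = (n, k)" by (cases s')
   have S: "n = f" "k \<in> ahom (mdom f') (mdom f)" "acmp f k = f'" using s'[unfolded sn yon_hom] by auto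
   show ?thesis unfolding l_def using morD(6)[OF m\<pi> s' lh[OF f]] sn S by simp
  qed
  note Fs = hom_overI[OF morD(3)[OF m\<pi> s(1)] refl]
  show ?thesis
  proof (rule ex1I[of _ "Cmp C (FA \<pi> s) th"], intro conjI)
   show "Cmp C (FA \<pi> s) th \<in> Hom w' (FO \<pi> f)" using hoD(4)[OF ho_comp[OF th(1) Fs]] .
   show "Cmp C (l f) (Cmp C (FA \<pi> s) th) = a'" using ho_assoc[OF th(1) Fs l(1)[OF f]] lt[OF s(1)] th(2) by simp
   show "Cmp C b (Cmp C (FA \<pi> s) th) = b'"
    using ho_assoc[OF th(1) Fs b] s(2) ho_assoc[OF th(1) th'(1) b'h] th'(3) ho_idr[OF b'h] by simp
  next
   fix c assume c: "c \<in> Hom w' (FO \<pi> f) \<and> Cmp C (l f) c = a' \<and> Cmp C b c = b'"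
   define k where "k = PA C c"
   have ch: "c \<in> Ov k w' (FO \<pi> f)" using c by (simp add: k_def hom_over_def)
   have k: "k \<in> ahom V (mdom f)" using hoD(3)[OF ch] l(2)[OF f] V_def by simp
   have fk: "acmp f k = f'" using hoD(5)[OF ho_comp[OF ch l(1)[OF f]]] c f'_def by simp
   have sk: "(f, k) \<in> hom_set (yon X) f' f" unfolding yon_hom using f k fk ana_homD(1)[OF f'] by simp
   have Fk: "FA \<pi> (f, k) \<in> Ov k (FO \<pi> f') (FO \<pi> f)" using morD(4)[OF m\<pi> hom_overI[OF sk]] by simp
   have cth: "Cmp C c th' \<in> Ov k (FO \<pi> f') (FO \<pi> f)" using ho_comp[OF th'(1) ch] anaD(5)[OF k] by simp
   have "Cmp C (l f) (Cmp C c th') = l f'"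
    using ho_assoc[OF th'(1) ch l(1)[OF f]] c th(2)[symmetric] ho_assoc[OF th'(1) th(1) l(1)[OF f']] th'(2)
     ho_idr[OF l(1)[OF f']] by simp
   then have e: "Cmp C c th' = FA \<pi> (f, k)" using cart_eq[OF l(1)[OF f] cth Fk] lt[OF sk] by simp
   have "Cmp C b (FA \<pi> (f, k)) = Cmp C b' th'" unfolding e[symmetric] using ho_assoc[OF th'(1) ch b] c by simp
   then have "FA \<pi> s = Cmp C c th'" using su[OF sk] e by simp
   then show "c = Cmp C (FA \<pi> s) th"
    using ho_assoc[OF th(1) th'(1) ch] th'(3) ho_idr[OF ch] by simp
  qed
 qed
 show ?thesis by (rule that[OF hoD(4)[OF l(1)[OF f]] hoD(4)[OF b] R' univ'])
qed

lemma pt_comp: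
 assumes "r \<in> Hom z' z" "e \<in> Hom z y" "t \<in> Pts z'"
 shows "Fn (Cmp C e r) t = Fn e (Fn r t)"
 using PA_Cmp[OF assms(1,2)] mfun_Cmp[OF PA_hom[OF assms(1)] assms(3)] by simp

lemma pt_in:
 assumes "r \<in> Hom z' z" "t \<in> Pts z'"
 shows "Fn r t \<in> Pts z"
 using ana_homD(6)[OF PA_hom[OF assms(1)] assms(2)] .

text \<open>Combines the cartesian property with \<open>factor_open\<close>: a condition on points
  decides whether an arrow factors through a restriction.\<close>

lemma factor_through_open:
 assumes i: "i \<in> Ov (incl U W) zi y" and U: "PO C y = U" and W: "aopen U W"
  and e: "e \<in> Hom z y" and im: "\<And>t. t \<in> Pts z \<Longrightarrow> Fn e t \<in> W"
 shows "\<exists>!c. c \<in> Hom z zi \<and> Cmp C i c = e"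
proof -
 have an: "analytic_space U" using PO_ana[OF hoD(2)[OF i]] U by simp
 have zi: "PO C zi = open_sub U W"
  using ana_homD(1)[OF hoD(3)[OF i]] ana_homD(1)[OF incl_hom[OF an W]] by simp
 have f: "PA C e \<in> ahom (PO C z) U" using PA_hom[OF e] U by simp
 have im': "Fn e ` Pts z \<subseteq> W" using im by auto
 note F = factor_open[OF f W im']
 obtain c where c: "c \<in> Ov (mrestr (PA C e) (Pts z) W) z zi" "Cmp C i c = e"
  using cart_ex[OF i hom_overI[OF e refl]] F zi by metis
 show ?thesis
 proof (rule ex1I[of _ c])
  show "c \<in> Hom z zi \<and> Cmp C i c = e" using hoD(4)[OF c(1)] c(2) by simp
  fix c' assume c': "c' \<in> Hom z zi \<and> Cmp C i c' = e"
  have "acmp (incl U W) (PA C c') = PA C e"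
   using PA_Cmp[OF conjunct1[OF c'] hoD(4)[OF i]] hoD(5)[OF i] c' by simp
  then have "PA C c' = mrestr (PA C e) (Pts z) W"
   using inclusion_mono[OF an W openin_topspace openin_subset[OF W] _ F(1)] F(2) PA_hom[OF conjunct1[OF c']] zi by simp
  then show "c' = c" using cart_eq[OF i _ c(1)] c' c(2) by (simp add: hom_over_def)
 qed
qed

lemma lres_factor:
 assumes "y \<in> Obj C" "aopen (PO C y) W" "e \<in> Hom z y" "\<And>t. t \<in> Pts z \<Longrightarrow> Fn e t \<in> W"
 shows "\<exists>!c. c \<in> Hom z (pres y W) \<and> Cmp C (lres y W) c = e"
 using factor_through_open[OF lres_ho(1)[OF assms(1,2)] refl assms(2-4)] by blast

lemma pt_lres:
 assumes "y \<in> Obj C" "aopen (PO C y) W" "t \<in> W"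
 shows "Fn (lres y W) t = t" "Pts (pres y W) = W"
 using hoD(5)[OF lres_ho(1)[OF assms(1,2)]] openin_subset[OF assms(2)] assms(3)
  lres_ho(2)[OF assms(1,2)] pts_open_sub[OF assms(2)] by simp_all

end

section \<open>The groupoid of an atlas near a point\<close>

lemma stab_iff: "g \<in> carrier (stabilizer C x) \<longleftrightarrow> g \<in> hom_over C (aid (PO C x)) x x"
 by (simp add: stabilizer_def)

lemma Hausdorff_finite_separation:
 assumes H: "Hausdorff_space T" and F: "finite F" and z: "z ` F \<subseteq> topspace T" and inj: "inj_on z F"
 shows "\<exists>U. (\<forall>g\<in>F. openin T (U g)) \<and> (\<forall>g\<in>F. z g \<in> U g) \<and> (\<forall>g\<in>F. \<forall>g'\<in>F. g \<noteq> g' \<longrightarrow> U g \<inter> U g' = {})"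
proof -
 have "\<exists>A B. openin T A \<and> openin T B \<and> z g \<in> A \<and> z g' \<in> B \<and> A \<inter> B = {}"
  if g: "g \<in> F" "g' \<in> F" "g \<noteq> g'" for g g'
 proof -
  have "z g \<noteq> z g'" using inj g by (auto dest: inj_onD)
  then show ?thesis using H z g unfolding Hausdorff_space_def disjnt_def by blast
 qed
 then have "\<forall>g g'. \<exists>A B. g \<in> F \<longrightarrow> g' \<in> F \<longrightarrow> g \<noteq> g' \<longrightarrow> openin T A \<and> openin T B \<and> z g \<in> A \<and> z g' \<in> B \<and> A \<inter> B = {}"
  by (metis (no_types))
 then obtain A B where AB: "\<And>g g'. g \<in> F \<Longrightarrow> g' \<in> F \<Longrightarrow> g \<noteq> g' \<Longrightarrow>
   openin T (A g g') \<and> openin T (B g g') \<and> z g \<in> A g g' \<and> z g' \<in> B g g' \<and> A g g' \<inter> B g g' = {}" by metis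
 \<comment> \<open>Intersecting with the whole space covers the case of a single index, where the
   family of separating sets is empty.\<close>
 define U where "U g = (\<Inter>g'\<in>F - {g}. A g g' \<inter> B g' g) \<inter> topspace T" for g
 have "openin T (U g)" if "g \<in> F" for g
  unfolding U_def using F that AB by (intro openin_INT openin_Int) auto
 moreover have "z g \<in> U g" if "g \<in> F" for g unfolding U_def using AB that z by auto
 moreover have "U g \<inter> U g' = {}" if g: "g \<in> F" "g' \<in> F" "g \<noteq> g'" for g g'
 proof -
  have "U g \<subseteq> A g g'" "U g' \<subseteq> B g g'" unfolding U_def using g by auto
  then show ?thesis using AB[OF g] by blast
 qed
 ultimately show ?thesis by (intro exI[of _ U]) blast
qed

text \<open>\<open>full\<close> and \<open>free\<close> state, without mentioning a fibre product,
  that two arrows to \<open>xi\<close> differ by a unique locally constant element of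
  \<open>G\<close>: the arrow space of the groupoid is \<open>G\<close> times the base of
  \<open>xi\<close>.\<close>

locale groupoid_chart = fibred_category C for C :: "('u, 'o, 'a) ocat" +
 fixes G :: "('g, 'm) monoid_scheme" and xi :: 'o and be :: "'g \<Rightarrow> 'a"
 assumes G: "monoid G" and xi: "xi \<in> Obj C"
  and be: "\<And>g. g \<in> carrier G \<Longrightarrow> be g \<in> Hom xi xi" and be1: "be \<one>\<^bsub>G\<^esub> = Idt C xi"
  and bem: "\<And>g g'. g \<in> carrier G \<Longrightarrow> g' \<in> carrier G \<Longrightarrow> be (g \<otimes>\<^bsub>G\<^esub> g') = Cmp C (be g) (be g')"
  and full: "\<And>y e e'. e \<in> Hom y xi \<Longrightarrow> e' \<in> Hom y xi \<Longrightarrow>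
   \<exists>ga. \<forall>v\<in>Pts y. ga v \<in> carrier G \<and> aopen (PO C y) {u \<in> Pts y. ga u = ga v} \<and>
    (\<forall>z r. r \<in> Hom z y \<longrightarrow> (\<forall>t\<in>Pts z. ga (Fn r t) = ga v) \<longrightarrow>
     Cmp C e' r = Cmp C (be (ga v)) (Cmp C e r))"
  and free: "\<And>g g' z e. g \<in> carrier G \<Longrightarrow> g' \<in> carrier G \<Longrightarrow> e \<in> Hom z xi \<Longrightarrow> Pts z \<noteq> {} \<Longrightarrow>
   Cmp C (be g) e = Cmp C (be g') e \<Longrightarrow> g = g'"

text \<open>\<open>w\<close> with target \<open>a\<close> and source \<open>b\<close> is the arrow
  space of the groupoid presented by the atlas, in the form given by \<open>atlas_universal\<close>;
  \<open>mu\<close> places the point \<open>x\<close> in the atlas.\<close>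

locale atlas_groupoid = fibred_category C for C :: "('u, 'o, 'a) ocat" +
 fixes xi w :: 'o and a b :: 'a and x :: 'o and mu :: 'a
 assumes a: "a \<in> Hom w xi" and b: "b \<in> Hom w xi" and etale: "ana_etale (PA C b)"
  and univ: "\<And>w' a' b'. a' \<in> Hom w' xi \<Longrightarrow> b' \<in> Hom w' xi \<Longrightarrow>
   \<exists>!c. c \<in> Hom w' w \<and> Cmp C a c = a' \<and> Cmp C b c = b'"
  and point: "one_point_space (PO C x)" and mu: "mu \<in> Hom x xi"
  and closed: "representable_with ana_closed C (prod_over C C) diagonal"
  and finite_fibers: "representable_with ana_finite_fibers C (prod_over C C) diagonal"
begin

abbreviation X where "X \<equiv> PO C xi"
abbreviation Z where "Z \<equiv> PO C w"
abbreviation P where "P \<equiv> PO C x"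
abbreviation G where "G \<equiv> carrier (stabilizer C x)"
abbreviation src where "src \<equiv> Fn b"
abbreviation tgt where "tgt \<equiv> Fn a"

section \<open>Stabilizer elements as points of the arrow space\<close>

definition q where "q = (SOME q. q \<in> pts P)"
definition p where "p = Fn mu q"

lemma pts_P: "pts P = {q}"
proof -
 obtain q' where "pts P = {q'}" using one_point_spaceE[OF point] by metis
 then show ?thesis unfolding q_def by (simp add: some_equality)
qed

lemma objs: "x \<in> Obj C" "xi \<in> Obj C" "w \<in> Obj C" using catD(1,2)[OF mu] catD(1)[OF a] by auto

lemma anX: "analytic_space X" and anZ: "analytic_space Z" and anP: "analytic_space P"
 using PO_ana objs by blast+

lemma p_in: "p \<in> pts X" unfolding p_def using pt_in[OF mu] pts_P by simp

lemma univ_ex: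
 assumes "a' \<in> Hom w' xi" "b' \<in> Hom w' xi"
 obtains c where "c \<in> Hom w' w" "Cmp C a c = a'" "Cmp C b c = b'"
 using univ[OF assms] by blast

lemma univ_eq:
 assumes "c \<in> Hom w' w" "c' \<in> Hom w' w" "Cmp C a c = Cmp C a c'" "Cmp C b c = Cmp C b c'"
 shows "c = c'"
 using univ[OF catD(4)[OF assms(1) a] catD(4)[OF assms(1) b]] assms by metis

lemma assoc: "c \<in> Hom u v \<Longrightarrow> d \<in> Hom v y \<Longrightarrow> e \<in> Hom y z \<Longrightarrow> Cmp C e (Cmp C d c) = Cmp C (Cmp C e d) c"
 by (rule catD(7))

lemma cart_eq': "d \<in> Hom y z \<Longrightarrow> c \<in> Hom u y \<Longrightarrow> c' \<in> Hom u y \<Longrightarrow> PA C c = PA C c' \<Longrightarrow>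
 Cmp C d c = Cmp C d c' \<Longrightarrow> c = c'"
 by (rule cart_eq[OF hom_overI[OF _ refl] hom_overI[OF _ refl] hom_overI]) auto

lemma G_hom: "g \<in> G \<Longrightarrow> g \<in> Hom x x"
 by (rule hoD(4)) (simp only: stab_iff)

text \<open>Every automorphism of \<open>x\<close> is a point of the space of isomorphisms from
  \<open>x\<close> to itself. Distinct ones give distinct points, because a map from a reduced point
  is determined by its image, and the diagonal has finite fibres.\<close>

lemma finite_G: "finite G"
proof (rule diagonal_universal[OF finite_fibers objs(1) objs(1) refl])
 fix w0 b1 b2 h
 assume b: "b1 \<in> Ov h w0 x" "b2 \<in> Ov h w0 x" and fin: "ana_finite_fibers h"
  and u: "\<And>w' b1' b2' h'. b1' \<in> Ov h' w' x \<Longrightarrow> b2' \<in> Ov h' w' x \<Longrightarrow>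
   \<exists>!c. c \<in> Hom w' w0 \<and> Cmp C b1 c = b1' \<and> Cmp C b2 c = b2'"
 have "\<exists>c. c \<in> Hom x w0 \<and> Cmp C b1 c = Idt C x \<and> Cmp C b2 c = g" if g: "g \<in> G" for g
  using u[OF ho_id[OF objs(1)] g[unfolded stab_iff]] by blast
 then obtain c where c: "\<And>g. g \<in> G \<Longrightarrow> c g \<in> Hom x w0 \<and> Cmp C b1 (c g) = Idt C x \<and> Cmp C b2 (c g) = g" by metis
 note h = hoD(3)[OF b(1)]
 have qP: "q \<in> pts P" using pts_P by simp
 have "inj_on (\<lambda>g. Fn (c g) q) G"
 proof (rule inj_onI)
  fix g g' assume g: "g \<in> G" "g' \<in> G" and e: "Fn (c g) q = Fn (c g') q"
  have "PA C (c g) = PA C (c g')"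
   by (rule point_unique[OF point pts_P _ _ e]) (use c g PA_hom in blast)+
  then have "c g = c g'" using cart_eq'[OF hoD(4)[OF b(1)], of "c g" x "c g'"] c g by simp
  then show "g = g'" using c g by metis
 qed
 moreover have "(\<lambda>g. Fn (c g) q) ` G \<subseteq> {z \<in> Pts w0. mfun h z = q}"
 proof
  fix z assume "z \<in> (\<lambda>g. Fn (c g) q) ` G"
  then obtain g where g: "g \<in> G" "z = Fn (c g) q" by blast
  have "z \<in> Pts w0" using pt_in c[OF g(1)] qP g(2) by blast
  then show "z \<in> {z \<in> Pts w0. mfun h z = q}" using ana_homD(6)[OF h] pts_P by simp
 qed
 moreover have "finite {z \<in> Pts w0. mfun h z = q}"
  using fin qP ana_homD(1,2)[OF h] unfolding ana_finite_fibers_def by auto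
 ultimately show "finite G" by (rule inj_on_finite)
qed

lemma G_mult: "g \<in> G \<Longrightarrow> g' \<in> G \<Longrightarrow> Cmp C g g' \<in> G" and G_one: "Idt C x \<in> G"
proof -
 note i = aid_hom[OF anP]
 show "g \<in> G \<Longrightarrow> g' \<in> G \<Longrightarrow> Cmp C g g' \<in> G"
  unfolding stab_iff using ho_comp[of g' "aid P" x x g "aid P" x] anaD(5)[OF i] by simp
 show "Idt C x \<in> G" unfolding stab_iff by (rule ho_id[OF objs(1)])
qed

lemma monoid_stabilizer: "monoid (stabilizer C x)"
proof (rule monoidI)
 let ?G = "stabilizer C x"
 show "(h \<otimes>\<^bsub>?G\<^esub> k) \<otimes>\<^bsub>?G\<^esub> l = h \<otimes>\<^bsub>?G\<^esub> (k \<otimes>\<^bsub>?G\<^esub> l)" if "h \<in> G" "k \<in> G" "l \<in> G" for h k l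
  using assoc[OF G_hom[OF that(3)] G_hom[OF that(2)] G_hom[OF that(1)]] by (simp add: stabilizer_def)
qed (use G_mult G_one catD(5,6)[OF G_hom] in \<open>auto simp: stabilizer_def\<close>)

lemma mug: "g \<in> G \<Longrightarrow> Cmp C mu g \<in> Hom x xi" "g \<in> G \<Longrightarrow> PA C (Cmp C mu g) = PA C mu"
 using catD(4)[OF G_hom mu] PA_Cmp[OF G_hom mu] hoD(5)[of g "aid P" x x] anaD(5)[OF PA_hom[OF mu]]
 by (auto simp: stab_iff)

text \<open>The universal pair turns two arrows from \<open>x\<close> to the atlas object into an
  arrow to \<open>w\<close>. Moving only the target leg by \<open>g\<close> fixes the side on which
  the stabilizer acts.\<close>

definition nu where "nu g = (THE c. c \<in> Hom x w \<and> Cmp C a c = Cmp C mu g \<and> Cmp C b c = mu)"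

lemma nu:
 assumes "g \<in> G"
 shows "nu g \<in> Hom x w" "Cmp C a (nu g) = Cmp C mu g" "Cmp C b (nu g) = mu"
 using theI'[OF univ[OF mug(1)[OF assms] mu]] unfolding nu_def by auto

definition zpt where "zpt g = Fn (nu g) q"

lemma zpt:
 assumes g: "g \<in> G"
 shows "zpt g \<in> pts Z" "src (zpt g) = p" "tgt (zpt g) = p"
proof -
 have qP: "q \<in> pts P" using pts_P by simp
 show "zpt g \<in> pts Z" unfolding zpt_def by (rule pt_in[OF nu(1)[OF g] qP])
 show "src (zpt g) = p" unfolding zpt_def p_def using pt_comp[OF nu(1)[OF g] b qP] nu(3)[OF g] by simp
 show "tgt (zpt g) = p" unfolding zpt_def p_def using pt_comp[OF nu(1)[OF g] a qP] nu(2)[OF g] mug(2)[OF g] by simp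
qed

lemma point_eq:
 assumes "c \<in> Hom x z" "c' \<in> Hom x z" "d \<in> Hom z y"
  "Fn c q = Fn c' q" "Cmp C d c = Cmp C d c'"
 shows "c = c'"
 by (rule cart_eq'[OF assms(3,1,2) point_unique[OF point pts_P PA_hom[OF assms(1)] PA_hom[OF assms(2)] assms(4)] assms(5)])

lemma inj_zpt: "inj_on zpt G"
proof (rule inj_onI)
 fix g g' assume g: "g \<in> G" "g' \<in> G" "zpt g = zpt g'"
 have "nu g = nu g'" by (rule point_eq[OF nu(1)[OF g(1)] nu(1)[OF g(2)] b])
  (use g(3) nu(3)[OF g(1)] nu(3)[OF g(2)] in \<open>simp_all add: zpt_def\<close>)
 then have "Cmp C mu g = Cmp C mu g'" using nu(2)[OF g(1)] nu(2)[OF g(2)] by simp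
 moreover have "PA C g = PA C g'" using g hoD(5) unfolding stab_iff by metis
 ultimately show "g = g'" using cart_eq'[OF mu G_hom[OF g(1)] G_hom[OF g(2)]] by simp
qed

text \<open>Pull \<open>w\<close> back to the reduced point \<open>z\<close> and identify the result
  with \<open>x\<close> by matching sources; the target then differs from \<open>mu\<close> by an
  automorphism of \<open>x\<close>.\<close>

lemma fibre:
 assumes z: "z \<in> pts Z" "src z = p" "tgt z = p"
 shows "\<exists>g\<in>G. z = zpt g"
proof -
 have qP: "q \<in> pts P" using pts_P by simp
 obtain k where k: "k \<in> ahom P Z" "mfun k q = z" by (rule point_exists[OF point pts_P anZ z(1)])
 define l where "l = lift k w" define u where "u = pull k w"
 have l: "l \<in> Ov k u w" "PO C u = P" unfolding l_def u_def using lift_ho[OF objs(3) k(1)] PO_pull[OF objs(3) k(1)] by auto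
 have l': "l \<in> Hom u w" by (rule hoD(4)[OF l(1)])
 note al = catD(4)[OF l' a] and bl = catD(4)[OF l' b]
 have "PA C (Cmp C d l) = PA C mu" if d: "d \<in> Hom w xi" "Fn d z = p" for d
 proof (rule point_unique[OF point pts_P])
  show "PA C (Cmp C d l) \<in> ahom P X" using PA_hom[OF catD(4)[OF l' d(1)]] l(2) by simp
  show "PA C mu \<in> ahom P X" by (rule PA_hom[OF mu])
  show "Fn (Cmp C d l) q = Fn mu q"
   using pt_comp[OF l' d(1), of q] qP l(2) hoD(5)[OF l(1)] k(2) d(2) p_def by simp
 qed
 note Pa = this[OF a z(3)] and Pb = this[OF b z(2)]
 have iP: "aid P \<in> ahom P P" by (rule aid_hom[OF anP])
 \<comment> \<open>The identification is made through the source leg, so afterwards only the target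
   leg carries information.\<close>
 obtain th where th: "th \<in> Ov (aid P) x u" "Cmp C (Cmp C b l) th = mu"
  using cart_ex[OF hom_overI[OF bl Pb] hom_overI[OF mu refl], of "aid P"] l(2) iP anaD(5)[OF PA_hom[OF mu]] by metis
 note th' = hoD(4)[OF th(1)]
 define n where "n = Cmp C l th"
 have n: "n \<in> Hom x w" "Cmp C b n = mu" unfolding n_def using catD(4)[OF th' l'] assoc[OF th' l' b] th(2) by auto
 have an: "Cmp C a n \<in> Ov (PA C mu) x xi"
  unfolding n_def using ho_comp[OF th(1) hom_overI[OF al Pa]] anaD(5)[OF PA_hom[OF mu]] assoc[OF th' l' a] by simp
 obtain g where g: "g \<in> Ov (aid P) x x" "Cmp C mu g = Cmp C a n"
  using cart_ex[OF hom_overI[OF mu refl] an, of "aid P"] iP anaD(5)[OF PA_hom[OF mu]] by metis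
 have gG: "g \<in> G" using g(1) by (simp only: stab_iff)
 have "n = nu g" by (rule univ_eq[OF n(1) nu(1)[OF gG]]) (use g(2) nu[OF gG] n in auto)
 moreover have "Fn n q = z"
 proof -
  have "Fn th q = q" using hoD(5)[OF th(1)] mfun_Idt[OF qP] by simp
  then show ?thesis unfolding n_def using pt_comp[OF th' l' qP] hoD(5)[OF l(1)] k(2) by simp
 qed
 ultimately show ?thesis using gG unfolding zpt_def by auto
qed

text \<open>Pulled back to the space of \<open>local_product\<close>, the closed diagonal shows that the set of pairs
 \<open>(tgt z, src z)\<close> with \<open>z\<close> outside \<open>O'\<close> is closed near \<open>(p, p)\<close>.\<close>

lemma separation:
 assumes O: "aopen Z O'" and fib: "\<And>z. z \<in> pts Z \<Longrightarrow> src z = p \<Longrightarrow> tgt z = p \<Longrightarrow> z \<in> O'"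
 shows "\<exists>V. aopen X V \<and> p \<in> V \<and> (\<forall>z\<in>pts Z. src z \<in> V \<longrightarrow> tgt z \<in> V \<longrightarrow> z \<in> O')"
proof -
 show ?thesis
 proof (rule local_product[OF anX p_in point])
 fix T a1 a2 t0 U
 assume T: "a1 \<in> ahom T X" "a2 \<in> ahom T X" "t0 \<in> pts T" "mfun a1 t0 = p" "mfun a2 t0 = p"
  "aopen X U" "p \<in> U"
  and hit: "\<And>u v. u \<in> U \<Longrightarrow> v \<in> U \<Longrightarrow> \<exists>t\<in>pts T. mfun a1 t = u \<and> mfun a2 t = v"
  and nb: "\<And>W. aopen T W \<Longrightarrow> t0 \<in> W \<Longrightarrow>
   \<exists>V. aopen X V \<and> p \<in> V \<and> V \<subseteq> U \<and> (\<forall>t\<in>pts T. mfun a1 t \<in> V \<and> mfun a2 t \<in> V \<longrightarrow> t \<in> W)"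
 have anT: "analytic_space T" by (rule ana_homD(3)[OF T(1)])
 define y1 where "y1 = pull a1 xi" define y2 where "y2 = pull a2 xi"
 define l1 where "l1 = lift a1 xi" define l2 where "l2 = lift a2 xi"
 have l: "l1 \<in> Ov a1 y1 xi" "l2 \<in> Ov a2 y2 xi" and y: "y1 \<in> Obj C" "y2 \<in> Obj C" "PO C y1 = T" "PO C y2 = T"
  unfolding y1_def y2_def l1_def l2_def using lift_ho PO_pull objs(2) T(1,2) by blast+
 have y12: "PO C y1 = PO C y2" using y by simp
 show ?thesis
 proof (rule diagonal_universal[OF closed y(1,2) y12])
  fix v d1 d2 h
  assume d: "d1 \<in> Ov h v y1" "d2 \<in> Ov h v y2" and cl: "ana_closed h"
   and u: "\<And>w' b1' b2' h'. b1' \<in> Ov h' w' y1 \<Longrightarrow> b2' \<in> Ov h' w' y2 \<Longrightarrow>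
    \<exists>!c. c \<in> Hom w' v \<and> Cmp C d1 c = b1' \<and> Cmp C d2 c = b2'"
  let ?Q = "PO C v"
  have h: "h \<in> ahom ?Q T" using hoD(3)[OF d(1)] y by simp
  note d1 = hoD(4)[OF d(1)] and d2 = hoD(4)[OF d(2)] and l1 = hoD(4)[OF l(1)] and l2 = hoD(4)[OF l(2)]
  \<comment> \<open>An isomorphism between the two pullbacks of \<open>xi\<close> is in particular a
    pair of arrows to \<open>xi\<close>, hence gives a map to \<open>w\<close>.\<close>
  obtain c where c: "c \<in> Hom v w" "Cmp C a c = Cmp C l1 d1" "Cmp C b c = Cmp C l2 d2"
   by (rule univ_ex[OF catD(4)[OF d1 l1] catD(4)[OF d2 l2]])
  let ?k = "Fn c"
  have kQ: "?k ze \<in> pts Z" "tgt (?k ze) = mfun a1 (mfun h ze)" "src (?k ze) = mfun a2 (mfun h ze)" if "ze \<in> pts ?Q" for ze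
   using pt_in[OF c(1) that] pt_comp[OF c(1) a that] pt_comp[OF c(1) b that] c(2,3)
    pt_comp[OF d1 l1 that] pt_comp[OF d2 l2 that] hoD(5)[OF l(1)] hoD(5)[OF l(2)] hoD(5)[OF d(1)] hoD(5)[OF d(2)] by simp_all
  define N where "N = {ze \<in> pts ?Q. ?k ze \<in> O'}"
  have "aopen ?Q N" unfolding N_def by (rule openin_vimage[OF PA_hom[OF c(1)] O])
  then have "closedin (tp ?Q) (pts ?Q - N)" by (rule closedin_diff[OF closedin_topspace])
  then have "closedin (tp T) (mfun h ` (pts ?Q - N))"
   using cl ana_homD(1,2)[OF h] unfolding ana_closed_def closed_map_def by simp
  then have oW: "aopen T (pts T - mfun h ` (pts ?Q - N))" by (rule openin_diff[OF openin_topspace])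
  \<comment> \<open>A point over \<open>t0\<close> outside \<open>N\<close> would give a point of
    \<open>Z\<close> over \<open>(p, p)\<close> outside \<open>O'\<close>.\<close>
  have "t0 \<notin> mfun h ` (pts ?Q - N)"
  proof
   assume "t0 \<in> mfun h ` (pts ?Q - N)"
   then obtain ze where ze: "ze \<in> pts ?Q" "ze \<notin> N" "mfun h ze = t0" by blast
   have "?k ze \<in> O'" by (rule fib) (use kQ[OF ze(1)] ze(3) T(4,5) in auto)
   then show False using ze N_def by auto
  qed
  then have "t0 \<in> pts T - mfun h ` (pts ?Q - N)" using T(3) by blast
  from nb[OF oW this] obtain V where V: "aopen X V" "p \<in> V" "V \<subseteq> U"
   "\<forall>t\<in>pts T. mfun a1 t \<in> V \<and> mfun a2 t \<in> V \<longrightarrow> t \<in> pts T - mfun h ` (pts ?Q - N)" by blast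
  \<comment> \<open>\<open>T\<close> hits the pair \<open>(tgt z, src z)\<close> at some
    \<open>t\<close>, and \<open>z\<close> lifts to a point of the universal object over
    \<open>t\<close>. As \<open>t\<close> avoids the removed closed image, the lift lies in
    \<open>N\<close>.\<close>
  have "z \<in> O'" if z: "z \<in> pts Z" "src z \<in> V" "tgt z \<in> V" for z
  proof -
   have qP: "q \<in> pts P" using pts_P by simp
   obtain t where t: "t \<in> pts T" "mfun a1 t = tgt z" "mfun a2 t = src z" using hit z V(3) by blast
   obtain k where k: "k \<in> ahom P Z" "mfun k q = z" by (rule point_exists[OF point pts_P anZ z(1)])
   obtain ta where ta: "ta \<in> ahom P T" "mfun ta q = t" by (rule point_exists[OF point pts_P anT t(1)])
   define m where "m = lift k w" define n where "n = pull k w"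
   have m: "m \<in> Ov k n w" "PO C n = P" unfolding m_def n_def using lift_ho[OF objs(3) k(1)] PO_pull[OF objs(3) k(1)] by auto
   note m' = hoD(4)[OF m(1)]
   have e1: "acmp a1 ta = PA C (Cmp C a m)"
   proof (rule point_unique[OF point pts_P acmp_hom[OF ta(1) T(1)]])
    show "PA C (Cmp C a m) \<in> ahom P X" using PA_hom[OF catD(4)[OF m' a]] m(2) by simp
    show "mfun (acmp a1 ta) q = Fn (Cmp C a m) q"
     using mfun_Cmp[OF ta(1) qP, of a1] pt_comp[OF m' a, of q] qP m(2) hoD(5)[OF m(1)] k(2) ta(2) t(2) by simp
   qed
   have e2: "acmp a2 ta = PA C (Cmp C b m)"
   proof (rule point_unique[OF point pts_P acmp_hom[OF ta(1) T(2)]])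
    show "PA C (Cmp C b m) \<in> ahom P X" using PA_hom[OF catD(4)[OF m' b]] m(2) by simp
    show "mfun (acmp a2 ta) q = Fn (Cmp C b m) q"
     using mfun_Cmp[OF ta(1) qP, of a2] pt_comp[OF m' b, of q] qP m(2) hoD(5)[OF m(1)] k(2) ta(2) t(3) by simp
   qed
   obtain f1 where f1: "f1 \<in> Ov ta n y1" "Cmp C l1 f1 = Cmp C a m"
    using cart_ex[OF l(1) hom_overI[OF catD(4)[OF m' a] refl], of ta] ta(1) m(2) y(3) e1 by metis
   obtain f2 where f2: "f2 \<in> Ov ta n y2" "Cmp C l2 f2 = Cmp C b m"
    using cart_ex[OF l(2) hom_overI[OF catD(4)[OF m' b] refl], of ta] ta(1) m(2) y(4) e2 by metis
   obtain r where r: "r \<in> Hom n v" "Cmp C d1 r = f1" "Cmp C d2 r = f2" using u[OF f1(1) f2(1)] by blast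
   have cr: "Cmp C c r = m"
   proof (rule univ_eq[OF catD(4)[OF r(1) c(1)] m'])
    show "Cmp C a (Cmp C c r) = Cmp C a m" using assoc[OF r(1) c(1) a] c(2) assoc[OF r(1) d1 l1] r(2) f1(2) by simp
    show "Cmp C b (Cmp C c r) = Cmp C b m" using assoc[OF r(1) c(1) b] c(3) assoc[OF r(1) d2 l2] r(3) f2(2) by simp
   qed
   define ze where "ze = Fn r q"
   have qn: "q \<in> Pts n" using qP m(2) by simp
   have ze: "ze \<in> pts ?Q" unfolding ze_def by (rule pt_in[OF r(1) qn])
   have kze: "?k ze = z" unfolding ze_def using pt_comp[OF r(1) c(1) qn] cr hoD(5)[OF m(1)] k(2) by simp
   have "mfun h ze = t" unfolding ze_def using pt_comp[OF r(1) d1 qn] r(2) hoD(5)[OF f1(1)] ta(2) hoD(5)[OF d(1)] by simp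
   moreover have "t \<notin> mfun h ` (pts ?Q - N)" using V(4) t z(2,3) by auto
   ultimately have "ze \<in> N" using ze by blast
   then show ?thesis using kze N_def by auto
  qed
  then show ?thesis using V(1,2) by blast
 qed
 qed
qed

text \<open>The partial operations \<open>act g\<close> on arrows into \<open>xi\<close> come before
  the endomorphisms \<open>be g\<close>: the latter need an invariant open set, whose construction
  already uses the laws of the former. Arrows rather than points retain nilpotents.\<close>

lemma local_chart:
 obtains S xiS i be muS where "aopen X S" "i \<in> Ov (incl X S) xiS xi"
  "groupoid_chart C (stabilizer C x) xiS be" "muS \<in> Hom x xiS"
proof -
 have qP: "q \<in> pts P" using pts_P by simp
 have bZ: "PA C b \<in> ahom Z X" by (rule PA_hom[OF b])
 have H: "Hausdorff_space (tp Z)" using anZ by (simp add: analytic_space_def)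
 have zG: "zpt ` G \<subseteq> pts Z" using zpt(1) by blast
 \<comment> \<open>Disjointness ensures that a point of the arrow space lies on at most one of the
   sheets chosen inside these sets.\<close>
 from Hausdorff_finite_separation[OF H finite_G zG inj_zpt] obtain O' where O0: "(\<forall>g\<in>G. aopen Z (O' g)) \<and> (\<forall>g\<in>G. zpt g \<in> O' g) \<and>
  (\<forall>g\<in>G. \<forall>g'\<in>G. g \<noteq> g' \<longrightarrow> O' g \<inter> O' g' = {})"
  by (elim exE)
 have O: "\<And>g. g \<in> G \<Longrightarrow> aopen Z (O' g)" "\<And>g. g \<in> G \<Longrightarrow> zpt g \<in> O' g"
  "\<And>g g'. g \<in> G \<Longrightarrow> g' \<in> G \<Longrightarrow> g \<noteq> g' \<Longrightarrow> O' g \<inter> O' g' = {}"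
  using O0 by blast+
 \<comment> \<open>Bundles the output of \<open>etale_section\<close>, so that a sheet, its image
   and its section can be chosen for all \<open>g\<close> at once.\<close>
 define R where "R g U V s \<longleftrightarrow> aopen Z U \<and> zpt g \<in> U \<and> U \<subseteq> O' g \<and> aopen X V \<and> src ` U = V \<and>
  s \<in> ahom (open_sub X V) Z \<and> mfun s ` V = U \<and> acmp (PA C b) s = incl X V \<and>
  (\<forall>Q k k'. k \<in> ahom Q Z \<longrightarrow> k' \<in> ahom Q Z \<longrightarrow> mfun k ` pts Q \<subseteq> U \<longrightarrow>
   mfun k' ` pts Q \<subseteq> U \<longrightarrow> acmp (PA C b) k = acmp (PA C b) k' \<longrightarrow> k = k')" for g U V s
 have "\<exists>t. R g (fst t) (fst (snd t)) (snd (snd t))" if g: "g \<in> G" for g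
 proof (rule etale_section[OF bZ etale zpt(1)[OF g] O(1,2)[OF g]])
  fix U V s
  assume *: "aopen Z U" "zpt g \<in> U" "U \<subseteq> O' g" "aopen X V" "src ` U = V"
   "s \<in> ahom (open_sub X V) Z" "mfun s ` V = U" "acmp (PA C b) s = incl X V"
   and m: "\<And>Q k k'. k \<in> ahom Q Z \<Longrightarrow> k' \<in> ahom Q Z \<Longrightarrow> mfun k ` pts Q \<subseteq> U \<Longrightarrow>
   mfun k' ` pts Q \<subseteq> U \<Longrightarrow> acmp (PA C b) k = acmp (PA C b) k' \<Longrightarrow> k = k'"
  have "R g U V s" unfolding R_def using * m by blast
  then show ?thesis by (intro exI[of _ "(U, V, s)"]) simp
 qed
 then obtain t where t: "R g (fst (t g)) (fst (snd (t g))) (snd (snd (t g)))" if "g \<in> G" for g by metis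
 define U where "U g = fst (t g)" for g
 define V where "V g = fst (snd (t g))" for g
 define s where "s g = snd (snd (t g))" for g
 note t' = t[folded U_def V_def s_def, unfolded R_def]
 have U: "\<And>g. g \<in> G \<Longrightarrow> aopen Z (U g)" "\<And>g. g \<in> G \<Longrightarrow> zpt g \<in> U g" "\<And>g. g \<in> G \<Longrightarrow> U g \<subseteq> O' g"
  and V: "\<And>g. g \<in> G \<Longrightarrow> aopen X (V g)" "\<And>g. g \<in> G \<Longrightarrow> src ` U g = V g"
  and s: "\<And>g. g \<in> G \<Longrightarrow> s g \<in> ahom (open_sub X (V g)) Z" "\<And>g. g \<in> G \<Longrightarrow> mfun (s g) ` V g = U g"
   "\<And>g. g \<in> G \<Longrightarrow> acmp (PA C b) (s g) = incl X (V g)"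
  using t' by blast+
 have mono: "k = k'" if "g \<in> G" "k \<in> ahom Q Z" "k' \<in> ahom Q Z" "mfun k ` pts Q \<subseteq> U g"
   "mfun k' ` pts Q \<subseteq> U g" "acmp (PA C b) k = acmp (PA C b) k'" for g Q k k'
  using t'[OF that(1)] that(2-) by blast
 have disj: "g = g'" if "g \<in> G" "g' \<in> G" "z \<in> U g" "z \<in> U g'" for g g' z using O(3)[OF that(1,2)] U(3) that by blast
 have VX: "V g \<subseteq> pts X" if "g \<in> G" for g using openin_subset[OF V(1)[OF that]] .
 have sv: "src (mfun (s g) v) = v" "mfun (s g) v \<in> U g" if "g \<in> G" "v \<in> V g" for g v
 proof -
  have "v \<in> pts (open_sub X (V g))" using pts_open_sub[OF V(1)[OF that(1)]] that(2) by simp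
  from mfun_Cmp[OF s(1)[OF that(1)] this, of "PA C b"] show "src (mfun (s g) v) = v"
   using s(3)[OF that(1)] that VX by simp
  show "mfun (s g) v \<in> U g" using s(2)[OF that(1)] that(2) by blast
 qed
 have us: "mfun (s g) (src z) = z" if g: "g \<in> G" "z \<in> U g" for g z
 proof -
  obtain v where "v \<in> V g" "z = mfun (s g) v" using s(2)[OF g(1)] g(2) by blast
  then show ?thesis using sv(1)[OF g(1)] by simp
 qed
 define maps where "maps e z A \<longleftrightarrow> (\<forall>t\<in>Pts z. Fn e t \<in> A)" for e z and A :: "'u set"
 have maps_comp: "maps (Cmp C e r) z' A" if "maps e z A" "r \<in> Hom z' z" "e \<in> Hom z y" for e r z z' y A
  using that pt_comp[OF that(2,3)] pt_in[OF that(2)] unfolding maps_def by simp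
 \<comment> \<open>The base map of the lift is prescribed by the section of the sheet, the lift
   itself is cartesian, and rigidity of the sheet makes it unique.\<close>
 have lft_ex: "\<exists>!c. c \<in> Hom z w \<and> Cmp C b c = e \<and> maps c z (U g)"
  if g: "g \<in> G" and e: "e \<in> Hom z xi" "maps e z (V g)" for g e z
 proof -
  have f: "PA C e \<in> ahom (PO C z) X" by (rule PA_hom[OF e(1)])
  have im: "Fn e ` Pts z \<subseteq> V g" using e(2) unfolding maps_def by auto
  note F = factor_open[OF f V(1)[OF g] im]
  let ?k = "acmp (s g) (mrestr (PA C e) (Pts z) (V g))"
  have k: "?k \<in> ahom (PO C z) Z" by (rule acmp_hom[OF F(1) s(1)[OF g]])
  have "acmp (PA C b) ?k = PA C e" using anaD(7)[OF F(1) s(1)[OF g] bZ] s(3)[OF g] F(2) by simp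
  from cart_ex[OF hom_overI[OF b refl] hom_overI[OF e(1) refl] k this]
  obtain c where c: "c \<in> Ov ?k z w" "Cmp C b c = e" by blast
  have mc: "maps c z (U g)"
   unfolding maps_def hoD(5)[OF c(1)]
  proof
   fix t assume t: "t \<in> Pts z"
   have "Fn e t \<in> V g" using e(2) t unfolding maps_def by blast
   then show "mfun ?k t \<in> U g" using mfun_Cmp[OF F(1) t, of "s g"] t sv(2)[OF g] by simp
  qed
  show ?thesis
  proof (rule ex1I[of _ c])
   show "c \<in> Hom z w \<and> Cmp C b c = e \<and> maps c z (U g)" using hoD(4)[OF c(1)] c(2) mc by simp
   fix c' assume c': "c' \<in> Hom z w \<and> Cmp C b c' = e \<and> maps c' z (U g)"
   have "PA C c' = PA C c"
   proof (rule mono[OF g])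
    show "PA C c' \<in> ahom (PO C z) Z" "PA C c \<in> ahom (PO C z) Z" using PA_hom c' hoD(4)[OF c(1)] by blast+
    show "Fn c' ` Pts z \<subseteq> U g" "Fn c ` Pts z \<subseteq> U g" using c' mc unfolding maps_def by auto
    show "acmp (PA C b) (PA C c') = acmp (PA C b) (PA C c)"
     using PA_Cmp[OF conjunct1[OF c'] b] PA_Cmp[OF hoD(4)[OF c(1)] b] c' c(2) by simp
   qed
   then show "c' = c" using cart_eq'[OF b conjunct1[OF c'] hoD(4)[OF c(1)]] c' c(2) by simp
  qed
 qed
 define lft where "lft g z e = (THE c. c \<in> Hom z w \<and> Cmp C b c = e \<and> maps c z (U g))" for g z e
 have lft: "lft g z e \<in> Hom z w" "Cmp C b (lft g z e) = e" "maps (lft g z e) z (U g)"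
  if "g \<in> G" "e \<in> Hom z xi" "maps e z (V g)" for g e z
  using theI'[OF lft_ex[OF that]] unfolding lft_def by auto
 have lft_eq: "c = lft g z e" if "g \<in> G" "e \<in> Hom z xi" "maps e z (V g)" "c \<in> Hom z w" "Cmp C b c = e" "maps c z (U g)" for g e z c
  using lft_ex[OF that(1-3)] lft[OF that(1-3)] that(4-6) by blast
 \<comment> \<open>Lift to the sheet labelled \<open>g\<close>, then pass to the target.\<close>
 define act where "act g z e = Cmp C a (lft g z e)" for g z e
 have act_hom: "act g z e \<in> Hom z xi" if "g \<in> G" "e \<in> Hom z xi" "maps e z (V g)" for g e z
  unfolding act_def by (rule catD(4)[OF lft(1)[OF that] a])
 have lft_nat: "Cmp C (lft g z e) r = lft g z' (Cmp C e r)"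
  if g: "g \<in> G" and e: "e \<in> Hom z xi" "maps e z (V g)" and r: "r \<in> Hom z' z" for g e z r z'
  using lft_eq[OF g catD(4)[OF r e(1)] maps_comp[OF e(2) r e(1)] catD(4)[OF r lft(1)[OF g e]]]
   assoc[OF r lft(1)[OF g e] b] lft(2)[OF g e] maps_comp[OF lft(3)[OF g e] r lft(1)[OF g e]] by simp
 have act_nat: "Cmp C (act g z e) r = act g z' (Cmp C e r)"
  if g: "g \<in> G" and e: "e \<in> Hom z xi" "maps e z (V g)" and r: "r \<in> Hom z' z" for g e z r z'
  unfolding act_def using assoc[OF r lft(1)[OF g e] a] lft_nat[OF g e r] by simp
 \<comment> \<open>The effect of \<open>act g\<close> on underlying points; see
   \<open>act_pt\<close> below.\<close>
 define ph where "ph g v = tgt (mfun (s g) v)" for g v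
 have act_pt: "Fn (act g z e) t = ph g (Fn e t)"
  if g: "g \<in> G" and e: "e \<in> Hom z xi" "maps e z (V g)" and t: "t \<in> Pts z" for g e z t
 proof -
  let ?z = "Fn (lft g z e) t"
  have "?z \<in> U g" using lft(3)[OF g e] t unfolding maps_def by blast
  then have "mfun (s g) (src ?z) = ?z" by (rule us[OF g])
  moreover have "src ?z = Fn e t" using pt_comp[OF lft(1)[OF g e] b t] lft(2)[OF g e] by simp
  ultimately show ?thesis unfolding act_def ph_def using pt_comp[OF lft(1)[OF g e] a t] by simp
 qed
 have pV: "p \<in> V g" and php: "ph g p = p" if g: "g \<in> G" for g
 proof -
  show "p \<in> V g" using imageI[OF U(2)[OF g], of src] V(2)[OF g] zpt(2)[OF g] by simp
  show "ph g p = p" unfolding ph_def using us[OF g U(2)[OF g]] zpt(2,3)[OF g] by simp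
 qed
 have maps_mu: "maps e x A \<longleftrightarrow> Fn e q \<in> A" for e A unfolding maps_def pts_P by simp
 have muV: "maps mu x (V g)" if "g \<in> G" for g unfolding maps_mu using pV[OF that] p_def by simp
 have act_mu: "act g x mu = Cmp C mu g" if g: "g \<in> G" for g
 proof -
  have "maps (nu g) x (U g)" unfolding maps_mu using U(2)[OF g] zpt_def by simp
  then have "nu g = lft g x mu" by (rule lft_eq[OF g mu muV[OF g] nu(1,3)[OF g]])
  then show ?thesis unfolding act_def using nu(2)[OF g] by simp
 qed
 have act_mug: "act g x (Cmp C mu g') = Cmp C mu (Cmp C g g')" if g: "g \<in> G" "g' \<in> G" for g g'
  using act_nat[OF g(1) mu muV[OF g(1)] G_hom[OF g(2)]] act_mu[OF g(1)] assoc[OF G_hom[OF g(2)] G_hom[OF g(1)] mu] by simp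
 have ph_open: "aopen X {v \<in> V g. ph g v \<in> A}" if g: "g \<in> G" and A: "aopen X A" for g A
 proof -
  have h: "acmp (PA C a) (s g) \<in> ahom (open_sub X (V g)) X" by (rule acmp_hom[OF s(1)[OF g] PA_hom[OF a]])
  have "aopen (open_sub X (V g)) {v \<in> V g. mfun (acmp (PA C a) (s g)) v \<in> A}"
   using openin_vimage[OF h A] unfolding pts_open_sub[OF V(1)[OF g]] .
  moreover have "{v \<in> V g. mfun (acmp (PA C a) (s g)) v \<in> A} = {v \<in> V g. ph g v \<in> A}"
   using mfun_Cmp[OF s(1)[OF g], of _ "PA C a"] unfolding pts_open_sub[OF V(1)[OF g]] ph_def by auto
  ultimately show ?thesis using open_sub_iff[OF V(1)[OF g]] by simp
 qed
 \<comment> \<open>Naturality in the source means that such an operation is determined by its value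
   on the restriction arrow of \<open>xi\<close> to \<open>N\<close>.\<close>
 define nat_op where "nat_op N P \<longleftrightarrow> (\<forall>z e. e \<in> Hom z xi \<longrightarrow> maps e z N \<longrightarrow> P z e \<in> Hom z xi \<and>
   (\<forall>u k. k \<in> Hom u z \<longrightarrow> Cmp C (P z e) k = P u (Cmp C e k)))" for N P
 text \<open>Operations on arrows to \<open>xi\<close> which agree at the point \<open>x\<close> agree near it, because they are compared
   by two sections of the etale map \<open>src\<close>.\<close>
 have agree: "\<exists>N. aopen X N \<and> p \<in> N \<and> N \<subseteq> N0 \<and> (\<forall>z e. e \<in> Hom z xi \<longrightarrow> maps e z N \<longrightarrow> P1 z e = P2 z e)"
  if N0: "aopen X N0" "p \<in> N0" and nat: "nat_op N0 P1" "nat_op N0 P2" and eq: "P1 x mu = P2 x mu" for N0 P1 P2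
 proof -
  let ?z = "pres xi N0" let ?r = "lres xi N0"
  have r: "?r \<in> Hom ?z xi" using hoD(4)[OF lres_ho(1)[OF objs(2) N0(1)]] .
  have rpt: "Fn ?r t = t" if "t \<in> N0" for t using pt_lres(1)[OF objs(2) N0(1) that] .
  have pz: "Pts ?z = N0" using pt_lres(2)[OF objs(2) N0] .
  have rm: "maps ?r ?z N0" unfolding maps_def pz using rpt by simp
  have e: "P1 ?z ?r \<in> Hom ?z xi" "P2 ?z ?r \<in> Hom ?z xi"
   and nat': "\<And>u k. k \<in> Hom u ?z \<Longrightarrow> Cmp C (P1 ?z ?r) k = P1 u (Cmp C ?r k)"
    "\<And>u k. k \<in> Hom u ?z \<Longrightarrow> Cmp C (P2 ?z ?r) k = P2 u (Cmp C ?r k)"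
   using nat r rm unfolding nat_op_def by simp_all
  obtain kp where kp: "kp \<in> Hom x ?z" "Cmp C ?r kp = mu"
   using lres_factor[OF objs(2) N0(1) mu] pts_P N0(2) p_def by auto
  have kpq: "Fn kp q = p"
  proof -
   have "Fn kp q \<in> N0" using pt_in[OF kp(1) qP] pz by simp
   then show ?thesis using pt_comp[OF kp(1) r qP] kp(2) rpt p_def by simp
  qed
  obtain c1 where c1: "c1 \<in> Hom ?z w" "Cmp C a c1 = P1 ?z ?r" "Cmp C b c1 = ?r" by (rule univ_ex[OF e(1) r])
  obtain c2 where c2: "c2 \<in> Hom ?z w" "Cmp C a c2 = P2 ?z ?r" "Cmp C b c2 = ?r" by (rule univ_ex[OF e(2) r])
  have ck: "Cmp C c1 kp = Cmp C c2 kp"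
   by (rule univ_eq[OF catD(4)[OF kp(1) c1(1)] catD(4)[OF kp(1) c2(1)]])
    (use assoc[OF kp(1) c1(1) a] assoc[OF kp(1) c2(1) a] assoc[OF kp(1) c1(1) b] assoc[OF kp(1) c2(1) b] c1 c2
      nat'[OF kp(1)] kp(2) eq in simp_all)
  \<comment> \<open>The two sections of the source map meet over \<open>p\<close>; by rigidity of
    one sheet through the common point they coincide near \<open>p\<close>.\<close>
  define ze where "ze = Fn c1 p"
  have ze2: "ze = Fn c2 p"
   unfolding ze_def using pt_comp[OF kp(1) c1(1) qP] pt_comp[OF kp(1) c2(1) qP] ck kpq by simp
  have ze: "ze \<in> pts Z" unfolding ze_def using pt_in[OF c1(1), of p] pz N0(2) by simp
  show ?thesis
  proof (rule etale_section[OF bZ etale ze openin_topspace ze])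
   fix U' V' s'
   assume U': "aopen Z U'" "ze \<in> U'"
    and mono': "\<And>Q k k'. k \<in> ahom Q Z \<Longrightarrow> k' \<in> ahom Q Z \<Longrightarrow> mfun k ` pts Q \<subseteq> U' \<Longrightarrow>
     mfun k' ` pts Q \<subseteq> U' \<Longrightarrow> acmp (PA C b) k = acmp (PA C b) k' \<Longrightarrow> k = k'"
   define N where "N = {t \<in> N0. Fn c1 t \<in> U'} \<inter> {t \<in> N0. Fn c2 t \<in> U'}"
   have "aopen (PO C ?z) N"
    unfolding N_def using openin_vimage[OF PA_hom[OF c1(1)] U'(1)] openin_vimage[OF PA_hom[OF c2(1)] U'(1)]
    unfolding pz by (rule openin_Int)
   then have oN: "aopen X N" using lres_ho(2)[OF objs(2) N0(1)] open_sub_iff[OF N0(1)] by simp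
   have pN: "p \<in> N" "N \<subseteq> N0" unfolding N_def using N0(2) U'(2) ze2 ze_def by auto
   have "P1 z e = P2 z e" if e: "e \<in> Hom z xi" "maps e z N" for z e
   proof -
    have eN0: "Fn e t \<in> N0" if "t \<in> Pts z" for t using e(2) pN(2) that unfolding maps_def by auto
    obtain k where k: "k \<in> Hom z ?z" "Cmp C ?r k = e" using lres_factor[OF objs(2) N0(1) e(1) eN0] by blast
    have kt: "Fn k t \<in> N" if t: "t \<in> Pts z" for t
    proof -
     have "Fn k t \<in> N0" using pt_in[OF k(1) t] pz by simp
     then show ?thesis using bspec[OF e(2)[unfolded maps_def] t] pt_comp[OF k(1) r t] rpt k(2) by simp
    qed
    note k1 = catD(4)[OF k(1) c1(1)] and k2 = catD(4)[OF k(1) c2(1)]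
    have bk: "Cmp C b (Cmp C c1 k) = Cmp C b (Cmp C c2 k)"
     using assoc[OF k(1) c1(1) b] assoc[OF k(1) c2(1) b] c1(3) c2(3) by simp
    have "PA C (Cmp C c1 k) = PA C (Cmp C c2 k)"
    proof (rule mono'[OF PA_hom[OF k1] PA_hom[OF k2]])
     show "Fn (Cmp C c1 k) ` Pts z \<subseteq> U'" "Fn (Cmp C c2 k) ` Pts z \<subseteq> U'"
      using pt_comp[OF k(1) c1(1)] pt_comp[OF k(1) c2(1)] kt unfolding N_def by auto
     show "acmp (PA C b) (PA C (Cmp C c1 k)) = acmp (PA C b) (PA C (Cmp C c2 k))"
      using PA_Cmp[OF k1 b] PA_Cmp[OF k2 b] bk by simp
    qed
    then have "Cmp C c1 k = Cmp C c2 k" using cart_eq'[OF b k1 k2] bk by simp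
    then show ?thesis using assoc[OF k(1) c1(1) a] assoc[OF k(1) c2(1) a] c1(2) c2(2) nat'[OF k(1)] k(2) by simp
   qed
   then show ?thesis using oN pN by blast
  qed
 qed
 \<comment> \<open>At \<open>x\<close> both sides give \<open>mu\<close> after the product, by
   \<open>act_mug\<close>. The neighbourhood is also shrunk until the iterated operation is
   defined.\<close>
 have law: "\<exists>N. aopen X N \<and> p \<in> N \<and> N \<subseteq> V g' \<and> N \<subseteq> V (Cmp C g g') \<and> (\<forall>v\<in>N. ph g' v \<in> V g) \<and>
   (\<forall>z e. e \<in> Hom z xi \<longrightarrow> maps e z N \<longrightarrow> act g z (act g' z e) = act (Cmp C g g') z e)" if g: "g \<in> G" "g' \<in> G" for g g'
 proof -
  note gg = G_mult[OF g]
  define N0 where "N0 = {v \<in> V g'. ph g' v \<in> V g} \<inter> V (Cmp C g g')"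
  have N0: "aopen X N0" "p \<in> N0"
   unfolding N0_def using ph_open[OF g(2) V(1)[OF g(1)]] V(1)[OF gg] pV[OF g(2)] pV[OF g(1)] pV[OF gg] php[OF g(2)]
   by (auto intro: openin_Int)
  have md: "maps e z (V g')" "maps e z (V (Cmp C g g'))" "maps (act g' z e) z (V g)"
   if e: "e \<in> Hom z xi" "maps e z N0" for e z
  proof -
   show 1: "maps e z (V g')" "maps e z (V (Cmp C g g'))" using e(2) unfolding maps_def N0_def by auto
   show "maps (act g' z e) z (V g)" using e(2) act_pt[OF g(2) e(1) 1(1)] unfolding maps_def N0_def by auto
  qed
  have n: "nat_op N0 (\<lambda>z e. act g z (act g' z e))" "nat_op N0 (act (Cmp C g g'))"
   unfolding nat_op_def using act_hom[OF g(1) act_hom[OF g(2) _ md(1)] md(3)] act_nat[OF g(1) act_hom[OF g(2) _ md(1)] md(3)]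
    act_nat[OF g(2) _ md(1)] act_hom[OF gg _ md(2)] act_nat[OF gg _ md(2)] by simp_all
  have e: "act g x (act g' x mu) = act (Cmp C g g') x mu" using act_mu[OF g(2)] act_mug[OF g] act_mu[OF gg] by simp
  from agree[OF N0 n e] obtain N where N: "aopen X N" "p \<in> N" "N \<subseteq> N0"
   "\<forall>z e. e \<in> Hom z xi \<longrightarrow> maps e z N \<longrightarrow> act g z (act g' z e) = act (Cmp C g g') z e" by (elim exE conjE)
  have "N0 \<subseteq> V g'" "N0 \<subseteq> V (Cmp C g g')" "\<forall>v\<in>N0. ph g' v \<in> V g" unfolding N0_def by auto
  then show ?thesis using N by (intro exI[of _ N]) blast
 qed
 let ?one = "Idt C x"
 have n1: "nat_op (V ?one) (act ?one)" "nat_op (V ?one) (\<lambda>z e. e)"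
  unfolding nat_op_def using act_hom[OF G_one] act_nat[OF G_one] by simp_all
 have "act ?one x mu = mu" using act_mu[OF G_one] catD(5)[OF mu] by simp
 from agree[OF V(1)[OF G_one] pV[OF G_one] n1 this]
 have unit: "\<exists>N. aopen X N \<and> p \<in> N \<and> N \<subseteq> V ?one \<and>
   (\<forall>z e. e \<in> Hom z xi \<longrightarrow> maps e z N \<longrightarrow> act ?one z e = e)" .
 obtain N1 where N1: "aopen X N1" "p \<in> N1" "\<And>z e. e \<in> Hom z xi \<Longrightarrow> maps e z N1 \<Longrightarrow> act ?one z e = e"
  using unit by blast
 define N2 where "N2 g g' = (SOME N. aopen X N \<and> p \<in> N \<and> N \<subseteq> V g' \<and> N \<subseteq> V (Cmp C g g') \<and> (\<forall>v\<in>N. ph g' v \<in> V g) \<and>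
   (\<forall>z e. e \<in> Hom z xi \<longrightarrow> maps e z N \<longrightarrow> act g z (act g' z e) = act (Cmp C g g') z e))" for g g'
 have N2: "aopen X (N2 g g') \<and> p \<in> N2 g g' \<and> N2 g g' \<subseteq> V g' \<and> N2 g g' \<subseteq> V (Cmp C g g') \<and> (\<forall>v\<in>N2 g g'. ph g' v \<in> V g) \<and>
   (\<forall>z e. e \<in> Hom z xi \<longrightarrow> maps e z (N2 g g') \<longrightarrow> act g z (act g' z e) = act (Cmp C g g') z e)" if "g \<in> G" "g' \<in> G" for g g'
  unfolding N2_def by (rule someI_ex[OF law[OF that]])
 \<comment> \<open>The sheets contain all points over \<open>(p, p)\<close>, so
   \<open>separation\<close> confines the arrow space over a small neighbourhood to them.\<close>
 have "aopen Z (\<Union>g\<in>G. U g)" using U(1) by blast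
 moreover have "z \<in> (\<Union>g\<in>G. U g)" if "z \<in> pts Z" "src z = p" "tgt z = p" for z using fibre[OF that] U(2) by auto
 ultimately obtain V0 where V0: "aopen X V0" "p \<in> V0"
  "\<And>z. z \<in> pts Z \<Longrightarrow> src z \<in> V0 \<Longrightarrow> tgt z \<in> V0 \<Longrightarrow> z \<in> (\<Union>g\<in>G. U g)"
  using separation by meson
 \<comment> \<open>On this common neighbourhood no points of the arrow space lie off the sheets, and
   the unit and multiplication laws hold; finiteness of the stabilizer keeps it open.\<close>
 define W0 where "W0 = (V0 \<inter> N1) \<inter> ((\<Inter>j\<in>G \<times> G. N2 (fst j) (snd j)) \<inter> pts X)"
 have oW0: "aopen X W0"
  unfolding W0_def using V0(1) N1(1) N2 finite_G by (intro openin_Int openin_INT) auto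
 have pW0: "p \<in> W0" unfolding W0_def using V0(2) N1(2) N2 p_in by auto
 have W0N: "W0 \<subseteq> N2 g g'" if "g \<in> G" "g' \<in> G" for g g' unfolding W0_def using that by fastforce
 have W0V: "W0 \<subseteq> V g" if "g \<in> G" for g using W0N[OF that that] N2[OF that that] by blast
 \<comment> \<open>The points whose whole orbit stays in \<open>W0\<close>. This set is invariant
   because acting twice is acting by the product.\<close>
 define S where "S = ((\<Inter>g\<in>G. {v \<in> V g. ph g v \<in> W0}) \<inter> pts X) \<inter> W0"
 have oS: "aopen X S" unfolding S_def using ph_open[OF _ oW0] oW0 finite_G by (intro openin_Int openin_INT) auto
 have S: "v \<in> W0" "ph g v \<in> W0" if "v \<in> S" "g \<in> G" for v g using that unfolding S_def by auto
 have SW0: "S \<subseteq> W0" unfolding S_def by auto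
 have pS: "p \<in> S" unfolding S_def using pW0 pV php p_in by auto
 \<comment> \<open>The law for arrows, applied to the restriction of \<open>xi\<close> to
   \<open>W0\<close> and read off at the point \<open>v\<close>.\<close>
 have ph_law: "ph g (ph g' v) = ph (Cmp C g g') v" if g: "g \<in> G" "g' \<in> G" and v: "v \<in> W0" for g g' v
 proof -
  let ?r = "lres xi W0" let ?z = "pres xi W0"
  have r: "?r \<in> Hom ?z xi" using hoD(4)[OF lres_ho(1)[OF objs(2) oW0]] .
  have pz: "Pts ?z = W0" "Fn ?r v = v" using pt_lres[OF objs(2) oW0 v] by auto
  have rm: "maps ?r ?z W0" unfolding maps_def pz(1) using pt_lres(1)[OF objs(2) oW0] by simp
  then have "maps ?r ?z (N2 g g')" "maps ?r ?z (V g')" "maps ?r ?z (V (Cmp C g g'))"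
   using W0N[OF g] W0V[OF g(2)] W0V[OF G_mult[OF g]] unfolding maps_def by blast+
  note rm' = this
  have am: "maps (act g' ?z ?r) ?z (V g)"
   unfolding maps_def using act_pt[OF g(2) r rm'(2)] N2[OF g] rm'(1) unfolding maps_def by auto
  have vz: "v \<in> Pts ?z" using pz(1) v by simp
  have "act g ?z (act g' ?z ?r) = act (Cmp C g g') ?z ?r" using N2[OF g] r rm'(1) by blast
  then show ?thesis
   using act_pt[OF g(1) act_hom[OF g(2) r rm'(2)] am vz] act_pt[OF g(2) r rm'(2) vz] act_pt[OF G_mult[OF g] r rm'(3) vz] pz(2) by simp
 qed
 have ph_S: "ph g v \<in> S" if g: "g \<in> G" and v: "v \<in> S" for g v
 proof -
  have 1: "ph g v \<in> W0" using S[OF v g] by simp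
  have "ph g v \<in> V g' \<and> ph g' (ph g v) \<in> W0" if g': "g' \<in> G" for g'
   using ph_law[OF g' g S(1)[OF v g]] S(2)[OF v G_mult[OF g' g]] W0V[OF g'] 1 by auto
  then show ?thesis unfolding S_def using 1 openin_subset[OF oW0] by auto
 qed
 define xiS where "xiS = pres xi S" define i where "i = lres xi S"
 have ih: "i \<in> Ov (incl X S) xiS xi" unfolding i_def xiS_def by (rule lres_ho(1)[OF objs(2) oS])
 have i: "i \<in> Hom xiS xi" by (rule hoD(4)[OF ih])
 have iS: "Fn i v = v" if "v \<in> S" for v unfolding i_def by (rule pt_lres(1)[OF objs(2) oS that])
 have pxiS: "Pts xiS = S" unfolding xiS_def by (rule pt_lres(2)[OF objs(2) oS pS])
 have mi: "maps i xiS S" unfolding maps_def pxiS using iS by simp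
 have SV: "S \<subseteq> V g" if "g \<in> G" for g using W0V[OF that] SW0 by blast
 have maps_mono: "maps e z B" if "maps e z A" "A \<subseteq> B" for e z A B using that unfolding maps_def by blast
 have fac: "\<exists>!c. c \<in> Hom z xiS \<and> Cmp C i c = e" if "e \<in> Hom z xi" "maps e z S" for e z
  unfolding i_def xiS_def by (rule lres_factor[OF objs(2) oS that(1)]) (use that(2) maps_def in blast)
 have i_mono: "c = c'" if "c \<in> Hom z xiS" "c' \<in> Hom z xiS" "Cmp C i c = Cmp C i c'" for c c' z
 proof -
  have "maps (Cmp C i c') z S" by (rule maps_comp[OF mi that(2) i])
  from fac[OF catD(4)[OF that(2) i] this] show ?thesis using that by blast
 qed
 have mie: "maps (Cmp C i e) z S" if "e \<in> Hom z xiS" for e z by (rule maps_comp[OF mi that i])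
 have actS: "maps (act g z e) z S" if g: "g \<in> G" and e: "e \<in> Hom z xi" "maps e z S" for g e z
  unfolding maps_def using act_pt[OF g e(1) maps_mono[OF e(2) SV[OF g]]] ph_S[OF g] e(2) unfolding maps_def by simp
 \<comment> \<open>Invariance of \<open>S\<close> allows the operation on the inclusion arrow to be
   factored through the inclusion again.\<close>
 define be where "be g = (THE c. c \<in> Hom xiS xiS \<and> Cmp C i c = act g xiS i)" for g
 have be: "be g \<in> Hom xiS xiS" "Cmp C i (be g) = act g xiS i" if g: "g \<in> G" for g
  using theI'[OF fac[OF act_hom[OF g i maps_mono[OF mi SV[OF g]]] actS[OF g i mi]]] unfolding be_def by auto
 have ibe: "Cmp C i (Cmp C (be g) e) = act g z (Cmp C i e)" if g: "g \<in> G" and e: "e \<in> Hom z xiS" for g e z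
  using assoc[OF e be(1)[OF g] i] be(2)[OF g] act_nat[OF g i maps_mono[OF mi SV[OF g]] e] by simp
 note idS = catD(3)[OF catD(1)[OF i]]
 have be1: "be ?one = Idt C xiS"
 proof (rule i_mono[OF be(1)[OF G_one] idS])
  have "act ?one xiS i = i" by (rule N1(3)[OF i maps_mono[OF mi]]) (use SW0 W0_def in blast)
  then show "Cmp C i (be ?one) = Cmp C i (Idt C xiS)" using be(2)[OF G_one] catD(5)[OF i] by simp
 qed
 have bem: "be (Cmp C g g') = Cmp C (be g) (be g')" if g: "g \<in> G" "g' \<in> G" for g g'
 proof (rule i_mono[OF be(1)[OF G_mult[OF g]] catD(4)[OF be(1)[OF g(2)] be(1)[OF g(1)]]])
  have "maps i xiS (N2 g g')" by (rule maps_mono[OF mi]) (use SW0 W0N[OF g] in blast)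
  then have "act g xiS (act g' xiS i) = act (Cmp C g g') xiS i" using N2[OF g] i by blast
  then show "Cmp C i (be (Cmp C g g')) = Cmp C i (Cmp C (be g) (be g'))"
   using ibe[OF g(1) be(1)[OF g(2)]] be(2)[OF g(2)] be(2)[OF G_mult[OF g]] by simp
 qed
 have "maps mu x S" unfolding maps_mu using pS p_def by simp
 then obtain muS where muS: "muS \<in> Hom x xiS" using fac[OF mu] by blast
 \<comment> \<open>Two arrows to the restricted object give an arrow to \<open>w\<close> whose
   points lie on the sheets. Labelling each point by its sheet is locally constant, since the sheets
   are open and disjoint.\<close>
 have full: "\<exists>ga. \<forall>v\<in>Pts y. ga v \<in> G \<and> aopen (PO C y) {u \<in> Pts y. ga u = ga v} \<and>
    (\<forall>z r. r \<in> Hom z y \<longrightarrow> (\<forall>t\<in>Pts z. ga (Fn r t) = ga v) \<longrightarrow>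
     Cmp C e' r = Cmp C (be (ga v)) (Cmp C e r))"
  if e: "e \<in> Hom y xiS" "e' \<in> Hom y xiS" for y e e'
 proof -
  obtain c where c: "c \<in> Hom y w" "Cmp C a c = Cmp C i e'" "Cmp C b c = Cmp C i e"
   by (rule univ_ex[OF catD(4)[OF e(2) i] catD(4)[OF e(1) i]])
  have SV0: "S \<subseteq> V0" using SW0 W0_def by blast
  have "\<exists>g\<in>G. Fn c v \<in> U g" if v: "v \<in> Pts y" for v
  proof -
   have "src (Fn c v) \<in> V0" "tgt (Fn c v) \<in> V0"
    using pt_comp[OF c(1) b v] pt_comp[OF c(1) a v] c(2,3) mie[OF e(1)] mie[OF e(2)] SV0 v unfolding maps_def by auto
   from V0(3)[OF pt_in[OF c(1) v] this] show ?thesis by blast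
  qed
  then obtain ga where ga: "\<And>v. v \<in> Pts y \<Longrightarrow> ga v \<in> G \<and> Fn c v \<in> U (ga v)" by metis
  have "aopen (PO C y) {u \<in> Pts y. ga u = ga v}" if v: "v \<in> Pts y" for v
  proof -
   have "{u \<in> Pts y. ga u = ga v} = {u \<in> Pts y. Fn c u \<in> U (ga v)}"
    using ga disj v by (auto; metis)
   then show ?thesis using openin_vimage[OF PA_hom[OF c(1)] U(1)] ga[OF v] by simp
  qed
  moreover have "Cmp C e' r = Cmp C (be (ga v)) (Cmp C e r)"
   if v: "v \<in> Pts y" and r: "r \<in> Hom z y" "\<forall>t\<in>Pts z. ga (Fn r t) = ga v" for v z r
  proof -
   have g: "ga v \<in> G" using ga[OF v] by simp
   note er = catD(4)[OF r(1) e(1)] and er' = catD(4)[OF r(1) e(2)]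
   have "maps (Cmp C c r) z (U (ga v))"
    unfolding maps_def using pt_comp[OF r(1) c(1)] ga[OF pt_in[OF r(1)]] r(2) by force
   moreover have "Cmp C b (Cmp C c r) = Cmp C i (Cmp C e r)"
    using assoc[OF r(1) c(1) b] c(3) assoc[OF r(1) e(1) i] by simp
   ultimately have "Cmp C c r = lft (ga v) z (Cmp C i (Cmp C e r))"
    using lft_eq[OF g catD(4)[OF er i] maps_mono[OF mie[OF er] SV[OF g]] catD(4)[OF r(1) c(1)]] by blast
   then have "Cmp C i (Cmp C e' r) = act (ga v) z (Cmp C i (Cmp C e r))"
    unfolding act_def using assoc[OF r(1) c(1) a] c(2) assoc[OF r(1) e(2) i] by simp
   also have "\<dots> = Cmp C i (Cmp C (be (ga v)) (Cmp C e r))" using ibe[OF g er] by simp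
   finally show ?thesis by (rule i_mono[OF er' catD(4)[OF er be(1)[OF g]]])
  qed
  ultimately show ?thesis using ga by (intro exI[of _ ga]) blast
 qed
 \<comment> \<open>Equal values force equal lifts, but lifts along different sheets have disjoint
   images; nonemptiness of the source supplies a point.\<close>
 have free: "g = g'" if g: "g \<in> G" "g' \<in> G" and e: "e \<in> Hom z xiS" "Pts z \<noteq> {}"
  and eq: "Cmp C (be g) e = Cmp C (be g') e" for g g' z e
 proof -
  note ie = catD(4)[OF e(1) i]
  note L = lft[OF g(1) ie maps_mono[OF mie[OF e(1)] SV[OF g(1)]]] and L' = lft[OF g(2) ie maps_mono[OF mie[OF e(1)] SV[OF g(2)]]]
  have "act g z (Cmp C i e) = act g' z (Cmp C i e)" using ibe[OF g(1) e(1)] ibe[OF g(2) e(1)] eq by simp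
  then have "lft g z (Cmp C i e) = lft g' z (Cmp C i e)"
   using univ_eq[OF L(1) L'(1)] L(2) L'(2) unfolding act_def by simp
  then have "maps (lft g z (Cmp C i e)) z (U g')" using L'(3) by simp
  then show ?thesis using L(3) e(2) disj[OF g] unfolding maps_def by blast
 qed
 have "groupoid_chart C (stabilizer C x) xiS be"
 proof (intro groupoid_chart.intro fibred_category_axioms groupoid_chart_axioms.intro monoid_stabilizer catD(1)[OF i])
  show "be \<one>\<^bsub>stabilizer C x\<^esub> = Idt C xiS" using be1 by (simp add: stabilizer_def)
  show "be (g \<otimes>\<^bsub>stabilizer C x\<^esub> g') = Cmp C (be g) (be g')" if "g \<in> G" "g' \<in> G" for g g'
   using bem[OF that] by (simp add: stabilizer_def)
 qed (fact be(1) full free)+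
 then show ?thesis using that[OF oS ih _ muS] by blast
qed

end

section \<open>Translation groupoids\<close>

text \<open>Agreement of point images and of germ maps at \<open>p\<close>. It allows a locally
  constant group element to be evaluated point by point instead of on its level sets.\<close>

definition eq_at :: "'u amor \<Rightarrow> 'u amor \<Rightarrow> 'u \<Rightarrow> bool" where
 "eq_at m n p \<longleftrightarrow> mfun m p = mfun n p \<and> (\<forall>a\<in>germs (mcod m) (mfun m p). mgerm m p a = mgerm n p a)"

lemma eq_at_pre:
 assumes k: "k \<in> ahom Q X" "p \<in> pts Q" and m: "m \<in> ahom X Y" "n \<in> ahom X Y"
  and e: "eq_at m n (mfun k p)"
 shows "eq_at (acmp m k) (acmp n k) p"
 using e mfun_Cmp[OF k] mgerm_Cmp[OF k(1) m(1) k(2)] mgerm_Cmp[OF k(1) m(2) k(2)]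
  ana_homD(2)[OF m(1)] ana_homD(2)[OF acmp_hom[OF k(1) m(1)]] unfolding eq_at_def by simp

lemma eq_at_post:
 assumes m: "m \<in> ahom X Y" "n \<in> ahom X Y" and p: "p \<in> pts X" and l: "l \<in> ahom Y Z"
  and e: "eq_at m n p"
 shows "eq_at (acmp l m) (acmp l n) p"
 using e mfun_Cmp[OF m(1) p] mfun_Cmp[OF m(2) p] mgerm_Cmp[OF m(1) l p] mgerm_Cmp[OF m(2) l p]
  ana_homD(2)[OF m(1)] ana_homD(2)[OF acmp_hom[OF m(1) l]] mgerm_carrier[OF l ana_homD(6)[OF m(1) p]]
 unfolding eq_at_def by simp

lemma eq_at_trans:
 assumes "m \<in> ahom X Y" "n \<in> ahom X Y" "eq_at m n p" "eq_at n l p"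
 shows "eq_at m l p"
 using assms ana_homD(2)[OF assms(1)] ana_homD(2)[OF assms(2)] unfolding eq_at_def by simp

text \<open>Restriction to an open subspace changes neither point images nor germ maps, so equality
  of restrictions is a pointwise matter.\<close>

lemma eq_at_inclusion:
 assumes m: "m \<in> ahom X Y" "n \<in> ahom X Y" and W: "aopen X W"
 shows "acmp m (incl X W) = acmp n (incl X W) \<longleftrightarrow> (\<forall>p\<in>W. eq_at m n p)"
proof -
 let ?i = "incl X W"
 have X: "analytic_space X" by (rule ana_homD(3)[OF m(1)])
 note i = incl_hom[OF X W]
 note mi = acmp_hom[OF i m(1)] and ni = acmp_hom[OF i m(2)]
 have WX: "W \<subseteq> pts X" and pW: "pts (open_sub X W) = W" using openin_subset[OF W] by auto
 have f: "mfun (acmp k ?i) p = mfun k p" if "p \<in> W" for k p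
  using mfun_Cmp[OF i, of p k] that WX unfolding pW by simp
 have g: "mgerm (acmp k ?i) p c = mgerm k p c"
  if k: "k \<in> ahom X Y" and p: "p \<in> W" and c: "c \<in> germs Y (mfun k p)" for k p c
 proof -
  have pX: "p \<in> pts X" using p WX by blast
  show ?thesis using mgerm_Cmp[OF i k, of p c] p c WX mgerm_inclusion[OF WX p mgerm_carrier[OF k pX c]] unfolding pW by simp
 qed
 show ?thesis
 proof
  assume e: "acmp m ?i = acmp n ?i"
  show "\<forall>p\<in>W. eq_at m n p"
  proof
   fix p assume p: "p \<in> W"
   have fp: "mfun m p = mfun n p" using f[OF p, of m] f[OF p, of n] e by simp
   show "eq_at m n p"
    unfolding eq_at_def ana_homD(2)[OF m(1)] using fp g[OF m(1) p] g[OF m(2) p] e by simp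
  qed
 next
  assume e: "\<forall>p\<in>W. eq_at m n p"
  show "acmp m ?i = acmp n ?i"
  proof (rule ana_hom_eqI[OF mi ni])
   fix p assume "p \<in> pts (open_sub X W)"
   then have p: "p \<in> W" unfolding pW .
   have ep: "mfun m p = mfun n p" "\<And>c. c \<in> germs Y (mfun m p) \<Longrightarrow> mgerm m p c = mgerm n p c"
    using e p ana_homD(2)[OF m(1)] unfolding eq_at_def by auto
   show "mfun (acmp m ?i) p = mfun (acmp n ?i) p" using ep(1) f[OF p] by simp
   fix c assume "c \<in> germs Y (mfun (acmp m ?i) p)"
   then have c: "c \<in> germs Y (mfun m p)" using f[OF p] by simp
   then have c': "c \<in> germs Y (mfun n p)" using ep(1) by simp
   show "mgerm (acmp m ?i) p c = mgerm (acmp n ?i) p c" using g[OF m(1) p c] g[OF m(2) p c'] ep(2)[OF c] by simp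
  qed
 qed
qed

definition locconst :: "('g, 'm) monoid_scheme \<Rightarrow> 'u aspace \<Rightarrow> ('u \<Rightarrow> 'g) \<Rightarrow> bool" where
 "locconst G U ga \<longleftrightarrow> ga \<in> (\<Pi>\<^sub>E p\<in>pts U. carrier G) \<and> (\<forall>g\<in>carrier G. aopen U {p \<in> pts U. ga p = g})"

lemma locconstD:
 assumes "locconst G U ga"
 shows "p \<in> pts U \<Longrightarrow> ga p \<in> carrier G" "g \<in> carrier G \<Longrightarrow> aopen U {p \<in> pts U. ga p = g}" "ga \<in> extensional (pts U)"
 using assms unfolding locconst_def by (auto simp: PiE_iff)

lemma locconst_mult:
 assumes G: "monoid G" and ga: "locconst G U ga" and de: "locconst G V de" and h: "h \<in> ahom U V"
 shows "locconst G U (\<lambda>p\<in>pts U. de (mfun h p) \<otimes>\<^bsub>G\<^esub> ga p)"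
proof -
 note hp = ana_homD(6)[OF h]
 have "aopen U {p \<in> pts U. de (mfun h p) \<otimes>\<^bsub>G\<^esub> ga p = g}" for g
 proof (subst openin_subopen, intro ballI)
  fix p assume p: "p \<in> {p \<in> pts U. de (mfun h p) \<otimes>\<^bsub>G\<^esub> ga p = g}"
  let ?W = "{p' \<in> pts U. ga p' = ga p} \<inter> {p' \<in> pts U. mfun h p' \<in> {v \<in> pts V. de v = de (mfun h p)}}"
  have "aopen U ?W"
   using p hp locconstD(1,2)[OF ga] locconstD(1,2)[OF de] by (intro openin_Int openin_vimage[OF h]) auto
  moreover have "p \<in> ?W" "?W \<subseteq> {p \<in> pts U. de (mfun h p) \<otimes>\<^bsub>G\<^esub> ga p = g}" using p hp by auto
  ultimately show "\<exists>W. aopen U W \<and> p \<in> W \<and> W \<subseteq> {p \<in> pts U. de (mfun h p) \<otimes>\<^bsub>G\<^esub> ga p = g}" by blast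
 qed
 moreover have "{p \<in> pts U. (\<lambda>p\<in>pts U. de (mfun h p) \<otimes>\<^bsub>G\<^esub> ga p) p = g} = {p \<in> pts U. de (mfun h p) \<otimes>\<^bsub>G\<^esub> ga p = g}" for g
  by auto
 ultimately show ?thesis
  unfolding locconst_def using monoid.m_closed[OF G] locconstD(1)[OF ga] locconstD(1)[OF de] hp by auto
qed

lemma locconst_one: "monoid G \<Longrightarrow> locconst G U (\<lambda>p\<in>pts U. \<one>\<^bsub>G\<^esub>)"
proof -
 assume G: "monoid G"
 have "{p \<in> pts U. (\<lambda>p\<in>pts U. \<one>\<^bsub>G\<^esub>) p = g} = (if g = \<one>\<^bsub>G\<^esub> then pts U else {})" for g by auto
 then show ?thesis unfolding locconst_def using monoid.one_closed[OF G] by auto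
qed

locale monoid_action =
 fixes G :: "('g, 'm) monoid_scheme" and S :: "'u aspace" and \<rho> :: "'g \<Rightarrow> 'u amor"
 assumes G: "monoid G" and S: "analytic_space S" and action: "acts_on G S \<rho>"
begin

abbreviation (input) T where "T \<equiv> translation_prestack G S \<rho>"

lemma \<rho>: "g \<in> carrier G \<Longrightarrow> \<rho> g \<in> ahom S S" "\<rho> \<one>\<^bsub>G\<^esub> = aid S"
 "g \<in> carrier G \<Longrightarrow> g' \<in> carrier G \<Longrightarrow> \<rho> (g \<otimes>\<^bsub>G\<^esub> g') = acmp (\<rho> g) (\<rho> g')"
 using action unfolding acts_on_def by auto

lemma T_sel [simp]:
 "Dom T (f', f, h, ga) = f'" "Cod T (f', f, h, ga) = f" "PA T (f', f, h, ga) = h" "PO T = mdom"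
 "Idt T f = (f, f, aid (mdom f), \<lambda>p\<in>pts (mdom f). \<one>\<^bsub>G\<^esub>)"
 "Cmp T (f2', f2, k, de) (f', f, h, ga) = (f', f2, acmp k h, \<lambda>p\<in>pts (mdom f'). de (mfun h p) \<otimes>\<^bsub>G\<^esub> ga p)"
 by (simp_all add: translation_prestack_def)

lemma T_Obj: "f \<in> Obj T \<longleftrightarrow> f \<in> ahom (mdom f) S"
 by (auto simp: translation_prestack_def hom_set_def)

text \<open>The defining equations on the level sets of \<open>ga\<close> are restrictions of global
  maps, hence equivalent to one pointwise equivariance condition.\<close>

lemma T_hom: "(f1, f2, h, ga) \<in> hom_set T f' f \<longleftrightarrow> f1 = f' \<and> f2 = f \<and>
  f' \<in> ahom (mdom f') S \<and> f \<in> ahom (mdom f) S \<and> h \<in> ahom (mdom f') (mdom f) \<and>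
  locconst G (mdom f') ga \<and> (\<forall>p\<in>pts (mdom f'). eq_at (acmp (\<rho> (ga p)) f') (acmp f h) p)"
 (is "?L \<longleftrightarrow> ?R")
proof -
 let ?U = "mdom f'" let ?W = "\<lambda>g. {p \<in> pts ?U. ga p = g}"
 have "acmp (\<rho> g) (mrestr f' (?W g) (pts S)) = mrestr (acmp f h) (?W g) (pts S) \<longleftrightarrow>
   (\<forall>p\<in>?W g. eq_at (acmp (\<rho> g) f') (acmp f h) p)"
  if f: "f' \<in> ahom ?U S" "f \<in> ahom (mdom f) S" "h \<in> ahom ?U (mdom f)" and g: "g \<in> carrier G"
   and W: "aopen ?U (?W g)" for g
 proof -
  note i = incl_hom[OF ana_homD(3)[OF f(1)] W] and fh = acmp_hom[OF f(3,2)]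
  show ?thesis
   using eq_at_inclusion[OF acmp_hom[OF f(1) \<rho>(1)[OF g]] fh W] Cmp_inclusion_pts[OF f(1) W]
    Cmp_inclusion_pts[OF fh W] anaD(7)[OF i f(1) \<rho>(1)[OF g]] by simp
 qed
 note eqv = this
 have key: "(ga \<in> (\<Pi>\<^sub>E p\<in>pts ?U. carrier G) \<and> (\<forall>g\<in>carrier G. aopen ?U (?W g) \<and>
    acmp (\<rho> g) (mrestr f' (?W g) (pts S)) = mrestr (acmp f h) (?W g) (pts S))) \<longleftrightarrow>
   (locconst G ?U ga \<and> (\<forall>p\<in>pts ?U. eq_at (acmp (\<rho> (ga p)) f') (acmp f h) p))" (is "?A \<longleftrightarrow> ?B")
  if f: "f' \<in> ahom ?U S" "f \<in> ahom (mdom f) S" "h \<in> ahom ?U (mdom f)"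
 proof
  assume H: ?A
  have "eq_at (acmp (\<rho> (ga p)) f') (acmp f h) p" if p: "p \<in> pts ?U" for p
  proof -
   have g: "ga p \<in> carrier G" using H p by auto
   show ?thesis using eqv[OF f g] H p by blast
  qed
  then show ?B using H unfolding locconst_def by blast
 next
  assume H: ?B
  have "acmp (\<rho> g) (mrestr f' (?W g) (pts S)) = mrestr (acmp f h) (?W g) (pts S)" if g: "g \<in> carrier G" for g
   using eqv[OF f g] H g unfolding locconst_def by blast
  then show ?A using H unfolding locconst_def by blast
 qed
 have "?L \<longleftrightarrow> f1 = f' \<and> f2 = f \<and> f' \<in> ahom ?U S \<and> f \<in> ahom (mdom f) S \<and> h \<in> ahom ?U (mdom f) \<and>
  ga \<in> (\<Pi>\<^sub>E p\<in>pts ?U. carrier G) \<and> (\<forall>g\<in>carrier G. aopen ?U (?W g) \<and>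
   acmp (\<rho> g) (mrestr f' (?W g) (pts S)) = mrestr (acmp f h) (?W g) (pts S))"
  unfolding hom_set_def[of T] by (auto simp: translation_prestack_def Let_def hom_set_def)
 also have "\<dots> \<longleftrightarrow> ?R" using key by meson
 finally show ?thesis .
qed

lemma T_homE:
 assumes "t \<in> hom_set T f' f"
 obtains h ga where "t = (f', f, h, ga)" "f' \<in> ahom (mdom f') S" "f \<in> ahom (mdom f) S"
  "h \<in> ahom (mdom f') (mdom f)" "locconst G (mdom f') ga"
  "\<And>p. p \<in> pts (mdom f') \<Longrightarrow> eq_at (acmp (\<rho> (ga p)) f') (acmp f h) p"
proof -
 obtain f1 f2 h ga where t: "t = (f1, f2, h, ga)" by (cases t)
 show ?thesis using assms that[of h ga] unfolding t T_hom by simp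
qed

lemma T_Cmp_hom:
 assumes s: "s \<in> hom_set T f' f" and t: "t \<in> hom_set T f f2"
 shows "Cmp T t s \<in> hom_set T f' f2"
proof -
 obtain h ga where s': "s = (f', f, h, ga)" and f': "f' \<in> ahom (mdom f') S" and f: "f \<in> ahom (mdom f) S"
  and h: "h \<in> ahom (mdom f') (mdom f)" and ga: "locconst G (mdom f') ga"
  and e: "\<And>p. p \<in> pts (mdom f') \<Longrightarrow> eq_at (acmp (\<rho> (ga p)) f') (acmp f h) p" by (rule T_homE[OF s]) blast
 obtain k de where t': "t = (f, f2, k, de)" and f2: "f2 \<in> ahom (mdom f2) S"
  and k: "k \<in> ahom (mdom f) (mdom f2)" and de: "locconst G (mdom f) de"
  and e2: "\<And>p. p \<in> pts (mdom f) \<Longrightarrow> eq_at (acmp (\<rho> (de p)) f) (acmp f2 k) p" by (rule T_homE[OF t]) blast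
 have "eq_at (acmp (\<rho> (de (mfun h p) \<otimes>\<^bsub>G\<^esub> ga p)) f') (acmp f2 (acmp k h)) p" if p: "p \<in> pts (mdom f')" for p
 proof -
  have hp: "mfun h p \<in> pts (mdom f)" by (rule ana_homD(6)[OF h p])
  note g = locconstD(1)[OF ga p] and d = locconstD(1)[OF de hp]
  note rg = \<rho>(1)[OF g] and rd = \<rho>(1)[OF d]
  have 1: "acmp (\<rho> (de (mfun h p) \<otimes>\<^bsub>G\<^esub> ga p)) f' = acmp (\<rho> (de (mfun h p))) (acmp (\<rho> (ga p)) f')"
   using \<rho>(3)[OF d g] anaD(7)[OF f' rg rd] by simp
  have 2: "eq_at (acmp (\<rho> (de (mfun h p))) (acmp (\<rho> (ga p)) f')) (acmp (\<rho> (de (mfun h p))) (acmp f h)) p"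
   by (rule eq_at_post[OF acmp_hom[OF f' rg] acmp_hom[OF h f] p rd e[OF p]])
  have 3: "eq_at (acmp (acmp (\<rho> (de (mfun h p))) f) h) (acmp (acmp f2 k) h) p"
   by (rule eq_at_pre[OF h p acmp_hom[OF f rd] acmp_hom[OF k f2] e2[OF hp]])
  show ?thesis
   using eq_at_trans[OF acmp_hom[OF acmp_hom[OF f' rg] rd] acmp_hom[OF acmp_hom[OF h f] rd] 2, of "acmp f2 (acmp k h)"]
    3 anaD(7)[OF h f rd] anaD(7)[OF h k f2] 1 by simp
 qed
 then show ?thesis
  unfolding s' t' T_sel T_hom using f' f2 acmp_hom[OF h k] locconst_mult[OF G ga de h] by simp
qed

lemma T_Idt_hom:
 assumes "f \<in> Obj T"
 shows "Idt T f \<in> hom_set T f f"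
proof -
 have f: "f \<in> ahom (mdom f) S" using assms by (simp add: T_Obj)
 show ?thesis
  unfolding T_sel T_hom using f aid_hom[OF ana_homD(3)[OF f]] locconst_one[OF G] \<rho>(2) anaD(5,6)[OF f]
  by (simp add: eq_at_def)
qed

lemma over_category_T: "over_category T"
proof -
 have arr: "s \<in> hom_set T (Dom T s) (Cod T s)" if "s \<in> Arr T" for s using that by (simp add: hom_set_def)
 have obj: "f' \<in> Obj T" "f \<in> Obj T" if "s \<in> hom_set T f' f" for s f' f
  using T_homE[OF that] T_Obj by (metis, metis)
 have assoc: "Cmp T u (Cmp T t s) = Cmp T (Cmp T u t) s"
  if s: "s \<in> hom_set T f1 f2" and t: "t \<in> hom_set T f2 f3" and u: "u \<in> hom_set T f3 f4" for s t u f1 f2 f3 f4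
 proof -
  obtain h ga where s': "s = (f1, f2, h, ga)" and h: "h \<in> ahom (mdom f1) (mdom f2)" and ga: "locconst G (mdom f1) ga"
   by (rule T_homE[OF s]) blast
  obtain k de where t': "t = (f2, f3, k, de)" and k: "k \<in> ahom (mdom f2) (mdom f3)" and de: "locconst G (mdom f2) de"
   by (rule T_homE[OF t]) blast
  obtain l ep where u': "u = (f3, f4, l, ep)" and l: "l \<in> ahom (mdom f3) (mdom f4)" and ep: "locconst G (mdom f3) ep"
   by (rule T_homE[OF u]) blast
  have "ep (mfun (acmp k h) p) \<otimes>\<^bsub>G\<^esub> (de (mfun h p) \<otimes>\<^bsub>G\<^esub> ga p) =
   (ep (mfun k (mfun h p)) \<otimes>\<^bsub>G\<^esub> de (mfun h p)) \<otimes>\<^bsub>G\<^esub> ga p" if p: "p \<in> pts (mdom f1)" for p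
   using mfun_Cmp[OF h p, of k] ana_homD(6)[OF h p] ana_homD(6)[OF k ana_homD(6)[OF h p]]
   by (simp add: monoid.m_assoc[OF G] locconstD(1)[OF ga p] locconstD(1)[OF de] locconstD(1)[OF ep])
  then show ?thesis
   unfolding s' t' u' T_sel using anaD(7)[OF h k l] ana_homD(6)[OF h] by (auto simp: fun_eq_iff restrict_def)
 qed
 have unit: "Cmp T s (Idt T f') = s \<and> Cmp T (Idt T f) s = s" if s: "s \<in> hom_set T f' f" for s f' f
 proof -
  obtain h ga where s': "s = (f', f, h, ga)" and h: "h \<in> ahom (mdom f') (mdom f)" and ga: "locconst G (mdom f') ga"
   by (rule T_homE[OF s]) blast
  show ?thesis
   unfolding s' T_sel using anaD(5,6)[OF h] locconstD(1,3)[OF ga] ana_homD(6)[OF h] G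
   by (auto simp: fun_eq_iff mfun_Idt monoid.l_one monoid.r_one extensional_def)
 qed
 have "category T"
  unfolding category_def
 proof (intro conjI ballI impI)
  show "Dom T s \<in> Obj T" "Cod T s \<in> Obj T" if "s \<in> Arr T" for s using obj[OF arr[OF that]] .
  show "Idt T f \<in> hom_set T f f" if "f \<in> Obj T" for f by (rule T_Idt_hom[OF that])
  show "Cmp T t s \<in> hom_set T (Dom T s) (Cod T t)" if "s \<in> Arr T" "t \<in> Arr T" "Cod T s = Dom T t" for s t
   using T_Cmp_hom[OF arr[OF that(1)]] arr[OF that(2)] that(3) by simp
  show "Cmp T s (Idt T (Dom T s)) = s" "Cmp T (Idt T (Cod T s)) s = s" if "s \<in> Arr T" for s using unit[OF arr[OF that]] by auto
  show "Cmp T u (Cmp T t s) = Cmp T (Cmp T u t) s"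
   if "s \<in> Arr T" "t \<in> Arr T" "u \<in> Arr T" "Cod T s = Dom T t \<and> Cod T t = Dom T u" for s t u
   using assoc[OF arr[OF that(1)], of t "Cod T t" u "Cod T u"] arr[OF that(2)] arr[OF that(3)] that(4) by simp
 qed
 moreover have "PA T s \<in> ahom (mdom f') (mdom f)" if s: "s \<in> hom_set T f' f" for s f' f by (rule T_homE[OF s]) simp
 moreover have "PA T (Cmp T t s) = acmp (PA T t) (PA T s)" if "s \<in> hom_set T f1 f2" "t \<in> hom_set T f2 f3" for s t f1 f2 f3
  by (rule T_homE[OF that(1)], rule T_homE[OF that(2)]) simp
 moreover have "analytic_space (mdom f)" if "f \<in> Obj T" for f using that T_Obj ana_homD(3) by blast
 ultimately have "over_ana T"
  unfolding over_ana_def is_functor_def using arr by (auto dest: hom_setD)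
 then show ?thesis by (rule over_category.intro)
qed

end

section \<open>The comparison functor\<close>

text \<open>The condition \<open>is_open\<close> is openness of the substack generated by
  \<open>xi\<close>: the image of an object that maps to \<open>xi\<close> lies where the target
  itself maps to \<open>xi\<close> locally.\<close>

locale chart = ana_stack C + groupoid_chart C G xi be
 for C :: "('u, 'o, 'a) ocat" and G :: "('g, 'm) monoid_scheme" and xi :: 'o and be :: "'g \<Rightarrow> 'a" +
 assumes is_open: "\<And>z y a v. a \<in> Hom z y \<Longrightarrow> Hom z xi \<noteq> {} \<Longrightarrow> v \<in> Pts z \<Longrightarrow>
   \<exists>W. aopen (PO C y) W \<and> Fn a v \<in> W \<and> Hom (pres y W) xi \<noteq> {}"
begin

section \<open>Arrows to the chart differing by locally constant group elements\<close>

abbreviation S where "S \<equiv> PO C xi"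
abbreviation \<rho> where "\<rho> g \<equiv> PA C (be g)"

lemma acts: "acts_on G S \<rho>"
 unfolding acts_on_def using PA_hom[OF be] be1 bem PA_Cmp[OF be be] PA_Idt[OF xi] by simp

sublocale monoid_action G S \<rho>
 by (rule monoid_action.intro[OF G PO_ana[OF xi] acts])

text \<open>Local form of the equation \<open>c = ga * e\<close>; there is no single arrow
  representing a locally constant multiplier.\<close>

definition twist :: "'o \<Rightarrow> 'a \<Rightarrow> 'a \<Rightarrow> ('u \<Rightarrow> 'g) \<Rightarrow> bool" where
 "twist y e c ga \<longleftrightarrow> (\<forall>v\<in>Pts y. \<exists>W. aopen (PO C y) W \<and> v \<in> W \<and>
  (\<forall>z r. r \<in> Hom z y \<longrightarrow> (\<forall>t\<in>Pts z. Fn r t \<in> W) \<longrightarrow>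
   Cmp C c r = Cmp C (be (ga v)) (Cmp C e r)))"

lemma twistD:
 assumes y: "y \<in> Obj C" and t: "twist y e c ga" "twist y e' c' ga'" and v: "v \<in> Pts y"
 obtains W where "aopen (PO C y) W" "v \<in> W" "lres y W \<in> Hom (pres y W) y" "Pts (pres y W) = W"
  "Cmp C c (lres y W) = Cmp C (be (ga v)) (Cmp C e (lres y W))"
  "Cmp C c' (lres y W) = Cmp C (be (ga' v)) (Cmp C e' (lres y W))"
proof -
 obtain W1 where W1: "aopen (PO C y) W1" "v \<in> W1" "\<And>z r. r \<in> Hom z y \<Longrightarrow>
  \<forall>t\<in>Pts z. Fn r t \<in> W1 \<Longrightarrow> Cmp C c r = Cmp C (be (ga v)) (Cmp C e r)"
  using t(1) v unfolding twist_def by meson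
 obtain W2 where W2: "aopen (PO C y) W2" "v \<in> W2" "\<And>z r. r \<in> Hom z y \<Longrightarrow>
  \<forall>t\<in>Pts z. Fn r t \<in> W2 \<Longrightarrow> Cmp C c' r = Cmp C (be (ga' v)) (Cmp C e' r)"
  using t(2) v unfolding twist_def by meson
 define W where "W = W1 \<inter> W2"
 have W: "aopen (PO C y) W" "v \<in> W" unfolding W_def using W1 W2 by auto
 have r: "lres y W \<in> Hom (pres y W) y" by (rule hoD(4)[OF lres_ho(1)[OF y W(1)]])
 note p = pt_lres(2)[OF y W]
 have m: "\<forall>t\<in>Pts (pres y W). Fn (lres y W) t \<in> W1" "\<forall>t\<in>Pts (pres y W). Fn (lres y W) t \<in> W2"
  unfolding p using pt_lres(1)[OF y W(1)] W_def by auto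
 show ?thesis by (rule that[OF W r p W1(3)[OF r m(1)] W2(3)[OF r m(2)]])
qed

text \<open>Near each point both arrows are the same multiple of \<open>e\<close>, so separatedness
  applies.\<close>

lemma twist_unique:
 assumes e: "e \<in> Hom y xi" and c: "c \<in> Ov f y xi" "c' \<in> Ov f y xi"
  and t: "twist y e c ga" "twist y e c' ga"
 shows "c = c'"
proof (rule separated[OF c refl])
 note y = catD(1)[OF e]
 fix v assume v: "v \<in> Pts y"
 show "\<exists>W l z. aopen (PO C y) W \<and> v \<in> W \<and> l \<in> Ov (incl (PO C y) W) z y \<and> Cmp C c l = Cmp C c' l"
  by (rule twistD[OF y t v]) (use lres_ho(1)[OF y] in metis)
qed

text \<open>The condition \<open>free\<close> is applied to the restriction of \<open>e\<close> to a
  neighbourhood of each point.\<close>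

lemma twist_inj:
 assumes e: "e \<in> Hom y xi" and ga: "locconst G (PO C y) ga" "locconst G (PO C y) ga'"
  and t: "twist y e c ga" "twist y e c ga'"
 shows "ga = ga'"
proof (rule extensionalityI[OF locconstD(3)[OF ga(1)] locconstD(3)[OF ga(2)]])
 fix v assume v: "v \<in> Pts y"
 show "ga v = ga' v"
 proof (rule twistD[OF catD(1)[OF e] t v])
  fix W assume W: "v \<in> W" "lres y W \<in> Hom (pres y W) y" "Pts (pres y W) = W"
   and q: "Cmp C c (lres y W) = Cmp C (be (ga v)) (Cmp C e (lres y W))" "Cmp C c (lres y W) = Cmp C (be (ga' v)) (Cmp C e (lres y W))"
  show ?thesis
   by (rule free[OF locconstD(1)[OF ga(1) v] locconstD(1)[OF ga(2) v] catD(4)[OF W(2) e]]) (use W q in auto)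
 qed
qed

lemma twist_full:
 assumes e: "e \<in> Hom y xi" "c \<in> Hom y xi"
 shows "\<exists>ga. locconst G (PO C y) ga \<and> twist y e c ga"
proof -
 let ?U = "Pts y"
 obtain ga where ga: "\<forall>v\<in>?U. ga v \<in> carrier G \<and> aopen (PO C y) {u \<in> ?U. ga u = ga v} \<and>
    (\<forall>z r. r \<in> Hom z y \<longrightarrow> (\<forall>t\<in>Pts z. ga (Fn r t) = ga v) \<longrightarrow>
     Cmp C c r = Cmp C (be (ga v)) (Cmp C e r))" using full[OF e] by blast
 define de where "de = restrict ga ?U"
 have op: "aopen (PO C y) {u \<in> ?U. de u = g}" for g
 proof (cases "\<exists>v\<in>?U. ga v = g")
  case True
  then obtain v where v: "v \<in> ?U" "ga v = g" by blast
  have "{u \<in> ?U. de u = g} = {u \<in> ?U. ga u = ga v}" using v by (auto simp: de_def)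
  then show ?thesis using bspec[OF ga v(1)] by simp
 next
  case False
  then have "{u \<in> ?U. de u = g} = {}" by (auto simp: de_def)
  then show ?thesis by (simp only: openin_empty)
 qed
 have "locconst G (PO C y) de" unfolding locconst_def using op ga by (auto simp: de_def)
 moreover have "twist y e c de"
  unfolding twist_def
 proof
  fix v assume v: "v \<in> ?U"
  have g: "ga v = de v" using v by (simp add: de_def)
  have "Cmp C c r = Cmp C (be (de v)) (Cmp C e r)"
   if r: "r \<in> Hom z y" "\<forall>t\<in>Pts z. Fn r t \<in> {u \<in> ?U. de u = de v}" for z r
  proof -
   have "\<forall>t\<in>Pts z. ga (Fn r t) = ga v" using r(2) g by (auto simp: de_def)
   then show ?thesis using bspec[OF ga v] r(1) g by simp
  qed
  then show "\<exists>W. aopen (PO C y) W \<and> v \<in> W \<and> (\<forall>z r. r \<in> Hom z y \<longrightarrow>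
   (\<forall>t\<in>Pts z. Fn r t \<in> W) \<longrightarrow> Cmp C c r = Cmp C (be (de v)) (Cmp C e r))"
   using op v by (intro exI[of _ "{u \<in> ?U. de u = de v}"]) simp
 qed
 ultimately show ?thesis by blast
qed

text \<open>Projecting a twist to the base yields the equivariance condition on arrows of the
  translation prestack.\<close>

lemma PA_twist:
 assumes e: "e \<in> Ov f y xi" and c: "c \<in> Ov f' y xi" and ga: "locconst G (PO C y) ga"
  and t: "twist y e c ga" and v: "v \<in> Pts y"
 shows "eq_at (acmp (\<rho> (ga v)) f) f' v"
proof (rule twistD[OF hoD(1)[OF e] t t v])
 fix W assume W: "aopen (PO C y) W" "v \<in> W"
   and q: "Cmp C c (lres y W) = Cmp C (be (ga v)) (Cmp C e (lres y W))"
 let ?i = "incl (PO C y) W"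
 note l = lres_ho(1)[OF hoD(1)[OF e] W(1)] and g = be[OF locconstD(1)[OF ga v]]
 note r = PA_hom[OF g]
 have "acmp f' ?i = acmp (\<rho> (ga v)) (acmp f ?i)"
  using hoD(5)[OF ho_comp[OF l c]] hoD(5)[OF ho_comp[OF ho_comp[OF l e] hom_overI[OF g refl]]] q by simp
 then have "acmp (acmp (\<rho> (ga v)) f) ?i = acmp f' ?i" using anaD(7)[OF hoD(3)[OF l] hoD(3)[OF e] r] by simp
 then show ?thesis using eq_at_inclusion[OF acmp_hom[OF hoD(3)[OF e] r] hoD(3)[OF c] W(1)] W(2) by blast
qed

text \<open>On the level set of \<open>ga\<close> with value \<open>g\<close> the arrow is
  \<open>be g\<close> after \<open>e\<close>; the equivariance condition puts it over the
  restriction of \<open>f'\<close>, and the pieces are glued.\<close>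

lemma twist_ex:
 assumes e: "e \<in> Ov f y xi" and f': "f' \<in> ahom (PO C y) S" and ga: "locconst G (PO C y) ga"
  and q: "\<And>v. v \<in> Pts y \<Longrightarrow> eq_at (acmp (\<rho> (ga v)) f) f' v"
 obtains c where "c \<in> Ov f' y xi" "twist y e c ga"
proof -
 let ?U = "PO C y" let ?W = "\<lambda>g. {v \<in> pts ?U. ga v = g}" let ?i = "\<lambda>g. incl ?U (?W g)"
 note y = hoD(1)[OF e]
 have W: "aopen ?U (?W g)" if "g \<in> carrier G" for g by (rule locconstD(2)[OF ga that])
 have cov: "pts ?U \<subseteq> (\<Union>g\<in>carrier G. ?W g)" using locconstD(1)[OF ga] by auto
 have l: "lres y (?W g) \<in> Ov (?i g) (pres y (?W g)) y" if "g \<in> carrier G" for g by (rule lres_ho(1)[OF y W[OF that]])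
 define a where "a g = Cmp C (be g) (Cmp C e (lres y (?W g)))" for g
 have a: "a g \<in> Ov (acmp f' (?i g)) (pres y (?W g)) xi" if g: "g \<in> carrier G" for g
 proof -
  have "acmp (acmp (\<rho> g) f) (?i g) = acmp f' (?i g)"
   using eq_at_inclusion[OF acmp_hom[OF hoD(3)[OF e] PA_hom[OF be[OF g]]] f' W[OF g]] q by blast
  then have "acmp (\<rho> g) (acmp f (?i g)) = acmp f' (?i g)"
   using anaD(7)[OF hoD(3)[OF l[OF g]] hoD(3)[OF e] PA_hom[OF be[OF g]]] by simp
  then show ?thesis unfolding a_def using ho_comp[OF ho_comp[OF l[OF g] e] hom_overI[OF be[OF g] refl]] by simp
 qed
 show ?thesis
 proof (rule glue[where I = "carrier G" and W = ?W, OF y refl xi f' W cov l a])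
  fix i j w V r s
  assume ij: "i \<in> carrier G" "j \<in> carrier G" and V: "V \<subseteq> ?W i" "V \<subseteq> ?W j" "V \<noteq> {}"
   and r: "r \<in> Ov (inclusion ?U V (?W i)) w (pres y (?W i))" "s \<in> Ov (inclusion ?U V (?W j)) w (pres y (?W j))"
   and eq: "Cmp C (lres y (?W i)) r = Cmp C (lres y (?W j)) s"
  \<comment> \<open>Level sets are disjoint, so a nonempty overlap involves only one label.\<close>
  have "i = j" using V by blast
  then show "Cmp C (a i) r = Cmp C (a j) s" using cart_eq[OF l[OF ij(1)] r(1)] r(2) eq by simp
 next
  fix c assume c: "c \<in> Ov f' y xi" and ca: "\<And>i. i \<in> carrier G \<Longrightarrow> Cmp C c (lres y (?W i)) = a i"
  have "twist y e c ga"
   unfolding twist_def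
  proof
   fix v assume v: "v \<in> pts ?U"
   let ?g = "ga v"
   have g: "?g \<in> carrier G" by (rule locconstD(1)[OF ga v])
   have "Cmp C c r = Cmp C (be ?g) (Cmp C e r)"
    if r: "r \<in> Hom z y" "\<forall>t\<in>Pts z. Fn r t \<in> ?W ?g" for z r
   proof -
    obtain k where k: "k \<in> Hom z (pres y (?W ?g))" "Cmp C (lres y (?W ?g)) k = r"
     using lres_factor[OF y W[OF g] r(1)] r(2) by blast
    note l' = hoD(4)[OF l[OF g]] and e' = hoD(4)[OF e]
    show ?thesis
     using ca[OF g] catD(7)[OF k(1) l' hoD(4)[OF c]] catD(7)[OF k(1) l' e']
      catD(7)[OF k(1) catD(4)[OF l' e'] be[OF g]] k(2) unfolding a_def by simp
   qed
   then show "\<exists>W. aopen ?U W \<and> v \<in> W \<and> (\<forall>z r. r \<in> Hom z y \<longrightarrow>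
    (\<forall>t\<in>Pts z. Fn r t \<in> W) \<longrightarrow> Cmp C c r = Cmp C (be (ga v)) (Cmp C e r))"
    using W[OF g] v by (intro exI[of _ "?W ?g"]) simp
  qed
  then show ?thesis by (rule that[OF c])
 qed
qed

lemma twist_Idt:
 assumes "e \<in> Hom y xi"
 shows "twist y e e (\<lambda>p\<in>Pts y. \<one>\<^bsub>G\<^esub>)"
 unfolding twist_def using be1 catD(6)[OF catD(4)[OF _ assms]] by (auto intro!: exI[of _ "Pts y"])

text \<open>Matches the composition law of \<open>translation_prestack\<close>: the later label is
  evaluated at the image point and multiplied on the left.\<close>

lemma twist_comp:
 assumes e: "e' \<in> Hom y' xi" "e \<in> Hom y xi" "c \<in> Hom y xi" and b: "b \<in> Hom y' y"
  and ga: "locconst G (PO C y') ga" "locconst G (PO C y) de"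
  and t: "twist y' e' (Cmp C e b) ga" "twist y e c de"
 shows "twist y' e' (Cmp C c b) (\<lambda>p\<in>Pts y'. de (Fn b p) \<otimes>\<^bsub>G\<^esub> ga p)"
 unfolding twist_def
proof
 let ?h = "Fn b"
 fix v assume v: "v \<in> Pts y'"
 have hv: "?h v \<in> Pts y" by (rule pt_in[OF b v])
 note g = locconstD(1)[OF ga(1) v] and d = locconstD(1)[OF ga(2) hv]
 obtain W1 where W1: "aopen (PO C y') W1" "v \<in> W1" "\<And>z r. r \<in> Hom z y' \<Longrightarrow>
  \<forall>t\<in>Pts z. Fn r t \<in> W1 \<Longrightarrow> Cmp C (Cmp C e b) r = Cmp C (be (ga v)) (Cmp C e' r)"
  using t(1) v unfolding twist_def by meson
 obtain W2 where W2: "aopen (PO C y) W2" "?h v \<in> W2" "\<And>z r. r \<in> Hom z y \<Longrightarrow>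
  \<forall>t\<in>Pts z. Fn r t \<in> W2 \<Longrightarrow> Cmp C c r = Cmp C (be (de (?h v))) (Cmp C e r)"
  using t(2) hv unfolding twist_def by meson
 let ?W = "W1 \<inter> {p \<in> Pts y'. ?h p \<in> W2}"
 have "Cmp C (Cmp C c b) r = Cmp C (be (de (?h v) \<otimes>\<^bsub>G\<^esub> ga v)) (Cmp C e' r)"
  if r: "r \<in> Hom z y'" "\<forall>t\<in>Pts z. Fn r t \<in> ?W" for z r
 proof -
  have 1: "Cmp C (Cmp C e b) r = Cmp C (be (ga v)) (Cmp C e' r)" using W1(3)[OF r(1)] r(2) by blast
  have "\<forall>t\<in>Pts z. Fn (Cmp C b r) t \<in> W2" using pt_comp[OF r(1) b] r(2) by simp
  then have 2: "Cmp C c (Cmp C b r) = Cmp C (be (de (?h v))) (Cmp C e (Cmp C b r))" by (rule W2(3)[OF catD(4)[OF r(1) b]])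
  show ?thesis
   using 1 2 catD(7)[OF r(1) b e(3)] catD(7)[OF r(1) b e(2)] bem[OF d g] catD(7)[OF catD(4)[OF r(1) e(1)] be[OF g] be[OF d]] by simp
 qed
 moreover have "aopen (PO C y') ?W" by (intro openin_Int W1(1) openin_vimage[OF PA_hom[OF b] W2(1)])
 moreover have "v \<in> ?W" using W1(2) W2(2) v by simp
 ultimately show "\<exists>W. aopen (PO C y') W \<and> v \<in> W \<and> (\<forall>z r. r \<in> Hom z y' \<longrightarrow>
   (\<forall>t\<in>Pts z. Fn r t \<in> W) \<longrightarrow> Cmp C (Cmp C c b) r =
    Cmp C (be ((\<lambda>p\<in>Pts y'. de (?h p) \<otimes>\<^bsub>G\<^esub> ga p) v)) (Cmp C e' r))"
  using v by (intro exI[of _ ?W]) simp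
qed

text \<open>On objects the comparison functor sends \<open>f : U \<rightarrow> S\<close> to the pullback of \<open>xi\<close>; an arrow \<open>(f', f, h, ga)\<close> goes to the
 arrow over \<open>h\<close> which is induced by \<open>be g\<close> where \<open>ga = g\<close>.\<close>

definition LA where
 "LA = (\<lambda>(f', f, h, ga). THE b. b \<in> Ov h (pull f' xi) (pull f xi) \<and>
  twist (pull f' xi) (lift f' xi) (Cmp C (lift f xi) b) ga)"

definition L :: "('u amor, 'u amor \<times> 'u amor \<times> 'u amor \<times> ('u \<Rightarrow> 'g), 'o, 'a) fct" where
 "L = \<lparr>FO = (\<lambda>f. pull f xi), FA = LA\<rparr>"

lemma lift_S:
 assumes "f \<in> ahom (mdom f) S"
 shows "lift f xi \<in> Ov f (pull f xi) xi" "PO C (pull f xi) = mdom f" "pull f xi \<in> Obj C"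
 using lift_ho[OF xi assms] PO_pull[OF xi assms] by auto

lemma LA_unique:
 assumes f: "f' \<in> ahom (mdom f') S" "f \<in> ahom (mdom f) S"
  and b: "b \<in> Ov h (pull f' xi) (pull f xi)" "b' \<in> Ov h (pull f' xi) (pull f xi)"
  and t: "twist (pull f' xi) (lift f' xi) (Cmp C (lift f xi) b) ga" "twist (pull f' xi) (lift f' xi) (Cmp C (lift f xi) b') ga"
 shows "b = b'"
proof (rule cart_eq[OF lift_S(1)[OF f(2)] b])
 note l = lift_S(1)[OF f(2)]
 show "Cmp C (lift f xi) b = Cmp C (lift f xi) b'"
  by (rule twist_unique[OF hoD(4)[OF lift_S(1)[OF f(1)]] ho_comp[OF b(1) l] ho_comp[OF b(2) l] t])
qed

lemma LA:
 assumes "(f', f, h, ga) \<in> hom_set T f' f"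
 shows "LA (f', f, h, ga) \<in> Ov h (pull f' xi) (pull f xi)"
  "twist (pull f' xi) (lift f' xi) (Cmp C (lift f xi) (LA (f', f, h, ga))) ga"
proof -
 have f: "f' \<in> ahom (mdom f') S" "f \<in> ahom (mdom f) S" and h: "h \<in> ahom (mdom f') (mdom f)"
  and ga: "locconst G (mdom f') ga" and q: "\<And>p. p \<in> pts (mdom f') \<Longrightarrow> eq_at (acmp (\<rho> (ga p)) f') (acmp f h) p"
  using assms unfolding T_hom by auto
 note l' = lift_S[OF f(1)] and l = lift_S[OF f(2)]
 obtain c where c: "c \<in> Ov (acmp f h) (pull f' xi) xi" "twist (pull f' xi) (lift f' xi) c ga"
  by (rule twist_ex[OF l'(1), of "acmp f h" ga, unfolded l'(2), OF acmp_hom[OF h f(2)] ga q])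
 obtain b where b: "b \<in> Ov h (pull f' xi) (pull f xi)" "Cmp C (lift f xi) b = c"
  by (rule cart_ex[OF l(1) c(1), of h]) (use h l'(2) l(2) in auto)
 have "\<exists>!b. b \<in> Ov h (pull f' xi) (pull f xi) \<and> twist (pull f' xi) (lift f' xi) (Cmp C (lift f xi) b) ga"
  using b c(2) LA_unique[OF f] by blast
 from theI'[OF this] show "LA (f', f, h, ga) \<in> Ov h (pull f' xi) (pull f xi)"
  "twist (pull f' xi) (lift f' xi) (Cmp C (lift f xi) (LA (f', f, h, ga))) ga" unfolding LA_def by auto
qed

lemma LA_eqI:
 assumes "(f', f, h, ga) \<in> hom_set T f' f" "b \<in> Ov h (pull f' xi) (pull f xi)"
  "twist (pull f' xi) (lift f' xi) (Cmp C (lift f xi) b) ga"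
 shows "LA (f', f, h, ga) = b"
 using LA_unique[OF _ _ LA(1)[OF assms(1)] assms(2) LA(2)[OF assms(1)] assms(3)] assms(1) unfolding T_hom by blast

lemma LA_Idt:
 assumes "f \<in> Obj T"
 shows "LA (Idt T f) = Idt C (pull f xi)"
proof -
 have f: "f \<in> ahom (mdom f) S" using assms by (simp add: T_Obj)
 note l = lift_S[OF f]
 show ?thesis
  using LA_eqI[OF T_Idt_hom[OF assms, unfolded T_sel] ho_id[OF l(3), unfolded l(2)]]
   twist_Idt[OF hoD(4)[OF l(1)]] ho_idr[OF l(1)] l(2) by simp
qed

lemma LA_Cmp:
 assumes s: "s \<in> hom_set T f' f" and t: "t \<in> hom_set T f f2"
 shows "LA (Cmp T t s) = Cmp C (LA t) (LA s)"
proof -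
 obtain h ga where s': "s = (f', f, h, ga)" and f': "f' \<in> ahom (mdom f') S" and f: "f \<in> ahom (mdom f) S"
  and ga: "locconst G (mdom f') ga" by (rule T_homE[OF s]) blast
 obtain k de where t': "t = (f, f2, k, de)" and f2: "f2 \<in> ahom (mdom f2) S"
  and de: "locconst G (mdom f) de" by (rule T_homE[OF t]) blast
 note l' = lift_S[OF f'] and l = lift_S[OF f] and l2 = lift_S[OF f2]
 note A = LA[OF s[unfolded s']] and B = LA[OF t[unfolded t']]
 note A' = hoD(4)[OF A(1)] and B' = hoD(4)[OF B(1)]
 have "twist (pull f' xi) (lift f' xi) (Cmp C (Cmp C (lift f2 xi) (LA t)) (LA s)) (\<lambda>p\<in>pts (mdom f'). de (mfun h p) \<otimes>\<^bsub>G\<^esub> ga p)"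
  using twist_comp[OF hoD(4)[OF l'(1)] hoD(4)[OF l(1)] catD(4)[OF B' hoD(4)[OF l2(1)]] A' _ _ A(2) B(2)] ga de l'(2) l(2)
   hoD(5)[OF A(1)] unfolding s' t' by simp
 then have "twist (pull f' xi) (lift f' xi) (Cmp C (lift f2 xi) (Cmp C (LA t) (LA s))) (\<lambda>p\<in>pts (mdom f'). de (mfun h p) \<otimes>\<^bsub>G\<^esub> ga p)"
  using catD(7)[OF A' B' hoD(4)[OF l2(1)]] unfolding s' t' by simp
 from LA_eqI[OF T_Cmp_hom[OF s t, unfolded s' t' T_sel] ho_comp[OF A(1) B(1)] this[unfolded s' t']]
 show ?thesis unfolding s' t' T_sel .
qed

text \<open>Injectivity on labels is \<open>free\<close> by way of \<open>twist_inj\<close>. For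
  surjectivity \<open>twist_full\<close> produces the label and \<open>PA_twist\<close> the required
  equivariance.\<close>

lemma LA_bij:
 assumes "f' \<in> Obj T" "f \<in> Obj T"
 shows "bij_betw LA (hom_set T f' f) (Hom (pull f' xi) (pull f xi))"
proof -
 have f': "f' \<in> ahom (mdom f') S" and f: "f \<in> ahom (mdom f) S" using assms by (simp_all add: T_Obj)
 note l' = lift_S[OF f'] and l = lift_S[OF f]
 have inj: "s = t" if s: "s \<in> hom_set T f' f" and t: "t \<in> hom_set T f' f" and eq: "LA s = LA t" for s t
 proof -
  obtain h ga where s': "s = (f', f, h, ga)" and ga: "locconst G (mdom f') ga" by (rule T_homE[OF s]) blast
  obtain k de where t': "t = (f', f, k, de)" and de: "locconst G (mdom f') de" by (rule T_homE[OF t]) blast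
  note A = LA[OF s[unfolded s']] and B = LA[OF t[unfolded t']]
  have "h = k" using hoD(5)[OF A(1)] hoD(5)[OF B(1)] eq unfolding s' t' by simp
  moreover have "ga = de"
   by (rule twist_inj[OF hoD(4)[OF l'(1)], unfolded l'(2), OF ga de A(2)]) (use B(2) eq s' t' in simp)
  ultimately show ?thesis using s' t' by simp
 qed
 have surj: "\<exists>s\<in>hom_set T f' f. LA s = b" if b: "b \<in> Hom (pull f' xi) (pull f xi)" for b
 proof -
  define h where "h = PA C b"
  have bh: "b \<in> Ov h (pull f' xi) (pull f xi)" using b by (simp add: h_def hom_over_def)
  have h: "h \<in> ahom (mdom f') (mdom f)" using hoD(3)[OF bh] l(2) l'(2) by simp
  note lb = ho_comp[OF bh l(1)]
  obtain ga where ga: "locconst G (PO C (pull f' xi)) ga" "twist (pull f' xi) (lift f' xi) (Cmp C (lift f xi) b) ga"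
   using twist_full[OF hoD(4)[OF l'(1)] hoD(4)[OF lb]] by blast
  have "(f', f, h, ga) \<in> hom_set T f' f"
   unfolding T_hom using f f' h ga(1) PA_twist[OF l'(1) lb ga] l'(2) by simp
  then show ?thesis using LA_eqI[OF _ bh ga(2)] by blast
 qed
 have "LA s \<in> Hom (pull f' xi) (pull f xi)" if s: "s \<in> hom_set T f' f" for s
 proof -
  obtain h ga where s': "s = (f', f, h, ga)" by (rule T_homE[OF s]) blast
  show ?thesis unfolding s' by (rule hoD(4)[OF LA(1)[OF s[unfolded s']]])
 qed
 then show ?thesis using inj surj unfolding bij_betw_def inj_on_def by blast
qed

lemma morphism_over_L: "morphism_over T C L"
proof -
 have arr: "s \<in> hom_set T (Dom T s) (Cod T s)" if "s \<in> Arr T" for s using that by (simp add: hom_set_def)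
 have L: "LA s \<in> Ov (PA T s) (pull f' xi) (pull f xi)" if s: "s \<in> hom_set T f' f" for s f' f
 proof -
  obtain h ga where s': "s = (f', f, h, ga)" by (rule T_homE[OF s]) blast
  show ?thesis using LA(1)[OF s[unfolded s']] unfolding s' by simp
 qed
 have f: "pull f xi \<in> Obj C" "PO C (pull f xi) = mdom f" if "f \<in> Obj T" for f
  using lift_S that by (auto simp: T_Obj)
 show ?thesis
  unfolding morphism_over_def is_functor_def
 proof (intro conjI ballI impI)
  show "FO L f \<in> Obj C" "FA L (Idt T f) = Idt C (FO L f)" "PO C (FO L f) = PO T f" if "f \<in> Obj T" for f
   using f[OF that] LA_Idt[OF that] by (simp_all add: L_def)
  show "FA L s \<in> Hom (FO L (Dom T s)) (FO L (Cod T s))" "PA C (FA L s) = PA T s" if "s \<in> Arr T" for s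
   using hoD(4,5)[OF L[OF arr[OF that]]] by (simp_all add: L_def)
  show "FA L (Cmp T t s) = Cmp C (FA L t) (FA L s)" if "s \<in> Arr T" "t \<in> Arr T" "Cod T s = Dom T t" for s t
   using LA_Cmp[OF arr[OF that(1)], of t] arr[OF that(2)] that(3) by (simp add: L_def)
 qed
qed

sublocale Q: ff_into_stack C T L
proof -
 interpret T: over_category T by (rule over_category_T)
 show "ff_into_stack C T L"
  by unfold_locales (use morphism_over_L LA_bij in \<open>simp_all add: L_def\<close>)
qed

end

section \<open>The quotient stack as an open substack\<close>

context chart
begin

abbreviation F where "F \<equiv> Q.FF"

lemma restricts:
 assumes z: "z \<in> Obj C" and W: "aopen (PO C z) W" "W \<subseteq> V" "Hom (pres z V) xi \<noteq> {}" "aopen (PO C z) V"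
 shows "Hom (pres z W) xi \<noteq> {}"
proof -
 obtain e where e: "e \<in> Hom (pres z V) xi" using W(3) by blast
 have "Fn (lres z W) t \<in> V" if t: "t \<in> Pts (pres z W)" for t
 proof -
  have "t \<in> W" using t lres_ho(2)[OF z W(1)] by simp
  then show ?thesis using pt_lres(1)[OF z W(1)] W(2) by auto
 qed
 then obtain c where "c \<in> Hom (pres z W) (pres z V)"
  using lres_factor[OF z W(4) hoD(4)[OF lres_ho(1)[OF z W(1)]]] by blast
 then show ?thesis using catD(4)[OF _ e] by blast
qed

text \<open>An arrow to \<open>xi\<close> identifies a restriction of \<open>z\<close> with a
  pullback of \<open>xi\<close>, an object in the image of \<open>L\<close>;
  \<open>FF_essential_image\<close> glues these identifications.\<close>

lemma in_image:
 assumes z: "z \<in> Obj C" and cov: "\<And>v. v \<in> Pts z \<Longrightarrow> \<exists>W. aopen (PO C z) W \<and> v \<in> W \<and> Hom (pres z W) xi \<noteq> {}"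
 shows "\<exists>d\<in>Obj (stackification T). isomorphic_over C (FO F d) z"
proof -
 define \<S> where "\<S> = {W. aopen (PO C z) W \<and> Hom (pres z W) xi \<noteq> {}}"
 have sv: "covering_sieve (PO C z) \<S>"
  unfolding covering_sieve_def
 proof (intro conjI ballI allI impI)
  show "\<Union>\<S> = Pts z"
  proof
   show "\<Union>\<S> \<subseteq> Pts z" unfolding \<S>_def by (auto dest: openin_subset)
   show "Pts z \<subseteq> \<Union>\<S>"
   proof
    fix v assume "v \<in> Pts z"
    from cov[OF this] obtain W where "aopen (PO C z) W \<and> v \<in> W \<and> Hom (pres z W) xi \<noteq> {}" ..
    then show "v \<in> \<Union>\<S>" unfolding \<S>_def by (intro UnionI[of W]) simp_all
   qed
  qed
 qed (use restricts[OF z] in \<open>auto simp: \<S>_def\<close>)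
 have S: "aopen (PO C z) W" "\<exists>c. c \<in> Hom (pres z W) xi" if "W \<in> \<S>" for W using that unfolding \<S>_def by auto
 define c where "c W = (SOME c. c \<in> Hom (pres z W) xi)" for W
 have c: "c W \<in> Hom (pres z W) xi" if "W \<in> \<S>" for W unfolding c_def by (rule someI_ex[OF S(2)[OF that]])
 have "\<exists>e. e \<in> Ov (incl (PO C z) W) (pull (PA C (c W)) xi) z" if W: "W \<in> \<S>" for W
 proof -
  note l = lres_ho[OF z S(1)[OF W]]
  let ?V = "open_sub (PO C z) W"
  have f: "PA C (c W) \<in> ahom ?V S" using PA_hom[OF c[OF W]] l(2) by simp
  note iV = aid_hom[OF ana_homD(3)[OF f]]
  obtain th where th: "th \<in> Ov (aid ?V) (pres z W) (pull (PA C (c W)) xi)"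
   using cart_ex[OF lift_ho[OF xi f] hom_overI[OF c[OF W] refl], of "aid ?V"] iV anaD(5)[OF f] PO_pull(1)[OF xi f] l(2) by metis
  obtain th' where th': "th' \<in> Ov (aid ?V) (pull (PA C (c W)) xi) (pres z W)" by (rule over_id_inverse[OF th])
  show ?thesis using ho_comp[OF th' l(1)] anaD(5)[OF hoD(3)[OF l(1)]] l(2) by metis
 qed
 then obtain e where e: "\<And>W. W \<in> \<S> \<Longrightarrow> e W \<in> Ov (incl (PO C z) W) (pull (PA C (c W)) xi) z" by metis
 have p: "PA C (c W) \<in> Obj T" if "W \<in> \<S>" for W
  unfolding T_Obj using PA_hom[OF c[OF that]] ana_homD(1) by metis
 show ?thesis
  by (rule Q.FF_essential_image[OF z refl sv p, where e = e]) (use e in \<open>auto simp: L_def\<close>)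
qed

text \<open>Converse to \<open>in_image\<close>: a descent datum is locally an object of the
  prestack, that is, a pullback of \<open>xi\<close>, and so carries an arrow to
  \<open>xi\<close>.\<close>

lemma image_locally:
 assumes d: "d \<in> Obj (stackification T)" and i: "isomorphic_over C (FO F d) z" and v: "v \<in> Pts z"
 shows "\<exists>W. aopen (PO C z) W \<and> v \<in> W \<and> Hom (pres z W) xi \<noteq> {}"
proof -
 have Fd: "PO C (FO F d) = dbase d" using morD(2)[OF Q.morphism_over_FF d] by simp
 obtain kp where kp: "kp \<in> Ov (aid (PO C (FO F d))) (FO F d) z" and zd: "PO C (FO F d) = PO C z"
  using i unfolding isomorphic_over_def by blast
 let ?Z = "PO C z"
 note z = hoD(2)[OF kp]
 have dz: "dbase d = ?Z" using Fd zd by simp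
 show ?thesis
 proof (rule Q.FF_locally_in_image[OF d, of v])
  show "v \<in> pts (dbase d)" using v dz by simp
  fix W p e assume W: "aopen (dbase d) W" "v \<in> W" and p: "p \<in> Obj T"
   and e: "e \<in> Ov (incl (dbase d) W) (FO L p) (FO F d)"
  note W = W[unfolded dz] and e = e[unfolded dz]
  have p': "p \<in> ahom (mdom p) S" using p by (simp add: T_Obj)
  have ke: "Cmp C kp e \<in> Ov (incl ?Z W) (FO L p) z"
   using ho_comp[OF e kp] anaD(6)[OF incl_hom[OF PO_ana[OF z] W(1)]] zd by simp
  obtain r where r: "r \<in> Ov (inclusion ?Z W W) (pres z W) (FO L p)"
   by (rule restrict_factor[OF ke refl W(1) W(1) order_refl lres_ho(1)[OF z W(1)]])
  have "lift p xi \<in> Hom (FO L p) xi" using hoD(4)[OF lift_S(1)[OF p']] by (simp add: L_def)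
  then have "Cmp C (lift p xi) r \<in> Hom (pres z W) xi" by (rule catD(4)[OF hoD(4)[OF r]])
  then show ?thesis using W by blast
 qed
qed

text \<open>\<open>in_image\<close> and \<open>image_locally\<close> describe the essential image by
  local arrows to \<open>xi\<close>. The openness assumption then places it in the setting of
  \<open>open_substack\<close>.\<close>

lemma FF_etale: "representable_with ana_etale (stackification T) C F"
proof -
 have oQ: "over_category (stackification T)" by (rule over_category.intro[OF Q.over_ana_QS])
 have op: "\<exists>T0. aopen (PO C y) T0 \<and> (\<forall>m z a. a \<in> Ov m z y \<longrightarrow>
   ((\<exists>q\<in>Obj (stackification T). isomorphic_over C (FO F q) z) \<longleftrightarrow> mfun m ` Pts z \<subseteq> T0))" if y: "y \<in> Obj C" for y
 proof (intro exI conjI allI impI)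
  \<comment> \<open>The union of these opens is the locus where \<open>y\<close> locally maps to the
    chart.\<close>
  let ?P = "\<lambda>W. aopen (PO C y) W \<and> Hom (pres y W) xi \<noteq> {}"
  show "aopen (PO C y) (\<Union>{W. ?P W})" by (rule openin_Union) blast
  fix m z a assume a: "a \<in> Ov m z y"
  note z = hoD(1)[OF a] and a' = hoD(4)[OF a]
  show "(\<exists>q\<in>Obj (stackification T). isomorphic_over C (FO F q) z) \<longleftrightarrow> mfun m ` Pts z \<subseteq> \<Union>{W. ?P W}"
  proof (intro iffI subsetI)
   fix u assume ex: "\<exists>q\<in>Obj (stackification T). isomorphic_over C (FO F q) z" and "u \<in> mfun m ` Pts z"
   then obtain v where v: "v \<in> Pts z" "u = Fn a v" using hoD(5)[OF a] by blast
   obtain d where d: "d \<in> Obj (stackification T)" "isomorphic_over C (FO F d) z" using ex by (elim bexE)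
   obtain W where W: "aopen (PO C z) W" "v \<in> W" "Hom (pres z W) xi \<noteq> {}"
    using image_locally[OF d v(1)] by (elim exE conjE)
   note l = hoD(4)[OF lres_ho(1)[OF z W(1)]]
   have vz: "v \<in> Pts (pres z W)" using pt_lres(2)[OF z W(1,2)] W(2) by simp
   have "Fn (Cmp C a (lres z W)) v = u" using pt_comp[OF l a' vz] pt_lres(1)[OF z W(1,2)] v(2) by simp
   then show "u \<in> \<Union>{W. ?P W}" using is_open[OF catD(4)[OF l a'] W(3) vz] by auto
  next
   assume sub: "mfun m ` Pts z \<subseteq> \<Union>{W. ?P W}"
   show "\<exists>q\<in>Obj (stackification T). isomorphic_over C (FO F q) z"
   proof (rule in_image[OF z])
    fix v assume v: "v \<in> Pts z"
    then obtain W where W: "aopen (PO C y) W" "mfun m v \<in> W" "Hom (pres y W) xi \<noteq> {}" using sub by blast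
    obtain e where e: "e \<in> Hom (pres y W) xi" using W(3) by blast
    define V where "V = {u \<in> Pts z. mfun m u \<in> W}"
    have V: "aopen (PO C z) V" "v \<in> V" unfolding V_def using openin_vimage[OF hoD(3)[OF a] W(1)] W(2) v by auto
    note l = hoD(4)[OF lres_ho(1)[OF z V(1)]]
    have "Fn (Cmp C a (lres z V)) t \<in> W" if t: "t \<in> Pts (pres z V)" for t
    proof -
     have tV: "t \<in> V" using t pt_lres(2)[OF z V] by simp
     then show ?thesis using pt_comp[OF l a' t] pt_lres(1)[OF z V(1) tV] hoD(5)[OF a] by (simp add: V_def)
    qed
    then obtain k where "k \<in> Hom (pres z V) (pres y W)" using lres_factor[OF y W(1) catD(4)[OF l a']] by blast
    then have "Cmp C e k \<in> Hom (pres z V) xi" by (rule catD(4)[OF _ e])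
    then show "\<exists>W. aopen (PO C z) W \<and> v \<in> W \<and> Hom (pres z W) xi \<noteq> {}" using V by blast
   qed
  qed
 qed
 interpret open_substack "stackification T" C F
  by (intro open_substack.intro open_substack_axioms.intro oQ fibred_category_axioms Q.morphism_over_FF Q.FF_bij op)
 show ?thesis by (rule representable_with_etale)
qed

lemma point_in_image:
 assumes x: "stack_point C x" and mu: "mu \<in> Hom x xi"
 shows "\<exists>q. stack_point (stackification T) q \<and> isomorphic_over C (FO F q) x"
proof -
 note xo = catD(1)[OF mu]
 have "\<exists>q\<in>Obj (stackification T). isomorphic_over C (FO F q) x"
 proof (rule in_image[OF xo])
  fix v assume "v \<in> Pts x"
  then show "\<exists>W. aopen (PO C x) W \<and> v \<in> W \<and> Hom (pres x W) xi \<noteq> {}"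
   using catD(4)[OF hoD(4)[OF lres_ho(1)[OF xo openin_topspace]] mu] by blast
 qed
 then obtain q where q: "q \<in> Obj (stackification T)" "isomorphic_over C (FO F q) x" by blast
 have "PO (stackification T) q = PO C x"
  using morD(2)[OF Q.morphism_over_FF q(1)] q(2) by (simp add: isomorphic_over_def)
 then show ?thesis using q x by (auto simp: stack_point_def simp del: Q.QS_sel)
qed

end

section \<open>Local sections of the atlas and the conclusion\<close>

context fibred_category
begin

text \<open>The section of base spaces from \<open>etale_section\<close> lifts to an arrow by the
  cartesian property of \<open>b\<close>.\<close>

lemma etale_local_section:
 assumes b: "b \<in> Hom w y" and et: "ana_etale (PA C b)" and t: "t \<in> O'" "aopen (PO C w) O'"
 shows "\<exists>V sg. aopen (PO C y) V \<and> Fn b t \<in> V \<and> sg \<in> Hom (pres y V) w \<and> Cmp C b sg = lres y V \<and>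
  (\<forall>v\<in>V. Fn sg v \<in> O')"
proof -
 have tw: "t \<in> Pts w" using openin_subset[OF t(2)] t(1) by blast
 note y = catD(2)[OF b]
 show ?thesis
 proof (rule etale_section[OF PA_hom[OF b] et tw t(2,1)])
  fix U V s assume U: "t \<in> U" "U \<subseteq> O'" and V: "aopen (PO C y) V" "Fn b ` U = V"
   and s: "s \<in> ahom (open_sub (PO C y) V) (PO C w)" "mfun s ` V = U" "acmp (PA C b) s = incl (PO C y) V"
  note l = lres_ho[OF y V(1)]
  obtain sg where sg: "sg \<in> Ov s (pres y V) w" "Cmp C b sg = lres y V"
   by (rule cart_ex[OF hom_overI[OF b refl] l(1), of s]) (use s l(2) in auto)
  have "\<forall>v\<in>V. Fn sg v \<in> O'" using s(2) U(2) hoD(5)[OF sg(1)] by blast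
  then show ?thesis using V U(1) hoD(4)[OF sg(1)] sg(2) by blast
 qed
qed

end

text \<open>Ensures that one and the same base change of the atlas is both etale and
  surjective.\<close>

lemma representable_with_conj:
 "representable_with R A B F \<Longrightarrow> representable_with R' A B F \<Longrightarrow> representable_with (\<lambda>h. R h \<and> R' h) A B F"
 unfolding representable_with_def by blast

theorem theorem3p1:
 fixes \<X> :: "('u, 'o, 'a) ocat" and X :: "'u aspace"
  and \<pi> :: "('u amor, 'u amor \<times> 'u amor, 'o, 'a) fct" and x :: 'o
 assumes "deligne_mumford X \<X> \<pi>"
  and "representable_with ana_closed \<X> (prod_over \<X> \<X>) diagonal"
  and "representable_with ana_finite_fibers \<X> (prod_over \<X> \<X>) diagonal"
  and "stack_point \<X> x"
 shows "\<exists>(S :: 'u aspace) \<rho> F q.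
  S \<in> Obj ana \<and> acts_on (stabilizer \<X> x) S \<rho> \<and>
  representable_with ana_etale (quotient_stack (stabilizer \<X> x) S \<rho>) \<X> F \<and>
  stack_point (quotient_stack (stabilizer \<X> x) S \<rho>) q \<and> isomorphic_over \<X> (FO F q) x"
proof -
 have stack: "is_stack \<X>" and X: "analytic_space X"
  and rep: "representable_with (\<lambda>h. ana_etale h \<and> ana_surjective h) (yon X) \<X> \<pi>"
  using assms(1) representable_with_conj unfolding deligne_mumford_def analytic_stack_def by auto
 have x: "x \<in> Obj \<X>" and pt: "one_point_space (PO \<X> x)" using assms(4) by (auto simp: stack_point_def)
 interpret ana_stack \<X>
  using stack by unfold_locales (auto simp: is_stack_def fibred_in_groupoids_def)
 let ?xi = "FO \<pi> (aid X)"
 note atlas = atlas_universal[OF X rep]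
 \<comment> \<open>The base change of the atlas to the point is nonempty by surjectivity, and being
   etale it has a section through any of its points. This lifts \<open>x\<close> to the
   atlas.\<close>
 have "\<exists>mu. mu \<in> hom_set \<X> x ?xi"
 proof (rule atlas[OF x])
  fix w a b assume a: "a \<in> hom_set \<X> w ?xi" and b: "b \<in> hom_set \<X> w x" and R: "ana_etale (PA \<X> b) \<and> ana_surjective (PA \<X> b)"
  obtain q where q: "pts (PO \<X> x) = {q}" using one_point_spaceE[OF pt] by metis
  have "mfun (PA \<X> b) ` pts (PO \<X> w) = {q}"
   using R ana_homD(1,2)[OF PA_hom[OF b]] q unfolding ana_surjective_def by simp
  then obtain t where t: "t \<in> pts (PO \<X> w)" "mfun (PA \<X> b) t = q" by blast
  obtain V sg where V: "aopen (PO \<X> x) V" "q \<in> V" "sg \<in> hom_set \<X> (pres x V) w"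
   using etale_local_section[OF b conjunct1[OF R] t(1) openin_topspace] t(2) by blast
  \<comment> \<open>\<open>V\<close> contains the only point, so the identity of \<open>x\<close>
    factors through the restriction to \<open>V\<close>.\<close>
  have "mfun (PA \<X> (Idt \<X> x)) u \<in> V" if "u \<in> pts (PO \<X> x)" for u
   using that q V(2) PA_Idt[OF x] mfun_Idt[OF that] by simp
  then obtain c where "c \<in> hom_set \<X> x (pres x V)" using lres_factor[OF x V(1) catD(3)[OF x]] by blast
  then show ?thesis using catD(4)[OF catD(4)[OF _ V(3)] a] by blast
 qed
 then obtain mu where mu: "mu \<in> hom_set \<X> x ?xi" ..
 show ?thesis
 proof (rule atlas[OF catD(2)[OF mu]])
  fix w a b assume a: "a \<in> hom_set \<X> w ?xi" and b: "b \<in> hom_set \<X> w ?xi" and R: "ana_etale (PA \<X> b) \<and> ana_surjective (PA \<X> b)"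
   and univ: "\<And>w' a' b'. a' \<in> hom_set \<X> w' ?xi \<Longrightarrow> b' \<in> hom_set \<X> w' ?xi \<Longrightarrow>
    \<exists>!c. c \<in> hom_set \<X> w' w \<and> Cmp \<X> a c = a' \<and> Cmp \<X> b c = b'"
  interpret A: atlas_groupoid \<X> ?xi w a b x mu
   by unfold_locales (use a b R univ pt mu assms(2,3) in auto)
  let ?G = "stabilizer \<X> x"
  show ?thesis
  proof (rule A.local_chart)
   fix S xiS i be muS
   assume S: "aopen (PO \<X> ?xi) S" "i \<in> hom_over \<X> (incl (PO \<X> ?xi) S) xiS ?xi"
    and ch: "groupoid_chart \<X> ?G xiS be" and muS: "muS \<in> hom_set \<X> x xiS"
   note ih = hoD(4)[OF S(2)]
   \<comment> \<open>\<open>z\<close> gives a point of the fibre product of the atlas with the base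
     of \<open>y\<close> whose atlas component lies in \<open>S\<close>. An etale local section
     through that point provides an arrow to \<open>xiS\<close> on a neighbourhood in the base of
     \<open>y\<close>.\<close>
   have op: "\<exists>W. aopen (PO \<X> y) W \<and> mfun (PA \<X> k) v \<in> W \<and> hom_set \<X> (pres y W) xiS \<noteq> {}"
    if k: "k \<in> hom_set \<X> z y" and z: "hom_set \<X> z xiS \<noteq> {}" and v: "v \<in> pts (PO \<X> z)" for z y k v
   proof (rule atlas[OF catD(2)[OF k]])
    fix w' a' b' assume a': "a' \<in> hom_set \<X> w' ?xi" and b': "b' \<in> hom_set \<X> w' y" and R': "ana_etale (PA \<X> b') \<and> ana_surjective (PA \<X> b')"
     and univ': "\<And>u c d. c \<in> hom_set \<X> u ?xi \<Longrightarrow> d \<in> hom_set \<X> u y \<Longrightarrow>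
      \<exists>!f. f \<in> hom_set \<X> u w' \<and> Cmp \<X> a' f = c \<and> Cmp \<X> b' f = d"
    obtain e where e: "e \<in> hom_set \<X> z xiS" using z by blast
    obtain f where f: "f \<in> hom_set \<X> z w'" "Cmp \<X> a' f = Cmp \<X> i e" "Cmp \<X> b' f = k"
     using univ'[OF catD(4)[OF e ih] k] by blast
    define t where "t = mfun (PA \<X> f) v"
    let ?O = "{t \<in> pts (PO \<X> w'). mfun (PA \<X> a') t \<in> S}"
    have pS: "pts (PO \<X> xiS) = S"
     using ana_homD(1)[OF hoD(3)[OF S(2)]] ana_homD(1)[OF incl_hom[OF PO_ana[OF catD(2)[OF mu]] S(1)]]
      pts_open_sub[OF S(1)] by simp
    have "mfun (PA \<X> (Cmp \<X> i e)) v \<in> S"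
     using pt_comp[OF e ih v] hoD(5)[OF S(2)] pt_in[OF e v] pS openin_subset[OF S(1)] by simp
    then have tO: "t \<in> ?O" unfolding t_def using pt_in[OF f(1) v] pt_comp[OF f(1) a' v] f(2) by simp
    have bt: "mfun (PA \<X> b') t = mfun (PA \<X> k) v" unfolding t_def using pt_comp[OF f(1) b' v] f(3) by simp
    have oO: "aopen (PO \<X> w') ?O" by (rule openin_vimage[OF PA_hom[OF a'] S(1)])
    obtain V sg where V: "aopen (PO \<X> y) V" "mfun (PA \<X> k) v \<in> V" "sg \<in> hom_set \<X> (pres y V) w'"
     "\<forall>u\<in>V. mfun (PA \<X> sg) u \<in> ?O"
     using etale_local_section[OF b' conjunct1[OF R'] tO oO] unfolding bt by blast
    have pV: "pts (PO \<X> (pres y V)) = V" by (rule pt_lres(2)[OF catD(2)[OF k] V(1,2)])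
    have "mfun (PA \<X> (Cmp \<X> a' sg)) u \<in> S" if u: "u \<in> pts (PO \<X> (pres y V))" for u
     using pt_comp[OF V(3) a' u] V(4) u unfolding pV by auto
    then obtain c where "c \<in> hom_set \<X> (pres y V) xiS"
     using factor_through_open[OF S(2) refl S(1) catD(4)[OF V(3) a']] by blast
    then show ?thesis using V(1,2) by blast
   qed
   interpret chart \<X> ?G xiS be
    by (intro chart.intro ana_stack_axioms ch chart_axioms.intro) (fact op)
   obtain q where "stack_point (stackification T) q" "isomorphic_over \<X> (FO F q) x"
    using point_in_image[OF assms(4) muS] by (elim exE conjE)
   moreover have "PO \<X> xiS \<in> Obj ana" using PO_ana[OF catD(1)[OF ih]] by simp
   ultimately show ?thesis using acts FF_etale by (intro exI conjI)
  qed
 qed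
qed

end
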